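(* Let $m\in[1,\infty)$. Let $r\in(1,\infty)$, $\vec u=(u_t,u_x)\in[1,\infty)^2$ and $\vec v=(v_t,v_x)\in(1,\infty]^2$ be such that $\max\{u_t,u_x\}\le r\le\min\{v_t,v_x\}$. Let $\kappa,M\in\mathbb R$ and suppose that $T$ is a singular operator of type $(\kappa,m,r,\vec u,\vec v,M)$. Let $p,q\in(0,\infty]$ and $\beta\in\mathbb R$, and assume the decay condition $$M>-[u_t,v_t]+\tfrac nm[\min\{p,q,u_x\},u_x]+\tfrac nm[v_x,\max\{p,q,v_x\}]+\kappa$$ and the lower and upper bounds $$\text{(l)}\quad \beta>-[u_t,q]+\tfrac nm[\min\{p,q,u_x\},u_x],\qquad \text{(u)}\quad \beta<[q,v_t]-\tfrac nm[v_x,\max\{p,q,v_x\}]-\kappa.$$ Then for all $f\in L^\infty_c(\mathbb R^{1+n}_+)$, $$\|Tf\|_{T^{p,q,r}_{\beta+\kappa}}\lesssim\|f\|_{T^{p,q,r}_\beta},$$ with implicit constant independent of $f$. If $T$ is causal, the upper bound (u) is not required. If $T$ is anti-causal, the lower bound (l) is not required.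
   Context: Notation. $n\ge1$; $\mathbb R_+=(0,\infty)$, $\mathbb R^{1+n}_+=\mathbb R_+\times\mathbb R^n$ with points $(t,x)$. $L^0(\mathbb R^{1+n}_+)$: measurable complex functions; $L^\infty_c(\mathbb R^{1+n}_+)$: bounded ones with compact support in $\mathbb R^{1+n}_+$. In algebraic expressions $[p,q]:=\frac1p-\frac1q$ for $p,q\in(0,\infty]$ ($1/\infty=0$). $\|f\|_{L^a_tL^b_x}=\big\|t\mapsto\|f(t,\cdot)\|_{L^b(\mathbb R^n)}\big\|_{L^a(\mathbb R_+)}$, $L^a_{t,x}=L^a_tL^a_x$. A constant $c\in(0,1)$ with $c\le\frac1{16\sqrt n}$, depending only on $n$, is fixed. Singular operators. A rectangle is a set $\boldsymbol E=E_t\times E_x\subseteq\mathbb R^{1+n}_+$ with $E_t\subseteq\mathbb R_+$ an interval and $E_x\subseteq\mathbb R^n$ a cube with sides parallel to the axes. For two rectangles $\boldsymbol E,\boldsymbol F$ put $\ell_x=\operatorname{diam}(E_x\cup F_x)$, $\ell_t=\sup(E_t\cup F_t)$; $d$ denotes distance. $T:L^\infty_c(\mathbb R^{1+n}_+)\to L^0(\mathbb R^{1+n}_+)$ is subadditive if $|T(f+g)|\le|Tf|+|Tg|$ a.e. For $r\in[1,\infty]$, $\vec u,\vec v\in[1,\infty]^2$, $\kappa,M\in\mathbb R$, $m\in(0,\infty)$, a subadditive operator $T:L^\infty_c\to L^0$ is a singular operator of type $(\kappa,m,r,\vec u,\vec v,M)$ if there is $C<\infty$ such that for all $f\in L^\infty_c$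 and all rectangles $\boldsymbol E,\boldsymbol F$: (i) if $\boldsymbol F=\boldsymbol E$, $c\,\ell_x\le\ell_t^{1/m}\le\ell_x$ and $\inf E_t\ge c^m\ell_t$, then $\|1_{\boldsymbol E}T(f1_{\boldsymbol E})\|_{L^r_{t,x}}\le C(\inf E_t)^\kappa\|f1_{\boldsymbol E}\|_{L^r_{t,x}}$; (ii) if $c\,\ell_x\le\ell_t^{1/m}\le\ell_x$ and $d(E_t,F_t)\ge c^m\ell_t$, then $\|1_{\boldsymbol F}T(f1_{\boldsymbol E})\|_{L^{v_t}_tL^{v_x}_x}\le C\,d(E_t,F_t)^{-[u_t,v_t]-\frac nm[u_x,v_x]+\kappa}\|f1_{\boldsymbol E}\|_{L^{u_t}_tL^{u_x}_x}$; (iii) if $\ell_t^{1/m}\le\ell_x$, $d(E_t,F_t)\ge c^m\ell_t$ and $d(E_x,F_x)\ge c\,\ell_x$, then $\|1_{\boldsymbol F}T(f1_{\boldsymbol E})\|_{L^{v_t}_tL^{v_x}_x}\le C\,d(E_x,F_x)^{-m[u_t,v_t]-n[u_x,v_x]+m\kappa}\Big(\frac{\operatorname{diam}(E_t\cup F_t)}{d(E_x,F_x)^m}\Big)^{M}\|f1_{\boldsymbol E}\|_{L^{u_t}_tL^{u_x}_x}$; (iv) if $\ell_t^{1/m}\le\ell_x$ and $d(E_x,F_x)\ge c\,\ell_x$, then $\|1_{\boldsymbol F}T(f1_{\boldsymbol E})\|_{L^{r}_tL^{v_x}_x}\le C\,d(E_x,F_x)^{-n[u_x,v_x]+m\kappa}\Big(\frac{\operatorname{diam}(E_t\cup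 F_t)}{d(E_x,F_x)^m}\Big)^{M+[u_t,v_t]}\|f1_{\boldsymbol E}\|_{L^{r}_tL^{u_x}_x}$. $T$ is causal if $T(f1_{\boldsymbol E})(t,x)=0$ for $t<\inf E_t$, for all $f\in L^\infty_c$ and $\boldsymbol E=E_t\times E_x$ with $E_t\subseteq\mathbb R_+$, $E_x\subseteq\mathbb R^n$; anti-causal if $T(f1_{\boldsymbol E})(t,x)=0$ for $t>\sup E_t$, for all such $f,\boldsymbol E$. Tent spaces (homogeneity $m$). $W_rf(t,x)=\Big(⨍_{2^{-m}t}^t⨍_{B(x,t^{1/m})}|f(s,y)|^rdy\,ds\Big)^{1/r}$ (⨍ is the mean value integral; ess sup if $r=\infty$). For $p<\infty$, $\|f\|_{T^{p,q,r}_\beta}=\Big(\int_{\mathbb R^n}\Big(\int_0^\infty|t^{-\beta}W_rf(t,x)|^qdt\Big)^{p/q}dx\Big)^{1/p}$ (ess sup in $t$ if $q=\infty$). For $p=\infty$, $q<\infty$, $\|f\|_{T^{\infty,q,r}_\beta}=\sup_{(\tau,y)\in\mathbb R^{1+n}_+}\Big(\int_0^\tau⨍_{B(y,\tau^{1/m})}|t^{-\beta}W_rf(t,x)|^qdx\,dt\Big)^{1/q}$. For $p=q=\infty$, $\|f\|_{T^{\infty,\infty,r}_\beta}=\|t^{-\beta}W_rf\|_{L^\infty(\mathbb R^{1+n}_+)}$. $T^{p,q,r}_\beta$ is the space of measurable $f:\mathbb R^{1+n}_+\to\mathbb C$ with finite (quasi-)norm. *)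

theory Defs
  imports "HOL-Analysis.Analysis" "HOL-Probability.Essential_Supremum"
begin

text \<open>
  Points of the upper half-space are pairs \<open>(t, x) :: real \<times> (real ^ 'n)\<close> with \<open>t > 0\<close>, so
  \<open>n = CARD('n)\<close>. A function on the half-space is represented by a total function; its values at
  \<open>t \<le> 0\<close> never matter. Exponents in \<open>(0, \<infinity>]\<close> have type \<^typ>\<open>ennreal\<close>, and ``measurable'' means
  Lebesgue measurable. Elements of function spaces are genuine functions, not classes modulo null
  sets; compatibility of an operator with a.e. equality is not assumed.
\<close>

definition upper_half_space :: "(real \<times> (real ^ 'n)) set" where
  "upper_half_space = {0<..} \<times> UNIV"

definition L0 :: "(real \<times> (real ^ 'n) \<Rightarrow> complex) set" where
  "L0 = borel_measurable (lebesgue_on upper_half_space)"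

definition Linf_c :: "(real \<times> (real ^ 'n) \<Rightarrow> complex) set" where
  "Linf_c = {f. f \<in> borel_measurable lebesgue \<and> bounded (range f) \<and>
     (\<exists>K. compact K \<and> K \<subseteq> upper_half_space \<and> (\<forall>z. z \<notin> K \<longrightarrow> f z = 0))}"

text \<open>\<open>[a, b] = 1/a - 1/b\<close>; note that \<open>inverse \<infinity> = 0\<close>.\<close>

definition brk :: "ennreal \<Rightarrow> ennreal \<Rightarrow> real" where
  "brk a b = enn2real (inverse a) - enn2real (inverse b)"

text \<open>The power \<open>x\<^sup>a\<close> on \<open>[0, \<infinity>]\<close>, only meant for \<open>0 < a < \<infinity>\<close>.\<close>

definition epowr :: "ennreal \<Rightarrow> real \<Rightarrow> ennreal" where
  "epowr x a = (if x = \<infinity> then \<infinity> else ennreal (enn2real x powr a))"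

definition Lp_norm :: "ennreal \<Rightarrow> 'a measure \<Rightarrow> ('a \<Rightarrow> ennreal) \<Rightarrow> ennreal" where
  "Lp_norm p \<mu> g =
     (if p = \<infinity> then esssup \<mu> g
      else epowr (\<integral>\<^sup>+ z. epowr (g z) (enn2real p) \<partial>\<mu>) (1 / enn2real p))"

definition mixed_norm :: "ennreal \<Rightarrow> ennreal \<Rightarrow> (real \<times> (real ^ 'n) \<Rightarrow> complex) \<Rightarrow> ennreal" where
  "mixed_norm a b f =
     Lp_norm a (lebesgue_on {0<..}) (\<lambda>t. Lp_norm b lebesgue (\<lambda>x. ennreal (norm (f (t, x)))))"

definition mean_integral :: "'a::euclidean_space set \<Rightarrow> ('a \<Rightarrow> ennreal) \<Rightarrow> ennreal" where
  "mean_integral A g = (\<integral>\<^sup>+ z \<in> A. g z \<partial>lebesgue) / emeasure lebesgue A"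

definition restr :: "'a set \<Rightarrow> ('a \<Rightarrow> complex) \<Rightarrow> 'a \<Rightarrow> complex" where
  "restr E f = (\<lambda>z. indicator E z * f z)"

text \<open>
  Cubes and intervals may be open, closed or half-open, but have positive side length.
\<close>

definition axis_cube :: "(real ^ 'n) set \<Rightarrow> bool" where
  "axis_cube Q \<longleftrightarrow> (\<exists>l > 0. \<exists>J :: 'n \<Rightarrow> real set.
     (\<forall>i. is_interval (J i) \<and> bounded (J i) \<and> diameter (J i) = l) \<and>
     Q = {x. \<forall>i. x $ i \<in> J i})"

text \<open>
  Boundedness of \<open>E\<^sub>t\<close> loses nothing: if one of the two time intervals is unbounded then
  \<open>\<ell>\<^sub>t = \<infinity>\<close>, and every estimate below presupposes \<open>\<ell>\<^sub>t\<^bsup>1/m\<^esup> \<le> \<ell>\<^sub>x < \<infinity>\<close>.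
\<close>

definition rectangle :: "real set \<Rightarrow> (real ^ 'n) set \<Rightarrow> bool" where
  "rectangle E\<^sub>t E\<^sub>x \<longleftrightarrow>
     E\<^sub>t \<subseteq> {0<..} \<and> is_interval E\<^sub>t \<and> bounded E\<^sub>t \<and> 0 < diameter E\<^sub>t \<and> axis_cube E\<^sub>x"

definition len_x :: "(real ^ 'n) set \<Rightarrow> (real ^ 'n) set \<Rightarrow> real" where
  "len_x E\<^sub>x F\<^sub>x = diameter (E\<^sub>x \<union> F\<^sub>x)"

definition len_t :: "real set \<Rightarrow> real set \<Rightarrow> real" where
  "len_t E\<^sub>t F\<^sub>t = Sup (E\<^sub>t \<union> F\<^sub>t)"

definition subadditive_op ::
  "((real \<times> (real ^ 'n) \<Rightarrow> complex) \<Rightarrow> (real \<times> (real ^ 'n) \<Rightarrow> complex)) \<Rightarrow> bool" where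
  "subadditive_op T \<longleftrightarrow>
     (\<forall>f \<in> Linf_c. T f \<in> L0) \<and>
     (\<forall>f \<in> Linf_c. \<forall>g \<in> Linf_c. AE z in lebesgue_on upper_half_space.
        norm (T (\<lambda>w. f w + g w) z) \<le> norm (T f z) + norm (T g z))"

definition singular_operator ::
  "real \<Rightarrow> real \<Rightarrow> real \<Rightarrow> ennreal \<Rightarrow> ennreal \<Rightarrow> ennreal \<Rightarrow> ennreal \<Rightarrow> ennreal \<Rightarrow> real \<Rightarrow>
   ((real \<times> (real ^ 'n) \<Rightarrow> complex) \<Rightarrow> (real \<times> (real ^ 'n) \<Rightarrow> complex)) \<Rightarrow> bool" where
  "singular_operator c \<kappa> m r ut ux vt vx M T \<longleftrightarrow> subadditive_op T \<and>
   (\<exists>C::real. C \<ge> 0 \<and> (\<forall>f \<in> Linf_c.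
     (\<forall>E\<^sub>t E\<^sub>x. rectangle E\<^sub>t E\<^sub>x \<longrightarrow>
        c * len_x E\<^sub>x E\<^sub>x \<le> len_t E\<^sub>t E\<^sub>t powr (1 / m) \<longrightarrow>
        len_t E\<^sub>t E\<^sub>t powr (1 / m) \<le> len_x E\<^sub>x E\<^sub>x \<longrightarrow>
        Inf E\<^sub>t \<ge> c powr m * len_t E\<^sub>t E\<^sub>t \<longrightarrow>
        mixed_norm r r (restr (E\<^sub>t \<times> E\<^sub>x) (T (restr (E\<^sub>t \<times> E\<^sub>x) f)))
          \<le> ennreal (C * Inf E\<^sub>t powr \<kappa>) * mixed_norm r r (restr (E\<^sub>t \<times> E\<^sub>x) f)) \<and>
     (\<forall>E\<^sub>t E\<^sub>x F\<^sub>t F\<^sub>x. rectangle E\<^sub>t E\<^sub>x \<longrightarrow> rectangle F\<^sub>t F\<^sub>x \<longrightarrow>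
        c * len_x E\<^sub>x F\<^sub>x \<le> len_t E\<^sub>t F\<^sub>t powr (1 / m) \<longrightarrow>
        len_t E\<^sub>t F\<^sub>t powr (1 / m) \<le> len_x E\<^sub>x F\<^sub>x \<longrightarrow>
        setdist E\<^sub>t F\<^sub>t \<ge> c powr m * len_t E\<^sub>t F\<^sub>t \<longrightarrow>
        mixed_norm vt vx (restr (F\<^sub>t \<times> F\<^sub>x) (T (restr (E\<^sub>t \<times> E\<^sub>x) f)))
          \<le> ennreal (C * setdist E\<^sub>t F\<^sub>t powr (- brk ut vt - real CARD('n) / m * brk ux vx + \<kappa>))
             * mixed_norm ut ux (restr (E\<^sub>t \<times> E\<^sub>x) f)) \<and>
     (\<forall>E\<^sub>t E\<^sub>x F\<^sub>t F\<^sub>x. rectangle E\<^sub>t E\<^sub>x \<longrightarrow> rectangle F\<^sub>t F\<^sub>x \<longrightarrow>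
        len_t E\<^sub>t F\<^sub>t powr (1 / m) \<le> len_x E\<^sub>x F\<^sub>x \<longrightarrow>
        setdist E\<^sub>t F\<^sub>t \<ge> c powr m * len_t E\<^sub>t F\<^sub>t \<longrightarrow>
        setdist E\<^sub>x F\<^sub>x \<ge> c * len_x E\<^sub>x F\<^sub>x \<longrightarrow>
        mixed_norm vt vx (restr (F\<^sub>t \<times> F\<^sub>x) (T (restr (E\<^sub>t \<times> E\<^sub>x) f)))
          \<le> ennreal (C * setdist E\<^sub>x F\<^sub>x powr (- m * brk ut vt - real CARD('n) * brk ux vx + m * \<kappa>)
                       * (diameter (E\<^sub>t \<union> F\<^sub>t) / setdist E\<^sub>x F\<^sub>x powr m) powr M)
             * mixed_norm ut ux (restr (E\<^sub>t \<times> E\<^sub>x) f)) \<and>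
     (\<forall>E\<^sub>t E\<^sub>x F\<^sub>t F\<^sub>x. rectangle E\<^sub>t E\<^sub>x \<longrightarrow> rectangle F\<^sub>t F\<^sub>x \<longrightarrow>
        len_t E\<^sub>t F\<^sub>t powr (1 / m) \<le> len_x E\<^sub>x F\<^sub>x \<longrightarrow>
        setdist E\<^sub>x F\<^sub>x \<ge> c * len_x E\<^sub>x F\<^sub>x \<longrightarrow>
        mixed_norm r vx (restr (F\<^sub>t \<times> F\<^sub>x) (T (restr (E\<^sub>t \<times> E\<^sub>x) f)))
          \<le> ennreal (C * setdist E\<^sub>x F\<^sub>x powr (- real CARD('n) * brk ux vx + m * \<kappa>)
                       * (diameter (E\<^sub>t \<union> F\<^sub>t) / setdist E\<^sub>x F\<^sub>x powr m) powr (M + brk ut vt))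
             * mixed_norm r ux (restr (E\<^sub>t \<times> E\<^sub>x) f))))"

text \<open>
  In the next two definitions the sets are arbitrary measurable ones, so the infimum and supremum
  are taken in \<^typ>\<open>ereal\<close> (\<open>Sup E\<^sub>t\<close> may be \<open>\<infinity>\<close>). Measurability makes the restriction of \<open>f\<close> an
  element of \<^const>\<open>Linf_c\<close>.
\<close>

definition causal ::
  "((real \<times> (real ^ 'n) \<Rightarrow> complex) \<Rightarrow> (real \<times> (real ^ 'n) \<Rightarrow> complex)) \<Rightarrow> bool" where
  "causal T \<longleftrightarrow> (\<forall>f \<in> Linf_c. \<forall>E\<^sub>t \<in> sets lebesgue. \<forall>E\<^sub>x \<in> sets lebesgue. E\<^sub>t \<subseteq> {0<..} \<longrightarrow>
     (AE z in lebesgue_on upper_half_space.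
        ereal (fst z) < (INF s\<in>E\<^sub>t. ereal s) \<longrightarrow> T (restr (E\<^sub>t \<times> E\<^sub>x) f) z = 0))"

definition anticausal ::
  "((real \<times> (real ^ 'n) \<Rightarrow> complex) \<Rightarrow> (real \<times> (real ^ 'n) \<Rightarrow> complex)) \<Rightarrow> bool" where
  "anticausal T \<longleftrightarrow> (\<forall>f \<in> Linf_c. \<forall>E\<^sub>t \<in> sets lebesgue. \<forall>E\<^sub>x \<in> sets lebesgue. E\<^sub>t \<subseteq> {0<..} \<longrightarrow>
     (AE z in lebesgue_on upper_half_space.
        ereal (fst z) > (SUP s\<in>E\<^sub>t. ereal s) \<longrightarrow> T (restr (E\<^sub>t \<times> E\<^sub>x) f) z = 0))"

definition whitney ::
  "real \<Rightarrow> ennreal \<Rightarrow> (real \<times> (real ^ 'n) \<Rightarrow> complex) \<Rightarrow> real \<Rightarrow> real ^ 'n \<Rightarrow> ennreal" where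
  "whitney m r f t x =
     (if r = \<infinity>
      then esssup (lebesgue_on ({2 powr (- m) * t <..< t} \<times> ball x (t powr (1 / m))))
             (\<lambda>z. ennreal (norm (f z)))
      else epowr
             (mean_integral {2 powr (- m) * t <..< t} (\<lambda>s.
                mean_integral (ball x (t powr (1 / m))) (\<lambda>y.
                  epowr (ennreal (norm (f (s, y)))) (enn2real r))))
             (1 / enn2real r))"

definition tent_norm ::
  "real \<Rightarrow> ennreal \<Rightarrow> ennreal \<Rightarrow> ennreal \<Rightarrow> real \<Rightarrow> (real \<times> (real ^ 'n) \<Rightarrow> complex) \<Rightarrow> ennreal" where
  "tent_norm m p q r \<beta> f =
     (let g = (\<lambda>t x. ennreal (t powr (- \<beta>)) * whitney m r f t x) in
      if p < \<infinity> then
        Lp_norm p lebesgue (\<lambda>x. Lp_norm q (lebesgue_on {0<..}) (\<lambda>t. g t x))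
      else if q < \<infinity> then
        (SUP (\<tau>, y) \<in> upper_half_space.
           epowr (\<integral>\<^sup>+ t \<in> {0<..<\<tau>}.
                    mean_integral (ball y (\<tau> powr (1 / m))) (\<lambda>x. epowr (g t x) (enn2real q))
                  \<partial>lebesgue)
                 (1 / enn2real q))
      else esssup (lebesgue_on upper_half_space) (\<lambda>(t, x). g t x))"

end

theory Submission
 imports Defs
begin

text \<open>
 Off-diagonal estimates are summed over dyadic pieces. A tile of \<open>f\<close> is its \<open>L\<^sup>r\<close> mean over a Whitney box, an octave in
 time times a dyadic cell, and tent space norms are equivalent to discrete norms of the tiles. For a target box the
 function is cut into pieces \<open>f 1\<^sub>E\<close> according to the octave and the dyadic ring of \<open>E\<close>. The hypotheses on \<open>T\<close>, with
 Minkowski's and Hoelder's inequalities, bound a \<open>V\<close>-average of the tiles of \<open>T (f 1\<^sub>E)\<close> by a coefficient times a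
 \<open>U\<close>-average of the tiles of \<open>f\<close> at the scale of the piece, where \<open>U < p, q < V\<close>. As tiles are constant on cells, passing
 from \<open>u\<^sub>x\<close> down to \<open>U\<close> and from \<open>v\<^sub>x\<close> up to \<open>V\<close> costs a fixed factor per dyadic step. The decay condition is what
 makes the coefficients geometrically small in the ring number; the lower bound on \<open>\<beta>\<close> does the same for sources in
 earlier octaves and the upper bound for sources in later ones, which a causal operator does not see.

 The summation rests on a vector-valued inequality: functions \<open>B\<^sub>i\<close> whose \<open>V\<close>-averages on cells are dominated by
 \<open>U\<close>-averages of \<open>A\<^sub>i\<close> satisfy \<open>\<parallel>\<Sum> B\<^sub>i\<parallel>\<^sub>P \<le> K \<parallel>\<Sum> A\<^sub>i\<parallel>\<^sub>P\<close> for \<open>U < P < V\<close>. For \<open>P > 1\<close> this is duality with the maximal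
 function, for \<open>P < 1\<close> a weight built by the Rubio de Francia iteration reduces it to \<open>P = 1\<close>.
\<close>

\<comment> \<open>The operator is merely subadditive, and only over finitely many summands, so there
  is no kernel and no linear decomposition to work with: for each target box the function is split
  afresh, exactly and pointwise, and compact support makes the splitting finite. Neighbouring
  octaves have no separation in time; they are merged into one source, to which only the local
  \<open>L^r\<close> estimate and the estimate with separation in space apply. All bounds carry
  explicit powers of 2, so the exponent of a piece is, on each side of shift zero, affine in the
  octave shift and in the ring number. Its slopes are the slacks in the bounds on \<beta> and in the
  decay condition, up to the loss caused by \<open>U\<close> and \<open>V\<close>. This is why
  strict inequalities are assumed: \<open>U\<close> has to lie strictly below \<open>p\<close> and
  \<open>q\<close>, and for finite \<open>p\<close> and \<open>q\<close> \<open>V\<close> strictly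
  above them, since the maximal function is unbounded on \<open>L^1\<close>; the slack pays for the
  distance. The two bracket terms with \<open>min\<close> and \<open>max\<close> are the price per
  dyadic step of passing to such exponents for functions constant on cells.\<close>
text \<open>
 Below, \<open>\<integral>\<close> without a measure is the nonnegative (not the Bochner) integral over \<open>lborel\<close>, and \<open>\<Sum>\<^sup>+\<close> is the
 unconditional sum in \<open>[0, \<infinity>]\<close>.
\<close>

syntax
 "_lint" :: "pttrn => ennreal => ennreal" ("(\<integral>_./ _)" [0, 10] 10)
 "_lsint" :: "pttrn => 'a set => ennreal => ennreal" ("(\<integral>_\<in>_./ _)" [0, 0, 10] 10)
 "_csum" :: "pttrn => ennreal => ennreal" ("(\<Sum>\<^sup>+_./ _)" [0, 10] 10)
 "_cssum" :: "pttrn => 'a set => ennreal => ennreal" ("(\<Sum>\<^sup>+_\<in>_./ _)" [0, 0, 10] 10)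
translations
 "\<integral>x. f" == "CONST nn_integral (CONST lborel) (\<lambda>x. f)"
 "\<integral>x\<in>A. f" == "CONST set_nn_integral (CONST lborel) A (\<lambda>x. f)"
 "\<Sum>\<^sup>+x. f" == "CONST nn_integral (CONST count_space (CONST UNIV)) (\<lambda>x. f)"
 "\<Sum>\<^sup>+x\<in>A. f" == "CONST nn_integral (CONST count_space A) (\<lambda>x. f)"

abbreviation rl :: "int => real" where "rl == real_of_int"

abbreviation bor :: "('a::topological_space => 'b::topological_space) set" where "bor == borel_measurable borel"

abbreviation joint_borel :: "('a::topological_space => 'b::topological_space => 'c::topological_space) => bool" where
 "joint_borel w == (\<lambda>(t, x). w t x) \<in> borel_measurable (borel \<Otimes>\<^sub>M borel)"

section \<open>Powers and integral inequalities\<close>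

lemma epowr_ennreal: "0 <= x ==> epowr (ennreal x) a = ennreal (x powr a)"
 by (simp add: epowr_def)

lemma epowr_zero [simp]: "epowr 0 a = 0"
 by (simp add: epowr_def)

lemma epowr_top [simp]: "epowr top a = top"
 by (simp add: epowr_def)

lemma epowr_one_left [simp]: "epowr 1 a = 1"
 by (simp add: epowr_def)

lemma epowr_one [simp]: "epowr x 1 = x"
 by (cases x) (auto simp: epowr_def)

lemma epowr_eq_0_iff [simp]: "epowr x a = 0 \<longleftrightarrow> x = 0"
 by (cases x) (auto simp: epowr_def)

lemma epowr_eq_top_iff [simp]: "epowr x a = top \<longleftrightarrow> x = top"
 by (cases x) (auto simp: epowr_def)

lemma epowr_less_top_iff [simp]: "epowr x a < top \<longleftrightarrow> x < top"
 by (simp add: less_top[symmetric])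

lemma epowr_mono: "x <= y ==> 0 <= a ==> epowr x a <= epowr y a"
 by (cases x; cases y) (auto simp: epowr_def top_unique intro!: ennreal_leI powr_mono2)

lemma epowr_mult: "epowr (x * y) a = epowr x a * epowr y a"
 by (cases x; cases y; cases "x = 0"; cases "y = 0")
  (auto simp: epowr_def ennreal_mult'' [symmetric] powr_mult ennreal_top_mult ennreal_mult_top
   ennreal_mult_eq_top_iff)

lemma epowr_epowr: "epowr (epowr x a) b = epowr x (a * b)"
 by (cases x) (auto simp: epowr_def powr_powr)

lemma epowr_add: "epowr x (a + b) = epowr x a * epowr x b"
 by (cases x) (auto simp: epowr_def powr_add ennreal_mult'' )

lemma epowr_le_iff: "0 < a ==> epowr x a <= y \<longleftrightarrow> x <= epowr y (1 / a)"
proof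
 assume a: "0 < a" and "epowr x a <= y"
 from epowr_mono[OF this(2), of "1 / a"] a show "x <= epowr y (1 / a)"
 by (simp add: epowr_epowr)
next
 assume a: "0 < a" and "x <= epowr y (1 / a)"
 from epowr_mono[OF this(2), of "a"] a show "epowr x a <= y"
 by (simp add: epowr_epowr)
qed

text \<open>For a positive exponent the power is an order isomorphism of [0, \<infinity>] whose
  inverse is the power \<open>1 / a\<close>; hence it commutes with arbitrary suprema.\<close>

lemma epowr_SUP:
 assumes "0 < a"
 shows "epowr (SUP i\<in>I. f i) a = (SUP i\<in>I. epowr (f i) a)"
proof (rule antisym)
 have "f i <= epowr (SUP i\<in>I. epowr (f i) a) (1 / a)" if "i \<in> I" for i
  using that assms by (subst epowr_le_iff[symmetric]) (auto intro: SUP_upper)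
 then show "epowr (SUP i\<in>I. f i) a <= (SUP i\<in>I. epowr (f i) a)"
  using assms by (subst epowr_le_iff) (auto intro: SUP_least)
 show "(SUP i\<in>I. epowr (f i) a) <= epowr (SUP i\<in>I. f i) a"
  using assms by (intro SUP_least epowr_mono SUP_upper) auto
qed

lemma borel_measurable_epowr [measurable (raw)]:
 assumes [measurable]: "f \<in> borel_measurable M"
 shows "(\<lambda>x. epowr (f x) a) \<in> borel_measurable M"
 unfolding epowr_def by measurable

text \<open>The sum is at most \<open>card I\<close> times its largest term. This crude route gives
  one constant for exponents below and above 1, where convexity would need two cases.\<close>

lemma epowr_sum_le:
 assumes "0 < a" "finite I"
 shows "epowr (\<Sum>i\<in>I. f i) a <= ennreal (real (card I) powr a) * (\<Sum>i\<in>I. epowr (f i) a)"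
proof (cases "I = {}")
 case False
 define m where "m = Max (f ` I)"
 have "m \<in> f ` I" unfolding m_def using False assms by (intro Max_in) auto
 then obtain i where i: "i \<in> I" "m = f i" by auto
 have "(\<Sum>i\<in>I. f i) <= of_nat (card I) * m"
  using assms by (intro sum_bounded_above) (auto simp: m_def)
 then have "epowr (\<Sum>i\<in>I. f i) a <= epowr (ennreal (card I) * m) a"
  using assms by (intro epowr_mono) (auto simp: ennreal_of_nat_eq_real_of_nat)
 also have "... = ennreal (real (card I) powr a) * epowr (f i) a"
  using i by (simp add: epowr_mult epowr_ennreal)
 also have "... <= ennreal (real (card I) powr a) * (\<Sum>i\<in>I. epowr (f i) a)"
  using i assms by (intro mult_left_mono member_le_sum) auto
 finally show ?thesis .
qed simp

lemma epowr_Young: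
 assumes "0 < a" "a < 1"
 shows "epowr x a * epowr y (1 - a) <= ennreal a * x + ennreal (1 - a) * y"
proof (cases "x = 0 \<or> y = 0 \<or> x = top \<or> y = top")
 case True
 then show ?thesis using assms by (auto simp: ennreal_mult_top)
next
 case False
 then obtain u v where uv: "x = ennreal u" "y = ennreal v" "u > 0" "v > 0"
 by (cases x; cases y) (auto simp: less_le)
 have "u powr a * v powr (1 - a) <= a * u + (1 - a) * v"
  using assms uv by (intro Youngs_inequality_0) auto
 then show ?thesis
  using assms uv by (simp add: epowr_ennreal ennreal_mult'' [symmetric] ennreal_plus[symmetric]
    ennreal_leI del: ennreal_plus)
qed

text \<open>Both functions are divided by their integrals and the weighted Young inequality is
  integrated; the cases of an integral \<open>0\<close> or \<open>top\<close>, where the division is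
  meaningless, are settled beforehand. In the form \<open>f^a g^(1-a)\<close> both sides are
  homogeneous of degree one in the measure, so the inequality passes to averages.\<close>

lemma nn_integral_Holder:
 assumes [measurable]: "f \<in> borel_measurable M" "g \<in> borel_measurable M" and a: "0 < a" "a < 1"
 shows "(\<integral>\<^sup>+ x. epowr (f x) a * epowr (g x) (1 - a) \<partial>M)
      <= epowr (\<integral>\<^sup>+ x. f x \<partial>M) a * epowr (\<integral>\<^sup>+ x. g x \<partial>M) (1 - a)"
proof -
 let ?F = "\<integral>\<^sup>+ x. f x \<partial>M" and ?G = "\<integral>\<^sup>+ x. g x \<partial>M"
 consider "?F = 0 \<or> ?G = 0" | "?F \<noteq> 0" "?G \<noteq> 0" "?F = top \<or> ?G = top"
  | "?F \<noteq> 0" "?G \<noteq> 0" "?F \<noteq> top" "?G \<noteq> top" by blast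
 then show ?thesis
 proof cases
  case 1
  then have "AE x in M. f x = 0 \<or> g x = 0" by (auto simp: nn_integral_0_iff_AE elim: AE_mp)
  then have "(\<integral>\<^sup>+ x. epowr (f x) a * epowr (g x) (1 - a) \<partial>M) = 0"
  by (subst nn_integral_0_iff_AE) auto
  then show ?thesis by simp
 next
  case 2
  then show ?thesis by (auto simp: ennreal_top_mult ennreal_mult_top)
 next
  case 3
  have eq: "epowr (f x) a * epowr (g x) (1 - a) =
    epowr ?F a * epowr ?G (1 - a) * (epowr (f x / ?F) a * epowr (g x / ?G) (1 - a))" for x
  proof -
   have "f x = ?F * (f x / ?F)" "g x = ?G * (g x / ?G)"
    using 3 by (auto simp: ennreal_times_divide mult.commute[of "?F"] mult.commute[of "?G"] mult_divide_eq_ennreal)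
   then show ?thesis by (metis (no_types, lifting) epowr_mult mult.assoc mult.left_commute)
  qed
  have "(\<integral>\<^sup>+ x. epowr (f x) a * epowr (g x) (1 - a) \<partial>M)
    = epowr ?F a * epowr ?G (1 - a) * (\<integral>\<^sup>+ x. epowr (f x / ?F) a * epowr (g x / ?G) (1 - a) \<partial>M)"
  by (subst eq, subst nn_integral_cmult) auto
  also have "(\<integral>\<^sup>+ x. epowr (f x / ?F) a * epowr (g x / ?G) (1 - a) \<partial>M)
    <= (\<integral>\<^sup>+ x. ennreal a * (f x / ?F) + ennreal (1 - a) * (g x / ?G) \<partial>M)"
   using a by (intro nn_integral_mono epowr_Young)
  also have "... = ennreal a * (?F / ?F) + ennreal (1 - a) * (?G / ?G)"
  by (simp add: nn_integral_add nn_integral_cmult nn_integral_divide)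
  also have "... = 1"
   using 3 a by (simp add: ennreal_divide_self ennreal_plus[symmetric] less_top del: ennreal_plus)
  finally show ?thesis by (simp add: mult_left_mono)
 qed
qed

lemma nn_integral_Holder_conj:
 assumes [measurable]: "f \<in> borel_measurable M" "g \<in> borel_measurable M" and s: "1 < s"
 shows "(\<integral>\<^sup>+ x. f x * g x \<partial>M)
  <= epowr (\<integral>\<^sup>+ x. epowr (f x) s \<partial>M) (1 / s) * epowr (\<integral>\<^sup>+ x. epowr (g x) (s / (s - 1)) \<partial>M) (1 - 1 / s)"
proof -
 have "s / (s - 1) * (1 - 1 / s) = 1" using s by (simp add: field_simps)
 then show ?thesis
  using nn_integral_Holder[of "\<lambda>x. epowr (f x) s" M "\<lambda>x. epowr (g x) (s / (s - 1))" "1 / s"] s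
 by (simp add: epowr_epowr)
qed

text \<open>Hoelder for \<open>k f\<close> and \<open>k\<close>, since
  \<open>k f^a = (k f)^a k^(1-a)\<close>. At \<open>a = 1\<close> the last factor is a zeroth power,
  which by convention is \<open>0\<close> when the integral of \<open>k\<close> vanishes; the left
  side then vanishes too.\<close>

lemma nn_integral_Jensen_weight:
 assumes [measurable]: "k \<in> borel_measurable M" "f \<in> borel_measurable M" and a: "0 < a" "a <= 1"
 shows "(\<integral>\<^sup>+ x. k x * epowr (f x) a \<partial>M) <= epowr (\<integral>\<^sup>+ x. k x * f x \<partial>M) a * epowr (\<integral>\<^sup>+ x. k x \<partial>M) (1 - a)"
proof (cases "a = 1")
 case True
 then show ?thesis
 proof (cases "(\<integral>\<^sup>+ x. k x \<partial>M) = 0")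
  case t: True
  then have "AE x in M. k x = 0" by (simp add: nn_integral_0_iff_AE)
  then have "(\<integral>\<^sup>+ x. k x * epowr (f x) a \<partial>M) = 0" by (subst nn_integral_0_iff_AE) auto
  then show ?thesis by simp
 next
  case False
  then have "1 <= epowr (\<integral>\<^sup>+ x. k x \<partial>M) (1 - a)"
   using True by (simp add: epowr_def enn2real_eq_0_iff)
  from mult_left_mono[OF this, of "\<integral>\<^sup>+ x. k x * f x \<partial>M"] show ?thesis using True by simp
 qed
next
 case False
 have "k x * epowr (f x) a = epowr (k x * f x) a * epowr (k x) (1 - a)" for x
 proof -
  have "k x = epowr (k x) (a + (1 - a))" by simp
  also have "... = epowr (k x) a * epowr (k x) (1 - a)" by (rule epowr_add)
  finally show ?thesis by (simp add: epowr_mult mult_ac)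
 qed
 then show ?thesis using nn_integral_Holder[of "\<lambda>x. k x * f x" M k a] False a by simp
qed

text \<open>Let \<open>H\<close> be the inner integral and \<open>K\<close> the integral of
  \<open>H^s\<close>. Writing \<open>H^s\<close> as \<open>H\<close> times \<open>H^(s-1)\<close>,
  exchanging the integrals and applying Hoelder bounds \<open>K\<close> by the right side times
  \<open>K^(1-1/s)\<close>. Dividing requires \<open>K < top\<close>; this is arranged by truncating
  \<open>G\<close> in height and support, and monotone convergence removes the truncation.\<close>

lemma nn_integral_Minkowski:
 assumes "sigma_finite_measure M1" "sigma_finite_measure M2"
  and [measurable]: "(\<lambda>(t, x). G t x) \<in> borel_measurable (M1 \<Otimes>\<^sub>M M2)" and s: "1 <= s"
 shows "epowr (\<integral>\<^sup>+ x. epowr (\<integral>\<^sup>+ t. G t x \<partial>M1) s \<partial>M2) (1 / s)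
  <= (\<integral>\<^sup>+ t. epowr (\<integral>\<^sup>+ x. epowr (G t x) s \<partial>M2) (1 / s) \<partial>M1)"
proof (cases "s = 1")
 interpret M1: sigma_finite_measure M1 by fact
 interpret M2: sigma_finite_measure M2 by fact
 interpret pair_sigma_finite M1 M2 ..
 case True
 then show ?thesis using Fubini'[of G] by simp
next
 interpret M1: sigma_finite_measure M1 by fact
 interpret M2: sigma_finite_measure M2 by fact
 interpret pair_sigma_finite M1 M2 ..
 case False
 with s have s: "1 < s" by simp
 have fin: "epowr (\<integral>\<^sup>+ x. epowr (\<integral>\<^sup>+ t. G t x \<partial>M1) s \<partial>M2) (1 / s)
  <= (\<integral>\<^sup>+ t. epowr (\<integral>\<^sup>+ x. epowr (G t x) s \<partial>M2) (1 / s) \<partial>M1)"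
  if [measurable]: "(\<lambda>(t, x). G t x) \<in> borel_measurable (M1 \<Otimes>\<^sub>M M2)"
   and K: "(\<integral>\<^sup>+ x. epowr (\<integral>\<^sup>+ t. G t x \<partial>M1) s \<partial>M2) < top" for G
 proof -
  define H where "H x = (\<integral>\<^sup>+ t. G t x \<partial>M1)" for x
  have [measurable]: "H \<in> borel_measurable M2" unfolding H_def by measurable
  define K where "K = (\<integral>\<^sup>+ x. epowr (H x) s \<partial>M2)"
  have "K = (\<integral>\<^sup>+ x. H x * epowr (H x) (s - 1) \<partial>M2)"
   unfolding K_def using epowr_add[of _ 1 "s - 1"] by simp
  also have "... = (\<integral>\<^sup>+ x. (\<integral>\<^sup>+ t. G t x * epowr (H x) (s - 1) \<partial>M1) \<partial>M2)"
  by (auto intro!: nn_integral_cong simp: H_def nn_integral_multc)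
  also have "... = (\<integral>\<^sup>+ t. (\<integral>\<^sup>+ x. G t x * epowr (H x) (s - 1) \<partial>M2) \<partial>M1)"
  by (rule Fubini') measurable
  also have "... <= (\<integral>\<^sup>+ t. epowr (\<integral>\<^sup>+ x. epowr (G t x) s \<partial>M2) (1 / s) * epowr K (1 - 1 / s) \<partial>M1)"
  proof (rule nn_integral_mono)
   fix t assume "t \<in> space M1"
   then have [measurable]: "G t \<in> borel_measurable M2" by simp
   have "s - 1 \<noteq> 0" using s by simp
   then show "(\<integral>\<^sup>+ x. G t x * epowr (H x) (s - 1) \<partial>M2)
     <= epowr (\<integral>\<^sup>+ x. epowr (G t x) s \<partial>M2) (1 / s) * epowr K (1 - 1 / s)"
    using nn_integral_Holder_conj[of "G t" M2 "\<lambda>x. epowr (H x) (s - 1)" s] s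
   by (simp add: epowr_epowr K_def)
  qed
  also have "... = (\<integral>\<^sup>+ t. epowr (\<integral>\<^sup>+ x. epowr (G t x) s \<partial>M2) (1 / s) \<partial>M1) * epowr K (1 - 1 / s)"
  by (rule nn_integral_multc) measurable
  finally have *: "K <= (\<integral>\<^sup>+ t. epowr (\<integral>\<^sup>+ x. epowr (G t x) s \<partial>M2) (1 / s) \<partial>M1) * epowr K (1 - 1 / s)" .
  show ?thesis
  proof (cases "K = 0")
   case True
   then show ?thesis by (simp add: K_def H_def)
  next
   case False
   have K2: "K = epowr K (1 / s) * epowr K (1 - 1 / s)"
    using epowr_add[of K "1 / s" "1 - 1 / s"] by simp
   have nz: "epowr K (1 - 1 / s) \<noteq> 0" "epowr K (1 - 1 / s) \<noteq> top"
    using False that(2) by (auto simp: K_def H_def)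
   have "epowr K (1 / s) <= (\<integral>\<^sup>+ t. epowr (\<integral>\<^sup>+ x. epowr (G t x) s \<partial>M2) (1 / s) \<partial>M1)"
    using *[unfolded arg_cong[OF K2, of "\<lambda>u. u <= _"]] nz
   by (subst (asm) (1) K2) (simp add: ennreal_mult_le_mult_iff mult.commute[of _ "epowr K (1 - 1 / s)"])
   then show ?thesis by (simp add: K_def H_def)
  qed
 qed
 obtain A where A: "range A \<subseteq> sets M1" "(\<Union>i. A i) = space M1" "\<And>i. emeasure M1 (A i) \<noteq> \<infinity>" "incseq A"
  using M1.sigma_finite_incseq by metis
 obtain B where B: "range B \<subseteq> sets M2" "(\<Union>i. B i) = space M2" "\<And>i. emeasure M2 (B i) \<noteq> \<infinity>" "incseq B"
  using M2.sigma_finite_incseq by metis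
 have [measurable]: "A i \<in> sets M1" "B i \<in> sets M2" for i using A B by auto
 define g where "g n t x = min (G t x) (of_nat n) * indicator (A n) t * indicator (B n) x" for n :: nat and t x
 have [measurable]: "(\<lambda>(t, x). g n t x) \<in> borel_measurable (M1 \<Otimes>\<^sub>M M2)" for n
  unfolding g_def by measurable
 have [measurable]: "(\<lambda>t. g n t x) \<in> borel_measurable M1" if "x \<in> space M2" for n x
  using that by simp
 have mono: "g n t x <= g k t x" if "n <= k" for n k t x
  unfolding g_def using incseqD[OF A(4) that] incseqD[OF B(4) that] that
 by (intro mult_mono min.mono) (auto split: split_indicator)
 have sup: "(SUP n. g n t x) = G t x" if "t \<in> space M1" "x \<in> space M2" for t x
 proof (rule antisym)
  show "(SUP n. g n t x) <= G t x"
  by (rule SUP_least) (auto simp: g_def split: split_indicator)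
  from that A(2) B(2) have "t \<in> (\<Union>i. A i)" "x \<in> (\<Union>i. B i)" by auto
  then obtain a b where ab: "t \<in> A a" "x \<in> B b" by auto
  have in_AB: "t \<in> A n" "x \<in> B n" if "max a b <= n" for n
   using ab incseqD[OF A(4), of a n] incseqD[OF B(4), of b n] that by auto
  show "G t x <= (SUP n. g n t x)"
  proof (cases "G t x")
   case (real r)
   obtain n where n: "r <= of_nat n" using real_arch_simple by blast
   let ?n = "max n (max a b)"
   have "ennreal r <= of_nat ?n"
    using n by (simp add: ennreal_of_nat_eq_real_of_nat ennreal_leI)
   then have "G t x <= g ?n t x"
    using in_AB[of ?n] real by (simp add: g_def)
   also have "... <= (SUP n. g n t x)" by (rule SUP_upper) simp
   finally show ?thesis .
  next
   case top
   have "of_nat n <= (SUP n. g n t x)" for n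
   proof -
    let ?n = "max n (max a b)"
    have "(of_nat n :: ennreal) <= of_nat ?n" by (rule of_nat_mono) simp
    also have "... = g ?n t x"
     using in_AB[of ?n] top by (simp add: g_def)
    also have "... <= (SUP n. g n t x)" by (rule SUP_upper) simp
    finally show ?thesis .
   qed
   then have "(SUP n. of_nat n :: ennreal) <= (SUP n. g n t x)"
   by (intro SUP_least) auto
   then have "top <= (SUP n. g n t x)" by (simp only: ennreal_SUP_of_nat_eq_top)
   then show ?thesis by (rule order_trans[OF top_greatest])
  qed
 qed
 have bound: "(\<integral>\<^sup>+ x. epowr (\<integral>\<^sup>+ t. g n t x \<partial>M1) s \<partial>M2) < top" for n
 proof -
  have "(\<integral>\<^sup>+ x. epowr (\<integral>\<^sup>+ t. g n t x \<partial>M1) s \<partial>M2)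
    <= (\<integral>\<^sup>+ x. epowr (of_nat n * emeasure M1 (A n)) s * indicator (B n) x \<partial>M2)"
  proof (rule nn_integral_mono)
   fix x
   have "(\<integral>\<^sup>+ t. g n t x \<partial>M1) <= (\<integral>\<^sup>+ t. of_nat n * indicator (B n) x * indicator (A n) t \<partial>M1)"
   by (intro nn_integral_mono) (auto simp: g_def split: split_indicator)
   also have "... = of_nat n * indicator (B n) x * emeasure M1 (A n)"
   by (subst nn_integral_cmult_indicator) auto
   finally show "epowr (\<integral>\<^sup>+ t. g n t x \<partial>M1) s <= epowr (of_nat n * emeasure M1 (A n)) s * indicator (B n) x"
    using s epowr_mono[of "\<integral>\<^sup>+ t. g n t x \<partial>M1" _ s] by (auto split: split_indicator)
  qed
  also have "... = epowr (of_nat n * emeasure M1 (A n)) s * emeasure M2 (B n)"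
  by (subst nn_integral_cmult_indicator) auto
  also have "... < top"
   using A(3)[of n] B(3)[of n] by (auto simp: ennreal_mult_less_top less_top of_nat_less_top)
  finally show ?thesis .
 qed
 have "(\<integral>\<^sup>+ t. G t x \<partial>M1) = (SUP n. \<integral>\<^sup>+ t. g n t x \<partial>M1)" if "x \<in> space M2" for x
 proof -
  have "(\<integral>\<^sup>+ t. G t x \<partial>M1) = (\<integral>\<^sup>+ t. (SUP n. g n t x) \<partial>M1)"
   using that by (intro nn_integral_cong) (simp add: sup)
  also have "... = (SUP n. \<integral>\<^sup>+ t. g n t x \<partial>M1)"
   using that by (intro nn_integral_monotone_convergence_SUP) (auto simp: incseq_def le_fun_def intro: mono)
  finally show ?thesis .
 qed
 then have "(\<integral>\<^sup>+ x. epowr (\<integral>\<^sup>+ t. G t x \<partial>M1) s \<partial>M2) = (\<integral>\<^sup>+ x. (SUP n. epowr (\<integral>\<^sup>+ t. g n t x \<partial>M1) s) \<partial>M2)"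
  using s by (intro nn_integral_cong) (simp add: epowr_SUP)
 also have "... = (SUP n. \<integral>\<^sup>+ x. epowr (\<integral>\<^sup>+ t. g n t x \<partial>M1) s \<partial>M2)"
  using s by (intro nn_integral_monotone_convergence_SUP)
   (auto simp: incseq_def le_fun_def intro!: epowr_mono nn_integral_mono mono)
 finally have "epowr (\<integral>\<^sup>+ x. epowr (\<integral>\<^sup>+ t. G t x \<partial>M1) s \<partial>M2) (1 / s)
   = (SUP n. epowr (\<integral>\<^sup>+ x. epowr (\<integral>\<^sup>+ t. g n t x \<partial>M1) s \<partial>M2) (1 / s))"
  using s by (simp add: epowr_SUP)
 also have "... <= (\<integral>\<^sup>+ t. epowr (\<integral>\<^sup>+ x. epowr (G t x) s \<partial>M2) (1 / s) \<partial>M1)"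
 proof (rule SUP_least)
  fix n
  have "epowr (\<integral>\<^sup>+ x. epowr (\<integral>\<^sup>+ t. g n t x \<partial>M1) s \<partial>M2) (1 / s)
    <= (\<integral>\<^sup>+ t. epowr (\<integral>\<^sup>+ x. epowr (g n t x) s \<partial>M2) (1 / s) \<partial>M1)"
  by (rule fin) (auto simp: bound)
  also have "... <= (\<integral>\<^sup>+ t. epowr (\<integral>\<^sup>+ x. epowr (G t x) s \<partial>M2) (1 / s) \<partial>M1)"
   using s by (intro nn_integral_mono epowr_mono) (auto simp: g_def split: split_indicator)
  finally show "epowr (\<integral>\<^sup>+ x. epowr (\<integral>\<^sup>+ t. g n t x \<partial>M1) s \<partial>M2) (1 / s)
    <= (\<integral>\<^sup>+ t. epowr (\<integral>\<^sup>+ x. epowr (G t x) s \<partial>M2) (1 / s) \<partial>M1)" .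
 qed
 finally show ?thesis .
qed

section \<open>Dyadic cells and averages\<close>

text \<open>Cells are handled through integer index vectors: passing to the parent cell is
  \<open>div 2\<close> in each coordinate (\<open>idx_Suc\<close>), and being equal or adjacent is a
  condition on integers, so nesting and neighbourhood become linear arithmetic.\<close>

definition idx :: "int => real ^ 'n => int ^ 'n" where
 "idx R x = (\<chi> i. \<lfloor>x $ i / 2 powr rl R\<rfloor>)"

definition cell :: "int => real ^ 'n => (real ^ 'n) set" where
 "cell R x = {y. idx R y = idx R x}"

definition cell3 :: "int => real ^ 'n => (real ^ 'n) set" where
 "cell3 R x = {y. \<forall>i. \<bar>idx R y $ i - idx R x $ i\<bar> <= 1}"

text \<open>The normalisation is the volume of a cell of level \<open>R\<close>, whatever the set
  \<open>S\<close>. Hence the average is monotone in \<open>S\<close>, is the mean on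
  \<open>cell R x\<close> and \<open>3^n\<close> times the mean on \<open>cell3 R x\<close>, and a
  change of level costs an explicit power of 2 (\<open>avg_level\<close>).\<close>

definition avg :: "int => (real ^ 'n) set => (real ^ 'n => ennreal) => ennreal" where
 "avg R S g = ennreal (2 powr (- rl R * real CARD('n))) * (\<integral>y. g y * indicator S y)"

definition pavg :: "int => real => (real ^ 'n) set => (real ^ 'n => ennreal) => ennreal" where
 "pavg R u S g = epowr (avg R S (\<lambda>y. epowr (g y) u)) (1 / u)"

lemma idx_nth: "idx R x $ i = \<lfloor>x $ i / 2 powr rl R\<rfloor>"
 by (simp add: idx_def)

lemma idx_Suc: "idx (R + 1) x $ i = idx R x $ i div 2"
proof -
 have "x $ i / 2 powr rl (R + 1) = (x $ i / 2 powr rl R) / rl 2"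
 by (simp add: powr_add)
 then show ?thesis by (simp only: idx_nth floor_divide_real_eq_div)
qed

lemma idx_mono_eq:
 assumes "R <= R'" "idx R x = idx R y" shows "idx R' x = idx R' y"
 using assms(1)
proof (induction R' rule: int_ge_induct)
 case (step j)
 then show ?case by (simp add: vec_eq_iff idx_Suc)
qed (rule assms(2))

lemma idx_mono_adj:
 assumes "R <= R'" "\<bar>idx R x $ i - idx R y $ i\<bar> <= 1" shows "\<bar>idx R' x $ i - idx R' y $ i\<bar> <= 1"
 using assms(1)
proof (induction R' rule: int_ge_induct)
 case (step j)
 have "\<bar>a div 2 - b div 2\<bar> <= 1" if "\<bar>a - b\<bar> <= 1" for a b :: int
  using that by linarith
 with step show ?case by (simp add: idx_Suc)
qed (rule assms(2))

lemma cell_self [simp]: "x \<in> cell R x"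
 by (simp add: cell_def)

lemma cell3_self [simp]: "x \<in> cell3 R x"
 by (simp add: cell3_def)

lemma cell_sym: "y \<in> cell R x \<longleftrightarrow> x \<in> cell R y"
 by (auto simp: cell_def)

lemma cell3_sym: "y \<in> cell3 R x \<longleftrightarrow> x \<in> cell3 R y"
 by (auto simp: cell3_def abs_minus_commute)

lemma cell_eq: "y \<in> cell R x ==> cell R y = cell R x"
 by (auto simp: cell_def)

lemma cell3_eq: "y \<in> cell R x ==> cell3 R y = cell3 R x"
 by (auto simp: cell_def cell3_def)

lemma cell_subset_cell3: "cell R x \<subseteq> cell3 R x"
 by (auto simp: cell_def cell3_def)

lemma cell_mono: "R <= R' ==> cell R x \<subseteq> cell R' x"
 by (auto simp: cell_def intro: idx_mono_eq)

lemma cell3_mono: "R <= R' ==> cell3 R x \<subseteq> cell3 R' x"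
 unfolding cell3_def using idx_mono_adj by blast

lemma cell_subset: "k <= R ==> y \<in> cell R x ==> cell k y \<subseteq> cell R x"
 using cell_mono cell_eq by blast

lemma cell3_subset: "k <= R ==> y \<in> cell3 R x ==> cell k y \<subseteq> cell3 R x"
 using cell_mono[of k R y] by (auto simp: cell3_def cell_def)

text \<open>The index offsets of two adjacent steps add up to at most 2, and halving brings this
  back to at most 1.\<close>

lemma cell3_trans:
 assumes "y \<in> cell3 R x" "z \<in> cell3 R y" shows "z \<in> cell3 (R + 1) x"
proof -
 have "\<bar>c div 2 - a div 2\<bar> <= 1" if "\<bar>b - a\<bar> <= 1" "\<bar>c - b\<bar> <= 1" for a b c :: int
  using that by linarith
 from this[of "idx R y $ i" "idx R x $ i" "idx R z $ i" for i] show ?thesis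
  using assms by (simp add: cell3_def idx_Suc)
qed

section \<open>Measurability and volume of cells\<close>

lemma borel_measurable_vec_nth [measurable]: "(\<lambda>x :: real ^ 'n. x $ i) \<in> bor"
 by (intro borel_measurable_continuous_onI continuous_intros)

lemma pred_idx [measurable]: "Measurable.pred (borel \<Otimes>\<^sub>M borel) (\<lambda>(x :: real ^ 'n, y). x \<in> cell R y)"
 "Measurable.pred (borel \<Otimes>\<^sub>M borel) (\<lambda>(x :: real ^ 'n, y). x \<in> cell3 R y)"
proof -
 have [measurable]: "(\<lambda>z::(real^'n) \<times> (real^'n). \<lfloor>fst z $ i / 2 powr rl R\<rfloor>) \<in> (borel \<Otimes>\<^sub>M borel) \<rightarrow>\<^sub>M count_space UNIV"
   "(\<lambda>z::(real^'n) \<times> (real^'n). \<lfloor>snd z $ i / 2 powr rl R\<rfloor>) \<in> (borel \<Otimes>\<^sub>M borel) \<rightarrow>\<^sub>M count_space UNIV"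
   "(\<lambda>z::(real^'n) \<times> (real^'n). \<lfloor>fst z $ i / 2 powr rl R + 1\<rfloor>) \<in> (borel \<Otimes>\<^sub>M borel) \<rightarrow>\<^sub>M count_space UNIV"
   "(\<lambda>z::(real^'n) \<times> (real^'n). \<lfloor>snd z $ i / 2 powr rl R + 1\<rfloor>) \<in> (borel \<Otimes>\<^sub>M borel) \<rightarrow>\<^sub>M count_space UNIV" for i
 by measurable
 \<comment> \<open>Adjacency becomes a disjunction of equalities between integer-valued measurable
   functions.\<close>
 have eq: "\<bar>\<lfloor>a\<rfloor> - \<lfloor>b\<rfloor>\<bar> <= 1 \<longleftrightarrow> \<lfloor>a\<rfloor> = \<lfloor>b\<rfloor> \<or> \<lfloor>a\<rfloor> = \<lfloor>b + 1\<rfloor> \<or> \<lfloor>a + 1\<rfloor> = \<lfloor>b\<rfloor>" for a b :: real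
 by simp linarith
 show "Measurable.pred (borel \<Otimes>\<^sub>M borel) (\<lambda>(x :: real ^ 'n, y). x \<in> cell R y)"
  unfolding cell_def vec_eq_iff idx_nth case_prod_beta mem_Collect_eq by measurable
 show "Measurable.pred (borel \<Otimes>\<^sub>M borel) (\<lambda>(x :: real ^ 'n, y). x \<in> cell3 R y)"
  unfolding cell3_def idx_nth case_prod_beta mem_Collect_eq eq by measurable
qed

lemma indicator_cell_measurable [measurable (raw)]:
 assumes "f \<in> M \<rightarrow>\<^sub>M borel" "g \<in> M \<rightarrow>\<^sub>M borel"
 shows "(\<lambda>w. indicator (cell R (f w :: real ^ 'n)) (g w) :: ennreal) \<in> borel_measurable M"
  "(\<lambda>w. indicator (cell3 R (f w)) (g w) :: ennreal) \<in> borel_measurable M"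
proof -
 have p: "(\<lambda>w. (g w, f w)) \<in> M \<rightarrow>\<^sub>M borel \<Otimes>\<^sub>M borel" using assms by measurable
 have "Measurable.pred M (\<lambda>w. g w \<in> cell R (f w))" "Measurable.pred M (\<lambda>w. g w \<in> cell3 R (f w))"
  using measurable_compose[OF p pred_idx(1)[of R]] measurable_compose[OF p pred_idx(2)[of R]] by simp_all
 then show "(\<lambda>w. indicator (cell R (f w :: real ^ 'n)) (g w) :: ennreal) \<in> borel_measurable M"
  "(\<lambda>w. indicator (cell3 R (f w)) (g w) :: ennreal) \<in> borel_measurable M"
  unfolding indicator_def by measurable
qed

lemma sets_cell [measurable]: "cell R x \<in> sets borel" "cell3 R x \<in> sets borel"
proof -
 have "(\<lambda>y. indicator (cell R x) y :: ennreal) \<in> bor"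
 by (rule indicator_cell_measurable(1)) simp_all
 moreover have "(\<lambda>y. indicator (cell3 R x) y :: ennreal) \<in> bor"
 by (rule indicator_cell_measurable(2)) simp_all
 ultimately show "cell R x \<in> sets borel" "cell3 R x \<in> sets borel"
  unfolding borel_measurable_indicator_iff by auto
qed

text \<open>The half-open cube lies between the open and the closed box, which have the same
  volume.\<close>

lemma emeasure_half_open_cube:
 fixes l :: "real ^ 'n"
 assumes w: "0 <= w"
 shows "emeasure lborel {y. \<forall>i. l $ i <= y $ i \<and> y $ i < l $ i + w} = ennreal (w ^ CARD('n))"
proof -
 let ?S = "{y. \<forall>i. l $ i <= y $ i \<and> y $ i < l $ i + w}" and ?u = "l + (\<chi> i. w)"
 have prod: "(\<Prod>b\<in>Basis. (?u - l) \<bullet> b) = w ^ CARD('n)" (is "prod ?f _ = _")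
 proof -
  have "(\<Prod>b\<in>Basis. ?f b) = (\<Prod>b\<in>(Basis :: (real ^ 'n) set). w)"
  by (intro prod.cong refl) (auto simp: Basis_vec_def inner_axis)
  then show ?thesis by simp
 qed
 have le: "l \<bullet> b <= ?u \<bullet> b" if "b \<in> Basis" for b
  using that w by (auto simp: Basis_vec_def inner_axis)
 have [measurable]: "?S \<in> sets borel" by measurable
 have "box l ?u \<subseteq> ?S" "?S \<subseteq> cbox l ?u"
 by (auto simp: mem_box_cart less_imp_le)
 then have "emeasure lborel (box l ?u) <= emeasure lborel ?S" "emeasure lborel ?S <= emeasure lborel (cbox l ?u)"
 by (auto intro!: emeasure_mono)
 moreover have "emeasure lborel (box l ?u) = ennreal (w ^ CARD('n))" "emeasure lborel (cbox l ?u) = ennreal (w ^ CARD('n))"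
  using le prod by (subst emeasure_lborel_box emeasure_lborel_cbox; simp)+
 ultimately show ?thesis by simp
qed

lemma floor_divide_bounds:
 fixes a s :: real assumes "0 < s"
 shows "k <= \<lfloor>a / s\<rfloor> \<longleftrightarrow> rl k * s <= a" "\<lfloor>a / s\<rfloor> < k \<longleftrightarrow> a < rl k * s"
 using assms by (simp_all add: le_floor_iff floor_less_iff pos_le_divide_eq pos_divide_less_eq)

lemma cell_eq_cube: "cell R x = {y. \<forall>i. (\<chi> i. rl (idx R x $ i) * 2 powr rl R) $ i <= y $ i \<and>
   y $ i < (\<chi> i. rl (idx R x $ i) * 2 powr rl R) $ i + 2 powr rl R}"
proof -
 have "(\<lfloor>a / 2 powr rl R\<rfloor> = k) \<longleftrightarrow> rl k * 2 powr rl R <= a \<and> a < rl k * 2 powr rl R + 2 powr rl R"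
  for a :: real and k :: int
  using floor_divide_bounds(1)[of "2 powr rl R" k a] floor_divide_bounds(2)[of "2 powr rl R" a "k + 1"]
 by (auto simp: algebra_simps)
 then show ?thesis unfolding cell_def vec_eq_iff idx_nth by simp
qed

lemma cell3_eq_cube: "cell3 R x = {y. \<forall>i. (\<chi> i. rl (idx R x $ i - 1) * 2 powr rl R) $ i <= y $ i \<and>
   y $ i < (\<chi> i. rl (idx R x $ i - 1) * 2 powr rl R) $ i + 3 * 2 powr rl R}"
proof -
 have "\<bar>\<lfloor>a / 2 powr rl R\<rfloor> - k\<bar> <= 1 \<longleftrightarrow> rl (k - 1) * 2 powr rl R <= a \<and> a < rl (k - 1) * 2 powr rl R + 3 * 2 powr rl R"
  for a :: real and k :: int
  using floor_divide_bounds(1)[of "2 powr rl R" "k - 1" a] floor_divide_bounds(2)[of "2 powr rl R" a "k + 2"]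
 by (auto simp: algebra_simps)
 then show ?thesis unfolding cell3_def idx_nth by simp
qed

lemma emeasure_cell: "emeasure lborel (cell R (x :: real ^ 'n)) = ennreal (2 powr (rl R * real CARD('n)))"
 unfolding cell_eq_cube by (subst emeasure_half_open_cube) (auto simp: powr_powr[symmetric] powr_realpow)

lemma emeasure_cell3: "emeasure lborel (cell3 R (x :: real ^ 'n)) = ennreal (3 ^ CARD('n) * 2 powr (rl R * real CARD('n)))"
 unfolding cell3_eq_cube by (subst emeasure_half_open_cube) (auto simp: powr_powr[symmetric] powr_realpow power_mult_distrib)

section \<open>Calculus of averages over cells\<close>

lemma avg_one_cell: "avg R (cell R (x :: real ^ 'n)) (\<lambda>y. c) = c"
proof -
 have "avg R (cell R x) (\<lambda>y. c) = ennreal (2 powr (- rl R * real CARD('n))) * ennreal (2 powr (rl R * real CARD('n))) * c"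
  unfolding avg_def by (simp add: nn_integral_cmult_indicator emeasure_cell mult_ac)
 also have "... = c" by (simp add: ennreal_mult'' [symmetric] powr_add[symmetric])
 finally show ?thesis .
qed

lemma avg_one_cell3: "avg R (cell3 R (x :: real ^ 'n)) (\<lambda>y. c) = 3 ^ CARD('n) * c"
proof -
 have "avg R (cell3 R x) (\<lambda>y. c) = ennreal (2 powr (- rl R * real CARD('n))) * ennreal (3 ^ CARD('n) * 2 powr (rl R * real CARD('n))) * c"
  unfolding avg_def by (simp add: nn_integral_cmult_indicator emeasure_cell3 mult_ac)
 also have "ennreal (2 powr (- rl R * real CARD('n))) * ennreal (3 ^ CARD('n) * 2 powr (rl R * real CARD('n))) = ennreal (3 ^ CARD('n))"
 by (simp add: ennreal_mult'' [symmetric] powr_add[symmetric] mult.left_commute[of _ "3 ^ _"])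
 also have "ennreal (3 ^ CARD('n)) = 3 ^ CARD('n)"
 by (metis ennreal_numeral ennreal_power zero_le_numeral)
 finally show ?thesis .
qed

lemma avg_mono: "(\<And>y. y \<in> S ==> f y <= g y) ==> avg R S f <= avg R S g"
 unfolding avg_def by (intro mult_left_mono nn_integral_mono) (simp_all split: split_indicator)

lemma avg_mono_AE: "(AE y in lborel. y \<in> S --> f y <= g y) ==> avg R S f <= avg R S g"
 unfolding avg_def by (intro mult_left_mono nn_integral_mono_AE) (auto split: split_indicator)

lemma avg_cong: "(\<And>y. y \<in> S ==> f y = g y) ==> avg R S f = avg R S g"
 by (intro antisym avg_mono) auto

lemma avg_subset: "S \<subseteq> S' ==> avg R S f <= avg R S' f"
 unfolding avg_def by (intro mult_left_mono nn_integral_mono) (auto split: split_indicator)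

lemma avg_level: "avg R S f = ennreal (2 powr (rl (R' - R) * real CARD('n))) * avg R' (S :: (real ^ 'n) set) f"
 unfolding avg_def mult.assoc[symmetric]
 by (simp add: ennreal_mult'' [symmetric] powr_add[symmetric] algebra_simps)

lemma avg_cmult:
 assumes [measurable]: "f \<in> bor" "S \<in> sets borel"
 shows "avg R S (\<lambda>y. c * f y) = c * avg R S f"
proof -
 have "(\<integral>y \<in> S. c * f y) = c * (\<integral>y \<in> S. f y)"
 by (simp add: nn_integral_cmult[symmetric] mult.assoc)
 then show ?thesis by (simp add: avg_def mult.left_commute)
qed

lemma avg_add:
 assumes [measurable]: "f \<in> bor" "g \<in> bor" "S \<in> sets borel"
 shows "avg R S (\<lambda>y. f y + g y) = avg R S f + avg R S g"
 unfolding avg_def by (simp add: distrib_right nn_integral_add distrib_left)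

lemma avg_sum: "(\<And>i. i \<in> I ==> f i \<in> bor) ==> S \<in> sets borel ==>
  avg R S (\<lambda>y. \<Sum>i\<in>I. f i y) = (\<Sum>i\<in>I. avg R S (f i))"
proof (induction I rule: infinite_finite_induct)
 case (insert i I) then show ?case by (simp add: avg_add borel_measurable_sum)
qed (simp_all add: avg_def)

lemma avg_nn_integral:
 assumes "countable I" "\<And>i. i \<in> I ==> f i \<in> bor" and [measurable]: "S \<in> sets borel"
 shows "avg R S (\<lambda>y. (\<Sum>\<^sup>+i\<in>I. f i y)) = (\<Sum>\<^sup>+i\<in>I. avg R S (f i))"
proof -
 have "(\<integral>y. (\<Sum>\<^sup>+i\<in>I. f i y) * indicator S y) =
   (\<integral>y. (\<Sum>\<^sup>+i\<in>I. f i y * indicator S y))"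
 by (simp add: nn_integral_multc)
 also have "... = (\<Sum>\<^sup>+i\<in>I. (\<integral>y. f i y * indicator S y))"
  using assms by (intro nn_integral_count_space_nn_integral) auto
 finally show ?thesis unfolding avg_def by (simp add: nn_integral_cmult)
qed

lemma borel_measurable_avg [measurable (raw)]:
 assumes [measurable]: "(\<lambda>(w, y). f w y) \<in> borel_measurable (M \<Otimes>\<^sub>M borel)" "g \<in> M \<rightarrow>\<^sub>M borel"
 shows "(\<lambda>w. avg R (cell R (g w :: real ^ 'n)) (f w)) \<in> borel_measurable M"
  "(\<lambda>w. avg R (cell3 R (g w)) (f w)) \<in> borel_measurable M"
 unfolding avg_def by measurable

lemma borel_measurable_pavg [measurable (raw)]:
 assumes [measurable]: "(\<lambda>(w, y). f w y) \<in> borel_measurable (M \<Otimes>\<^sub>M borel)" "g \<in> M \<rightarrow>\<^sub>M borel"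
 shows "(\<lambda>w. pavg R u (cell R (g w :: real ^ 'n)) (f w)) \<in> borel_measurable M"
  "(\<lambda>w. pavg R u (cell3 R (g w)) (f w)) \<in> borel_measurable M"
 unfolding pavg_def by measurable

lemma avg_Holder:
 assumes [measurable]: "f \<in> bor" "g \<in> bor" "S \<in> sets borel" and a: "0 < a" "a < 1"
 shows "avg R S (\<lambda>y. epowr (f y) a * epowr (g y) (1 - a)) <= epowr (avg R S f) a * epowr (avg R S g) (1 - a)"
proof -
 let ?c = "ennreal (2 powr (- rl R * real CARD('a)))"
 have c: "?c = epowr ?c a * epowr ?c (1 - a)" using epowr_add[of ?c a "1 - a"] by simp
 have "(\<integral>y. (epowr (f y) a * epowr (g y) (1 - a)) * indicator S y) =
   (\<integral>y. epowr (f y * indicator S y) a * epowr (g y * indicator S y) (1 - a))"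
 by (intro nn_integral_cong) (auto split: split_indicator)
 also have "... <= epowr (\<integral>y. f y * indicator S y) a * epowr (\<integral>y. g y * indicator S y) (1 - a)"
  using a by (intro nn_integral_Holder) auto
 finally have "avg R S (\<lambda>y. epowr (f y) a * epowr (g y) (1 - a)) <= ?c * (epowr (\<integral>y. f y * indicator S y) a * epowr (\<integral>y. g y * indicator S y) (1 - a))"
  unfolding avg_def by (intro mult_left_mono) auto
 also have "... = epowr (avg R S f) a * epowr (avg R S g) (1 - a)"
  unfolding avg_def epowr_mult by (subst c) (simp only: mult_ac)
 finally show ?thesis .
qed

lemma avg_Jensen_cell:
 assumes "f \<in> bor" "0 < a" "a <= 1"
 shows "avg R (cell R x) (\<lambda>y. epowr (f y) a) <= epowr (avg R (cell R x) f) a"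
 using avg_Holder[of f "\<lambda>_. 1" "cell R x" a R] assms by (cases "a = 1") (auto simp: avg_one_cell)

text \<open>The averaging functional has mass \<open>3^n\<close> on \<open>cell3 R x\<close>, so
  Jensen costs \<open>3^(n(1-a))\<close>; the coarser \<open>3^n\<close> is kept because it does not
  depend on \<open>a\<close>.\<close>

lemma avg_Jensen_cell3:
 fixes x :: "real ^ 'n"
 assumes "f \<in> bor" "0 < a" "a <= 1"
 shows "avg R (cell3 R x) (\<lambda>y. epowr (f y) a) <= 3 ^ CARD('n) * epowr (avg R (cell3 R x) f) a"
proof (cases "a = 1")
 case True
 have "(1::ennreal) <= 3 ^ CARD('n)" by (intro one_le_power) simp
 from mult_right_mono[OF this, of "avg R (cell3 R x) f"] show ?thesis using True by simp
next
 case False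
 have "(1::ennreal) <= 3 ^ CARD('n)" by (intro one_le_power) simp
 have "epowr (3 ^ CARD('n)) (1 - a) <= (3 ^ CARD('n))"
 proof -
  have e: "(3 ^ CARD('n) :: ennreal) = ennreal (3 ^ CARD('n))"
  by (metis ennreal_numeral ennreal_power zero_le_numeral)
  have "(3 ^ CARD('n) :: real) powr (1 - a) <= (3 ^ CARD('n)) powr 1"
   using assms by (intro powr_mono) auto
  then show ?thesis unfolding e by (simp add: epowr_ennreal ennreal_leI)
 qed
 then have "epowr (avg R (cell3 R x) f) a * epowr (3 ^ CARD('n)) (1 - a) <= epowr (avg R (cell3 R x) f) a * 3 ^ CARD('n)"
 by (intro mult_left_mono) auto
 then show ?thesis using avg_Holder[of f "\<lambda>_. 1" "cell3 R x" a R] assms False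
 by (auto simp: avg_one_cell3 mult_ac intro: order_trans)
qed

lemma lborel_Fubini:
 fixes f :: "real ^ 'n => real ^ 'n => ennreal"
 assumes "joint_borel f"
 shows "(\<integral>x. (\<integral>y. f x y)) = (\<integral>y. (\<integral>x. f x y))"
 using lborel_pair.Fubini'[of "\<lambda>y x. f y x"] assms
 by (simp add: measurable_cong_sets[OF sets_pair_measure_cong[OF sets_lborel sets_lborel] refl])

text \<open>Both averaging operators have symmetric kernels, since \<open>y\<close> lies in the
  cell, or its neighbourhood, of \<open>x\<close> exactly when \<open>x\<close> lies in that of
  \<open>y\<close>. Testing with constants and indicators evaluates integrals of averages and
  iterated averages.\<close>

lemma avg_cell_adjoint:
 fixes f g :: "real ^ 'n => ennreal"
 assumes [measurable]: "f \<in> bor" "g \<in> bor"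
 shows "(\<integral>x. g x * avg R (cell R x) f) = (\<integral>x. f x * avg R (cell R x) g)"
  "(\<integral>x. g x * avg R (cell3 R x) f) = (\<integral>x. f x * avg R (cell3 R x) g)"
proof -
 let ?c = "ennreal (2 powr (- rl R * real CARD('n)))"
 have main: "(\<integral>x. g x * avg R (S x) f) = (\<integral>x. f x * avg R (S x) g)"
  if [measurable]: "(\<lambda>(x, y). indicator (S x) y :: ennreal) \<in> borel_measurable (borel \<Otimes>\<^sub>M borel)"
   and sym: "\<And>x y. y \<in> S x \<longleftrightarrow> x \<in> S y" and S: "\<And>x. S x \<in> sets borel" for S :: "real ^ 'n => (real ^ 'n) set"
 proof -
  have c: "h x * avg R (S x) k = (\<integral>y. ?c * (h x * (k y * indicator (S x) y)))"
   if "h \<in> bor" "k \<in> bor" for h k :: "real ^ 'n => ennreal" and x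
  proof -
   have [measurable]: "(\<lambda>y. k y * indicator (S x) y) \<in> bor"
    using that S by auto
   show ?thesis by (simp add: avg_def nn_integral_cmult) (simp only: mult.left_commute)
  qed
  have "(\<integral>x. g x * avg R (S x) f) = (\<integral>x. (\<integral>y. ?c * (g x * (f y * indicator (S x) y))))"
  by (intro nn_integral_cong c) auto
  also have "... = (\<integral>y. (\<integral>x. ?c * (g x * (f y * indicator (S x) y))))"
  by (rule lborel_Fubini) measurable
  also have "... = (\<integral>y. (\<integral>x. ?c * (f y * (g x * indicator (S y) x))))"
   using sym by (intro nn_integral_cong) (simp add: indicator_def mult.left_commute)
  also have "... = (\<integral>x. f x * avg R (S x) g)"
  by (intro nn_integral_cong c[symmetric]) auto
  finally show ?thesis .
 qed
 show "(\<integral>x. g x * avg R (cell R x) f) = (\<integral>x. f x * avg R (cell R x) g)"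
 by (rule main[of "cell R", OF _ cell_sym sets_cell(1)]) measurable
 show "(\<integral>x. g x * avg R (cell3 R x) f) = (\<integral>x. f x * avg R (cell3 R x) g)"
 by (rule main[of "cell3 R", OF _ cell3_sym sets_cell(2)]) measurable
qed

lemma nn_integral_avg_cell:
 assumes [measurable]: "f \<in> bor"
 shows "(\<integral>x. avg R (cell R x) f) = (\<integral>x. f x)"
 using avg_cell_adjoint(1)[of f "\<lambda>_. 1" R] by (simp add: avg_one_cell)

lemma nn_integral_avg_cell3:
 fixes f :: "real ^ 'n => ennreal"
 assumes [measurable]: "f \<in> bor"
 shows "(\<integral>x. avg R (cell3 R x) f) = 3 ^ CARD('n) * (\<integral>x. f x)"
 using avg_cell_adjoint(2)[of f "\<lambda>_. 1" R] by (simp add: avg_one_cell3 nn_integral_multc mult.commute)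

definition cellwise :: "int => (real ^ 'n => 'b) => bool" where
 "cellwise k a \<longleftrightarrow> (\<forall>x y. y \<in> cell k x --> a y = a x)"

text \<open>The function factors through \<open>idx k\<close>, whose range is countable, and each
  fibre is empty or a cell. Tiles are measurable for this reason.\<close>

lemma cellwise_measurable:
 fixes a :: "real ^ 'n => ennreal"
 assumes "cellwise k a" shows "a \<in> bor"
proof -
 define r where "r z = a (SOME x. idx k x = z)" for z
 have eq: "a x = r (idx k x)" for x
 proof -
  have "idx k (SOME x'. idx k x' = idx k x) = idx k x" by (rule someI[of _ x]) simp
  then have "(SOME x'. idx k x' = idx k x) \<in> cell k x" by (simp add: cell_def)
  with assms show ?thesis unfolding r_def cellwise_def by metis
 qed
 have "idx k \<in> (borel :: (real ^ 'n) measure) \<rightarrow>\<^sub>M count_space UNIV"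
 proof (rule measurable_count_space_eq_countable[THEN iffD2])
  show "countable (UNIV :: (int ^ 'n) set)" by simp
  have "idx k -` {z} \<inter> space borel \<in> sets (borel :: (real ^ 'n) measure)" for z
  proof (cases "\<exists>x. idx k x = z")
   case True
   then obtain x where "idx k x = z" by auto
   then have "idx k -` {z} \<inter> space borel = cell k x" by (auto simp: cell_def)
   then show ?thesis by simp
  next
   case False
   then have "idx k -` {z} = {}" by auto
   then show ?thesis by simp
  qed
  then show "idx k \<in> space borel \<rightarrow> UNIV \<and> (\<forall>z\<in>UNIV. idx k -` {z} \<inter> space borel \<in> sets (borel :: (real ^ 'n) measure))"
  by auto
 qed
 then have "(\<lambda>x. r (idx k x)) \<in> bor"
 by (rule measurable_compose) simp
 then show ?thesis unfolding eq[symmetric] .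
qed

lemma avg_cellwise: "cellwise k a ==> avg k (cell k x) a = a x"
 using avg_cong[of "cell k x" a "\<lambda>_. a x" k] by (auto simp: cellwise_def avg_one_cell)

text \<open>A set is a union of cells of level \<open>k\<close> exactly when its indicator is \<open>cellwise k\<close>.\<close>

lemma avg_avg_cell:
 fixes f :: "real ^ 'n => ennreal"
 assumes [measurable]: "f \<in> bor" and S: "\<And>y. y \<in> S ==> cell k y \<subseteq> S"
 shows "avg R S (\<lambda>y. avg k (cell k y) f) = avg R S f"
proof -
 have c: "cellwise k (indicator S :: _ => ennreal)"
  unfolding cellwise_def by (metis S cell_sym indicator_simps subsetD)
 note [measurable] = cellwise_measurable[OF c]
 have "(\<integral>y \<in> S. avg k (cell k y) f) = (\<integral>y. indicator S y * avg k (cell k y) f)"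
 by (simp add: mult.commute)
 also have "... = (\<integral>y. f y * avg k (cell k y) (indicator S))"
 by (rule avg_cell_adjoint) measurable
 also have "... = (\<integral>y. f y * indicator S y)"
 by (simp add: avg_cellwise[OF c])
 finally show ?thesis by (simp add: avg_def)
qed

text \<open>By symmetry the inner average is moved onto the indicator of \<open>cell3 j x\<close>.
  Its average around \<open>z\<close> is at most \<open>3^n\<close> and vanishes unless
  \<open>z\<close> is adjacent to an adjacent cell, hence in \<open>cell3 (j + 1) x\<close>. The
  change of level from \<open>j\<close> to \<open>j + 1\<close> contributes \<open>2^n\<close>,
  whence \<open>6^n\<close>.\<close>

lemma avg_avg_cell3:
 fixes f :: "real ^ 'n => ennreal"
 assumes [measurable]: "f \<in> bor" and R: "R <= j"
 shows "avg j (cell3 j x) (\<lambda>y. avg R (cell3 R y) f) <= 6 ^ CARD('n) * avg (j + 1) (cell3 (j + 1) x) f"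
proof -
 have "(\<integral>y \<in> cell3 j x. avg R (cell3 R y) f) = (\<integral>y. indicator (cell3 j x) y * avg R (cell3 R y) f)"
 by (simp add: mult.commute)
 also have "... = (\<integral>y. f y * avg R (cell3 R y) (indicator (cell3 j x)))"
 by (rule avg_cell_adjoint) measurable
 also have "... <= (\<integral>y. 3 ^ CARD('n) * (f y * indicator (cell3 (j + 1) x) y))"
 proof (rule nn_integral_mono)
  fix z :: "real ^ 'n"
  have "avg R (cell3 R z) (indicator (cell3 j x)) <= avg R (cell3 R z) (\<lambda>_. indicator (cell3 (j + 1) x) z)"
  proof (rule avg_mono)
   fix y assume y: "y \<in> cell3 R z"
   then have "z \<in> cell3 j y" using cell3_mono[OF R, of y] cell3_sym by blast
   then show "indicator (cell3 j x) y <= (indicator (cell3 (j + 1) x) z :: ennreal)"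
    using cell3_trans[of y j x z] by (auto split: split_indicator)
  qed
  then have "f z * avg R (cell3 R z) (indicator (cell3 j x)) <= f z * (3 ^ CARD('n) * indicator (cell3 (j + 1) x) z)"
   unfolding avg_one_cell3 by (intro mult_left_mono) auto
  then show "f z * avg R (cell3 R z) (indicator (cell3 j x)) <= 3 ^ CARD('n) * (f z * indicator (cell3 (j + 1) x) z)"
  by (simp only: mult_ac)
 qed
 also have "... = 3 ^ CARD('n) * (\<integral>y \<in> cell3 (j + 1) x. f y)"
 by (rule nn_integral_cmult) measurable
 finally have "avg j (cell3 j x) (\<lambda>y. avg R (cell3 R y) f) <= 3 ^ CARD('n) * avg j (cell3 (j + 1) x) f"
  unfolding avg_def by (simp add: mult.left_commute[of "3 ^ _"] mult_left_mono)
 also have "... = 3 ^ CARD('n) * ennreal (2 ^ CARD('n)) * avg (j + 1) (cell3 (j + 1) x) f"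
 by (subst avg_level[of j _ _ "j + 1"]) (simp add: powr_realpow mult.assoc)
 also have "3 ^ CARD('n) * ennreal (2 ^ CARD('n)) = (6 ^ CARD('n) :: ennreal)"
 proof -
  have "(6 ^ CARD('n) :: ennreal) = (3 * 2) ^ CARD('n)" by simp
  also have "... = 3 ^ CARD('n) * 2 ^ CARD('n)" by (rule power_mult_distrib)
  finally show ?thesis by (metis ennreal_numeral ennreal_power zero_le_numeral)
 qed
 finally show ?thesis .
qed

lemma pavg_cmult:
 assumes "f \<in> bor" "S \<in> sets borel" "0 < u"
 shows "pavg R u S (\<lambda>y. c * f y) = c * pavg R u S f"
 unfolding pavg_def using assms by (simp add: epowr_mult avg_cmult epowr_epowr)

lemma pavg_mono: "0 < u ==> (\<And>y. y \<in> S ==> f y <= g y) ==> pavg R u S f <= pavg R u S g"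
 unfolding pavg_def by (intro epowr_mono avg_mono) auto

text \<open>A value taken on a whole cell of level \<open>k\<close> contributes at least its share
  \<open>2^((k-R)n)\<close> to the average at level \<open>R\<close>. Solving for the value gives a
  substitute for the embedding of \<open>L^u\<close> into \<open>L^\<infinity>\<close>, which fails
  for general functions.\<close>

lemma cellwise_le_pavg:
 fixes a :: "real ^ 'n => ennreal"
 assumes a: "cellwise k a" and u: "0 < u" and S: "\<And>y. y \<in> S ==> cell k y \<subseteq> S" and y: "y \<in> S"
 shows "a y <= ennreal (2 powr (rl (R - k) * CARD('n) / u)) * pavg R u S a"
proof -
 have c: "cellwise k (\<lambda>y. epowr (a y) u)" using a by (auto simp: cellwise_def)
 have "epowr (a y) u = avg k (cell k y) (\<lambda>y. epowr (a y) u)" by (simp add: avg_cellwise[OF c])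
 also have "... <= avg k S (\<lambda>y. epowr (a y) u)" by (intro avg_subset S y)
 also have "... = ennreal (2 powr (rl (R - k) * CARD('n))) * avg R S (\<lambda>y. epowr (a y) u)"
 by (rule avg_level)
 finally have "a y <= epowr (ennreal (2 powr (rl (R - k) * CARD('n))) * avg R S (\<lambda>y. epowr (a y) u)) (1 / u)"
  using u by (simp add: epowr_le_iff)
 also have "... = ennreal (2 powr (rl (R - k) * CARD('n) / u)) * pavg R u S a"
 by (simp add: epowr_mult epowr_ennreal powr_powr pavg_def)
 finally show ?thesis .
qed

text \<open>A reverse Hoelder inequality for functions constant on cells: in
  \<open>a^u = a^(u-u0) a^u0\<close> the first factor is bounded by \<open>cellwise_le_pavg\<close>.
  The factor \<open>2^(n(1/u0 - 1/u))\<close> per level between \<open>k\<close> and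
  \<open>R\<close> is the origin of the spatial bracket terms with minimum and maximum in the
  theorem.\<close>

lemma pavg_exponent_le:
 fixes a :: "real ^ 'n => ennreal"
 assumes a: "cellwise k a" and u: "0 < u0" "u0 <= u" and S: "\<And>y. y \<in> S ==> cell k y \<subseteq> S" and [measurable]: "S \<in> sets borel"
 shows "pavg R u S a <= ennreal (2 powr (rl (R - k) * CARD('n) * (1 / u0 - 1 / u))) * pavg R u0 S a"
proof (cases "u = u0")
 case False
 have [measurable]: "a \<in> bor" using a by (rule cellwise_measurable)
 let ?X = "avg R S (\<lambda>y. epowr (a y) u0)" and ?c = "ennreal (2 powr (rl (R - k) * CARD('n) / u0))"
 have "avg R S (\<lambda>y. epowr (a y) u) <= avg R S (\<lambda>y. epowr (?c * pavg R u0 S a) (u - u0) * epowr (a y) u0)"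
 proof (rule avg_mono)
  fix y assume y: "y \<in> S"
  have "epowr (a y) u = epowr (a y) (u - u0) * epowr (a y) u0"
   using epowr_add[of "a y" "u - u0" u0] by simp
  also have "... <= epowr (?c * pavg R u0 S a) (u - u0) * epowr (a y) u0"
   using u by (intro mult_right_mono epowr_mono cellwise_le_pavg[OF a _ S y]) auto
  finally show "epowr (a y) u <= epowr (?c * pavg R u0 S a) (u - u0) * epowr (a y) u0" .
 qed
 also have "... = epowr (?c * pavg R u0 S a) (u - u0) * ?X" by (rule avg_cmult) measurable
 also have "?X = epowr (pavg R u0 S a) u0" using u by (simp add: pavg_def epowr_epowr)
 also have "epowr (?c * pavg R u0 S a) (u - u0) * epowr (pavg R u0 S a) u0 = epowr ?c (u - u0) * epowr (pavg R u0 S a) u"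
  using epowr_add[of "pavg R u0 S a" "u - u0" u0] by (simp add: epowr_mult mult_ac)
 finally have "pavg R u S a <= epowr (epowr ?c (u - u0) * epowr (pavg R u0 S a) u) (1 / u)"
  unfolding pavg_def[of R u] using u by (intro epowr_mono) auto
 also have "... = ennreal (2 powr (rl (R - k) * CARD('n) / u0 * (u - u0) / u)) * pavg R u0 S a"
  using u by (simp add: epowr_mult epowr_epowr epowr_ennreal powr_powr)
 also have "rl (R - k) * CARD('n) / u0 * (u - u0) / u = rl (R - k) * CARD('n) * (1 / u0 - 1 / u)"
  using u by (simp add: field_simps)
 finally show ?thesis .
qed simp

section \<open>The maximal function\<close>

text \<open>Two points of one \<open>cell3 R x\<close> differ by less than \<open>3 * 2^R\<close> in
  each coordinate, hence by less than this radius, the norm being at most the sum of the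
  coordinates.\<close>

definition rad :: "'n::finite itself => int => real" where
 "rad _ R = 3 * real CARD('n) * 2 powr rl R"

text \<open>A centred Hardy-Littlewood maximal function. Dyadic radii make it a countable supremum,
  hence measurable; balls instead of cells let it control the average over \<open>cell3 R x\<close>
  at every point of that set, and suit the Vitali covering lemma.\<close>

definition maxi :: "(real ^ 'n => ennreal) => real ^ 'n => ennreal" where
 "maxi h x = (SUP R. avg R (ball x (rad TYPE('n) R)) h)"

lemma rad_pos: "0 < rad TYPE('n::finite) R"
 by (simp add: rad_def)

lemma rad_mono: "R <= R' ==> rad TYPE('n::finite) R <= rad TYPE('n) R'"
 by (simp add: rad_def)

lemma idx_diff_bound:
 assumes "\<bar>idx R x $ i - idx R y $ i\<bar> <= k" shows "\<bar>x $ i - y $ i\<bar> < (rl k + 1) * 2 powr rl R"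
proof -
 have "\<bar>x $ i / 2 powr rl R - y $ i / 2 powr rl R\<bar> < rl k + 1"
  using assms unfolding idx_nth by linarith
 then show ?thesis by (simp add: diff_divide_distrib[symmetric] pos_divide_less_eq)
qed

lemma dist_bound:
 fixes x y :: "real ^ 'n"
 assumes "\<And>i. \<bar>x $ i - y $ i\<bar> < r" shows "dist x y < real CARD('n) * r"
proof -
 have "dist x y <= (\<Sum>i\<in>UNIV. \<bar>(x - y) $ i\<bar>)" unfolding dist_norm by (rule norm_le_l1_cart)
 also have "... < (\<Sum>i\<in>(UNIV :: 'n set). r)" using assms by (intro sum_strict_mono) auto
 finally show ?thesis by simp
qed

lemma cell3_subset_ball:
 fixes x y :: "real ^ 'n"
 assumes "y \<in> cell3 R x" shows "cell3 R x \<subseteq> ball y (rad TYPE('n) R)"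
proof
 fix z assume z: "z \<in> cell3 R x"
 have "\<bar>y $ i - z $ i\<bar> < (rl 2 + 1) * 2 powr rl R" for i
 proof (rule idx_diff_bound)
  have "\<bar>idx R y $ i - idx R x $ i\<bar> <= 1" "\<bar>idx R z $ i - idx R x $ i\<bar> <= 1" using assms z by (auto simp: cell3_def)
  then show "\<bar>idx R y $ i - idx R z $ i\<bar> <= 2" by linarith
 qed
 from dist_bound[OF this] show "z \<in> ball y (rad TYPE('n) R)" by (simp add: rad_def mult_ac)
qed

lemma avg_le_maxi: "y \<in> cell3 R x ==> avg R (cell3 R x) h <= maxi h y"
 unfolding maxi_def by (rule SUP_upper2[of R]) (simp_all add: avg_subset[OF cell3_subset_ball])

lemma borel_measurable_avg_ball [measurable]:
 fixes h :: "real ^ 'n => ennreal"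
 assumes [measurable]: "h \<in> bor"
 shows "(\<lambda>x. avg R (ball x r) h) \<in> bor"
proof -
 have "(\<lambda>x. avg R (ball x r) h) = (\<lambda>x. ennreal (2 powr (- rl R * real CARD('n))) * (\<integral>y. h y * indicator {z. dist (fst z) (snd z) < r} (x, y)))"
 by (auto simp: avg_def fun_eq_iff intro!: arg_cong[where f="(*) _"] nn_integral_cong split: split_indicator)
 also have "... \<in> bor" by measurable
 finally show ?thesis .
qed

lemma borel_measurable_maxi [measurable]:
 "h \<in> bor ==> maxi h \<in> bor"
 unfolding maxi_def[abs_def] by measurable

lemma avg_ball_const:
 fixes x :: "real ^ 'n"
 assumes "0 <= c"
 shows "avg R (ball x (c * rad TYPE('n) R)) (\<lambda>_. a) = ennreal (unit_ball_vol CARD('n) * (3 * real CARD('n) * c) ^ CARD('n)) * a"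
proof -
 have F1: "(\<integral>y \<in> ball x (c * rad TYPE('n) R). a) = a * ennreal (unit_ball_vol CARD('n) * (c * rad TYPE('n) R) ^ CARD('n))"
  using assms rad_pos[of R, where 'n='n] by (simp add: nn_integral_cmult_indicator emeasure_ball)
 have F2: "2 powr (- rl R * real CARD('n)) * (unit_ball_vol CARD('n) * (c * rad TYPE('n) R) ^ CARD('n)) =
   unit_ball_vol CARD('n) * (3 * real CARD('n) * c) ^ CARD('n)"
 proof -
  have "(2 powr rl R) ^ CARD('n) = 2 powr (rl R * real CARD('n))"
  by (simp add: powr_powr[symmetric] powr_realpow)
  then have "2 powr (- rl R * real CARD('n)) * (2 powr rl R) ^ CARD('n) = 1"
  by (simp add: powr_add[symmetric])
  then show ?thesis by (simp add: rad_def power_mult_distrib mult_ac)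
 qed
 have F3: "ennreal p * (a * ennreal q) = ennreal (p * q) * a" if "0 <= p" "0 <= q" for p q
  using that by (simp add: ennreal_mult mult_ac)
 show ?thesis
  unfolding avg_def F1 F2[symmetric]
  using assms rad_pos[of R, where 'n='n] by (intro F3) (simp_all add: less_imp_le)
qed

lemma maxi_mono: "(\<And>y. f y <= g y) ==> maxi f x <= maxi g x"
 unfolding maxi_def by (intro SUP_mono) (auto intro: avg_mono)

text \<open>The average of the constant 1 over these balls is the same at every level, and its value
  is the factor here. This lets a bounded part be split off in the interpolation argument.\<close>

lemma maxi_add_const:
 fixes h :: "real ^ 'n => ennreal"
 assumes [measurable]: "h \<in> bor"
 shows "maxi (\<lambda>y. h y + a) x <= maxi h x + ennreal (unit_ball_vol CARD('n) * (3 * real CARD('n)) ^ CARD('n)) * a"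
 unfolding maxi_def
proof (rule SUP_least)
 fix R
 have "avg R (ball x (rad TYPE('n) R)) (\<lambda>y. h y + a) = avg R (ball x (rad TYPE('n) R)) h + ennreal (unit_ball_vol CARD('n) * (3 * real CARD('n)) ^ CARD('n)) * a"
  using avg_ball_const[of 1 R x a] by (simp add: avg_add)
 also have "... <= (SUP R. avg R (ball x (rad TYPE('n) R)) h) + ennreal (unit_ball_vol CARD('n) * (3 * real CARD('n)) ^ CARD('n)) * a"
 by (intro add_right_mono SUP_upper) simp
 finally show "avg R (ball x (rad TYPE('n) R)) (\<lambda>y. h y + a) <= ..." .
qed

lemma maxi_nn_integral:
 fixes h :: "'i => real ^ 'n => ennreal"
 assumes "countable I" and m: "\<And>i. i \<in> I ==> h i \<in> bor"
 shows "maxi (\<lambda>y. (\<Sum>\<^sup>+i\<in>I. h i y)) x <= (\<Sum>\<^sup>+i\<in>I. maxi (h i) x)"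
 unfolding maxi_def
proof (rule SUP_least)
 fix R
 have "avg R (ball x (rad TYPE('n) R)) (\<lambda>y. (\<Sum>\<^sup>+i\<in>I. h i y)) = (\<Sum>\<^sup>+i\<in>I. avg R (ball x (rad TYPE('n) R)) (h i))"
  using assms by (intro avg_nn_integral) auto
 also have "... <= (\<Sum>\<^sup>+i\<in>I. (SUP R. avg R (ball x (rad TYPE('n) R)) (h i)))"
 by (intro nn_integral_mono SUP_upper) simp
 finally show "avg R (ball x (rad TYPE('n) R)) (\<lambda>y. (\<Sum>\<^sup>+i\<in>I. h i y)) <= ..." .
qed

lemma maxi_cmult:
 assumes "h \<in> bor"
 shows "maxi (\<lambda>y. c * h y) x = c * maxi h x"
 unfolding maxi_def using assms by (simp add: avg_cmult SUP_mult_left_ennreal)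

text \<open>Vitali covering: each point of the level set is the centre of a ball with large average.
  A disjoint subfamily has 5-fold dilates covering the set, and each dilate has measure at most
  \<open>B / l\<close> times the integral of \<open>h\<close> over the original ball. The number 15
  is this 5 times the 3 in \<open>rad\<close>. The covering lemma asks for bounded radii, so the
  level set is exhausted by the sets \<open>X N\<close>.\<close>

lemma maxi_weak:
 fixes h :: "real ^ 'n => ennreal"
 assumes [measurable]: "h \<in> bor" and l: "0 < l"
 shows "emeasure lborel {x. ennreal l < maxi h x}
   <= ennreal (unit_ball_vol CARD('n) * (15 * real CARD('n)) ^ CARD('n) / l) * (\<integral>x. h x)"
proof -
 define rr where "rr = rad TYPE('n)"
 define B where "B = unit_ball_vol CARD('n) * (15 * real CARD('n)) ^ CARD('n)"
 have B0: "0 <= B" unfolding B_def by simp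
 define X where "X N = {x :: real ^ 'n. \<exists>R\<le>int N. ennreal l < avg R (ball x (rr R)) h}" for N :: nat
 have [measurable]: "X N \<in> sets borel" for N unfolding X_def by measurable
 have [measurable]: "ball a r \<in> sets borel" for a :: "real ^ 'n" and r by simp
 have bound: "emeasure lborel (X N) <= ennreal (B / l) * (\<integral>x. h x)" for N
 proof -
  define K where "K = {(x, R). R <= int N \<and> ennreal l < avg R (ball x (rr R)) h}"
  have cov: "X N \<subseteq> (\<Union>i\<in>K. ball (fst i) (rr (snd i)))"
   using rad_pos[where 'n='n] by (force simp: X_def K_def rr_def)
  have r: "\<And>i. i \<in> K ==> 0 < rr (snd i) \<and> rr (snd i) <= rr (int N)"
   using rad_pos[where 'n='n] rad_mono[where 'n='n] by (auto simp: K_def rr_def)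
  obtain C where C: "countable C" "C \<subseteq> K"
   "pairwise (\<lambda>i j. disjnt (ball (fst i) (rr (snd i))) (ball (fst j) (rr (snd j)))) C"
   "X N \<subseteq> (\<Union>i\<in>C. ball (fst i) (5 * rr (snd i)))"
  by (rule Vitali_covering_lemma_balls[OF cov r]) auto
  have "emeasure lborel (X N) = (\<integral>x. indicator (X N) x)" by simp
  also have "... <= (\<integral>x. (\<Sum>\<^sup>+i\<in>C. indicator (ball (fst i) (5 * rr (snd i))) x))"
  proof (intro nn_integral_mono)
   fix x show "indicator (X N) x <= (\<Sum>\<^sup>+i\<in>C. indicator (ball (fst i) (5 * rr (snd i))) x)"
   proof (cases "x \<in> X N")
    case True
    then obtain i where i: "i \<in> C" "x \<in> ball (fst i) (5 * rr (snd i))" using C(4) by auto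
    then show ?thesis using nn_integral_ge_point[OF i(1), of "\<lambda>i. indicator (ball (fst i) (5 * rr (snd i))) x"] using True by simp
   qed simp
  qed
  also have "... = (\<Sum>\<^sup>+i\<in>C. (\<integral>x. indicator (ball (fst i) (5 * rr (snd i))) x))"
   using C(1) by (rule nn_integral_count_space_nn_integral) measurable
  also have "... <= (\<Sum>\<^sup>+i\<in>C. (\<integral>x. ennreal (B / l) * (h x * indicator (ball (fst i) (rr (snd i))) x)))"
  proof (rule nn_integral_mono)
   fix i assume "i \<in> space (count_space C)"
   then have "i \<in> K" using C by auto
   then obtain x R where i: "i = (x, R)" "ennreal l < avg R (ball x (rr R)) h" by (auto simp: K_def)
   have "(\<integral>x. indicator (ball (fst i) (5 * rr (snd i))) x) = ennreal (2 powr (rl R * real CARD('n))) * avg R (ball x (5 * rr R)) (\<lambda>_. 1)"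
    unfolding avg_def mult.assoc[symmetric] by (simp add: i ennreal_mult'' [symmetric] powr_add[symmetric])
   also have "... = ennreal (2 powr (rl R * real CARD('n))) * ennreal B"
    using avg_ball_const[of 5 R x 1] by (simp add: rr_def B_def)
   also have "ennreal B = ennreal (B / l) * ennreal l" using l B0 by (simp add: ennreal_mult'' [symmetric])
   also have "ennreal (2 powr (rl R * real CARD('n))) * (ennreal (B / l) * ennreal l)
     <= ennreal (2 powr (rl R * real CARD('n))) * (ennreal (B / l) * avg R (ball x (rr R)) h)"
    using i by (intro mult_left_mono) auto
   also have "... = ennreal (B / l) * (ennreal (2 powr (rl R * real CARD('n)) * 2 powr (- rl R * real CARD('n))) * (\<integral>y \<in> ball x (rr R). h y))"
    unfolding avg_def by (simp add: ennreal_mult'' mult_ac)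
   also have "... = (\<integral>y. ennreal (B / l) * (h y * indicator (ball (fst i) (rr (snd i))) y))"
   by (subst nn_integral_cmult) (auto simp: i powr_add[symmetric])
   finally show "(\<integral>x. indicator (ball (fst i) (5 * rr (snd i))) x) <= ..." .
  qed
  also have "... = (\<integral>x. (\<Sum>\<^sup>+i\<in>C. ennreal (B / l) * (h x * indicator (ball (fst i) (rr (snd i))) x)))"
   using C(1) by (rule nn_integral_count_space_nn_integral[symmetric]) measurable
  also have "... <= (\<integral>x. ennreal (B / l) * h x)"
  proof (intro nn_integral_mono)
   fix x
   have "(\<Sum>\<^sup>+i\<in>C. indicator (ball (fst i) (rr (snd i))) x) <= (1 :: ennreal)"
   proof (cases "\<exists>i\<in>C. x \<in> ball (fst i) (rr (snd i))")
    case True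
    then obtain i where i: "i \<in> C" "x \<in> ball (fst i) (rr (snd i))" by auto
    have "(\<Sum>\<^sup>+j\<in>C. indicator (ball (fst j) (rr (snd j))) x) <= (\<Sum>\<^sup>+j\<in>C. indicator {i} j)"
    proof (intro nn_integral_mono)
     fix j assume "j \<in> space (count_space C)"
     then show "indicator (ball (fst j) (rr (snd j))) x <= (indicator {i} j :: ennreal)"
      using pairwiseD[OF C(3), of i j] i by (auto simp: disjnt_iff split: split_indicator)
    qed
    also have "... <= 1" using i by simp
    finally show ?thesis .
   next
    case False
    then have "(\<Sum>\<^sup>+i\<in>C. indicator (ball (fst i) (rr (snd i))) x) = (\<Sum>\<^sup>+i\<in>C. 0)"
    by (intro nn_integral_cong) auto
    then show ?thesis by simp
   qed
   from mult_left_mono[OF this, of "ennreal (B / l) * h x"]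
   show "(\<Sum>\<^sup>+i\<in>C. ennreal (B / l) * (h x * indicator (ball (fst i) (rr (snd i))) x)) <= ennreal (B / l) * h x"
   by (simp add: nn_integral_cmult[symmetric] mult.assoc)
  qed
  also have "... = ennreal (B / l) * (\<integral>x. h x)" by (rule nn_integral_cmult) measurable
  finally show ?thesis .
 qed
 have "{x. ennreal l < maxi h x} = (\<Union>N. X N)"
 proof (intro set_eqI)
  fix x
  have "(\<exists>R. ennreal l < avg R (ball x (rr R)) h) \<longleftrightarrow> (\<exists>N::nat. \<exists>R\<le>int N. ennreal l < avg R (ball x (rr R)) h)"
  by (meson le_nat_iff nat_le_iff order_refl)
  then show "x \<in> {x. ennreal l < maxi h x} \<longleftrightarrow> x \<in> (\<Union>N. X N)"
  by (simp add: maxi_def less_SUP_iff X_def rr_def)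
 qed
 moreover have "emeasure lborel (\<Union>N. X N) = (SUP N. emeasure lborel (X N))"
 proof (rule SUP_emeasure_incseq[symmetric])
  have "X a \<subseteq> X b" if "a <= b" for a b
   using that unfolding X_def by (smt (verit) Collect_mono of_nat_le_iff)
  then show "incseq X" by (simp add: incseq_def)
 qed auto
 ultimately show ?thesis using bound unfolding B_def by (auto intro: SUP_least)
qed

lemma geometric_int_le:
 assumes a: "0 < a" and r: "0 < r"
 shows "(\<Sum>\<^sup>+k. ennreal (2 powr (a * rl k)) * indicator {k. 2 powr rl k < r} k)
  <= ennreal (r powr a / (1 - 2 powr (- a)))"
proof -
 \<comment> \<open>The largest integer \<open>k\<close> with \<open>2 powr rl k < r\<close>; the sum
   is a geometric series descending from it.\<close>
 define k0 where "k0 = \<lceil>log 2 r\<rceil> - 1"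
 have lt: "2 powr rl k < r \<longleftrightarrow> k <= k0" for k
 proof -
  have "2 powr rl k < r \<longleftrightarrow> rl k < log 2 r"
   using r by (simp add: less_log_iff)
  also have "... \<longleftrightarrow> k <= k0" unfolding k0_def by linarith
  finally show ?thesis .
 qed
 have bij: "bij_betw (\<lambda>j::nat. k0 - int j) UNIV {..k0}"
 by (rule bij_betwI[of _ _ _ "\<lambda>k. nat (k0 - k)"]) auto
 have "(\<Sum>\<^sup>+k. ennreal (2 powr (a * rl k)) * indicator {k. 2 powr rl k < r} k)
   = (\<Sum>\<^sup>+k\<in>{..k0}. ennreal (2 powr (a * rl k)))"
 by (subst nn_integral_count_space_indicator) (auto simp: lt intro!: nn_integral_cong split: split_indicator)
 also have "... = (\<Sum>\<^sup>+j. ennreal (2 powr (a * rl (k0 - int j))))"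
 by (rule nn_integral_bij_count_space[OF bij, symmetric])
 also have "... <= (\<Sum>\<^sup>+j. ennreal (r powr a * (2 powr (- a)) ^ j))"
 proof (intro nn_integral_mono ennreal_leI)
  fix j :: nat
  have "2 powr (a * rl (k0 - int j)) = (2 powr rl k0) powr a * (2 powr (- a)) ^ j"
  by (simp add: powr_powr powr_realpow[symmetric] powr_add[symmetric] algebra_simps)
  also have "... <= r powr a * (2 powr (- a)) ^ j"
   using a lt[of k0] by (intro mult_right_mono powr_mono2) auto
  finally show "2 powr (a * rl (k0 - int j)) <= r powr a * (2 powr (- a)) ^ j" .
 qed
 also have "... = (\<Sum>j. ennreal (r powr a * (2 powr (- a)) ^ j))" by (rule nn_integral_count_space_nat)
 also have "... = ennreal (r powr a / (1 - 2 powr (- a)))"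
 proof -
  have "(2::real) powr (- a) < 1" using a powr_less_mono[of "- a" 0 "2::real"] by simp
  then have "(\<lambda>j. r powr a * (2 powr (- a)) ^ j) sums (r powr a * (1 / (1 - 2 powr (- a))))"
  by (intro sums_mult geometric_sums) simp
  then show ?thesis by (intro suminf_ennreal_eq) auto
 qed
 finally show ?thesis .
qed

text \<open>One layer suffices: for finite \<open>y > 0\<close> the index with
  \<open>c 2^k < y <= c 2^(k+1)\<close>, for \<open>y = top\<close> arbitrarily high ones. This
  discrete layer-cake bound keeps the interpolation within countable sums.\<close>

lemma epowr_le_layers:
 assumes c: "0 < c" and s: "0 < s"
 shows "epowr y s <= (\<Sum>\<^sup>+k. ennreal ((c * 2 powr (rl k + 1)) powr s) * indicator {k. ennreal (c * 2 powr rl k) < y} k)"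
  (is "_ <= (\<integral>\<^sup>+ k. ?f k \<partial>_)")
proof (cases y)
 case (real r)
 show ?thesis
 proof (cases "r = 0")
  case False
  with real have r: "0 < r" by simp
  define k where "k = \<lceil>log 2 (r / c)\<rceil> - 1"
  have "rl k < log 2 (r / c)" "log 2 (r / c) <= rl k + 1" unfolding k_def by linarith+
  then have k: "c * 2 powr rl k < r" "r <= c * 2 powr (rl k + 1)"
   using r c by (simp_all add: less_log_iff log_le_iff pos_less_divide_eq pos_divide_le_eq mult.commute)
  have "epowr y s <= ?f k"
   using k r s real by (simp add: epowr_ennreal ennreal_leI powr_mono2 ennreal_less_iff c less_imp_le)
  also have "... <= (\<Sum>\<^sup>+k. ?f k)" by (rule nn_integral_ge_point) simp
  finally show ?thesis .
 qed (use real in simp)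
next
 case top
 have "ennreal (real n) <= (\<Sum>\<^sup>+k. ?f k)" for n :: nat
 proof -
  define k where "k = \<lceil>log 2 ((real n + 1) powr (1 / s) / c)\<rceil>"
  have "log 2 ((real n + 1) powr (1 / s) / c) <= rl k + 1" unfolding k_def by linarith
  then have "(real n + 1) powr (1 / s) <= c * 2 powr (rl k + 1)"
   using c by (simp add: log_le_iff pos_divide_le_eq mult.commute)
  then have "((real n + 1) powr (1 / s)) powr s <= (c * 2 powr (rl k + 1)) powr s"
   using s by (intro powr_mono2) auto
  then have "ennreal (real n) <= ?f k" using s top by (simp add: powr_powr ennreal_leI)
  also have "... <= (\<Sum>\<^sup>+k. ?f k)" by (rule nn_integral_ge_point) simp
  finally show ?thesis .
 qed
 then have "(SUP n. of_nat n) <= (\<Sum>\<^sup>+k. ?f k)"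
 by (intro SUP_least) (simp add: ennreal_of_nat_eq_real_of_nat)
 then show ?thesis unfolding ennreal_SUP_of_nat_eq_top by (rule order_trans[OF top_greatest])
qed

text \<open>Marcinkiewicz interpolation between the weak-type bound and boundedness. At height
  \<open>2 c0 2^k\<close> only the part \<open>hk k\<close> of \<open>h\<close> above
  \<open>2^k\<close> matters, because the rest contributes at most \<open>c0 2^k\<close> to the
  maximal function; the weak-type bounds for the \<open>hk k\<close> are then summed over
  \<open>k\<close>.\<close>

lemma maxi_strong:
 assumes s: "1 < s"
 shows "\<exists>C::real. 1 <= C \<and> (\<forall>h :: real ^ 'n => ennreal. h \<in> bor -->
   (\<integral>x. epowr (maxi h x) s) <= ennreal C * (\<integral>x. epowr (h x) s))"
proof -
 define c0 where "c0 = unit_ball_vol CARD('n) * (3 * real CARD('n)) ^ CARD('n)"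
 define B where "B = unit_ball_vol CARD('n) * (15 * real CARD('n)) ^ CARD('n)"
 have c0: "0 < c0" and B: "0 < B" unfolding c0_def B_def by (simp_all add: unit_ball_vol_pos)
 \<comment> \<open>\<open>(4 * c0) powr s\<close> comes from the upper end of a layer,
   \<open>B / c0\<close> from the weak-type bound at height \<open>c0 2^k\<close>; \<open>G\<close>
   adds the geometric series over the levels below \<open>h x\<close>.\<close>
 define A where "A = (4 * c0) powr s * (B / c0)"
 define G where "G = A / (1 - 2 powr (- (s - 1)))"
 have A: "0 < A" unfolding A_def using c0 B by simp
 have pl: "(2::real) powr (- (s - 1)) < 1"
  using s powr_less_mono[of "- (s - 1)" 0 "2::real"] by simp
 have G0: "0 < G" unfolding G_def using A pl by simp
 have main: "(\<integral>x. epowr (maxi h x) s) <= ennreal G * (\<integral>x. epowr (h x) s)"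
  if [measurable]: "h \<in> bor" for h :: "real ^ 'n => ennreal"
 proof -
  define hk where "hk k x = h x * indicator {x. ennreal (2 powr rl k) < h x} x" for k :: int and x
  have [measurable]: "hk k \<in> bor" for k unfolding hk_def by measurable
  have lev: "{x. ennreal (2 * c0 * 2 powr rl k) < maxi h x} \<subseteq> {x. ennreal (c0 * 2 powr rl k) < maxi (hk k) x}" for k
  proof safe
   fix x assume lt: "ennreal (2 * c0 * 2 powr rl k) < maxi h x"
   have "maxi h x <= maxi (\<lambda>y. hk k y + ennreal (2 powr rl k)) x"
   by (rule maxi_mono) (auto simp: hk_def split: split_indicator)
   also have "... <= maxi (hk k) x + ennreal c0 * ennreal (2 powr rl k)"
    unfolding c0_def by (rule maxi_add_const) measurable
   finally have le: "maxi h x <= maxi (hk k) x + ennreal (c0 * 2 powr rl k)" using c0 by (simp add: ennreal_mult'')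
   show "ennreal (c0 * 2 powr rl k) < maxi (hk k) x"
   proof (rule ccontr)
    assume "\<not> ?thesis"
    then have "maxi (hk k) x + ennreal (c0 * 2 powr rl k) <= ennreal (c0 * 2 powr rl k) + ennreal (c0 * 2 powr rl k)"
    by (intro add_right_mono) simp
    also have "... = ennreal (2 * c0 * 2 powr rl k)" using c0 by (simp add: ennreal_plus[symmetric] del: ennreal_plus)
    finally show False using lt le by simp
   qed
  qed
  have "(\<integral>x. epowr (maxi h x) s)
   <= (\<integral>x. (\<Sum>\<^sup>+k. ennreal ((2 * c0 * 2 powr (rl k + 1)) powr s) * indicator {x. ennreal (2 * c0 * 2 powr rl k) < maxi h x} x))"
  proof (intro nn_integral_mono)
   fix x
   show "epowr (maxi h x) s <= (\<Sum>\<^sup>+k. ennreal ((2 * c0 * 2 powr (rl k + 1)) powr s) * indicator {x. ennreal (2 * c0 * 2 powr rl k) < maxi h x} x)"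
    using epowr_le_layers[of "2 * c0" s "maxi h x"] c0 s by (simp add: indicator_def)
  qed
  also have "... = (\<Sum>\<^sup>+k. (\<integral>x. ennreal ((2 * c0 * 2 powr (rl k + 1)) powr s) * indicator {x. ennreal (2 * c0 * 2 powr rl k) < maxi h x} x))"
  by (intro nn_integral_count_space_nn_integral) auto
  also have "... <= (\<Sum>\<^sup>+k. (\<integral>x. ennreal (A * 2 powr ((s - 1) * rl k)) * (h x * indicator {x. ennreal (2 powr rl k) < h x} x)))"
  proof (rule nn_integral_mono)
   fix k :: int
   have "(\<integral>x. ennreal ((2 * c0 * 2 powr (rl k + 1)) powr s) * indicator {x. ennreal (2 * c0 * 2 powr rl k) < maxi h x} x)
    = ennreal ((2 * c0 * 2 powr (rl k + 1)) powr s) * emeasure lborel {x. ennreal (2 * c0 * 2 powr rl k) < maxi h x}"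
   by (subst nn_integral_cmult_indicator) auto
   also have "... <= ennreal ((2 * c0 * 2 powr (rl k + 1)) powr s) * (ennreal (B / (c0 * 2 powr rl k)) * (\<integral>x. hk k x))"
    unfolding B_def using c0
   by (intro mult_left_mono order_trans[OF emeasure_mono[OF lev] maxi_weak]) auto
   also have "... = ennreal ((2 * c0 * 2 powr (rl k + 1)) powr s * (B / (c0 * 2 powr rl k))) * (\<integral>x. hk k x)"
    using B c0 by (subst ennreal_mult) (auto simp: mult.assoc)
   also have "(2 * c0 * 2 powr (rl k + 1)) powr s * (B / (c0 * 2 powr rl k)) = A * 2 powr ((s - 1) * rl k)"
   proof -
    have "2 * c0 * 2 powr (rl k + 1) = (4 * c0) * 2 powr rl k" by (simp add: powr_add)
    then have "(2 * c0 * 2 powr (rl k + 1)) powr s = (4 * c0) powr s * 2 powr (rl k * s)"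
     using c0 by (simp add: powr_mult powr_powr)
    moreover have "2 powr (rl k * s) / 2 powr rl k = 2 powr ((s - 1) * rl k)"
    by (simp add: powr_diff[symmetric] algebra_simps)
    ultimately show ?thesis by (simp add: A_def field_simps)
   qed
   also have "ennreal (A * 2 powr ((s - 1) * rl k)) * (\<integral>x. hk k x) = (\<integral>x. ennreal (A * 2 powr ((s - 1) * rl k)) * hk k x)"
   by (rule nn_integral_cmult[symmetric]) measurable
   finally show "(\<integral>x. ennreal ((2 * c0 * 2 powr (rl k + 1)) powr s) * indicator {x. ennreal (2 * c0 * 2 powr rl k) < maxi h x} x) <= (\<integral>x. ennreal (A * 2 powr ((s - 1) * rl k)) * (h x * indicator {x. ennreal (2 powr rl k) < h x} x))"
    unfolding hk_def .
  qed
  also have "... = (\<integral>x. (\<Sum>\<^sup>+k. ennreal (A * 2 powr ((s - 1) * rl k)) * (h x * indicator {x. ennreal (2 powr rl k) < h x} x)))"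
  by (intro nn_integral_count_space_nn_integral[symmetric]) auto
  also have "... <= (\<integral>x. ennreal G * epowr (h x) s)"
  proof (intro nn_integral_mono)
   fix x
   show "(\<Sum>\<^sup>+k. ennreal (A * 2 powr ((s - 1) * rl k)) * (h x * indicator {x. ennreal (2 powr rl k) < h x} x)) <= ennreal G * epowr (h x) s"
   proof (cases "h x")
    case top
    then show ?thesis using G0 by (simp add: ennreal_mult_top)
   next
    case (real r)
    show ?thesis
    proof (cases "r = 0")
     case False
     then have r: "0 < r" using real by simp
     have "(\<Sum>\<^sup>+k. ennreal (A * 2 powr ((s - 1) * rl k)) * (h x * indicator {x. ennreal (2 powr rl k) < h x} x))
      = (\<Sum>\<^sup>+k. ennreal (A * r) * (ennreal (2 powr ((s - 1) * rl k)) * indicator {k. 2 powr rl k < r} k))"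
      using real A by (intro nn_integral_cong) (auto simp: ennreal_mult'' mult_ac ennreal_less_iff split: split_indicator)
     also have "... = ennreal (A * r) * (\<Sum>\<^sup>+k. ennreal (2 powr ((s - 1) * rl k)) * indicator {k. 2 powr rl k < r} k)"
     by (rule nn_integral_cmult) simp
     also have "... <= ennreal (A * r) * ennreal (r powr (s - 1) / (1 - 2 powr (- (s - 1))))"
      using s r by (intro mult_left_mono geometric_int_le) auto
     also have "... = ennreal (G * (r powr (s - 1) * r))"
      using A r pl by (simp add: ennreal_mult'' [symmetric] G_def field_simps)
     also have "r powr (s - 1) * r = r powr s" using r by (simp add: powr_diff)
     also have "ennreal (G * r powr s) = ennreal G * epowr (h x) s" using real G0 by (simp add: epowr_ennreal ennreal_mult'')
     finally show ?thesis .
    qed (use real in simp)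
   qed
  qed
  also have "... = ennreal G * (\<integral>x. epowr (h x) s)" by (rule nn_integral_cmult) measurable
  finally show ?thesis .
 qed
 show ?thesis
 proof (intro exI[of _ "max 1 G"] conjI allI impI)
  fix h :: "real ^ 'n => ennreal" assume h: "h \<in> bor"
  have "ennreal G * (\<integral>x. epowr (h x) s) <= ennreal (max 1 G) * (\<integral>x. epowr (h x) s)"
  by (intro mult_right_mono ennreal_leI) auto
  with main[OF h] show "(\<integral>x. epowr (maxi h x) s) <= ennreal (max 1 G) * (\<integral>x. epowr (h x) s)"
  by (rule order_trans)
 qed simp
qed

text \<open>The Rubio de Francia iteration \<open>\<Sum> b\<^sup>-\<^sup>k M\<^sup>k g\<close>.\<close>

lemma Rubio_de_Francia:
 assumes s: "1 < s"
 shows "\<exists>C::real. 1 <= C \<and> (\<forall>g :: real ^ 'n => ennreal. g \<in> bor -->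
   (\<exists>H. H \<in> bor \<and> (\<forall>x. g x <= H x) \<and> (\<forall>x. maxi H x <= ennreal C * H x) \<and>
    (\<integral>x. epowr (H x) s) <= ennreal C * (\<integral>x. epowr (g x) s)))"
proof -
 obtain A where A: "1 <= A" and M: "\<And>h :: real ^ 'n => ennreal. h \<in> bor ==>
   (\<integral>x. epowr (maxi h x) s) <= ennreal A * (\<integral>x. epowr (h x) s)"
  using maxi_strong[OF s, where 'n='n] by auto
 show ?thesis
 \<comment> \<open>\<open>2 * A\<close> is lost when \<open>maxi\<close> shifts the series by one
   index; \<open>2 powr s\<close> is \<open>2 powr (s - 1)\<close> from Jensen's inequality times
   the sum 2 of the weights.\<close>
 proof (intro exI[of _ "max (2 * A) (2 powr s)"] conjI allI impI)
  show "1 <= max (2 * A) (2 powr s)" using A by simp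
  fix g :: "real ^ 'n => ennreal" assume [measurable]: "g \<in> bor"
  define Mk where "Mk k = (maxi ^^ k) g" for k
  have [measurable]: "Mk k \<in> bor" for k
   unfolding Mk_def by (induction k) auto
  have Mk: "(\<integral>x. epowr (Mk k x) s) <= ennreal (A ^ k) * (\<integral>x. epowr (g x) s)" for k
  proof (induction k)
   case (Suc k)
   have "(\<integral>x. epowr (Mk (Suc k) x) s) <= ennreal A * (\<integral>x. epowr (Mk k x) s)"
    using M[OF \<open>Mk k \<in> bor\<close>] by (simp add: Mk_def)
   also have "... <= ennreal A * (ennreal (A ^ k) * (\<integral>x. epowr (g x) s))"
   by (intro mult_left_mono Suc) simp
   finally show ?case using A by (simp add: ennreal_mult'' mult_ac)
  qed (simp add: Mk_def)
  \<comment> \<open>The weights \<open>(2 A)^(-k)\<close> are split in two: \<open>x2\<close> is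
    summable and serves as the measure in Jensen's inequality, \<open>w\<close> compensates the
    norms of the iterates.\<close>
  define x2 :: "nat => ennreal" where "x2 k = ennreal ((1 / 2) ^ k)" for k
  have x2: "(\<Sum>\<^sup>+k. x2 k) = 2"
   proof -
   have "(\<lambda>k. (1 / 2 :: real) ^ k) sums 2" using geometric_sums[of "1 / 2 :: real"] by simp
   then have "(\<Sum>k. ennreal ((1 / 2) ^ k)) = ennreal 2" by (intro suminf_ennreal_eq) auto
   then show ?thesis by (simp only: nn_integral_count_space_nat x2_def ennreal_numeral)
  qed
  define w where "w k = ennreal ((1 / A) ^ k)" for k
  define H where "H x = (\<Sum>\<^sup>+k. x2 k * (w k * Mk k x))" for x
  have [measurable]: "H \<in> bor"
   unfolding H_def[abs_def] nn_integral_count_space_nat by measurable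
  show "\<exists>H. H \<in> bor \<and> (\<forall>x. g x <= H x) \<and> (\<forall>x. maxi H x <= ennreal (max (2 * A) (2 powr s)) * H x) \<and>
    (\<integral>x. epowr (H x) s) <= ennreal (max (2 * A) (2 powr s)) * (\<integral>x. epowr (g x) s)"
  proof (intro exI[of _ H] conjI allI)
   show "H \<in> bor" by fact
   show "g x <= H x" for x
    using nn_integral_ge_point[of 0 UNIV "\<lambda>k. x2 k * (w k * Mk k x)"] by (simp add: H_def x2_def w_def Mk_def)
   fix x
   have "maxi H x <= (\<Sum>\<^sup>+k. maxi (\<lambda>x. x2 k * (w k * Mk k x)) x)"
    unfolding H_def by (rule maxi_nn_integral) auto
   also have "... = (\<Sum>\<^sup>+k. ennreal (2 * A) * (x2 (Suc k) * (w (Suc k) * Mk (Suc k) x)))"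
   proof (intro nn_integral_cong)
    fix k :: nat
    have "maxi (\<lambda>x. x2 k * (w k * Mk k x)) x = x2 k * (w k * Mk (Suc k) x)"
    by (simp add: maxi_cmult) (simp add: Mk_def)
    moreover have "x2 k = 2 * x2 (Suc k)"
     unfolding x2_def by (subst ennreal_numeral[symmetric], subst ennreal_mult[symmetric]) auto
    moreover have "w k = ennreal A * w (Suc k)"
     unfolding w_def using A by (subst ennreal_mult[symmetric]) auto
    ultimately have "maxi (\<lambda>x. x2 k * (w k * Mk k x)) x = (2 * x2 (Suc k)) * (ennreal A * w (Suc k) * Mk (Suc k) x)"
    by (simp only: mult.assoc)
    then show "maxi (\<lambda>x. x2 k * (w k * Mk k x)) x = ennreal (2 * A) * (x2 (Suc k) * (w (Suc k) * Mk (Suc k) x))"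
     using A by (simp add: ennreal_mult mult_ac)
   qed
   also have "... = ennreal (2 * A) * (\<Sum>\<^sup>+k. x2 (Suc k) * (w (Suc k) * Mk (Suc k) x))"
   by (rule nn_integral_cmult) simp
   also have "(\<Sum>\<^sup>+k. x2 (Suc k) * (w (Suc k) * Mk (Suc k) x)) = (\<Sum>\<^sup>+k\<in>(range Suc). x2 k * (w k * Mk k x))"
   by (rule nn_integral_bij_count_space[of Suc]) (auto simp: bij_betw_def)
   also have "... <= H x"
    unfolding H_def by (subst nn_integral_count_space_indicator) (auto intro!: nn_integral_mono split: split_indicator)
   finally have "maxi H x <= ennreal (2 * A) * H x" by (simp add: mult_left_mono)
   also have "... <= ennreal (max (2 * A) (2 powr s)) * H x" by (intro mult_right_mono ennreal_leI) auto
   finally show "maxi H x <= ennreal (max (2 * A) (2 powr s)) * H x" .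
  next
   have Hs: "epowr (H x) s <= ennreal (2 powr (s - 1)) * (\<Sum>\<^sup>+k. x2 k * epowr (w k * Mk k x) s)" for x
   proof -
    have "H x = (\<Sum>\<^sup>+k. x2 k * epowr (epowr (w k * Mk k x) s) (1 / s))"
     unfolding H_def using s by (simp add: epowr_epowr)
    also have "... <= epowr (\<Sum>\<^sup>+k. x2 k * epowr (w k * Mk k x) s) (1 / s) * epowr (\<Sum>\<^sup>+k. x2 k) (1 - 1 / s)"
     using s by (intro nn_integral_Jensen_weight) auto
    finally have "epowr (H x) s <= epowr (epowr (\<Sum>\<^sup>+k. x2 k * epowr (w k * Mk k x) s) (1 / s) * epowr 2 (1 - 1 / s)) s"
     unfolding x2 using s by (intro epowr_mono) auto
    also have "... = (\<Sum>\<^sup>+k. x2 k * epowr (w k * Mk k x) s) * epowr 2 (s - 1)"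
     using s by (simp add: epowr_mult epowr_epowr left_diff_distrib)
    also have "epowr 2 (s - 1) = ennreal (2 powr (s - 1))" using epowr_ennreal[of 2 "s - 1"] by simp
    finally show ?thesis by (simp add: mult.commute)
   qed
   have "(\<integral>x. epowr (H x) s) <= (\<integral>x. ennreal (2 powr (s - 1)) * (\<Sum>\<^sup>+k. x2 k * epowr (w k * Mk k x) s))"
   by (intro nn_integral_mono Hs)
   also have "... = ennreal (2 powr (s - 1)) * (\<integral>x. (\<Sum>\<^sup>+k. x2 k * epowr (w k * Mk k x) s))"
    unfolding nn_integral_count_space_nat by (rule nn_integral_cmult) measurable
   also have "(\<integral>x. (\<Sum>\<^sup>+k. x2 k * epowr (w k * Mk k x) s)) = (\<Sum>\<^sup>+k. (\<integral>x. x2 k * epowr (w k * Mk k x) s))"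
   by (intro nn_integral_count_space_nn_integral) auto
   also have "... <= (\<Sum>\<^sup>+k. x2 k * (\<integral>x. epowr (g x) s))"
   proof (intro nn_integral_mono)
    fix k :: nat
    have "(\<integral>x. x2 k * epowr (w k * Mk k x) s) = x2 k * epowr (w k) s * (\<integral>x. epowr (Mk k x) s)"
    by (simp add: epowr_mult nn_integral_cmult mult.assoc)
    also have "... <= x2 k * epowr (w k) s * (ennreal (A ^ k) * (\<integral>x. epowr (g x) s))"
    by (intro mult_left_mono Mk) simp
    also have "... = x2 k * ((epowr (w k) s * ennreal (A ^ k)) * (\<integral>x. epowr (g x) s))"
    by (simp add: mult.assoc)
    \<comment> \<open>\<open>A\<close> bounds integrals of \<open>s\<close>-th powers, so
      \<open>A^(-k)\<close> already compensates \<open>A^k\<close>; its \<open>s\<close>-th power is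
      smaller still because \<open>A >= 1\<close>.\<close>
    also have "epowr (w k) s * ennreal (A ^ k) <= 1"
    proof -
     have "((1 / A) ^ k) powr s <= ((1 / A) ^ k) powr 1"
      using A s by (intro powr_mono') (auto simp: power_le_one divide_simps)
     then have "((1 / A) ^ k) powr s * A ^ k <= (1 / A) ^ k * A ^ k"
      using A by (intro mult_right_mono) auto
     also have "... = 1" using A by (simp add: power_mult_distrib[symmetric])
     finally show ?thesis using A by (simp add: w_def epowr_ennreal ennreal_mult'' [symmetric])
    qed
    finally show "(\<integral>x. x2 k * epowr (w k * Mk k x) s) <= x2 k * (\<integral>x. epowr (g x) s)"
    by (simp add: mult_left_mono mult_right_mono)
   qed
   also have "... = 2 * (\<integral>x. epowr (g x) s)"
   by (simp add: nn_integral_multc x2)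
   finally have "(\<integral>x. epowr (H x) s) <= ennreal (2 powr (s - 1)) * (2 * (\<integral>x. epowr (g x) s))"
   by (simp add: mult_left_mono)
   also have "... = ennreal (2 powr (s - 1) * 2) * (\<integral>x. epowr (g x) s)"
   by (simp add: ennreal_mult'' mult.assoc)
   also have "... <= ennreal (max (2 * A) (2 powr s)) * (\<integral>x. epowr (g x) s)"
   by (intro mult_right_mono ennreal_leI) (auto simp: powr_diff)
   finally show "(\<integral>x. epowr (H x) s) <= ennreal (max (2 * A) (2 powr s)) * (\<integral>x. epowr (g x) s)" .
  qed
 qed
qed

section \<open>Vector-valued inequalities for averages\<close>

lemma borel_measurable_nn_integral_count_space:
 fixes f :: "'i => 'a => ennreal"
 assumes "countable I" "\<And>i. i \<in> I ==> f i \<in> borel_measurable M"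
 shows "(\<lambda>x. (\<Sum>\<^sup>+i\<in>I. f i x)) \<in> borel_measurable M"
proof (cases "finite I")
 case True
 then show ?thesis using assms by (simp add: nn_integral_count_space_finite)
next
 case False
 have "(\<Sum>\<^sup>+i\<in>I. f i x) = (\<Sum>k. f (from_nat_into I k) x)" for x
  using nn_integral_bij_count_space[OF bij_betw_from_nat_into[OF assms(1) False], of "\<lambda>i. f i x"]
 by (simp add: nn_integral_count_space_nat)
 moreover have "f (from_nat_into I k) \<in> borel_measurable M" for k
  using False by (intro assms from_nat_into) auto
 ultimately show ?thesis by simp
qed

lemma ennreal_inverse_anti_mono: "(a :: ennreal) <= b ==> inverse b <= inverse a"
 by (cases "a = 0"; cases a; cases b) (auto simp: inverse_ennreal ennreal_less_iff le_less)

definition dominated :: "real => real => int => (real ^ 'n => ennreal) => (real ^ 'n => ennreal) => bool" where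
 "dominated V U R B A \<longleftrightarrow> (\<forall>x. pavg R V (cell R x) B <= pavg R U (cell3 R x) A)"

lemma avg_le_pavg_cell:
 assumes "f \<in> bor" "1 <= V"
 shows "avg R (cell R x) f <= pavg R V (cell R x) f"
 using avg_Jensen_cell[of "\<lambda>y. epowr (f y) V" "1 / V" R x] assms by (simp add: epowr_epowr pavg_def)

lemma pavg_cell3_le_avg:
 fixes x :: "real ^ 'n"
 assumes "f \<in> bor" "0 < U" "U <= 1"
 shows "pavg R U (cell3 R x) f <= epowr (3 ^ CARD('n)) (1 / U) * avg R (cell3 R x) f"
proof -
 have "pavg R U (cell3 R x) f <= epowr (3 ^ CARD('n) * epowr (avg R (cell3 R x) f) U) (1 / U)"
  unfolding pavg_def using assms by (intro epowr_mono avg_Jensen_cell3) auto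
 then show ?thesis using assms by (simp add: epowr_mult epowr_epowr)
qed

lemma dominated_avg:
 fixes A B :: "real ^ 'n => ennreal"
 assumes "dominated V U R B A" "A \<in> bor" "B \<in> bor" "1 <= V" "0 < U" "U <= 1"
 shows "avg R (cell R x) B <= epowr (3 ^ CARD('n)) (1 / U) * avg R (cell3 R x) A"
 using avg_le_pavg_cell[of B V R x] pavg_cell3_le_avg[of A U R x] assms
 unfolding dominated_def by (meson order_trans)

lemma ennreal_three_power: "(3 ^ k :: ennreal) = ennreal (3 ^ k)"
 by (metis ennreal_numeral ennreal_power zero_le_numeral)

lemma epowr_three_power: "epowr (3 ^ k) a = ennreal (3 powr (k * a))"
 by (simp add: ennreal_three_power epowr_ennreal powr_powr[symmetric] powr_realpow)

lemma nn_integral_dominated: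
 fixes A B :: "real ^ 'n => ennreal"
 assumes "dominated V U R B A" "A \<in> bor" "B \<in> bor" "1 <= V" "0 < U" "U <= 1"
 shows "(\<integral>x. B x) <= epowr (3 ^ CARD('n)) (1 / U + 1) * (\<integral>x. A x)"
proof -
 have "(\<integral>x. B x) = (\<integral>x. avg R (cell R x) B)"
  using assms by (simp add: nn_integral_avg_cell)
 also have "... <= (\<integral>x. epowr (3 ^ CARD('n)) (1 / U) * avg R (cell3 R x) A)"
  using assms by (intro nn_integral_mono dominated_avg)
 also have "... = epowr (3 ^ CARD('n)) (1 / U) * (3 ^ CARD('n) * (\<integral>x. A x))"
  using assms by (simp add: nn_integral_cmult nn_integral_avg_cell3)
 finally show ?thesis by (simp add: epowr_add mult.assoc)
qed

text \<open>Dividing by \<open>X^(1 - 1/P)\<close> is legitimate for finite nonzero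
  \<open>X\<close>; this is the final step of the duality argument.\<close>

lemma epowr_absorb:
 assumes P: "1 < P" and "X < top" and le: "X <= D * epowr X (1 - 1 / P)"
 shows "X <= epowr D P"
proof (cases "X = 0")
 case False
 have X: "X = epowr X (1 / P) * epowr X (1 - 1 / P)"
  using epowr_add[of X "1 / P" "1 - 1 / P"] by simp
 have nz: "epowr X (1 - 1 / P) \<noteq> 0" "epowr X (1 - 1 / P) \<noteq> top" using False assms by auto
 have "epowr X (1 - 1 / P) * epowr X (1 / P) <= epowr X (1 - 1 / P) * D"
  using le X by (simp add: mult.commute)
 then have "epowr X (1 / P) <= D" using nz by (simp add: ennreal_mult_le_mult_iff)
 then show ?thesis using P epowr_le_iff[of "1 / P" X D] by simp
qed simp

text \<open>Duality with \<open>w = F^(P-1)\<close>, where \<open>F\<close> is the sum of the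
  \<open>B i\<close>. On each cell Hoelder with \<open>V\<close> and its conjugate exponent
  separates \<open>B i\<close> from \<open>w\<close>; the mean of \<open>w\<close> is bounded, at
  every point of \<open>cell3\<close>, by the maximal function \<open>\<mu>\<close>. Since
  \<open>\<mu>\<close> does not depend on \<open>i\<close>, the sum of the \<open>A i\<close>
  reappears, and Hoelder with the maximal theorem returns a power of the left side, which finiteness
  permits to absorb.\<close>

lemma vector_valued_gt_finite:
 assumes UV: "0 < U" "U <= 1" "P < V" and P: "1 < P"
 shows "\<exists>K::real. 0 <= K \<and> (\<forall>(I :: 'i set) R A (B :: 'i => real ^ 'n => ennreal). countable I -->
   (\<forall>i\<in>I. A i \<in> bor \<and> B i \<in> bor \<and> dominated V U (R i) (B i) (A i)) -->
   (\<integral>x. epowr (\<Sum>\<^sup>+i\<in>I. B i x) P) < top -->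
   (\<integral>x. epowr (\<Sum>\<^sup>+i\<in>I. B i x) P) <= ennreal K * (\<integral>x. epowr (\<Sum>\<^sup>+i\<in>I. A i x) P))"
proof -
 \<comment> \<open>\<open>\<theta>\<close> is the conjugate exponent of \<open>V\<close> and
   \<open>e\<close> its reciprocal. The maximal theorem is applied to \<open>w^\<theta>\<close> in
   \<open>L^s\<close>, where \<open>s\<close> is the conjugate exponent of \<open>P\<close> divided
   by \<open>\<theta>\<close>; \<open>s > 1\<close> says exactly \<open>P < V\<close>.\<close>
 define \<theta> where "\<theta> = V / (V - 1)"
 define e where "e = 1 - 1 / V"
 define s where "s = P / (P - 1) * e"
 have V: "1 < V" using UV P by simp
 have e: "0 < e" "\<theta> * e = 1" "0 < \<theta>" using V by (auto simp: e_def \<theta>_def field_simps)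
 have s: "1 < s" using UV V P by (simp add: s_def e_def field_simps)
 have ths: "\<theta> * s = P / (P - 1)" using e by (simp add: s_def mult.left_commute)
 have inv: "1 - 1 / P = (P - 1) / P" using P by (simp add: field_simps)
 obtain C where C: "1 <= C" and M: "\<And>h :: real ^ 'n => ennreal. h \<in> bor ==>
   (\<integral>x. epowr (maxi h x) s) <= ennreal C * (\<integral>x. epowr (h x) s)"
  using maxi_strong[OF s, where 'n='n] by auto
 define k where "k = (epowr (3 ^ CARD('n)) (1 / U + 1) :: ennreal)"
 define K where "K = (3 powr (CARD('n) * (1 / U + 1)) * C powr (1 - 1 / P)) powr P"
 have kK: "epowr (k * epowr (ennreal C) (1 - 1 / P)) P = ennreal K"
  using C by (simp add: k_def K_def epowr_three_power epowr_ennreal ennreal_mult'' [symmetric])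
 show ?thesis
 proof (intro exI[of _ K] conjI allI impI)
  show "0 <= K" by (simp add: K_def)
  fix I :: "'i set" and R and A B :: "'i => real ^ 'n => ennreal"
  assume I: "countable I" and H: "\<forall>i\<in>I. A i \<in> bor \<and> B i \<in> bor \<and> dominated V U (R i) (B i) (A i)"
   and fin: "(\<integral>x. epowr (\<Sum>\<^sup>+i\<in>I. B i x) P) < top"
  define F where "F x = (\<Sum>\<^sup>+i\<in>I. B i x)" for x
  define h where "h x = (\<Sum>\<^sup>+i\<in>I. A i x)" for x
  have mA: "A i \<in> bor" "B i \<in> bor" if "i \<in> I" for i using H that by auto
  have [measurable]: "F \<in> bor" "h \<in> bor"
   unfolding F_def[abs_def] h_def[abs_def] using I mA by (auto intro!: borel_measurable_nn_integral_count_space)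
  define w where "w x = epowr (F x) (P - 1)" for x
  have [measurable]: "w \<in> bor" unfolding w_def[abs_def] by measurable
  define \<mu> where "\<mu> x = epowr (maxi (\<lambda>y. epowr (w y) \<theta>) x) e" for x
  have [measurable]: "\<mu> \<in> bor" unfolding \<mu>_def[abs_def] by measurable
  define X where "X = (\<integral>x. epowr (F x) P)"
  have X2: "X = (\<integral>x. F x * w x)"
   unfolding X_def w_def using epowr_add[of _ 1 "P - 1"] by simp
  have "X = (\<integral>x. (\<Sum>\<^sup>+i\<in>I. B i x * w x))"
   unfolding X2 F_def by (simp add: nn_integral_multc)
  also have "... = (\<Sum>\<^sup>+i\<in>I. (\<integral>x. B i x * w x))"
   using I mA by (intro nn_integral_count_space_nn_integral) auto
  also have "... <= (\<Sum>\<^sup>+i\<in>I. k * (\<integral>x. A i x * \<mu> x))"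
  proof (rule nn_integral_mono)
   fix i assume "i \<in> space (count_space I)"
   then have i: "i \<in> I" by simp
   note [measurable] = mA[OF i]
   have dom: "dominated V U (R i) (B i) (A i)" using H i by auto
   have "(\<integral>x. B i x * w x) = (\<integral>x. avg (R i) (cell (R i) x) (\<lambda>y. B i y * w y))"
   by (simp add: nn_integral_avg_cell)
   also have "... <= (\<integral>x. epowr (3 ^ CARD('n)) (1 / U) * avg (R i) (cell3 (R i) x) (\<lambda>y. A i y * \<mu> y))"
   proof (rule nn_integral_mono)
    fix x
    define c where "c = epowr (avg (R i) (cell (R i) x) (\<lambda>y. epowr (w y) \<theta>)) e"
    have "avg (R i) (cell (R i) x) (\<lambda>y. B i y * w y) = avg (R i) (cell (R i) x) (\<lambda>y. epowr (epowr (B i y) V) (1 / V) * epowr (epowr (w y) \<theta>) (1 - 1 / V))"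
     using V e by (simp add: epowr_epowr e_def[symmetric])
    also have "... <= epowr (avg (R i) (cell (R i) x) (\<lambda>y. epowr (B i y) V)) (1 / V) * epowr (avg (R i) (cell (R i) x) (\<lambda>y. epowr (w y) \<theta>)) (1 - 1 / V)"
     using V by (intro avg_Holder) auto
    also have "... = pavg (R i) V (cell (R i) x) (B i) * c"
    by (simp add: pavg_def c_def e_def)
    also have "... <= (epowr (3 ^ CARD('n)) (1 / U) * avg (R i) (cell3 (R i) x) (A i)) * c"
     using dom UV by (intro mult_right_mono order_trans[OF _ pavg_cell3_le_avg]) (auto simp: dominated_def)
    also have "... = epowr (3 ^ CARD('n)) (1 / U) * (avg (R i) (cell3 (R i) x) (A i) * c)" by (rule mult.assoc)
    also have "avg (R i) (cell3 (R i) x) (A i) * c = avg (R i) (cell3 (R i) x) (\<lambda>y. c * A i y)"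
    by (simp add: avg_cmult mult.commute)
    also have "... <= avg (R i) (cell3 (R i) x) (\<lambda>y. A i y * \<mu> y)"
    proof (rule avg_mono)
     fix y assume y: "y \<in> cell3 (R i) x"
     have "c <= \<mu> y"
      unfolding c_def \<mu>_def using e y
     by (intro epowr_mono order_trans[OF avg_subset[OF cell_subset_cell3] avg_le_maxi]) auto
     then show "c * A i y <= A i y * \<mu> y" by (metis mult.commute mult_left_mono zero_le)
    qed
    finally show "avg (R i) (cell (R i) x) (\<lambda>y. B i y * w y) <= epowr (3 ^ CARD('n)) (1 / U) * avg (R i) (cell3 (R i) x) (\<lambda>y. A i y * \<mu> y)"
    by (simp add: mult_left_mono)
   qed
   also have "... = k * (\<integral>x. A i x * \<mu> x)"
   by (simp add: nn_integral_cmult nn_integral_avg_cell3 k_def epowr_add mult.assoc)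
   finally show "(\<integral>x. B i x * w x) <= k * (\<integral>x. A i x * \<mu> x)" .
  qed
  also have "... = k * (\<Sum>\<^sup>+i\<in>I. (\<integral>x. A i x * \<mu> x))"
  by (rule nn_integral_cmult) simp
  also have "(\<Sum>\<^sup>+i\<in>I. (\<integral>x. A i x * \<mu> x)) = (\<integral>x. (\<Sum>\<^sup>+i\<in>I. A i x * \<mu> x))"
   using I mA by (intro nn_integral_count_space_nn_integral[symmetric]) auto
  also have "... = (\<integral>x. h x * \<mu> x)"
   unfolding h_def by (simp add: nn_integral_multc)
  also have "... <= epowr (\<integral>x. epowr (h x) P) (1 / P) * epowr (\<integral>x. epowr (\<mu> x) (P / (P - 1))) (1 - 1 / P)"
   using P by (intro nn_integral_Holder_conj) auto
  also have "(\<integral>x. epowr (\<mu> x) (P / (P - 1))) = (\<integral>x. epowr (maxi (\<lambda>y. epowr (w y) \<theta>) x) s)"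
  by (simp add: \<mu>_def epowr_epowr s_def mult.commute)
  also have "epowr ... (1 - 1 / P) <= epowr (ennreal C * X) (1 - 1 / P)"
  proof (rule epowr_mono)
   have "epowr (epowr (w y) \<theta>) s = epowr (F y) P" for y
    using P by (simp add: w_def epowr_epowr mult.assoc ths)
   then show "(\<integral>x. epowr (maxi (\<lambda>y. epowr (w y) \<theta>) x) s) <= ennreal C * X"
    using M[of "\<lambda>y. epowr (w y) \<theta>"] by (simp add: X_def)
  qed (use P in auto)
  finally have "X <= k * (epowr (\<integral>x. epowr (h x) P) (1 / P) * epowr (ennreal C * X) (1 - 1 / P))"
  by (simp add: mult_left_mono)
  also have "... = (k * epowr (ennreal C) (1 - 1 / P) * epowr (\<integral>x. epowr (h x) P) (1 / P)) * epowr X (1 - 1 / P)"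
  by (simp add: epowr_mult mult_ac)
  finally have "X <= epowr (k * epowr (ennreal C) (1 - 1 / P) * epowr (\<integral>x. epowr (h x) P) (1 / P)) P"
   using fin P by (intro epowr_absorb) (auto simp: X_def F_def)
  also have "... = ennreal K * (\<integral>x. epowr (h x) P)"
   using P by (simp only: epowr_mult[of "k * _"] kK) (simp add: epowr_epowr)
  finally show "(\<integral>x. epowr (\<Sum>\<^sup>+i\<in>I. B i x) P) <= ennreal K * (\<integral>x. epowr (\<Sum>\<^sup>+i\<in>I. A i x) P)"
  by (simp add: X_def F_def h_def)
 qed
qed

text \<open>Finiteness of the left side is achieved by truncating the \<open>B i\<close> in height,
  index and support. Making \<open>B i\<close> smaller preserves its domination by
  \<open>A i\<close>, so \<open>K\<close> stays the same and monotone convergence concludes.\<close>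

lemma vector_valued_gt:
 assumes UV: "0 < U" "U <= 1" "P < V" and P: "1 < P"
 shows "\<exists>K::real. 0 <= K \<and> (\<forall>(I :: 'i set) R A (B :: 'i => real ^ 'n => ennreal). countable I -->
   (\<forall>i\<in>I. A i \<in> bor \<and> B i \<in> bor \<and> dominated V U (R i) (B i) (A i)) -->
   (\<integral>x. epowr (\<Sum>\<^sup>+i\<in>I. B i x) P) <= ennreal K * (\<integral>x. epowr (\<Sum>\<^sup>+i\<in>I. A i x) P))"
proof -
 obtain K where K: "0 <= K" and main: "\<And>(I :: 'i set) R A (B :: 'i => real ^ 'n => ennreal). countable I ==>
   (\<forall>i\<in>I. A i \<in> bor \<and> B i \<in> bor \<and> dominated V U (R i) (B i) (A i)) ==>
   (\<integral>x. epowr (\<Sum>\<^sup>+i\<in>I. B i x) P) < top ==>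
   (\<integral>x. epowr (\<Sum>\<^sup>+i\<in>I. B i x) P) <= ennreal K * (\<integral>x. epowr (\<Sum>\<^sup>+i\<in>I. A i x) P)"
  using vector_valued_gt_finite[OF UV P, where 'i='i and 'n='n]
 by (elim exE conjE) (rule that, assumption, blast)
 show ?thesis
 proof (intro exI[of _ K] conjI allI impI K)
  fix I :: "'i set" and R and A B :: "'i => real ^ 'n => ennreal"
  assume I: "countable I" and H: "\<forall>i\<in>I. A i \<in> bor \<and> B i \<in> bor \<and> dominated V U (R i) (B i) (A i)"
  have mA: "A i \<in> bor" "B i \<in> bor" if "i \<in> I" for i using H that by auto
  define IN where "IN N = {i \<in> I. to_nat_on I i < N}" for N
  have IN: "finite (IN N)" "card (IN N) <= N" "IN N \<subseteq> I" for N
  proof -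
   have "inj_on (to_nat_on I) (IN N)" "to_nat_on I ` IN N \<subseteq> {..<N}"
    using inj_on_to_nat_on[OF I] by (auto simp: IN_def inj_on_def)
   then show "finite (IN N)" "card (IN N) <= N"
    using inj_on_finite[of "to_nat_on I" "IN N" "{..<N}"] card_inj_on_le[of "to_nat_on I" "IN N" "{..<N}"] by auto
  qed (auto simp: IN_def)
  define BN where "BN N i x = min (B i x) (of_nat N) * indicator (IN N) i * indicator (ball 0 (real N)) x" for N i x
  have [measurable]: "ball a r \<in> sets borel" for a :: "real ^ 'n" and r by simp
  have mB: "BN N i \<in> bor" if "i \<in> I" for N i
   unfolding BN_def[abs_def] using mA[OF that] by measurable
  have mono: "BN N i x <= BN N' i x" if "N <= N'" for N N' i x
   unfolding BN_def using that by (intro mult_mono min.mono) (auto simp: IN_def split: split_indicator)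
  have le: "BN N i x <= B i x" for N i x
   unfolding BN_def by (auto split: split_indicator)
  have sup: "(SUP N. BN N i x) = B i x" if i: "i \<in> I" for i x
  proof (rule antisym)
   obtain N0 where "norm x < real N0" using reals_Archimedean2 by blast
   define N1 where "N1 = max N0 (Suc (to_nat_on I i))"
   have eq: "BN N i x = min (B i x) (of_nat N)" if "N1 <= N" for N
    using that i \<open>norm x < real N0\<close> by (auto simp: BN_def IN_def N1_def)
   show "B i x <= (SUP N. BN N i x)"
   proof (cases "B i x")
    case (real r)
    obtain N where "r <= of_nat N" using real_arch_simple by blast
    then have "ennreal r <= of_nat (max N N1)" by (simp add: ennreal_of_nat_eq_real_of_nat ennreal_leI)
    then have "B i x <= BN (max N N1) i x" using eq[of "max N N1"] real by simp
    also have "... <= (SUP N. BN N i x)" by (rule SUP_upper) simp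
    finally show ?thesis .
   next
    case top
    have "of_nat N <= (SUP N. BN N i x)" for N
    proof -
     have "(of_nat N :: ennreal) <= of_nat (max N N1)" by (rule of_nat_mono) simp
     also have "... = BN (max N N1) i x" using eq[of "max N N1"] top by simp
     also have "... <= (SUP N. BN N i x)" by (rule SUP_upper) simp
     finally show ?thesis .
    qed
    then have "(SUP N. of_nat N :: ennreal) <= (SUP N. BN N i x)" by (intro SUP_least) auto
    then have "top <= (SUP N. BN N i x)" by (simp only: ennreal_SUP_of_nat_eq_top)
    then show ?thesis by (rule order_trans[OF top_greatest])
   qed
  qed (rule SUP_least, rule le)
  have "(\<integral>x. epowr (\<Sum>\<^sup>+i\<in>I. B i x) P) = (\<integral>x. epowr (SUP N. (\<Sum>\<^sup>+i\<in>I. BN N i x)) P)"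
  proof (intro nn_integral_cong arg_cong[where f="\<lambda>u. epowr u P"])
   fix x
   have "(\<Sum>\<^sup>+i\<in>I. B i x) = (\<Sum>\<^sup>+i\<in>I. (SUP N. BN N i x))"
   by (intro nn_integral_cong) (simp add: sup)
   also have "... = (SUP N. (\<Sum>\<^sup>+i\<in>I. BN N i x))"
   by (intro nn_integral_monotone_convergence_SUP) (auto simp: incseq_def le_fun_def mono)
   finally show "(\<Sum>\<^sup>+i\<in>I. B i x) = (SUP N. (\<Sum>\<^sup>+i\<in>I. BN N i x))" .
  qed
  also have "... = (\<integral>x. (SUP N. epowr (\<Sum>\<^sup>+i\<in>I. BN N i x) P))"
   using P by (simp add: epowr_SUP)
  also have "... = (SUP N. (\<integral>x. epowr (\<Sum>\<^sup>+i\<in>I. BN N i x) P))"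
   using P I mB by (intro nn_integral_monotone_convergence_SUP)
    (auto simp: incseq_def le_fun_def intro!: epowr_mono nn_integral_mono mono borel_measurable_epowr borel_measurable_nn_integral_count_space)
  also have "... <= ennreal K * (\<integral>x. epowr (\<Sum>\<^sup>+i\<in>I. A i x) P)"
  proof (intro SUP_least main I ballI conjI)
   fix N i assume i: "i \<in> I"
   show "A i \<in> bor" "BN N i \<in> bor" using mA mB i by auto
   show "dominated V U (R i) (BN N i) (A i)"
    using H i UV P le unfolding dominated_def
   by (auto intro!: order_trans[OF pavg_mono[of V _ "BN N i" "B i"]])
  next
   fix N
   have "(\<integral>x. epowr (\<Sum>\<^sup>+i\<in>I. BN N i x) P) <= (\<integral>\<^sup>+ x. epowr (ennreal (real N * real N)) P * indicator (ball 0 (real N)) x \<partial>(lborel :: (real ^ 'n) measure))"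
   proof (rule nn_integral_mono)
    fix x
    have "(\<Sum>\<^sup>+i\<in>I. BN N i x) <= (\<Sum>\<^sup>+i\<in>I. of_nat N * indicator (ball 0 (real N)) x * indicator (IN N) i)"
    by (intro nn_integral_mono) (auto simp: BN_def split: split_indicator)
    also have "... = of_nat N * indicator (ball 0 (real N)) x * of_nat (card (IN N))"
     using IN[of N] by (subst nn_integral_cmult_indicator) (auto simp: emeasure_count_space_finite)
    also have "... <= of_nat N * indicator (ball 0 (real N)) x * of_nat N"
     using IN[of N] by (intro mult_left_mono of_nat_mono) auto
    also have "... = ennreal (real N * real N) * indicator (ball 0 (real N)) x"
    by (simp add: ennreal_of_nat_eq_real_of_nat ennreal_mult'' [symmetric] split: split_indicator)
    finally show "epowr (\<Sum>\<^sup>+i\<in>I. BN N i x) P <= epowr (ennreal (real N * real N)) P * indicator (ball 0 (real N)) x"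
     using P epowr_mono[of "(\<Sum>\<^sup>+i\<in>I. BN N i x)" _ P] by (auto split: split_indicator)
   qed
   also have "... = epowr (ennreal (real N * real N)) P * emeasure lborel (ball (0 :: real ^ 'n) (real N))"
   by (subst nn_integral_cmult_indicator) auto
   also have "... < top"
    using emeasure_bounded_finite[of "ball (0 :: real ^ 'n) (real N)"] by (simp add: ennreal_mult_less_top)
   finally show "(\<integral>x. epowr (\<Sum>\<^sup>+i\<in>I. BN N i x) P) < top" .
  qed
  finally show "(\<integral>x. epowr (\<Sum>\<^sup>+i\<in>I. B i x) P) <= ennreal K * (\<integral>x. epowr (\<Sum>\<^sup>+i\<in>I. A i x) P)" .
 qed
qed

lemma vector_valued_eq:
 fixes A B :: "'i => real ^ 'n => ennreal"
 assumes UV: "0 < U" "U <= 1" "1 <= V" and I: "countable I"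
  and H: "\<forall>i\<in>I. A i \<in> bor \<and> B i \<in> bor \<and> dominated V U (R i) (B i) (A i)"
 shows "(\<integral>x. (\<Sum>\<^sup>+i\<in>I. B i x))
   <= epowr (3 ^ CARD('n)) (1 / U + 1) * (\<integral>x. (\<Sum>\<^sup>+i\<in>I. A i x))"
proof -
 have "(\<integral>x. (\<Sum>\<^sup>+i\<in>I. B i x)) = (\<Sum>\<^sup>+i\<in>I. (\<integral>x. B i x))"
  using I H by (intro nn_integral_count_space_nn_integral) auto
 also have "... <= (\<Sum>\<^sup>+i\<in>I. epowr (3 ^ CARD('n)) (1 / U + 1) * (\<integral>x. A i x))"
  using H UV by (intro nn_integral_mono nn_integral_dominated[of V]) auto
 also have "... = epowr (3 ^ CARD('n)) (1 / U + 1) * (\<Sum>\<^sup>+i\<in>I. (\<integral>x. A i x))"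
 by (rule nn_integral_cmult) simp
 also have "(\<Sum>\<^sup>+i\<in>I. (\<integral>x. A i x)) = (\<integral>x. (\<Sum>\<^sup>+i\<in>I. A i x))"
  using I H by (intro nn_integral_count_space_nn_integral[symmetric]) auto
 finally show ?thesis .
qed

text \<open>
 For \<open>P < 1\<close> duality is not available. Instead the problem is moved to \<open>L\<^sup>1\<close> with the weight
 \<open>w = H\<^bsup>-(1-P)/U\<^esup>\<close>, where \<open>H\<close> is a Rubio de Francia majorant of \<open>(\<Sum> A\<^sub>i)\<^sup>U\<close>; the oscillation of
 \<open>w\<close> on cells is controlled by the maximal inequality for \<open>H\<close>.
\<close>

lemma dominated_weight:
 fixes A B H :: "real ^ 'n => ennreal"
 assumes UP: "0 < U" "U < P" "P < 1" "1 <= V" and C: "1 <= C"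
  and [measurable]: "H \<in> bor" "A \<in> bor" "B \<in> bor"
  and dom: "dominated V U R B A"
  and H: "\<And>x. maxi H x <= ennreal C * H x"
  and AH: "AE x in lborel. H x < top \<and> (H x = 0 --> A x = 0)"
 defines "w \<equiv> \<lambda>x. epowr (inverse (H x)) ((1 - P) / U)"
 shows "avg R (cell R x) (\<lambda>y. B y * w y) <= ennreal (C powr ((1 - P) / U) * 3 powr (real CARD('n) * (1 - U) / U)) * avg R (cell3 R x) (\<lambda>y. A y * w y)"
proof -
 define a where "a = (1 - P) / U"
 \<comment> \<open>With this \<open>e\<close> the power \<open>H^(e (1 - U)) = H^(1 - P)\<close> is
   inverse to \<open>w^U\<close>; and \<open>e <= 1\<close> because \<open>U < P\<close>, so
   Jensen's inequality applies to \<open>H^e\<close>.\<close>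
 define e where "e = (1 - P) / (1 - U)"
 have a: "0 < a" using UP by (simp add: a_def)
 have e: "0 < e" "e <= 1" "e * (1 - U) = 1 - P" using UP by (auto simp: e_def field_simps)
 have [measurable]: "w \<in> bor" unfolding w_def by measurable
 define \<eta> where "\<eta> = avg R (cell3 R x) H"
 \<comment> \<open>\<open>H\<close> is nowhere much smaller than its mean \<open>\<eta>\<close> over
   the neighbouring cells (an \<open>A_1\<close> condition), so its negative power \<open>w\<close>
   is bounded on the cell by the same power of \<open>\<eta>\<close>.\<close>
 have wy: "w y <= epowr (ennreal C * inverse \<eta>) a" if y: "y \<in> cell R x" for y
 proof -
  have "\<eta> <= ennreal C * H y"
   unfolding \<eta>_def using y cell_subset_cell3 by (intro order_trans[OF avg_le_maxi H]) auto
  then have "inverse (ennreal C * H y) <= inverse \<eta>" by (simp add: ennreal_inverse_anti_mono)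
  then have "ennreal C * (inverse (ennreal C) * inverse (H y)) <= ennreal C * inverse \<eta>"
   using C by (intro mult_left_mono) (auto simp: ennreal_inverse_mult')
  moreover have "ennreal C * (inverse (ennreal C) * inverse (H y)) = inverse (H y)"
   using C by (simp add: mult.assoc[symmetric] inverse_ennreal ennreal_mult'' [symmetric])
  ultimately have "inverse (H y) <= ennreal C * inverse \<eta>" by simp
  then show ?thesis unfolding w_def a_def[symmetric] using a by (intro epowr_mono) auto
 qed
 have "avg R (cell R x) (\<lambda>y. B y * w y) <= avg R (cell R x) (\<lambda>y. epowr (ennreal C * inverse \<eta>) a * B y)"
 by (rule avg_mono) (metis wy mult.commute mult_right_mono zero_le)
 also have "... = epowr (ennreal C * inverse \<eta>) a * avg R (cell R x) B"
 by (rule avg_cmult) measurable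
 also have "... <= epowr (ennreal C * inverse \<eta>) a * pavg R U (cell3 R x) A"
  using dom UP by (intro mult_left_mono order_trans[OF avg_le_pavg_cell[of _ V]]) (auto simp: dominated_def)
 \<comment> \<open>\<open>A^U\<close> is at most \<open>(A w)^U\<close> times \<open>H^(1-P)\<close>
   almost everywhere, and Hoelder with exponents \<open>1/U\<close> and \<open>1/(1-U)\<close>
   brings in the mean of \<open>A w\<close>. The positive power of \<open>\<eta>\<close> produced
   here cancels the negative one from \<open>wy\<close>.\<close>
 also have "pavg R U (cell3 R x) A <= ennreal (3 powr (real CARD('n) * (1 - U) / U)) * avg R (cell3 R x) (\<lambda>y. A y * w y) * epowr \<eta> a"
 proof -
  have "avg R (cell3 R x) (\<lambda>y. epowr (A y) U) <= avg R (cell3 R x) (\<lambda>y. epowr (A y * w y) U * epowr (epowr (H y) e) (1 - U))"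
  proof (rule avg_mono_AE)
   show "AE y in lborel. y \<in> cell3 R x --> epowr (A y) U <= epowr (A y * w y) U * epowr (epowr (H y) e) (1 - U)"
    using AH
   proof eventually_elim
    case (elim y)
    have "epowr (w y) U * epowr (epowr (H y) e) (1 - U) = 1" if "H y \<noteq> 0"
    proof -
     have "epowr (w y) U * epowr (epowr (H y) e) (1 - U) = epowr (inverse (H y) * H y) (1 - P)"
      using UP e by (simp add: w_def epowr_epowr epowr_mult)
     also have "inverse (H y) * H y = 1" using elim that by (simp add: mult.commute divide_ennreal_def[symmetric] ennreal_divide_self)
     finally show ?thesis by simp
    qed
    then show ?case using elim by (cases "H y = 0") (auto simp: epowr_mult mult.assoc)
   qed
  qed
  also have "... <= epowr (avg R (cell3 R x) (\<lambda>y. A y * w y)) U * epowr (avg R (cell3 R x) (\<lambda>y. epowr (H y) e)) (1 - U)"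
   using UP by (intro avg_Holder) auto
  also have "... <= epowr (avg R (cell3 R x) (\<lambda>y. A y * w y)) U * epowr (3 ^ CARD('n) * epowr \<eta> e) (1 - U)"
   unfolding \<eta>_def using e UP by (intro mult_left_mono epowr_mono avg_Jensen_cell3) auto
  finally have "pavg R U (cell3 R x) A <= epowr (epowr (avg R (cell3 R x) (\<lambda>y. A y * w y)) U * epowr (3 ^ CARD('n) * epowr \<eta> e) (1 - U)) (1 / U)"
   unfolding pavg_def using UP by (intro epowr_mono) auto
  also have "... = avg R (cell3 R x) (\<lambda>y. A y * w y) * (ennreal (3 powr (real CARD('n) * (1 - U) / U)) * epowr \<eta> a)"
   using UP e by (simp add: epowr_mult epowr_epowr epowr_three_power epowr_ennreal powr_powr a_def mult.assoc)
  finally show ?thesis by (simp add: mult_ac)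
 qed
 also have "epowr (ennreal C * inverse \<eta>) a * (ennreal (3 powr (real CARD('n) * (1 - U) / U)) * avg R (cell3 R x) (\<lambda>y. A y * w y) * epowr \<eta> a)
  = (ennreal (C powr a) * ennreal (3 powr (real CARD('n) * (1 - U) / U)) * avg R (cell3 R x) (\<lambda>y. A y * w y)) * epowr (inverse \<eta> * \<eta>) a"
  using C by (simp add: epowr_mult epowr_ennreal mult_ac)
 also have "... <= (ennreal (C powr a) * ennreal (3 powr (real CARD('n) * (1 - U) / U)) * avg R (cell3 R x) (\<lambda>y. A y * w y)) * 1"
 proof (intro mult_left_mono)
  have "inverse \<eta> * \<eta> <= 1"
  by (cases "\<eta> = 0 \<or> \<eta> = top") (auto simp: mult.commute divide_ennreal_def[symmetric] ennreal_divide_self less_top)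
  then have "epowr (inverse \<eta> * \<eta>) a <= epowr 1 a" using a by (intro epowr_mono) auto
  then show "epowr (inverse \<eta> * \<eta>) a <= 1" by simp
 qed simp
 finally show ?thesis by (simp add: a_def ennreal_mult'' mult_left_mono)
qed

text \<open>With \<open>h\<close> the sum of the \<open>A i\<close> and \<open>H\<close> a majorant
  of \<open>h^U\<close>, the weight satisfies \<open>h w <= H^(P/U)\<close>; so the weighted
  \<open>L^1\<close> norm is controlled by the integral of \<open>H^(P/U)\<close>, that is, by that
  of \<open>h^P\<close>. Hoelder for \<open>F^P = (F w)^P (H^(P/U))^(1-P)\<close> removes the weight
  from the left side.\<close>

lemma vector_valued_lt:
 assumes UP: "0 < U" "U < P" "P < 1" "1 <= V"
 shows "\<exists>K::real. 0 <= K \<and> (\<forall>(I :: 'i set) R A (B :: 'i => real ^ 'n => ennreal). countable I -->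
   (\<forall>i\<in>I. A i \<in> bor \<and> B i \<in> bor \<and> dominated V U (R i) (B i) (A i)) -->
   (\<integral>x. epowr (\<Sum>\<^sup>+i\<in>I. B i x) P) <= ennreal K * (\<integral>x. epowr (\<Sum>\<^sup>+i\<in>I. A i x) P))"
proof -
 define s where "s = P / U"
 have s: "1 < s" using UP by (simp add: s_def)
 obtain C where C: "1 <= C" and RdF: "\<And>g :: real ^ 'n => ennreal. g \<in> bor ==>
   (\<exists>H. H \<in> bor \<and> (\<forall>x. g x <= H x) \<and> (\<forall>x. maxi H x <= ennreal C * H x) \<and>
    (\<integral>x. epowr (H x) s) <= ennreal C * (\<integral>x. epowr (g x) s))"
  using Rubio_de_Francia[OF s, where 'n='n] by auto
 define k where "k = C powr ((1 - P) / U) * 3 powr (real CARD('n) * (1 - U) / U) * 3 ^ CARD('n)"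
 have k: "0 < k" using C by (simp add: k_def)
 show ?thesis
 proof (intro exI[of _ "k powr P * C"] conjI allI impI)
  show "0 <= k powr P * C" using C by simp
  fix I :: "'i set" and R and A B :: "'i => real ^ 'n => ennreal"
  assume I: "countable I" and D: "\<forall>i\<in>I. A i \<in> bor \<and> B i \<in> bor \<and> dominated V U (R i) (B i) (A i)"
  define F where "F x = (\<Sum>\<^sup>+i\<in>I. B i x)" for x
  define h where "h x = (\<Sum>\<^sup>+i\<in>I. A i x)" for x
  have mA: "A i \<in> bor" "B i \<in> bor" if "i \<in> I" for i using D that by auto
  have [measurable]: "F \<in> bor" "h \<in> bor"
   unfolding F_def[abs_def] h_def[abs_def] using I mA by (auto intro!: borel_measurable_nn_integral_count_space)
  define Y where "Y = (\<integral>x. epowr (h x) P)"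
  have "(\<integral>x. epowr (F x) P) <= ennreal (k powr P * C) * Y"
  proof (cases "Y = top")
   case True
   then show ?thesis using k C by (simp add: ennreal_mult_top)
  next
   case False
   obtain H where [measurable]: "H \<in> bor" and gH: "\<And>x. epowr (h x) U <= H x"
    and MH: "\<And>x. maxi H x <= ennreal C * H x"
    and HC: "(\<integral>x. epowr (H x) s) <= ennreal C * (\<integral>x. epowr (epowr (h x) U) s)"
    using RdF[of "\<lambda>x. epowr (h x) U"] by auto
   define S where "S = (\<integral>x. epowr (H x) s)"
   have SY: "S <= ennreal C * Y"
    using HC UP by (simp add: S_def Y_def epowr_epowr s_def)
   have Sfin: "S < top" using SY False by (metis ennreal_mult_less_top ennreal_less_top le_less_trans less_top)
   have Hfin: "AE x in lborel. H x < top"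
   proof -
    have "AE x in lborel. epowr (H x) s \<noteq> \<infinity>"
     using Sfin unfolding S_def by (intro nn_integral_PInf_AE) auto
    then show ?thesis by eventually_elim (simp add: less_top)
   qed
   define w where "w x = epowr (inverse (H x)) ((1 - P) / U)" for x
   have [measurable]: "w \<in> bor" unfolding w_def[abs_def] by measurable
   have hH: "h x <= epowr (H x) (1 / U)" for x
    using gH[of x] UP by (simp add: epowr_le_iff)
   have "(\<integral>x. F x * w x) = (\<integral>x. (\<Sum>\<^sup>+i\<in>I. B i x * w x))"
    unfolding F_def by (simp add: nn_integral_multc)
   also have "... = (\<Sum>\<^sup>+i\<in>I. (\<integral>x. B i x * w x))"
    using I mA by (intro nn_integral_count_space_nn_integral) auto
   also have "... <= (\<Sum>\<^sup>+i\<in>I. ennreal k * (\<integral>x. A i x * w x))"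
   proof (rule nn_integral_mono)
    fix i assume "i \<in> space (count_space I)"
    then have i: "i \<in> I" by simp
    note [measurable] = mA[OF i]
    have Ah: "A i x <= h x" for x
     unfolding h_def using nn_integral_ge_point[OF i, of "\<lambda>i. A i x"] .
    have AE: "AE x in lborel. H x < top \<and> (H x = 0 --> A i x = 0)"
     using Hfin
    proof eventually_elim
     case (elim x)
     then show ?case using Ah[of x] hH[of x] by auto
    qed
    have "(\<integral>x. B i x * w x) = (\<integral>x. avg (R i) (cell (R i) x) (\<lambda>y. B i y * w y))"
    by (simp add: nn_integral_avg_cell)
    also have "... <= (\<integral>x. ennreal (C powr ((1 - P) / U) * 3 powr (real CARD('n) * (1 - U) / U)) * avg (R i) (cell3 (R i) x) (\<lambda>y. A i y * w y))"
     unfolding w_def using D i by (intro nn_integral_mono dominated_weight[OF UP C _ _ _ _ MH AE]) auto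
    also have "... = ennreal k * (\<integral>x. A i x * w x)"
    by (simp add: nn_integral_cmult nn_integral_avg_cell3 k_def ennreal_mult'' ennreal_three_power mult.assoc)
    finally show "(\<integral>x. B i x * w x) <= ennreal k * (\<integral>x. A i x * w x)" .
   qed
   also have "... = ennreal k * (\<Sum>\<^sup>+i\<in>I. (\<integral>x. A i x * w x))"
   by (rule nn_integral_cmult) simp
   also have "(\<Sum>\<^sup>+i\<in>I. (\<integral>x. A i x * w x)) = (\<integral>x. (\<Sum>\<^sup>+i\<in>I. A i x * w x))"
    using I mA by (intro nn_integral_count_space_nn_integral[symmetric]) auto
   also have "... = (\<integral>x. h x * w x)"
    unfolding h_def by (simp add: nn_integral_multc)
   also have "... <= S"
    unfolding S_def
   proof (rule nn_integral_mono)
    fix x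
    have "h x * w x <= epowr (H x) (1 / U) * w x" using hH by (intro mult_right_mono) auto
    also have "... <= epowr (H x) s"
    proof (cases "H x = 0 \<or> H x = top")
     case False
     have "1 / U = s + (1 - P) / U" using UP by (simp add: s_def field_simps)
     then have "epowr (H x) (1 / U) * w x = epowr (H x) s * epowr (H x * inverse (H x)) ((1 - P) / U)"
     by (simp only: epowr_add w_def epowr_mult mult.assoc)
     also have "H x * inverse (H x) = 1"
      using False by (simp add: divide_ennreal_def[symmetric] ennreal_divide_self less_top)
     finally show ?thesis by simp
    qed (auto simp: w_def)
    finally show "h x * w x <= epowr (H x) s" .
   qed
   finally have Z: "(\<integral>x. F x * w x) <= ennreal k * S" by (simp add: mult_left_mono)
   \<comment> \<open>Where \<open>H = 0\<close> the weight is \<open>top\<close>; finiteness of the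
     weighted integral forces \<open>F = 0\<close> there, which settles these points below.\<close>
   have AE: "AE x in lborel. F x * w x < top"
   proof -
    have "(\<integral>x. F x * w x) < top"
     using Z Sfin by (metis ennreal_mult_less_top ennreal_less_top le_less_trans)
    then have "AE x in lborel. F x * w x \<noteq> \<infinity>"
    by (intro nn_integral_PInf_AE) auto
    then show ?thesis by eventually_elim (simp add: less_top)
   qed
   have "(\<integral>x. epowr (F x) P) <= (\<integral>x. epowr (F x * w x) P * epowr (epowr (H x) s) (1 - P))"
   proof (rule nn_integral_mono_AE)
    show "AE x in lborel. epowr (F x) P <= epowr (F x * w x) P * epowr (epowr (H x) s) (1 - P)"
     using AE Hfin
    proof eventually_elim
     case (elim x)
     show ?case
     proof (cases "H x = 0")
      case True
      then have "F x = 0" using elim by (auto simp: w_def ennreal_mult_top split: if_splits)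
      then show ?thesis by simp
     next
      case False
      have "epowr (F x * w x) P * epowr (epowr (H x) s) (1 - P) = epowr (F x) P * epowr (inverse (H x) * H x) ((1 - P) * P / U)"
      by (simp add: epowr_mult epowr_epowr w_def s_def mult_ac)
      also have "inverse (H x) * H x = 1"
       using False elim by (simp add: mult.commute divide_ennreal_def[symmetric] ennreal_divide_self)
      finally show ?thesis by simp
     qed
    qed
   qed
   also have "... <= epowr (\<integral>x. F x * w x) P * epowr S (1 - P)"
    unfolding S_def using UP by (intro nn_integral_Holder) auto
   also have "... <= epowr (ennreal k * S) P * epowr S (1 - P)"
    using Z UP by (intro mult_right_mono epowr_mono) auto
   also have "... = ennreal (k powr P) * (epowr S P * epowr S (1 - P))"
    using k by (simp add: epowr_mult epowr_ennreal mult.assoc)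
   also have "epowr S P * epowr S (1 - P) = S" using epowr_add[of S P "1 - P"] by simp
   also have "ennreal (k powr P) * S <= ennreal (k powr P) * (ennreal C * Y)"
    using SY by (intro mult_left_mono) auto
   finally show ?thesis using C by (simp add: ennreal_mult'' mult.assoc)
  qed
  then show "(\<integral>x. epowr (\<Sum>\<^sup>+i\<in>I. B i x) P) <= ennreal (k powr P * C) * (\<integral>x. epowr (\<Sum>\<^sup>+i\<in>I. A i x) P)"
  by (simp add: F_def h_def Y_def)
 qed
qed

lemma vector_valued:
 assumes "0 < U" "U < 1" "1 < V" "U < P" "P < V"
 shows "\<exists>K::real. 0 <= K \<and> (\<forall>(I :: 'i set) R A (B :: 'i => real ^ 'n => ennreal). countable I -->
   (\<forall>i\<in>I. A i \<in> bor \<and> B i \<in> bor \<and> dominated V U (R i) (B i) (A i)) -->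
   (\<integral>x. epowr (\<Sum>\<^sup>+i\<in>I. B i x) P) <= ennreal K * (\<integral>x. epowr (\<Sum>\<^sup>+i\<in>I. A i x) P))"
proof -
 consider "P < 1" | "P = 1" | "1 < P" by linarith
 then show ?thesis
 proof cases
  case 1
  show ?thesis by (rule vector_valued_lt) (use assms 1 in auto)
 next
  case 2
  show ?thesis
  proof (intro exI[of _ "3 powr (CARD('n) * (1 / U + 1))"] conjI allI impI)
   fix I :: "'i set" and R and A B :: "'i => real ^ 'n => ennreal"
   assume I: "countable I" and H: "\<forall>i\<in>I. A i \<in> bor \<and> B i \<in> bor \<and> dominated V U (R i) (B i) (A i)"
   have "(\<integral>x. (\<Sum>\<^sup>+i\<in>I. B i x))
     <= epowr (3 ^ CARD('n)) (1 / U + 1) * (\<integral>x. (\<Sum>\<^sup>+i\<in>I. A i x))"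
    using assms by (intro vector_valued_eq[OF _ _ _ I H]) auto
   then show "(\<integral>x. epowr (\<Sum>\<^sup>+i\<in>I. B i x) P) <= ennreal (3 powr (CARD('n) * (1 / U + 1))) * (\<integral>x. epowr (\<Sum>\<^sup>+i\<in>I. A i x) P)"
   by (simp add: 2 epowr_three_power)
  qed simp
 next
  case 3
  show ?thesis by (rule vector_valued_gt) (use assms 3 in auto)
 qed
qed

lemma pavg_le_maxi:
 assumes "0 < U" "\<And>y. a y <= h y"
 shows "pavg R U (cell3 R x) a <= epowr (maxi (\<lambda>y. epowr (h y) U) x) (1 / U)"
 unfolding pavg_def using assms
 by (intro epowr_mono order_trans[OF avg_mono[of _ _ "\<lambda>y. epowr (h y) U"] avg_le_maxi]) auto

text \<open>The maximal theorem in \<open>L^(P/U)\<close>. It serves the norms with a supremum over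
  scales, where pointwise bounds by a maximal function replace domination in mean.\<close>

lemma maxi_exponent:
 assumes "0 < U" "U < P"
 shows "\<exists>K::real. 0 <= K \<and> (\<forall>h :: real ^ 'n => ennreal. h \<in> bor -->
   (\<integral>x. epowr (epowr (maxi (\<lambda>y. epowr (h y) U) x) (1 / U)) P) <= ennreal K * (\<integral>x. epowr (h x) P))"
proof -
 have s: "1 < P / U" using assms by simp
 obtain C where C: "1 <= C" and M: "\<And>h :: real ^ 'n => ennreal. h \<in> bor ==>
   (\<integral>x. epowr (maxi h x) (P / U)) <= ennreal C * (\<integral>x. epowr (h x) (P / U))"
  using maxi_strong[OF s, where 'n='n] by auto
 have "(\<integral>x. epowr (epowr (maxi (\<lambda>y. epowr (h y) U) x) (1 / U)) P) <= ennreal C * (\<integral>x. epowr (h x) P)"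
  if [measurable]: "h \<in> bor" for h :: "real ^ 'n => ennreal"
  using M[of "\<lambda>y. epowr (h y) U"] assms by (simp add: epowr_epowr)
 then show ?thesis using C by (intro exI[of _ C]) auto
qed

section \<open>Discrete tent space norms\<close>

text \<open>The four cases mirror those of the tent norm, with octaves for times and the scales up
  to \<open>j\<close> over \<open>cell3 j x\<close> for Carleson boxes. The power of
  \<open>t\<close> and the length of the octave are not included; they enter through
  \<open>g\<close>, by the factor \<open>weight\<close>.\<close>

definition dnorm :: "ennreal => ennreal => (int => real ^ 'n => ennreal) => ennreal" where
 "dnorm p q g =
   (if p < \<infinity> \<and> q < \<infinity> then
    epowr (\<integral>x. epowr (\<Sum>\<^sup>+k. epowr (g k x) (enn2real q)) (enn2real p / enn2real q)) (1 / enn2real p)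
   else if p < \<infinity> then epowr (\<integral>x. epowr (SUP k. g k x) (enn2real p)) (1 / enn2real p)
   else if q < \<infinity> then
    (SUP (j, x). epowr (avg j (cell3 j x) (\<lambda>y. (\<Sum>\<^sup>+k\<in>{..j}. epowr (g k y) (enn2real q)))) (1 / enn2real q))
   else esssup lborel (\<lambda>x. SUP k. g k x))"

text \<open>For finite \<open>p\<close> and \<open>q\<close> a piece is estimated in
  \<open>V\<close>-mean, as the vector-valued inequality requires; in the other cases suprema or
  Carleson averages occur and the bound is pointwise.\<close>

definition piece_bound ::
 "ennreal => ennreal => real => real => int => real => (real ^ 'n => ennreal) => (real ^ 'n => ennreal) => bool" where
 "piece_bound p q V U R e b a \<longleftrightarrow>
   (\<forall>x. (if p < \<infinity> \<and> q < \<infinity> then pavg R V (cell R x) b else b x) <= ennreal e * pavg R U (cell3 R x) a)"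

text \<open>The right side is constant on \<open>cell R x\<close>, as \<open>cell3\<close> depends
  only on the cell; hence the pointwise bound passes to the mean.\<close>

lemma piece_bound_pointwise:
 assumes V: "0 < V" and le: "\<And>x. b x <= ennreal e * pavg R U (cell3 R x) a"
 shows "piece_bound p q V U R e b a"
proof -
 have "pavg R V (cell R x) b <= ennreal e * pavg R U (cell3 R x) a" for x
 proof -
  have "pavg R V (cell R x) b <= pavg R V (cell R x) (\<lambda>_. ennreal e * pavg R U (cell3 R x) a)"
   using V by (rule pavg_mono) (metis le cell3_eq)
  also have "... = ennreal e * pavg R U (cell3 R x) a"
   using V by (simp add: pavg_def avg_one_cell epowr_epowr)
  finally show ?thesis .
 qed
 with le show ?thesis by (simp add: piece_bound_def)
qed

lemma nn_integral_count_space_times: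
 assumes "countable A" "countable B"
 shows "(\<Sum>\<^sup>+z\<in>(A \<times> B). f (fst z) (snd z)) = (\<Sum>\<^sup>+a\<in>A. (\<Sum>\<^sup>+b\<in>B. f a b))"
proof -
 interpret sigma_finite_measure "count_space B" using assms by (rule_tac sigma_finite_measure_count_space_countable)
 have "(\<Sum>\<^sup>+a\<in>A. (\<Sum>\<^sup>+b\<in>B. f a b)) = (\<integral>\<^sup>+ z. f (fst z) (snd z) \<partial>(count_space A \<Otimes>\<^sub>M count_space B))"
  using nn_integral_fst[of "\<lambda>z. f (fst z) (snd z)" "count_space A"] assms by (simp add: pair_measure_countable)
 then show ?thesis using assms by (simp add: pair_measure_countable)
qed

lemma nn_integral_count_space_swap:
 assumes "countable A"
 shows "(\<Sum>\<^sup>+b\<in>B. (\<Sum>\<^sup>+a\<in>A. f a b)) = (\<Sum>\<^sup>+a\<in>A. (\<Sum>\<^sup>+b\<in>B. f a b))"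
 using assms by (intro nn_integral_count_space_nn_integral) auto

lemma nn_integral_int_shift: "(\<Sum>\<^sup>+l. f (l - d)) = (\<Sum>\<^sup>+k\<in>(UNIV :: int set). f k)"
 by (rule nn_integral_bij_count_space) (rule bij_betwI[of _ _ _ "\<lambda>k. k + d"], auto)

text \<open>A sum is controlled by a weighted supremum, hence by a sum of powers, whatever the exponent.\<close>

lemma epowr_sum_le_weighted:
 assumes q: "0 < q" and e: "\<forall>j\<in>J. 0 < e j"
 shows "epowr (\<Sum>\<^sup>+j\<in>J. y j) q
  <= epowr (\<Sum>\<^sup>+j\<in>J. ennreal (e j powr (1/2))) q * (\<Sum>\<^sup>+j\<in>J. epowr (ennreal (e j powr (- 1/2)) * y j) q)"
proof -
 define S where "S = (SUP j\<in>J. ennreal (e j powr (- 1/2)) * y j)"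
 have "(\<Sum>\<^sup>+j\<in>J. y j) <= (\<Sum>\<^sup>+j\<in>J. ennreal (e j powr (1/2)) * S)"
 proof (rule nn_integral_mono)
  fix j assume "j \<in> space (count_space J)"
  then have j: "j \<in> J" by simp
  have "y j = ennreal (e j powr (1/2)) * (ennreal (e j powr (- 1/2)) * y j)"
   using bspec[OF e j] by (simp add: mult.assoc[symmetric] ennreal_mult'' [symmetric] powr_add[symmetric])
  also have "... <= ennreal (e j powr (1/2)) * S"
   unfolding S_def using j by (intro mult_left_mono SUP_upper) auto
  finally show "y j <= ennreal (e j powr (1/2)) * S" .
 qed
 also have "... = (\<Sum>\<^sup>+j\<in>J. ennreal (e j powr (1/2))) * S"
 by (rule nn_integral_multc) simp
 finally have "epowr (\<Sum>\<^sup>+j\<in>J. y j) q <= epowr (\<Sum>\<^sup>+j\<in>J. ennreal (e j powr (1/2))) q * epowr S q"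
  using q epowr_mono[of _ "_ * _" q] by (simp add: epowr_mult)
 also have "epowr S q <= (\<Sum>\<^sup>+j\<in>J. epowr (ennreal (e j powr (- 1/2)) * y j) q)"
  unfolding S_def epowr_SUP[OF q]
 by (rule SUP_least) (rule nn_integral_ge_point[of _ _ "\<lambda>j. epowr (ennreal (e j powr (- 1/2)) * y j) q"])
 finally show ?thesis by (simp add: mult_left_mono)
qed

lemma pavg_epowr:
 assumes "0 < q"
 shows "pavg R (v / q) S (\<lambda>y. epowr (f y) q) = epowr (pavg R v S f) q"
 unfolding pavg_def using assms by (simp add: epowr_epowr)

text \<open>The vector-valued inequality is applied to \<open>q\<close>-th powers, with all
  exponents divided by \<open>q\<close> and with pairs of scale and piece as indices. The square
  root of each coefficient \<open>e j\<close> makes the sum over the pieces converge inside the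
  \<open>q\<close>-th power (\<open>E\<close>); the other square root stays on the source side and
  is summed there (\<open>G\<close>).\<close>

lemma dnorm_pieces_finite:
 fixes J :: "'j set"
 assumes p: "0 < p" and q: "0 < q" and U: "0 < U" "U < p" "U < q" and V: "p < V" "q < V"
  and J: "countable J" and e': "\<forall>j\<in>J. 0 < e j"
  and fin': "\<forall>\<eta>>0. (\<Sum>\<^sup>+j\<in>J. ennreal (e j powr \<eta>)) < top"
 shows "\<exists>K::real. 0 <= K \<and> (\<forall>a b (bb :: int => 'j => real ^ 'n => ennreal).
   (\<forall>k. a k \<in> bor) --> (\<forall>l. \<forall>j\<in>J. bb l j \<in> bor) -->
   (\<forall>l x. b l x <= (\<Sum>\<^sup>+j\<in>J. bb l j x)) -->
   (\<forall>l. \<forall>j\<in>J. \<forall>x. pavg (R l j) V (cell (R l j) x) (bb l j) <= ennreal (e j) * pavg (R l j) U (cell3 (R l j) x) (a (l - \<delta> j))) -->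
   (\<integral>x. epowr (\<Sum>\<^sup>+k. epowr (b k x) q) (p / q))
    <= ennreal K * (\<integral>x. epowr (\<Sum>\<^sup>+k. epowr (a k x) q) (p / q)))"
proof -
 have e: "\<And>j. j \<in> J ==> 0 < e j" using e' by auto
 have fin: "\<And>\<eta>. 0 < \<eta> ==> (\<Sum>\<^sup>+j\<in>J. ennreal (e j powr \<eta>)) < top" using fin' by auto
 obtain K0 where K0: "0 <= K0" and vv: "\<And>(I :: (int \<times> 'j) set) R A (B :: int \<times> 'j => real ^ 'n => ennreal). countable I ==>
   (\<forall>i\<in>I. A i \<in> bor \<and> B i \<in> bor \<and> dominated (V / q) (U / q) (R i) (B i) (A i)) ==>
   (\<integral>x. epowr (\<Sum>\<^sup>+i\<in>I. B i x) (p / q)) <= ennreal K0 * (\<integral>x. epowr (\<Sum>\<^sup>+i\<in>I. A i x) (p / q))"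
 proof -
  have "0 < U / q" "U / q < 1" "1 < V / q" "U / q < p / q" "p / q < V / q"
   using p q U V by (auto simp: divide_strict_right_mono)
  from vector_valued[OF this, where 'n='n and 'i="int \<times> 'j"] show ?thesis
  by (elim exE conjE) (rule that, assumption, blast)
 qed
 define E where "E = enn2real (\<Sum>\<^sup>+j\<in>J. ennreal (e j powr (1/2)))"
 have E: "(\<Sum>\<^sup>+j\<in>J. ennreal (e j powr (1/2))) = ennreal E" "0 <= E"
  using fin[of "1/2"] by (simp_all add: E_def)
 define G where "G = enn2real (\<Sum>\<^sup>+j\<in>J. ennreal (e j powr (q / 2)))"
 have G: "(\<Sum>\<^sup>+j\<in>J. ennreal (e j powr (q / 2))) = ennreal G" "0 <= G"
  using fin[of "q/2"] q by (simp_all add: G_def)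
 show ?thesis
 proof (intro exI[of _ "E powr p * K0 * G powr (p / q)"] conjI allI impI)
  show "0 <= E powr p * K0 * G powr (p / q)" using K0 by simp
  fix a b and bb :: "int => 'j => real ^ 'n => ennreal"
  assume ma: "\<forall>k. a k \<in> bor" and mb: "\<forall>l. \<forall>j\<in>J. bb l j \<in> bor"
   and bsum: "\<forall>l x. b l x <= (\<Sum>\<^sup>+j\<in>J. bb l j x)"
   and H: "\<forall>l. \<forall>j\<in>J. \<forall>x. pavg (R l j) V (cell (R l j) x) (bb l j) <= ennreal (e j) * pavg (R l j) U (cell3 (R l j) x) (a (l - \<delta> j))"
  have IJ: "countable ((UNIV :: int set) \<times> J)" using J by (intro countable_SIGMA) auto
  define B where "B \<iota> x = epowr (ennreal (e (snd \<iota>) powr (- 1/2)) * bb (fst \<iota>) (snd \<iota>) x) q" for \<iota> x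
  define A where "A \<iota> x = epowr (ennreal (e (snd \<iota>) powr (1/2)) * a (fst \<iota> - \<delta> (snd \<iota>)) x) q" for \<iota> x
  define h where "h x = (\<Sum>\<^sup>+k. epowr (a k x) q)" for x
  have [measurable]: "h \<in> bor"
   unfolding h_def[abs_def] using ma by (intro borel_measurable_nn_integral_count_space borel_measurable_epowr) auto
  have le1: "(\<Sum>\<^sup>+k. epowr (b k x) q) <= epowr (ennreal E) q * (\<Sum>\<^sup>+\<iota>\<in>(UNIV \<times> J). B \<iota> x)" for x
  proof -
   have "(\<Sum>\<^sup>+k. epowr (b k x) q) <= (\<Sum>\<^sup>+k. epowr (ennreal E) q * (\<Sum>\<^sup>+j\<in>J. B (k, j) x))"
   proof (rule nn_integral_mono)
    fix k
    have "epowr (b k x) q <= epowr (\<Sum>\<^sup>+j\<in>J. bb k j x) q"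
     using bsum q by (intro epowr_mono) auto
    also have "... <= epowr (ennreal E) q * (\<Sum>\<^sup>+j\<in>J. B (k, j) x)"
     using epowr_sum_le_weighted[OF q e', where y="\<lambda>j. bb k j x"] E by (simp add: B_def)
    finally show "epowr (b k x) q <= epowr (ennreal E) q * (\<Sum>\<^sup>+j\<in>J. B (k, j) x)" .
   qed
   also have "... = epowr (ennreal E) q * (\<Sum>\<^sup>+k. (\<Sum>\<^sup>+j\<in>J. B (k, j) x))"
   by (rule nn_integral_cmult) simp
   also have "(\<Sum>\<^sup>+k. (\<Sum>\<^sup>+j\<in>J. B (k, j) x)) = (\<Sum>\<^sup>+\<iota>\<in>(UNIV \<times> J). B \<iota> x)"
    using nn_integral_count_space_times[of UNIV J "\<lambda>k j. B (k, j) x"] J by simp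
   finally show ?thesis .
  qed
  have le2: "(\<Sum>\<^sup>+\<iota>\<in>(UNIV \<times> J). A \<iota> x) = ennreal G * h x" for x
  proof -
   have "(\<Sum>\<^sup>+\<iota>\<in>(UNIV \<times> J). A \<iota> x) = (\<Sum>\<^sup>+l. (\<Sum>\<^sup>+j\<in>J. A (l, j) x))"
    using nn_integral_count_space_times[of UNIV J "\<lambda>k j. A (k, j) x"] J by simp
   also have "... = (\<Sum>\<^sup>+j\<in>J. (\<Sum>\<^sup>+l. A (l, j) x))"
   by (rule nn_integral_count_space_swap[symmetric]) simp
   also have "... = (\<Sum>\<^sup>+j\<in>J. ennreal (e j powr (q / 2)) * h x)"
   proof (rule nn_integral_cong)
    fix j assume "j \<in> space (count_space J)"
    have "(\<Sum>\<^sup>+l. A (l, j) x) = (\<Sum>\<^sup>+l. ennreal (e j powr (q / 2)) * epowr (a (l - \<delta> j) x) q)"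
    by (simp add: A_def epowr_mult epowr_ennreal powr_powr)
    also have "... = ennreal (e j powr (q / 2)) * (\<Sum>\<^sup>+l. epowr (a (l - \<delta> j) x) q)"
    by (rule nn_integral_cmult) simp
    finally show "(\<Sum>\<^sup>+l. A (l, j) x) = ennreal (e j powr (q / 2)) * h x"
     using nn_integral_int_shift[of "\<lambda>k. epowr (a k x) q" "\<delta> j"] by (simp add: h_def)
   qed
   also have "... = ennreal G * h x" by (simp add: nn_integral_multc G)
   finally show ?thesis .
  qed
  have "(\<integral>x. epowr (\<Sum>\<^sup>+k. epowr (b k x) q) (p / q))
    <= (\<integral>x. epowr (epowr (ennreal E) q * (\<Sum>\<^sup>+\<iota>\<in>(UNIV \<times> J). B \<iota> x)) (p / q))"
   using p q le1 by (intro nn_integral_mono epowr_mono) auto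
  also have "... = ennreal (E powr p) * (\<integral>x. epowr (\<Sum>\<^sup>+\<iota>\<in>(UNIV \<times> J). B \<iota> x) (p / q))"
  proof -
   have m: "(\<lambda>x. (\<Sum>\<^sup>+\<iota>\<in>(UNIV \<times> J). B \<iota> x)) \<in> bor"
   proof (rule borel_measurable_nn_integral_count_space[OF IJ])
    fix i :: "int \<times> 'j" assume "i \<in> UNIV \<times> J"
    then have [measurable]: "bb (fst i) (snd i) \<in> bor" using mb by auto
    show "B i \<in> bor" unfolding B_def[abs_def] by measurable
   qed
   show ?thesis using q E m by (simp add: epowr_mult epowr_epowr epowr_ennreal nn_integral_cmult powr_powr)
  qed
  also have "(\<integral>x. epowr (\<Sum>\<^sup>+\<iota>\<in>(UNIV \<times> J). B \<iota> x) (p / q))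
   <= ennreal K0 * (\<integral>x. epowr (\<Sum>\<^sup>+\<iota>\<in>(UNIV \<times> J). A \<iota> x) (p / q))"
  proof (rule vv[where R="\<lambda>\<iota>. R (fst \<iota>) (snd \<iota>)", OF IJ])
   show "\<forall>i\<in>UNIV \<times> J. A i \<in> bor \<and> B i \<in> bor \<and> dominated (V / q) (U / q) (R (fst i) (snd i)) (B i) (A i)"
   proof (intro ballI conjI)
    fix i :: "int \<times> 'j" assume i: "i \<in> UNIV \<times> J"
    obtain l j where lj: "i = (l, j)" "j \<in> J" using i by auto
    note [measurable] = mb[rule_format, OF lj(2), of l] ma[rule_format, of "l - \<delta> j"]
    show "A i \<in> bor" "B i \<in> bor"
     unfolding A_def[abs_def] B_def[abs_def] lj by simp_all
    have "pavg (R l j) (V / q) (cell (R l j) x) (B i) <= pavg (R l j) (U / q) (cell3 (R l j) x) (A i)" for x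
    proof -
     have "ennreal (e j powr (- 1/2)) * pavg (R l j) V (cell (R l j) x) (bb l j)
      <= ennreal (e j powr (- 1/2)) * (ennreal (e j) * pavg (R l j) U (cell3 (R l j) x) (a (l - \<delta> j)))"
      using H lj by (intro mult_left_mono) auto
     also have "... = ennreal (e j powr (1/2)) * pavg (R l j) U (cell3 (R l j) x) (a (l - \<delta> j))"
     proof -
      have "e j powr (- 1/2) * e j = e j powr (1/2)"
       using e[OF lj(2)] powr_add[of "e j" "- 1/2" 1] by simp
      then show ?thesis using e[OF lj(2)] by (simp add: mult.assoc[symmetric] ennreal_mult'' [symmetric] less_imp_le del: times_divide_eq_left)
     qed
     finally show ?thesis
      unfolding A_def B_def lj fst_conv snd_conv pavg_epowr[OF q]
      using q U V p by (intro epowr_mono) (simp_all add: pavg_cmult)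
    qed
    then show "dominated (V / q) (U / q) (R (fst i) (snd i)) (B i) (A i)"
     unfolding dominated_def lj by simp
   qed
  qed
  also have "(\<integral>x. epowr (\<Sum>\<^sup>+\<iota>\<in>(UNIV \<times> J). A \<iota> x) (p / q)) = ennreal (G powr (p / q)) * (\<integral>x. epowr (h x) (p / q))"
   unfolding le2 using G by (simp add: epowr_mult epowr_ennreal nn_integral_cmult)
  finally show "(\<integral>x. epowr (\<Sum>\<^sup>+k. epowr (b k x) q) (p / q))
    <= ennreal (E powr p * K0 * G powr (p / q)) * (\<integral>x. epowr (\<Sum>\<^sup>+k. epowr (a k x) q) (p / q))"
   using K0 by (simp add: ennreal_mult'' mult_left_mono mult.assoc h_def)
 qed
qed

lemma dnorm_pieces_sup:
 assumes p: "0 < p" and U: "0 < U" "U < p"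
 shows "\<exists>K::real. 0 <= K \<and> (\<forall>(a :: int => real ^ 'n => ennreal) (b :: int => real ^ 'n => ennreal) c.
   (\<forall>k. a k \<in> bor) -->
   (\<forall>l x. b l x <= ennreal c * epowr (maxi (\<lambda>y. epowr (SUP k. a k y) U) x) (1 / U)) -->
   (\<integral>x. epowr (SUP k. b k x) p) <= epowr (ennreal c) p * (ennreal K * (\<integral>x. epowr (SUP k. a k x) p)))"
proof -
 obtain K where K: "0 <= K" and M: "\<And>h :: real ^ 'n => ennreal. h \<in> bor ==>
   (\<integral>x. epowr (epowr (maxi (\<lambda>y. epowr (h y) U) x) (1 / U)) p) <= ennreal K * (\<integral>x. epowr (h x) p)"
  using maxi_exponent[OF U, where 'n='n] by auto
 show ?thesis
 proof (intro exI[of _ K] conjI K allI impI)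
  fix a b :: "int => real ^ 'n => ennreal" and c
  assume "\<forall>k. a k \<in> bor"
  then have [measurable]: "a k \<in> bor" for k by simp
  assume H: "\<forall>l x. b l x <= ennreal c * epowr (maxi (\<lambda>y. epowr (SUP k. a k y) U) x) (1 / U)"
  have "(\<integral>x. epowr (SUP k. b k x) p)
    <= (\<integral>x. epowr (ennreal c * epowr (maxi (\<lambda>y. epowr (SUP k. a k y) U) x) (1 / U)) p)"
   using p H by (intro nn_integral_mono epowr_mono SUP_least) auto
  also have "... = epowr (ennreal c) p * (\<integral>x. epowr (epowr (maxi (\<lambda>y. epowr (SUP k. a k y) U) x) (1 / U)) p)"
  by (simp add: epowr_mult nn_integral_cmult)
  also have "... <= epowr (ennreal c) p * (ennreal K * (\<integral>x. epowr (SUP k. a k x) p))"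
  by (intro mult_left_mono M) auto
  finally show "(\<integral>x. epowr (SUP k. b k x) p) <= epowr (ennreal c) p * (ennreal K * (\<integral>x. epowr (SUP k. a k x) p))" .
 qed
qed

lemma pavg_power_le_avg:
 fixes x :: "real ^ 'n"
 assumes "f \<in> bor" "0 < U" "U <= q"
 shows "epowr (pavg R U (cell3 R x) f) q <= ennreal (3 powr (real CARD('n) * q / U)) * avg R (cell3 R x) (\<lambda>y. epowr (f y) q)"
 using pavg_cell3_le_avg[of "\<lambda>y. epowr (f y) q" "U / q" R x] assms
 by (simp add: pavg_epowr epowr_three_power)

text \<open>
 The scales \<open>l\<close> with \<open>l + s > j\<close> see averages over larger cells than the Carleson box; there are
 only \<open>s\<close> of them.
\<close>

lemma Carleson_shift:
 fixes a :: "int => real ^ 'n => ennreal"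
 assumes m: "\<And>k. a k \<in> bor" and s: "- d <= int s"
  and N: "\<And>j x. avg j (cell3 j x) (\<lambda>y. (\<Sum>\<^sup>+k\<in>{..j}. a k y)) <= N"
 shows "(\<Sum>\<^sup>+l\<in>{..j}. avg j (cell3 j x) (\<lambda>y. avg (l + int s) (cell3 (l + int s) y) (a (l - d))))
   <= 6 ^ CARD('n) * (1 + of_nat s) * N"
proof -
 note [measurable] = m
 define g where "g l = avg j (cell3 j x) (\<lambda>y. avg (l + int s) (cell3 (l + int s) y) (a (l - d)))" for l
 have split: "(\<Sum>\<^sup>+l\<in>{..j}. g l) = (\<Sum>\<^sup>+l\<in>{..j - int s}. g l) + (\<Sum>\<^sup>+l\<in>{j - int s<..j}. g l)"
 proof -
  have "(\<Sum>\<^sup>+l\<in>{..j}. g l) = (\<Sum>\<^sup>+l. g l * indicator {..j - int s} l + g l * indicator {j - int s<..j} l)"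
  by (subst nn_integral_count_space_indicator) (auto intro!: nn_integral_cong split: split_indicator)
  then show ?thesis by (simp add: nn_integral_add nn_integral_count_space_indicator)
 qed
 have single: "avg R (cell3 R y) (a k) <= N" if "k <= R" for R y k
 proof -
  have "avg R (cell3 R y) (a k) <= avg R (cell3 R y) (\<lambda>y. (\<Sum>\<^sup>+k\<in>{..R}. a k y))"
   using that by (intro avg_mono) (rule nn_integral_ge_point[of k _ "\<lambda>k. a k _"], simp)
  then show ?thesis using N[of R y] by (rule order_trans)
 qed
 have "(\<Sum>\<^sup>+l\<in>{..j - int s}. g l) <= (\<Sum>\<^sup>+l\<in>{..j - int s}. 6 ^ CARD('n) * avg (j + 1) (cell3 (j + 1) x) (a (l - d)))"
  unfolding g_def by (intro nn_integral_mono avg_avg_cell3) auto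
 also have "... = 6 ^ CARD('n) * (\<Sum>\<^sup>+l\<in>{..j - int s}. avg (j + 1) (cell3 (j + 1) x) (a (l - d)))"
 by (rule nn_integral_cmult) simp
 also have "(\<Sum>\<^sup>+l\<in>{..j - int s}. avg (j + 1) (cell3 (j + 1) x) (a (l - d))) = (\<Sum>\<^sup>+k\<in>{..j - int s - d}. avg (j + 1) (cell3 (j + 1) x) (a k))"
 by (rule nn_integral_bij_count_space[of "\<lambda>l. l - d"]) (rule bij_betwI[of _ _ _ "\<lambda>k. k + d"], auto)
 also have "... <= (\<Sum>\<^sup>+k\<in>{..j + 1}. avg (j + 1) (cell3 (j + 1) x) (a k))"
  using s by (subst (1 2) nn_integral_count_space_indicator) (auto intro!: nn_integral_mono split: split_indicator)
 also have "... = avg (j + 1) (cell3 (j + 1) x) (\<lambda>y. (\<Sum>\<^sup>+k\<in>{..j + 1}. a k y))"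
 by (rule avg_nn_integral[symmetric]) auto
 also have "... <= N" by (rule N)
 finally have 1: "(\<Sum>\<^sup>+l\<in>{..j - int s}. g l) <= 6 ^ CARD('n) * N" by (simp add: mult_left_mono)
 have "(\<Sum>\<^sup>+l\<in>{j - int s<..j}. g l) <= (\<Sum>\<^sup>+l\<in>{j - int s<..j}. 3 ^ CARD('n) * N)"
 proof (rule nn_integral_mono)
  fix l
  have "g l <= avg j (cell3 j x) (\<lambda>y. N)"
   unfolding g_def using s by (intro avg_mono single) auto
  then show "g l <= 3 ^ CARD('n) * N" by (simp add: avg_one_cell3)
 qed
 also have "... = 3 ^ CARD('n) * N * of_nat s" by (simp add: emeasure_count_space)
 also have "... <= 6 ^ CARD('n) * N * of_nat s" by (intro mult_right_mono power_mono) auto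
 finally have 2: "(\<Sum>\<^sup>+l\<in>{j - int s<..j}. g l) <= 6 ^ CARD('n) * N * of_nat s" .
 show ?thesis using add_mono[OF 1 2] split unfolding g_def by (simp add: distrib_left distrib_right mult_ac)
qed

text \<open>One set of data covers all four norms. The averaging level \<open>l + s j\<close> is at
  least the source scale \<open>l - \<delta> j\<close>, so that a Carleson box at that level sees
  the source; the factor \<open>1 + s j\<close> in the summability assumption pays for the
  exceptional scales of \<open>Carleson_shift\<close>.\<close>

theorem dnorm_pieces:
 fixes J :: "'j set" and \<delta> :: "'j => int" and s :: "'j => nat"
 assumes p: "0 < p" and q: "0 < q" and U: "0 < U" "ennreal U < p" "ennreal U < q"
  and V: "p < \<infinity> ==> q < \<infinity> ==> p < ennreal V \<and> q < ennreal V"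
  and J: "countable J" and e: "\<And>j. j \<in> J ==> 0 < e j" and s: "\<And>j. j \<in> J ==> - \<delta> j <= int (s j)"
  and fin: "\<And>\<eta>. 0 < \<eta> ==> (\<Sum>\<^sup>+j\<in>J. (1 + of_nat (s j)) * ennreal (e j powr \<eta>)) < top"
 shows "\<exists>K::real. 0 <= K \<and> (\<forall>a b (bb :: int => 'j => real ^ 'n => ennreal).
   (\<forall>k. a k \<in> bor) --> (\<forall>k. b k \<in> bor) --> (\<forall>l. \<forall>j\<in>J. bb l j \<in> bor) -->
   (\<forall>l x. b l x <= (\<Sum>\<^sup>+j\<in>J. bb l j x)) -->
   (\<forall>l. \<forall>j\<in>J. piece_bound p q V U (l + int (s j)) (e j) (bb l j) (a (l - \<delta> j))) -->
   dnorm p q b <= ennreal K * dnorm p q a)"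
proof -
 have fin': "(\<Sum>\<^sup>+j\<in>J. ennreal (e j powr \<eta>)) < top" if "0 < \<eta>" for \<eta>
 proof -
  have "(\<Sum>\<^sup>+j\<in>J. ennreal (e j powr \<eta>)) <= (\<Sum>\<^sup>+j\<in>J. (1 + of_nat (s j)) * ennreal (e j powr \<eta>))"
  by (intro nn_integral_mono) (simp add: distrib_right)
  then show ?thesis using fin[OF that] by (rule le_less_trans)
 qed
 have e_all: "\<forall>j\<in>J. 0 < e j" and fin_all: "\<forall>\<eta>>0. (\<Sum>\<^sup>+j\<in>J. ennreal (e j powr \<eta>)) < top"
  using e fin' by auto
 define E where "E = enn2real (\<Sum>\<^sup>+j\<in>J. ennreal (e j))"
 have E: "(\<Sum>\<^sup>+j\<in>J. ennreal (e j)) = ennreal E" "0 <= E"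
 proof -
  have "(\<Sum>\<^sup>+j\<in>J. ennreal (e j)) = (\<Sum>\<^sup>+j\<in>J. ennreal (e j powr 1))"
   using e by (intro nn_integral_cong) (simp add: less_imp_le)
  then show "(\<Sum>\<^sup>+j\<in>J. ennreal (e j)) = ennreal E" using fin'[of 1] by (simp add: E_def)
 qed (simp add: E_def)
 show ?thesis
 proof (cases "p < \<infinity>")
  case pf: True
  define p' where "p' = enn2real p"
  have p': "p = ennreal p'" "0 < p'" "U < p'"
   using p pf U by (auto simp: p'_def enn2real_positive_iff) (metis ennreal_enn2real ennreal_less_iff less_imp_le)
  show ?thesis
  proof (cases "q < \<infinity>")
   case qf: True
   define q' where "q' = enn2real q"
   have q': "q = ennreal q'" "0 < q'" "U < q'"
    using q qf U by (auto simp: q'_def enn2real_positive_iff) (metis ennreal_enn2real ennreal_less_iff less_imp_le)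
   have V': "p' < V" "q' < V" using V[OF pf qf] p' q' by (auto simp: ennreal_less_iff)
   obtain K where K: "0 <= K" and main: "\<And>a b (bb :: int => 'j => real ^ 'n => ennreal).
     (\<forall>k. a k \<in> bor) ==> (\<forall>l. \<forall>j\<in>J. bb l j \<in> bor) ==>
     (\<forall>l x. b l x <= (\<Sum>\<^sup>+j\<in>J. bb l j x)) ==>
     (\<forall>l. \<forall>j\<in>J. \<forall>x. pavg (l + int (s j)) V (cell (l + int (s j)) x) (bb l j) <= ennreal (e j) * pavg (l + int (s j)) U (cell3 (l + int (s j)) x) (a (l - \<delta> j))) ==>
     (\<integral>x. epowr (\<Sum>\<^sup>+k. epowr (b k x) q') (p' / q'))
      <= ennreal K * (\<integral>x. epowr (\<Sum>\<^sup>+k. epowr (a k x) q') (p' / q'))"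
    using dnorm_pieces_finite[OF p'(2) q'(2) U(1) p'(3) q'(3) V' J e_all fin_all, where 'n='n and R="\<lambda>l j. l + int (s j)" and \<delta>=\<delta>]
   by (elim exE conjE) (rule that, assumption, blast)
   show ?thesis
   proof (intro exI[of _ "K powr (1 / p')"] conjI allI impI)
    fix a b and bb :: "int => 'j => real ^ 'n => ennreal"
    assume H: "\<forall>k. a k \<in> bor" "\<forall>k. b k \<in> bor" "\<forall>l. \<forall>j\<in>J. bb l j \<in> bor"
     "\<forall>l x. b l x <= (\<Sum>\<^sup>+j\<in>J. bb l j x)" "\<forall>l. \<forall>j\<in>J. piece_bound p q V U (l + int (s j)) (e j) (bb l j) (a (l - \<delta> j))"
    have "(\<integral>x. epowr (\<Sum>\<^sup>+k. epowr (b k x) q') (p' / q'))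
      <= ennreal K * (\<integral>x. epowr (\<Sum>\<^sup>+k. epowr (a k x) q') (p' / q'))"
     using H pf qf by (intro main) (auto simp: piece_bound_def)
    then have "epowr (\<integral>x. epowr (\<Sum>\<^sup>+k. epowr (b k x) q') (p' / q')) (1 / p')
      <= epowr (ennreal K * (\<integral>x. epowr (\<Sum>\<^sup>+k. epowr (a k x) q') (p' / q'))) (1 / p')"
     using p' by (intro epowr_mono) auto
    then show "dnorm p q b <= ennreal (K powr (1 / p')) * dnorm p q a"
     using pf qf K unfolding dnorm_def p'_def[symmetric] q'_def[symmetric] by (simp add: epowr_mult epowr_ennreal)
   qed simp
  next
   case qi: False
   obtain K where K: "0 <= K" and main: "\<And>(a :: int => real ^ 'n => ennreal) (b :: int => real ^ 'n => ennreal) c.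
     (\<forall>k. a k \<in> bor) ==> (\<forall>l x. b l x <= ennreal c * epowr (maxi (\<lambda>y. epowr (SUP k. a k y) U) x) (1 / U)) ==>
     (\<integral>x. epowr (SUP k. b k x) p') <= epowr (ennreal c) p' * (ennreal K * (\<integral>x. epowr (SUP k. a k x) p'))"
    using dnorm_pieces_sup[OF p'(2) U(1) p'(3), where 'n='n]
   by (elim exE conjE) (rule that, assumption, blast)
   show ?thesis
   proof (intro exI[of _ "E * K powr (1 / p')"] conjI allI impI)
    fix a b and bb :: "int => 'j => real ^ 'n => ennreal"
    assume H: "\<forall>k. a k \<in> bor" "\<forall>k. b k \<in> bor" "\<forall>l. \<forall>j\<in>J. bb l j \<in> bor"
     "\<forall>l x. b l x <= (\<Sum>\<^sup>+j\<in>J. bb l j x)" "\<forall>l. \<forall>j\<in>J. piece_bound p q V U (l + int (s j)) (e j) (bb l j) (a (l - \<delta> j))"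
    have bE: "b l x <= ennreal E * epowr (maxi (\<lambda>y. epowr (SUP k. a k y) U) x) (1 / U)" for l x
    proof -
     have "b l x <= (\<Sum>\<^sup>+j\<in>J. ennreal (e j) * epowr (maxi (\<lambda>y. epowr (SUP k. a k y) U) x) (1 / U))"
     proof (rule order_trans[OF H(4)[rule_format] nn_integral_mono])
      fix j assume "j \<in> space (count_space J)"
      then have "bb l j x <= ennreal (e j) * pavg (l + int (s j)) U (cell3 (l + int (s j)) x) (a (l - \<delta> j))"
       using H(5) qi by (auto simp: piece_bound_def)
      also have "... <= ennreal (e j) * epowr (maxi (\<lambda>y. epowr (SUP k. a k y) U) x) (1 / U)"
       using U by (intro mult_left_mono pavg_le_maxi) (auto intro: SUP_upper)
      finally show "bb l j x <= ennreal (e j) * epowr (maxi (\<lambda>y. epowr (SUP k. a k y) U) x) (1 / U)" .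
     qed
     also have "... = ennreal E * epowr (maxi (\<lambda>y. epowr (SUP k. a k y) U) x) (1 / U)"
     by (simp add: nn_integral_multc E)
     finally show ?thesis .
    qed
    have "(\<integral>x. epowr (SUP k. b k x) p') <= epowr (ennreal E) p' * (ennreal K * (\<integral>x. epowr (SUP k. a k x) p'))"
    by (rule main[OF H(1)]) (intro allI bE)
    then have "epowr (\<integral>x. epowr (SUP k. b k x) p') (1 / p') <= epowr (epowr (ennreal E) p' * (ennreal K * (\<integral>x. epowr (SUP k. a k x) p'))) (1 / p')"
     using p' by (intro epowr_mono) auto
    then show "dnorm p q b <= ennreal (E * K powr (1 / p')) * dnorm p q a"
     using pf qi K E p' unfolding dnorm_def p'_def[symmetric] by (simp add: epowr_mult epowr_epowr epowr_ennreal ennreal_mult mult.assoc powr_powr)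
   qed (use E in simp)
  qed
 next
  case pi: False
  show ?thesis
  proof (cases "q < \<infinity>")
   case qf: True
   define q' where "q' = enn2real q"
   have q': "q = ennreal q'" "0 < q'" "U < q'"
    using q qf U by (auto simp: q'_def enn2real_positive_iff) (metis ennreal_enn2real ennreal_less_iff less_imp_le)
   define E2 where "E2 = enn2real (\<Sum>\<^sup>+j\<in>J. ennreal (e j powr (1/2)))"
   have E2: "(\<Sum>\<^sup>+j\<in>J. ennreal (e j powr (1/2))) = ennreal E2" "0 <= E2"
    using fin'[of "1/2"] by (simp_all add: E2_def)
   define G where "G = enn2real (\<Sum>\<^sup>+j\<in>J. (1 + of_nat (s j)) * ennreal (e j powr (q' / 2)))"
   have G: "(\<Sum>\<^sup>+j\<in>J. (1 + of_nat (s j)) * ennreal (e j powr (q' / 2))) = ennreal G" "0 <= G"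
    using fin[of "q'/2"] q' by (simp_all add: G_def)
   define k0 where "k0 = 3 powr (real CARD('n) * q' / U)"
   define K where "K = E2 powr q' * k0 * 6 ^ CARD('n) * G"
   have K: "0 <= K" using G by (simp add: K_def k0_def)
   show ?thesis
   proof (intro exI[of _ "K powr (1 / q')"] conjI allI impI)
    fix a b and bb :: "int => 'j => real ^ 'n => ennreal"
    assume H: "\<forall>k. a k \<in> bor" "\<forall>k. b k \<in> bor" "\<forall>l. \<forall>j\<in>J. bb l j \<in> bor"
     "\<forall>l x. b l x <= (\<Sum>\<^sup>+j\<in>J. bb l j x)" "\<forall>l. \<forall>j\<in>J. piece_bound p q V U (l + int (s j)) (e j) (bb l j) (a (l - \<delta> j))"
    note [measurable] = H(1)[rule_format] H(2)[rule_format]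
    define N where "N = (SUP (j, x). avg j (cell3 j x) (\<lambda>y. (\<Sum>\<^sup>+k\<in>{..j}. epowr (a k y) q')))"
    have N: "avg j (cell3 j x) (\<lambda>y. (\<Sum>\<^sup>+k\<in>{..j}. epowr (a k y) q')) <= N" for j x
     unfolding N_def by (rule SUP_upper2[of "(j, x)"]) auto
    have main: "avg j (cell3 j x) (\<lambda>y. (\<Sum>\<^sup>+l\<in>{..j}. epowr (b l y) q')) <= ennreal K * N" for j x
    proof -
     \<comment> \<open>The coefficient is split into two square roots as for finite exponents. The
       \<open>U\<close>-mean raised to \<open>q'\<close> is then bounded by the mean of
       \<open>q'\<close>-th powers, which is linear in them and so can be summed over scales and
       pieces.\<close>
     have b1: "epowr (b l y) q' <= (\<Sum>\<^sup>+i\<in>J. ennreal (E2 powr q' * k0) * (ennreal (e i powr (q' / 2)) * avg (l + int (s i)) (cell3 (l + int (s i)) y) (\<lambda>z. epowr (a (l - \<delta> i) z) q')))" for l y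
     proof -
      have "epowr (b l y) q' <= epowr (\<Sum>\<^sup>+j\<in>J. bb l j y) q'"
       using H q' by (intro epowr_mono) auto
      also have "... <= epowr (ennreal E2) q' * (\<Sum>\<^sup>+i\<in>J. epowr (ennreal (e i powr (- 1/2)) * bb l i y) q')"
       using epowr_sum_le_weighted[OF q'(2) e_all, where y="\<lambda>j. bb l j y"] E2 by simp
      also have "... = (\<Sum>\<^sup>+i\<in>J. epowr (ennreal E2) q' * epowr (ennreal (e i powr (- 1/2)) * bb l i y) q')"
      by (rule nn_integral_cmult[symmetric]) simp
      also have "... <= (\<Sum>\<^sup>+i\<in>J. ennreal (E2 powr q' * k0) * (ennreal (e i powr (q' / 2)) * avg (l + int (s i)) (cell3 (l + int (s i)) y) (\<lambda>z. epowr (a (l - \<delta> i) z) q')))"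
      proof (rule nn_integral_mono)
       fix i assume "i \<in> space (count_space J)"
       then have i: "i \<in> J" by simp
       let ?R = "l + int (s i)"
       have "ennreal (e i powr (- 1/2)) * bb l i y <= ennreal (e i powr (- 1/2)) * (ennreal (e i) * pavg ?R U (cell3 ?R y) (a (l - \<delta> i)))"
        using H(5) i pi by (intro mult_left_mono) (auto simp: piece_bound_def)
       also have "... = ennreal (e i powr (1/2)) * pavg ?R U (cell3 ?R y) (a (l - \<delta> i))"
       proof -
        have "e i powr (- 1/2) * e i = e i powr (1/2)"
         using e[OF i] powr_add[of "e i" "- 1/2" 1] by simp
        then show ?thesis using e[OF i] by (simp add: mult.assoc[symmetric] ennreal_mult'' [symmetric] less_imp_le del: times_divide_eq_left)
       qed
       finally have "epowr (ennreal (e i powr (- 1/2)) * bb l i y) q' <= epowr (ennreal (e i powr (1/2)) * pavg ?R U (cell3 ?R y) (a (l - \<delta> i))) q'"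
        using q' by (intro epowr_mono) auto
       also have "... = ennreal (e i powr (q' / 2)) * epowr (pavg ?R U (cell3 ?R y) (a (l - \<delta> i))) q'"
       by (simp add: epowr_mult epowr_ennreal powr_powr)
       also have "... <= ennreal (e i powr (q' / 2)) * (ennreal k0 * avg ?R (cell3 ?R y) (\<lambda>z. epowr (a (l - \<delta> i) z) q'))"
        unfolding k0_def using U q' by (intro mult_left_mono pavg_power_le_avg) auto
       finally have "epowr (ennreal E2) q' * epowr (ennreal (e i powr (- 1/2)) * bb l i y) q' <= epowr (ennreal E2) q' * (ennreal (e i powr (q' / 2)) * (ennreal k0 * avg ?R (cell3 ?R y) (\<lambda>z. epowr (a (l - \<delta> i) z) q')))"
       by (intro mult_left_mono) auto
       also have "... = ennreal (E2 powr q' * k0) * (ennreal (e i powr (q' / 2)) * avg ?R (cell3 ?R y) (\<lambda>z. epowr (a (l - \<delta> i) z) q'))"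
        using E2 by (simp add: epowr_ennreal ennreal_mult k0_def mult_ac)
       finally show "epowr (ennreal E2) q' * epowr (ennreal (e i powr (- 1/2)) * bb l i y) q' <= ..." .
      qed
      finally show ?thesis .
     qed
     have "avg j (cell3 j x) (\<lambda>y. (\<Sum>\<^sup>+l\<in>{..j}. epowr (b l y) q'))
      <= avg j (cell3 j x) (\<lambda>y. (\<Sum>\<^sup>+l\<in>{..j}. (\<Sum>\<^sup>+i\<in>J. ennreal (E2 powr q' * k0) * (ennreal (e i powr (q' / 2)) * avg (l + int (s i)) (cell3 (l + int (s i)) y) (\<lambda>z. epowr (a (l - \<delta> i) z) q')))))"
     by (intro avg_mono nn_integral_mono b1)
     also have "... = (\<Sum>\<^sup>+l\<in>{..j}. (\<Sum>\<^sup>+i\<in>J. ennreal (E2 powr q' * k0) * (ennreal (e i powr (q' / 2)) * avg j (cell3 j x) (\<lambda>y. avg (l + int (s i)) (cell3 (l + int (s i)) y) (\<lambda>z. epowr (a (l - \<delta> i) z) q')))))"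
      using J by (simp add: avg_nn_integral borel_measurable_nn_integral_count_space avg_cmult)
     also have "... = (\<Sum>\<^sup>+i\<in>J. (\<Sum>\<^sup>+l\<in>{..j}. ennreal (E2 powr q' * k0) * (ennreal (e i powr (q' / 2)) * avg j (cell3 j x) (\<lambda>y. avg (l + int (s i)) (cell3 (l + int (s i)) y) (\<lambda>z. epowr (a (l - \<delta> i) z) q')))))"
      using J by (rule nn_integral_count_space_swap)
     also have "... = (\<Sum>\<^sup>+i\<in>J. ennreal (E2 powr q' * k0) * (ennreal (e i powr (q' / 2)) * (\<Sum>\<^sup>+l\<in>{..j}. avg j (cell3 j x) (\<lambda>y. avg (l + int (s i)) (cell3 (l + int (s i)) y) (\<lambda>z. epowr (a (l - \<delta> i) z) q')))))"
     by (simp add: nn_integral_cmult)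
     also have "... <= (\<Sum>\<^sup>+i\<in>J. ennreal (E2 powr q' * k0) * (ennreal (e i powr (q' / 2)) * (6 ^ CARD('n) * (1 + of_nat (s i)) * N)))"
      using s N by (intro nn_integral_mono mult_left_mono Carleson_shift) auto
     also have "... = (\<Sum>\<^sup>+i\<in>J. (ennreal (E2 powr q' * k0) * 6 ^ CARD('n)) * ((1 + of_nat (s i)) * ennreal (e i powr (q' / 2))) * N)"
     by (intro nn_integral_cong) (simp only: mult_ac)
     also have "... = (ennreal (E2 powr q' * k0) * 6 ^ CARD('n)) * ennreal G * N"
     by (simp add: nn_integral_multc nn_integral_cmult G)
     also have "(ennreal (E2 powr q' * k0) * 6 ^ CARD('n)) * ennreal G = ennreal K"
     proof -
      have "(6 ^ CARD('n) :: ennreal) = ennreal (6 ^ CARD('n))" by (metis ennreal_numeral ennreal_power zero_le_numeral)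
      then show ?thesis using G by (simp add: K_def k0_def ennreal_mult'' [symmetric])
     qed
     finally show ?thesis .
    qed
    have "dnorm p q b <= epowr (ennreal K * N) (1 / q')"
     unfolding dnorm_def using pi qf q' main by (auto simp: q'_def[symmetric] intro!: SUP_least epowr_mono)
    also have "... = ennreal (K powr (1 / q')) * epowr N (1 / q')" using K by (simp add: epowr_mult epowr_ennreal)
    also have "epowr N (1 / q') = dnorm p q a"
     unfolding dnorm_def N_def using pi qf q' by (simp add: q'_def[symmetric] epowr_SUP case_prod_beta)
    finally show "dnorm p q b <= ennreal (K powr (1 / q')) * dnorm p q a" .
   qed simp
  next
   case qi: False
   show ?thesis
   proof (intro exI[of _ "E * 3 powr (real CARD('n) / U)"] conjI allI impI)
    fix a b and bb :: "int => 'j => real ^ 'n => ennreal"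
    assume H: "\<forall>k. a k \<in> bor" "\<forall>k. b k \<in> bor" "\<forall>l. \<forall>j\<in>J. bb l j \<in> bor"
     "\<forall>l x. b l x <= (\<Sum>\<^sup>+j\<in>J. bb l j x)" "\<forall>l. \<forall>j\<in>J. piece_bound p q V U (l + int (s j)) (e j) (bb l j) (a (l - \<delta> j))"
    note [measurable] = H(1)[rule_format] H(2)[rule_format]
    define N where "N = esssup lborel (\<lambda>x. SUP k. a k x)"
    have AE: "AE x in lborel. \<forall>k. a k x <= N"
     using esssup_AE[of "\<lambda>x. SUP k. a k x" lborel] unfolding N_def by eventually_elim (auto simp: SUP_le_iff)
    have pN: "pavg R U (cell3 R x) (a k) <= ennreal (3 powr (real CARD('n) / U)) * N" for R x k
    proof -
     have "avg R (cell3 R x) (\<lambda>y. epowr (a k y) U) <= avg R (cell3 R x) (\<lambda>y. epowr N U)"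
     proof (rule avg_mono_AE)
      show "AE y in lborel. y \<in> cell3 R x --> epowr (a k y) U <= epowr N U"
       using AE by eventually_elim (use U in \<open>auto intro: epowr_mono\<close>)
     qed
     then have "pavg R U (cell3 R x) (a k) <= epowr (3 ^ CARD('n) * epowr N U) (1 / U)"
      unfolding pavg_def avg_one_cell3 using U by (intro epowr_mono) auto
     then show ?thesis using U by (simp add: epowr_mult epowr_epowr epowr_three_power)
    qed
    have "b l x <= ennreal E * (ennreal (3 powr (real CARD('n) / U)) * N)" for l x
    proof -
     have "b l x <= (\<Sum>\<^sup>+j\<in>J. ennreal (e j) * (ennreal (3 powr (real CARD('n) / U)) * N))"
     proof (rule order_trans[OF H(4)[rule_format] nn_integral_mono])
      fix j assume "j \<in> space (count_space J)"
      then have "bb l j x <= ennreal (e j) * pavg (l + int (s j)) U (cell3 (l + int (s j)) x) (a (l - \<delta> j))"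
       using H(5) qi by (auto simp: piece_bound_def)
      also have "... <= ennreal (e j) * (ennreal (3 powr (real CARD('n) / U)) * N)"
      by (intro mult_left_mono pN) auto
      finally show "bb l j x <= ennreal (e j) * (ennreal (3 powr (real CARD('n) / U)) * N)" .
     qed
     also have "... = ennreal E * (ennreal (3 powr (real CARD('n) / U)) * N)"
     by (simp add: nn_integral_multc E)
     finally show ?thesis .
    qed
    then have "dnorm p q b <= ennreal E * (ennreal (3 powr (real CARD('n) / U)) * N)"
     unfolding dnorm_def using pi qi by (auto intro!: esssup_I SUP_least)
    then show "dnorm p q b <= ennreal (E * 3 powr (real CARD('n) / U)) * dnorm p q a"
     using pi qi E by (simp add: dnorm_def N_def ennreal_mult mult.assoc)
   qed (use E in simp)
  qed
 qed
qed

section \<open>Octaves and tent space norms\<close>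

text \<open>Octaves are adapted to the homogeneity: \<open>t\<close> lies in
  \<open>octave m k\<close> exactly when \<open>t^(1/m)\<close> lies between \<open>2^k\<close> and
  \<open>2^(k+1)\<close>, so balls of radius \<open>t^(1/m)\<close> compare with cells of levels
  \<open>k\<close> and \<open>k + 1\<close>.\<close>

definition tscale :: "real => int => real" where
 "tscale m k = 2 powr (m * rl k)"

definition octave :: "real => int => real set" where
 "octave m k = {tscale m k ..< tscale m (k + 1)}"

text \<open>The normalisation by \<open>tscale m k\<close> differs from the length of the octave by
  the constant \<open>2^m - 1\<close>.\<close>

definition octave_mean :: "real => real => (real => 'a => ennreal) => int => 'a => ennreal" where
 "octave_mean m U w k y = epowr (ennreal (tscale m (- k)) * (\<integral>t \<in> octave m k. epowr (w t y) U)) (1 / U)"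

text \<open>Up to constants, the size of \<open>t^(-\<beta>)\<close> on the octave times the length
  of the octave to the power \<open>1/q\<close>, a factor that is 1 for infinite
  \<open>q\<close>.\<close>

definition weight :: "real => ennreal => real => int => ennreal" where
 "weight m q \<beta> k = ennreal (2 powr (m * rl k * (enn2real (inverse q) - \<beta>)))"

lemma tscale_pos [simp]: "0 < tscale m k"
 by (simp add: tscale_def)

lemma tscale_nonneg [simp]: "0 <= tscale m k"
 by (simp add: tscale_def)

lemma tscale_add: "tscale m (k + l) = tscale m k * tscale m l"
 by (simp add: tscale_def distrib_left powr_add)

lemma tscale_minus: "tscale m (- k) * tscale m k = 1" "tscale m k * tscale m (- k) = 1"
 using tscale_add[of m "- k" k] tscale_add[of m k "- k"] by (simp_all add: tscale_def)

lemma tscale_mono: "0 <= m ==> k <= l ==> tscale m k <= tscale m l"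
 by (simp add: tscale_def mult_left_mono)

lemma tscale_strict_mono: "0 < m ==> k < l ==> tscale m k < tscale m l"
 by (simp add: tscale_def)

lemma tscale_one: "tscale m 1 = 2 powr m"
 by (simp add: tscale_def)

lemma tscale_powr: "tscale m k powr a = 2 powr (m * rl k * a)"
 by (simp add: tscale_def powr_powr)

lemma tscale_root: "0 < m ==> tscale m k powr (1 / m) = 2 powr rl k"
 by (simp add: tscale_powr)

lemma octave_pos: "t \<in> octave m k ==> 0 < t"
 by (auto simp: octave_def intro: less_le_trans[OF tscale_pos])

lemma sets_octave [measurable]: "octave m k \<in> sets borel"
 by (simp add: octave_def)

lemma octave_ex:
 assumes m: "0 < m" and t: "0 < t" shows "\<exists>k. t \<in> octave m k"
proof (intro exI[of _ "\<lfloor>log 2 t / m\<rfloor>"])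
 have "rl \<lfloor>log 2 t / m\<rfloor> <= log 2 t / m" "log 2 t / m < rl (\<lfloor>log 2 t / m\<rfloor> + 1)" by linarith+
 then have "m * rl \<lfloor>log 2 t / m\<rfloor> <= log 2 t" "log 2 t < m * rl (\<lfloor>log 2 t / m\<rfloor> + 1)"
  using m by (simp_all only: pos_le_divide_eq pos_divide_less_eq mult.commute)
 then show "t \<in> octave m \<lfloor>log 2 t / m\<rfloor>"
  using t by (simp add: octave_def tscale_def le_log_iff log_less_iff)
qed

lemma octave_unique:
 assumes m: "0 < m" and "t \<in> octave m k" "t \<in> octave m l" shows "k = l"
proof -
 have "k <= l" if "t \<in> octave m k" "t \<in> octave m l" for k l
  using that tscale_mono[of m "l + 1" k] m by (force simp: octave_def)
 with assms show ?thesis by (intro antisym)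
qed

lemma octave_le_iff:
 assumes m: "0 < m" and "t \<in> octave m k" shows "t < tscale m (j + 1) \<longleftrightarrow> k <= j"
 using assms tscale_mono[of m "k + 1" "j + 1"] tscale_mono[of m "j + 1" k] by (force simp: octave_def)

lemma emeasure_octave: "0 < m ==> emeasure lborel (octave m k) = ennreal (tscale m k * (2 powr m - 1))"
 using tscale_mono[of m k "k + 1"] by (simp add: octave_def tscale_add tscale_one algebra_simps)

lemma nn_integral_octaves:
 assumes m: "0 < m" and [measurable]: "h \<in> bor"
 shows "(\<integral>t \<in> {0<..}. h t) = (\<Sum>\<^sup>+k. (\<integral>t \<in> octave m k. h t))"
  "(\<integral>t \<in> {0<..<tscale m (j + 1)}. h t) = (\<Sum>\<^sup>+k\<in>{..j}. (\<integral>t \<in> octave m k. h t))"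
proof -
 have one: "(\<Sum>\<^sup>+k\<in>I. h t * indicator (octave m k) t) = h t * indicator (\<Union>k\<in>I. octave m k) t" for t I
 proof (cases "t \<in> (\<Union>k\<in>I. octave m k)")
  case True
  then obtain k where k: "k \<in> I" "t \<in> octave m k" by auto
  have "(\<Sum>\<^sup>+k\<in>I. h t * indicator (octave m k) t) = (\<Sum>\<^sup>+k'\<in>I. h t * indicator {k} k')"
  proof (rule nn_integral_cong)
   fix k'
   have "t \<in> octave m k' \<longleftrightarrow> k' = k" using k(2) octave_unique[OF m] by blast
   then show "h t * indicator (octave m k') t = h t * indicator {k} k'" by (simp add: indicator_def)
  qed
  also have "... = h t" using k by (subst nn_integral_cmult_indicator) auto
  finally show ?thesis using True by simp
 next
  case False
  then have "(\<Sum>\<^sup>+k\<in>I. h t * indicator (octave m k) t) = (\<Sum>\<^sup>+k\<in>I. 0)"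
  by (intro nn_integral_cong) auto
  then show ?thesis using False by simp
 qed
 have main: "(\<integral>t \<in> S. h t) = (\<Sum>\<^sup>+k\<in>I. (\<integral>t \<in> octave m k. h t))"
  if S: "S = (\<Union>k\<in>I. octave m k)" for S I
 proof -
  have "(\<integral>t \<in> S. h t) = (\<integral>t. (\<Sum>\<^sup>+k\<in>I. h t * indicator (octave m k) t))"
  by (simp add: one S)
  also have "... = (\<Sum>\<^sup>+k\<in>I. (\<integral>t \<in> octave m k. h t))"
  by (rule nn_integral_count_space_nn_integral) auto
  finally show ?thesis .
 qed
 have "{0<..} = (\<Union>k\<in>UNIV. octave m k)"
 proof (intro set_eqI)
  show "t \<in> {0<..} \<longleftrightarrow> t \<in> (\<Union>k\<in>UNIV. octave m k)" for t
   using octave_ex[OF m, of t] octave_pos[of t m] by blast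
 qed
 from main[OF this] show "(\<integral>t \<in> {0<..}. h t) = (\<Sum>\<^sup>+k. (\<integral>t \<in> octave m k. h t))" .
 have "{0<..<tscale m (j + 1)} = (\<Union>k\<in>{..j}. octave m k)"
 proof (intro set_eqI)
  show "t \<in> {0<..<tscale m (j + 1)} \<longleftrightarrow> t \<in> (\<Union>k\<in>{..j}. octave m k)" for t
   using octave_ex[OF m, of t] octave_pos[of t m] octave_le_iff[OF m, of t _ j]
  by (metis (no_types, lifting) UN_iff atMost_iff greaterThanLessThan_iff)
 qed
 from main[OF this] show "(\<integral>t \<in> {0<..<tscale m (j + 1)}. h t) = (\<Sum>\<^sup>+k\<in>{..j}. (\<integral>t \<in> octave m k. h t))" .
qed

lemma octave_powr:
 assumes m: "0 < m" and t: "t \<in> octave m k"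
 shows "t powr a <= 2 powr (m * \<bar>a\<bar>) * tscale m k powr a" "tscale m k powr a <= 2 powr (m * \<bar>a\<bar>) * t powr a"
proof -
 define u where "u = t / tscale m k"
 have u: "1 <= u" "u <= 2 powr m" and tu: "t = u * tscale m k"
  using t tscale_pos[of m k] by (auto simp: octave_def u_def tscale_add tscale_one pos_divide_le_eq mult.commute intro: less_imp_le)
 have "u powr a <= u powr \<bar>a\<bar>" "u powr (- a) <= u powr \<bar>a\<bar>" using u by (auto intro: powr_mono)
 moreover have "u powr \<bar>a\<bar> <= 2 powr (m * \<bar>a\<bar>)" using u by (simp add: powr_powr[symmetric] powr_mono2)
 ultimately have le: "u powr a <= 2 powr (m * \<bar>a\<bar>)" "u powr (- a) <= 2 powr (m * \<bar>a\<bar>)" by auto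
 have tp: "t powr a = u powr a * tscale m k powr a" using u by (simp add: tu powr_mult)
 show "t powr a <= 2 powr (m * \<bar>a\<bar>) * tscale m k powr a" unfolding tp using le by (intro mult_right_mono) auto
 have "tscale m k powr a = u powr (- a) * t powr a" unfolding tp using u by (simp add: powr_minus field_simps)
 also have "... <= 2 powr (m * \<bar>a\<bar>) * t powr a" using le by (intro mult_right_mono) auto
 finally show "tscale m k powr a <= 2 powr (m * \<bar>a\<bar>) * t powr a" .
qed

lemma borel_measurable_octave_mean [measurable]:
 assumes [measurable]: "(\<lambda>(t, x). w t x) \<in> borel_measurable (borel \<Otimes>\<^sub>M M)"
 shows "octave_mean m U w k \<in> borel_measurable M"
proof -
 have [measurable]: "(\<lambda>(x, t). w t x) \<in> borel_measurable (M \<Otimes>\<^sub>M lborel)"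
  using measurable_pair_swap[OF assms] by (simp add: measurable_cong_sets[OF sets_pair_measure_cong[OF refl sets_lborel] refl] case_prod_beta)
 show ?thesis unfolding octave_mean_def[abs_def] by measurable
qed

text \<open>Jensen's inequality for the measure with density \<open>kk\<close>, whose mass
  \<open>2^m - 1\<close> is replaced by \<open>2^m\<close> to obtain a power of 2.\<close>

lemma octave_mean_power_le:
 assumes m: "0 < m" and U: "0 < U" "U <= q" and [measurable]: "(\<lambda>t. w t y) \<in> bor"
 shows "epowr (octave_mean m U w k y) q
  <= ennreal (2 powr (m * (q / U - 1))) * (ennreal (tscale m (- k)) * (\<integral>t \<in> octave m k. epowr (w t y) q))"
proof -
 define kk where "kk t = ennreal (tscale m (- k)) * indicator (octave m k) t" for t
 have [measurable]: "kk \<in> bor" unfolding kk_def by measurable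
 have e: "ennreal (tscale m (- k)) * (\<integral>t \<in> octave m k. h t) = (\<integral>t. kk t * h t)"
  if "h \<in> bor" for h
  unfolding kk_def using that by (subst nn_integral_cmult[symmetric]) (auto simp: mult_ac)
 have kk: "(\<integral>t. kk t) <= ennreal (2 powr m)"
 proof -
  have "(\<integral>t. kk t) = ennreal (tscale m (- k)) * ennreal (tscale m k * (2 powr m - 1))"
   unfolding kk_def by (simp add: nn_integral_cmult_indicator emeasure_octave m)
  also have "... = ennreal (2 powr m - 1)"
   using m by (subst ennreal_mult[symmetric]) (auto simp: mult.assoc[symmetric] tscale_minus ge_one_powr_ge_zero)
  finally show ?thesis by (simp add: ennreal_leI)
 qed
 have "epowr (octave_mean m U w k y) q = epowr (\<integral>t. kk t * epowr (epowr (w t y) q) (U / q)) (q / U)"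
  unfolding octave_mean_def using U by (subst e) (auto simp: epowr_epowr)
 also have "... <= epowr (epowr (\<integral>t. kk t * epowr (w t y) q) (U / q) * epowr (\<integral>t. kk t) (1 - U / q)) (q / U)"
  using U by (intro epowr_mono nn_integral_Jensen_weight) auto
 also have "... = (\<integral>t. kk t * epowr (w t y) q) * epowr (\<integral>t. kk t) (q / U - 1)"
 proof -
  have "(1 - U / q) * (q / U) = q / U - 1" using U by (simp add: field_simps)
  then show ?thesis using U by (simp add: epowr_mult epowr_epowr)
 qed
 also have "... <= (\<integral>t. kk t * epowr (w t y) q) * epowr (ennreal (2 powr m)) (q / U - 1)"
  using U kk by (intro mult_left_mono epowr_mono) auto
 also have "... = ennreal (2 powr (m * (q / U - 1))) * (ennreal (tscale m (- k)) * (\<integral>t \<in> octave m k. epowr (w t y) q))"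
 by (subst e) (auto simp: epowr_ennreal powr_powr mult.commute)
 finally show ?thesis .
qed

lemma weighted_octave_mean_le:
 assumes m: "0 < m" and U: "0 < U" "U <= q" and [measurable]: "(\<lambda>t. w t y) \<in> bor"
 shows "epowr (weight m (ennreal q) \<beta> k * octave_mean m U w k y) q
  <= ennreal (2 powr (m * (q / U - 1 + \<bar>\<beta>\<bar> * q))) * (\<integral>t \<in> octave m k. epowr (ennreal (t powr - \<beta>) * w t y) q)"
proof -
 have q: "0 < q" using U by simp
 have iq: "enn2real (inverse (ennreal q)) = 1 / q" using q by (simp add: inverse_ennreal divide_inverse)
 have "epowr (weight m (ennreal q) \<beta> k * octave_mean m U w k y) q
   <= epowr (weight m (ennreal q) \<beta> k) q * (ennreal (2 powr (m * (q / U - 1))) * (ennreal (tscale m (- k)) * (\<integral>t \<in> octave m k. epowr (w t y) q)))"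
  unfolding epowr_mult using assms by (intro mult_left_mono octave_mean_power_le) auto
 also have "epowr (weight m (ennreal q) \<beta> k) q = ennreal (tscale m k * tscale m k powr (- \<beta> * q))"
 proof -
  have "m * rl k * (1 / q - \<beta>) * q = m * rl k + m * rl k * (- \<beta> * q)"
   using q by (simp add: field_simps)
  then show ?thesis unfolding weight_def iq
  by (simp add: epowr_ennreal powr_powr tscale_powr) (simp add: tscale_def powr_add[symmetric])
 qed
 also have "ennreal (tscale m k * tscale m k powr (- \<beta> * q)) * (ennreal (2 powr (m * (q / U - 1))) * (ennreal (tscale m (- k)) * (\<integral>t \<in> octave m k. epowr (w t y) q)))
   = ennreal (2 powr (m * (q / U - 1)) * ((tscale m k * tscale m (- k)) * tscale m k powr (- \<beta> * q))) * (\<integral>t \<in> octave m k. epowr (w t y) q)"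
 by (simp add: ennreal_mult mult_ac)
 also have "... = (\<integral>t \<in> octave m k. ennreal (2 powr (m * (q / U - 1)) * tscale m k powr (- \<beta> * q)) * epowr (w t y) q)"
 by (simp add: tscale_minus mult.assoc nn_integral_cmult)
 also have "... <= (\<integral>t \<in> octave m k. ennreal (2 powr (m * (q / U - 1 + \<bar>\<beta>\<bar> * q))) * epowr (ennreal (t powr - \<beta>) * w t y) q)"
 proof (rule nn_integral_mono, goal_cases)
  case (1 t)
  show ?case
  proof (cases "t \<in> octave m k")
   case True
   have "2 powr (m * (q / U - 1)) * tscale m k powr (- \<beta> * q) <= 2 powr (m * (q / U - 1)) * (2 powr (m * \<bar>- \<beta> * q\<bar>) * t powr (- \<beta> * q))"
   by (intro mult_left_mono octave_powr(2)[OF m True]) auto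
   also have "... = 2 powr (m * (q / U - 1 + \<bar>\<beta>\<bar> * q)) * (t powr (- \<beta>)) powr q"
    using q by (simp add: powr_powr powr_add[symmetric] abs_mult distrib_left)
   finally have "ennreal (2 powr (m * (q / U - 1)) * tscale m k powr (- \<beta> * q)) * epowr (w t y) q <= ennreal (2 powr (m * (q / U - 1 + \<bar>\<beta>\<bar> * q)) * (t powr (- \<beta>)) powr q) * epowr (w t y) q"
   by (intro mult_right_mono ennreal_leI) auto
   then show ?thesis using True by (simp add: epowr_mult epowr_ennreal ennreal_mult mult.assoc)
  qed simp
 qed
 also have "... = ennreal (2 powr (m * (q / U - 1 + \<bar>\<beta>\<bar> * q))) * (\<integral>t \<in> octave m k. epowr (ennreal (t powr - \<beta>) * w t y) q)"
 by (simp add: mult.assoc nn_integral_cmult)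
 finally show ?thesis .
qed

lemma weighted_octave_mean_le_sup:
 assumes m: "0 < m" and U: "0 < U" and [measurable]: "(\<lambda>t. w t y) \<in> bor"
  and N: "AE t in lborel. 0 < t --> ennreal (t powr - \<beta>) * w t y <= N"
 shows "weight m \<infinity> \<beta> k * octave_mean m U w k y <= ennreal (2 powr (m * (1 / U + \<bar>\<beta>\<bar>))) * N"
proof -
 have "(\<integral>t \<in> octave m k. epowr (w t y) U) <= (\<integral>t \<in> octave m k. epowr (ennreal (2 powr (m * \<bar>\<beta>\<bar>) * tscale m k powr \<beta>) * N) U)"
 proof (rule nn_integral_mono_AE)
  show "AE t in lborel. epowr (w t y) U * indicator (octave m k) t <= epowr (ennreal (2 powr (m * \<bar>\<beta>\<bar>) * tscale m k powr \<beta>) * N) U * indicator (octave m k) t"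
   using N
  proof eventually_elim
   case (elim t)
   show ?case
   proof (cases "t \<in> octave m k")
    case True
    then have t: "0 < t" by (rule octave_pos)
    have "w t y = ennreal (t powr \<beta>) * (ennreal (t powr - \<beta>) * w t y)"
     using t by (simp add: mult.assoc[symmetric] ennreal_mult'' [symmetric] powr_add[symmetric])
    also have "... <= ennreal (2 powr (m * \<bar>\<beta>\<bar>) * tscale m k powr \<beta>) * N"
     using elim t octave_powr(1)[OF m True] by (intro mult_mono ennreal_leI) auto
    finally show ?thesis using True U by (auto intro: epowr_mono)
   qed simp
  qed
 qed
 also have "... = epowr (ennreal (2 powr (m * \<bar>\<beta>\<bar>) * tscale m k powr \<beta>) * N) U * ennreal (tscale m k * (2 powr m - 1))"
 by (simp add: nn_integral_cmult_indicator emeasure_octave m)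
 also have "... <= epowr (ennreal (2 powr (m * \<bar>\<beta>\<bar>) * tscale m k powr \<beta>) * N) U * ennreal (tscale m k * 2 powr m)"
 by (intro mult_left_mono ennreal_leI) auto
 finally have "octave_mean m U w k y <= epowr (ennreal (tscale m (- k)) * (epowr (ennreal (2 powr (m * \<bar>\<beta>\<bar>) * tscale m k powr \<beta>) * N) U * ennreal (tscale m k * 2 powr m))) (1 / U)"
  unfolding octave_mean_def using U by (intro epowr_mono mult_left_mono) auto
 also have "... = epowr (ennreal (tscale m (- k) * tscale m k) * (ennreal (2 powr m) * epowr (ennreal (2 powr (m * \<bar>\<beta>\<bar>) * tscale m k powr \<beta>) * N) U)) (1 / U)"
 by (simp add: ennreal_mult mult_ac)
 also have "... = ennreal (2 powr (m / U)) * (ennreal (2 powr (m * \<bar>\<beta>\<bar>) * tscale m k powr \<beta>) * N)"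
  using U by (simp add: tscale_minus epowr_mult epowr_epowr epowr_ennreal powr_powr)
 finally have "weight m \<infinity> \<beta> k * octave_mean m U w k y <= ennreal (2 powr (m * rl k * (- \<beta>))) * (ennreal (2 powr (m / U)) * (ennreal (2 powr (m * \<bar>\<beta>\<bar>) * tscale m k powr \<beta>) * N))"
  unfolding weight_def by (intro mult_mono) auto
 also have "... = ennreal (2 powr (m * rl k * (- \<beta>)) * (2 powr (m / U) * (2 powr (m * \<bar>\<beta>\<bar>) * 2 powr (m * rl k * \<beta>)))) * N"
 by (simp add: ennreal_mult tscale_powr mult.assoc)
 also have "2 powr (m * rl k * (- \<beta>)) * (2 powr (m / U) * (2 powr (m * \<bar>\<beta>\<bar>) * 2 powr (m * rl k * \<beta>))) = 2 powr (m * (1 / U + \<bar>\<beta>\<bar>))"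
 by (simp add: powr_add[symmetric] algebra_simps)
 finally show ?thesis .
qed

section \<open>Tent norms as integrals of Borel functions\<close>

lemma nn_integral_lebesgue: "(\<integral>\<^sup>+ x. f x \<partial>lebesgue) = (\<integral>x. f x)"
 by (rule nn_integral_completion)

lemma nn_integral_lebesgue_on_pos: "(\<integral>\<^sup>+ t. h t \<partial>lebesgue_on {0<..}) = (\<integral>t \<in> {0<..}. h t)" for h :: "real => ennreal"
 by (subst nn_integral_restrict_space) (simp_all add: nn_integral_lebesgue)

lemma emeasure_lebesgue_borel: "A \<in> sets borel ==> emeasure lebesgue A = emeasure lborel A"
 using nn_integral_lebesgue[of "indicator A"] by (simp add: nn_integral_indicator)

text \<open>A jointly Borel function \<open>w\<close> in place of the Whitney average, together with
  \<open>lborel\<close> in place of \<open>lebesgue\<close>, makes Fubini available.\<close>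

lemma tent_norm_finite:
 assumes "p < \<infinity>" "q < \<infinity>" "0 < p" "0 < q" and w: "\<And>t x. 0 < t ==> whitney m r f t x = w t x"
 shows "tent_norm m p q r \<beta> f = epowr (\<integral>x. epowr (\<integral>t \<in> {0<..}. epowr (ennreal (t powr - \<beta>) * w t x) (enn2real q))
   (enn2real p / enn2real q)) (1 / enn2real p)"
proof -
 have "(\<integral>\<^sup>+ t. epowr (ennreal (t powr - \<beta>) * whitney m r f t x) (enn2real q) \<partial>lebesgue_on {0<..})
   = (\<integral>t \<in> {0<..}. epowr (ennreal (t powr - \<beta>) * w t x) (enn2real q))" for x
  unfolding nn_integral_lebesgue_on_pos by (intro nn_integral_cong) (auto simp: w split: split_indicator)
 moreover have "p \<noteq> top" "q \<noteq> top" using assms by auto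
 ultimately show ?thesis using assms
 by (simp add: tent_norm_def Lp_norm_def nn_integral_lebesgue epowr_epowr)
qed

lemma tent_norm_sup:
 assumes "p < \<infinity>" "0 < p"
 shows "tent_norm m p \<infinity> r \<beta> f = epowr (\<integral>x. epowr (esssup (lebesgue_on {0<..}) (\<lambda>t. ennreal (t powr - \<beta>) * whitney m r f t x)) (enn2real p)) (1 / enn2real p)"
 using assms by (auto simp: tent_norm_def Lp_norm_def nn_integral_lebesgue)

lemma tent_norm_Carleson:
 assumes "q < \<infinity>" and w: "\<And>t x. 0 < t ==> whitney m r f t x = w t x"
 shows "tent_norm m \<infinity> q r \<beta> f = (SUP (\<tau>, y) \<in> upper_half_space.
      epowr (\<integral>t \<in> {0<..<\<tau>}. ((\<integral>x \<in> ball y (\<tau> powr (1 / m)). epowr (ennreal (t powr - \<beta>) * w t x) (enn2real q))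
       / emeasure lborel (ball y (\<tau> powr (1 / m))))) (1 / enn2real q))"
proof -
 have e: "mean_integral (ball y \<rho>) (\<lambda>x. epowr (ennreal (t powr - \<beta>) * whitney m r f t x) (enn2real q))
   = (\<integral>x \<in> ball y \<rho>. epowr (ennreal (t powr - \<beta>) * w t x) (enn2real q)) / emeasure lborel (ball y \<rho>)" if "0 < t" for t y \<rho>
  unfolding mean_integral_def nn_integral_lebesgue using that by (simp add: emeasure_lebesgue_borel w)
 have "(\<integral>\<^sup>+ t \<in> {0<..<\<tau>}. mean_integral (ball y (\<tau> powr (1 / m))) (\<lambda>x. epowr (ennreal (t powr - \<beta>) * whitney m r f t x) (enn2real q)) \<partial>lebesgue)
   = (\<integral>t \<in> {0<..<\<tau>}. ((\<integral>x \<in> ball y (\<tau> powr (1 / m)). epowr (ennreal (t powr - \<beta>) * w t x) (enn2real q))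
       / emeasure lborel (ball y (\<tau> powr (1 / m)))))" for \<tau> y
  unfolding nn_integral_lebesgue by (intro nn_integral_cong) (auto simp: e split: split_indicator)
 then show ?thesis using assms(1) by (simp add: tent_norm_def)
qed

lemma AE_lebesgue_on: "S \<in> sets borel ==> (AE x in lebesgue_on S. P x) \<longleftrightarrow> (AE x in lborel. x \<in> S --> P x)"
 by (subst AE_restrict_space_iff) (auto simp: AE_completion_iff)

lemma borel_measurable_lebesgue_on:
 assumes "g \<in> bor" "\<And>x. x \<in> S ==> f x = g x"
 shows "f \<in> borel_measurable (lebesgue_on S)"
proof -
 have "g \<in> borel_measurable (lebesgue_on S)"
  using assms by (intro measurable_restrict_space1) (simp add: measurable_completion)
 then show ?thesis
  using assms(2) by (subst measurable_cong[where g=g]) (auto simp: space_restrict_space)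
qed

lemma sets_upper_half_space [measurable]: "(upper_half_space :: (real \<times> (real ^ 'n)) set) \<in> sets borel"
 unfolding upper_half_space_def by (intro borel_open open_Times) auto

lemma AE_lborel_swap:
 fixes w :: "real => real ^ 'n => ennreal"
 assumes [measurable]: "joint_borel w"
  and AE: "AE z in lborel. 0 < fst z --> w (fst z) (snd z) <= N"
 shows "AE x in lborel. AE t in lborel. 0 < t --> w t x <= N"
proof -
 have m: "(\<lambda>(t, x). w t x) \<in> borel_measurable (lborel \<Otimes>\<^sub>M lborel)" by measurable
 have "AE z in lborel \<Otimes>\<^sub>M lborel. 0 < fst z --> w (fst z) (snd z) <= N"
  using AE unfolding lborel_prod .
 then have "AE t in lborel. AE x in lborel. 0 < t --> w t x <= N"
 by (auto dest: lborel_pair.AE_pair)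
 then show ?thesis
 by (subst lborel_pair.AE_commute) measurable
qed

text \<open>Within an octave the \<open>U\<close>-mean in time is bounded by the
  \<open>q\<close>-mean because \<open>U < q\<close>, and summing over octaves restores the time
  integral. This happens for each \<open>x\<close> separately; only the Carleson case compares cells
  with balls.\<close>

theorem dnorm_le_tent_norm:
 assumes m: "0 < m" and p: "0 < p" and q: "0 < q" and U: "0 < U" "ennreal U < q"
 shows "\<exists>K::real. 0 <= K \<and> (\<forall>f (w :: real => real ^ 'n => ennreal). joint_borel w -->
   (\<forall>t x. 0 < t --> whitney m r f t x = w t x) -->
   dnorm p q (\<lambda>k x. weight m q \<beta> k * octave_mean m U w k x) <= ennreal K * tent_norm m p q r \<beta> f)"
proof (cases "q < \<infinity>")
 case qf: True
 define q' where "q' = enn2real q"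
 have q': "q = ennreal q'" "0 < q'" "U < q'"
  using q qf U by (auto simp: q'_def enn2real_positive_iff) (metis ennreal_enn2real ennreal_less_iff less_imp_le)
 define C where "C = 2 powr (m * (q' / U - 1 + \<bar>\<beta>\<bar> * q'))"
 have pw: "epowr (weight m q \<beta> k * octave_mean m U w k x) q' <= ennreal C * (\<integral>t \<in> octave m k. epowr (ennreal (t powr - \<beta>) * w t x) q')"
  if "joint_borel w" for w :: "real => real ^ 'n => ennreal" and k x
 proof -
  note [measurable] = that
  have "(\<lambda>t. w t x) \<in> bor" by measurable
  then show ?thesis unfolding C_def q'(1) using m U q' by (intro weighted_octave_mean_le) auto
 qed
 show ?thesis
 proof (cases "p < \<infinity>")
  case pf: True
  define p' where "p' = enn2real p"
  have p': "p = ennreal p'" "0 < p'"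
   using p pf by (auto simp: p'_def enn2real_positive_iff)
  show ?thesis
  proof (intro exI[of _ "C powr (1 / q')"] conjI allI impI)
   fix f and w :: "real => real ^ 'n => ennreal"
   assume [measurable]: "joint_borel w" and w: "\<forall>t x. 0 < t --> whitney m r f t x = w t x"
   define Y where "Y x = (\<integral>t \<in> {0<..}. epowr (ennreal (t powr - \<beta>) * w t x) q')" for x
   have le: "(\<Sum>\<^sup>+k. epowr (weight m q \<beta> k * octave_mean m U w k x) q') <= ennreal C * Y x" for x
   proof -
    have "(\<Sum>\<^sup>+k. epowr (weight m q \<beta> k * octave_mean m U w k x) q') <= (\<Sum>\<^sup>+k. ennreal C * (\<integral>t \<in> octave m k. epowr (ennreal (t powr - \<beta>) * w t x) q'))"
    by (intro nn_integral_mono pw) measurable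
    also have "... = ennreal C * (\<Sum>\<^sup>+k. (\<integral>t \<in> octave m k. epowr (ennreal (t powr - \<beta>) * w t x) q'))"
    by (rule nn_integral_cmult) simp
    also have "(\<Sum>\<^sup>+k. (\<integral>t \<in> octave m k. epowr (ennreal (t powr - \<beta>) * w t x) q')) = Y x"
     unfolding Y_def by (rule nn_integral_octaves(1)[OF m, symmetric]) measurable
    finally show ?thesis .
   qed
   have mY: "Y \<in> bor"
   proof -
    have [measurable]: "(\<lambda>(x, t). w t x) \<in> borel_measurable (borel \<Otimes>\<^sub>M lborel)"
     using measurable_pair_swap[OF \<open>joint_borel w\<close>]
    by (simp add: measurable_cong_sets[OF sets_pair_measure_cong[OF refl sets_lborel] refl] case_prod_beta)
    show ?thesis unfolding Y_def[abs_def] by measurable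
   qed
   have "dnorm p q (\<lambda>k x. weight m q \<beta> k * octave_mean m U w k x) <= epowr (\<integral>x. epowr (ennreal C * Y x) (p' / q')) (1 / p')"
    unfolding dnorm_def p'_def[symmetric] q'_def[symmetric] using pf qf p' q' le
   by (auto intro!: epowr_mono nn_integral_mono)
   also have "... = epowr (epowr (ennreal C) (p' / q') * (\<integral>x. epowr (Y x) (p' / q'))) (1 / p')"
    using mY by (simp add: epowr_mult nn_integral_cmult)
   also have "... = ennreal (C powr (1 / q')) * epowr (\<integral>x. epowr (Y x) (p' / q')) (1 / p')"
    using p' by (simp add: epowr_mult epowr_epowr epowr_ennreal C_def powr_powr)
   also have "epowr (\<integral>x. epowr (Y x) (p' / q')) (1 / p') = tent_norm m p q r \<beta> f"
    unfolding Y_def p'_def q'_def using pf qf p q w by (intro tent_norm_finite[symmetric]) auto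
   finally show "dnorm p q (\<lambda>k x. weight m q \<beta> k * octave_mean m U w k x) <= ennreal (C powr (1 / q')) * tent_norm m p q r \<beta> f" .
  qed simp
 next
  case pi: False
  then have pi': "p = \<infinity>" by (auto simp: less_top[symmetric])
  define \<kappa>n where "\<kappa>n = unit_ball_vol (real CARD('n))"
  have kn: "0 < \<kappa>n" by (simp add: \<kappa>n_def unit_ball_vol_pos)
  \<comment> \<open>Points of \<open>cell3 j x\<close> have distance less than
    \<open>2 n 2^j\<close> from \<open>x\<close>, and \<open>2 n <= 2^(n+1)\<close>, so the ball of
    radius \<open>2^(j+a)\<close> contains the set.\<close>
  define a where "a = int CARD('n) + 1"
  define D where "D = C * (\<kappa>n * 2 powr (rl a * real CARD('n)))"
  have D0: "0 <= D" using kn by (simp add: D_def C_def)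
  show ?thesis
  proof (intro exI[of _ "D powr (1 / q')"] conjI allI impI)
   fix f and w :: "real => real ^ 'n => ennreal"
   assume [measurable]: "joint_borel w" and w: "\<forall>t x. 0 < t --> whitney m r f t x = w t x"
   define G where "G t x = epowr (ennreal (t powr - \<beta>) * w t x) q'" for t x
   have [measurable]: "joint_borel G" unfolding G_def by measurable
   have tent: "tent_norm m p q r \<beta> f = (SUP (\<tau>, y) \<in> upper_half_space.
      epowr (\<integral>t \<in> {0<..<\<tau>}. ((\<integral>x \<in> ball y (\<tau> powr (1 / m)). G t x)
       / emeasure lborel (ball y (\<tau> powr (1 / m))))) (1 / q'))"
    using tent_norm_Carleson[OF qf, of m r f w \<beta>] w by (simp add: G_def q'_def pi')
   have main: "avg j (cell3 j x) (\<lambda>y. (\<Sum>\<^sup>+k\<in>{..j}. epowr (weight m q \<beta> k * octave_mean m U w k y) q')) <= ennreal D * epowr (tent_norm m p q r \<beta> f) q'" for j x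
   proof -
    define \<tau> where "\<tau> = tscale m (j + a)"
    have \<tau>: "\<tau> powr (1 / m) = 2 powr (rl j + rl a)" "0 < \<tau>"
     unfolding \<tau>_def using tscale_root[OF m, of "j + a"] by auto
    define \<rho> where "\<rho> = 2 powr (rl j + rl a)"
    have sub: "cell3 j x \<subseteq> ball x \<rho>"
    proof
     fix z assume z: "z \<in> cell3 j x"
     have "\<bar>x $ i - z $ i\<bar> < (rl 1 + 1) * 2 powr rl j" for i
      using z by (intro idx_diff_bound) (simp add: cell3_def abs_minus_commute)
     from dist_bound[OF this] have "dist x z < real CARD('n) * 2 * 2 powr rl j" by simp
     also have "... <= (2 powr rl a) * 2 powr rl j"
     proof (intro mult_right_mono)
      have "real CARD('n) <= 2 ^ CARD('n)" using less_exp[of "CARD('n)"] by (metis less_imp_le of_nat_le_iff of_nat_numeral of_nat_power)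
      then show "real CARD('n) * 2 <= 2 powr rl a" by (simp add: a_def powr_add powr_realpow)
     qed simp
     also have "... = \<rho>" by (simp add: \<rho>_def powr_add)
     finally show "z \<in> ball x \<rho>" by simp
    qed
    have ball: "emeasure lborel (ball x \<rho>) = ennreal (\<kappa>n * 2 powr (rl a * real CARD('n)) * 2 powr (rl j * real CARD('n)))"
    proof -
     have "\<rho> ^ CARD('n) = 2 powr (rl a * real CARD('n)) * 2 powr (rl j * real CARD('n))"
     by (simp add: \<rho>_def powr_realpow[symmetric] powr_powr powr_add[symmetric] algebra_simps)
     then show ?thesis by (simp add: emeasure_ball \<rho>_def \<kappa>n_def mult.assoc)
    qed
    have swap: "(\<integral>y. (\<integral>t. G t y * indicator {0<..<\<tau>} t * indicator (ball x \<rho>) y))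
      = (\<integral>t. (\<integral>y. G t y * indicator {0<..<\<tau>} t * indicator (ball x \<rho>) y))"
    proof (rule lborel_pair.Fubini')
     have "ball x \<rho> \<in> sets borel" by simp
     note [measurable] = this
     show "(\<lambda>(t, y). G t y * indicator {0<..<\<tau>} t * indicator (ball x \<rho>) y) \<in> borel_measurable (lborel \<Otimes>\<^sub>M lborel)"
     by measurable
    qed
    have "avg j (cell3 j x) (\<lambda>y. (\<Sum>\<^sup>+k\<in>{..j}. epowr (weight m q \<beta> k * octave_mean m U w k y) q'))
     <= avg j (cell3 j x) (\<lambda>y. ennreal C * (\<integral>t \<in> {0<..<\<tau>}. G t y))"
    proof (rule avg_mono)
     fix y
     have [measurable]: "(\<lambda>t. G t y) \<in> bor" by measurable
     have "(\<Sum>\<^sup>+k\<in>{..j}. epowr (weight m q \<beta> k * octave_mean m U w k y) q') <= (\<Sum>\<^sup>+k\<in>{..j}. ennreal C * (\<integral>t \<in> octave m k. G t y))"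
      unfolding G_def by (intro nn_integral_mono pw) measurable
     also have "... = ennreal C * (\<Sum>\<^sup>+k\<in>{..j}. (\<integral>t \<in> octave m k. G t y))"
     by (rule nn_integral_cmult) simp
     also have "(\<Sum>\<^sup>+k\<in>{..j}. (\<integral>t \<in> octave m k. G t y)) = (\<integral>t \<in> {0<..<tscale m (j + 1)}. G t y)"
     by (rule nn_integral_octaves(2)[OF m, symmetric]) measurable
     also have "... <= (\<integral>t \<in> {0<..<\<tau>}. G t y)"
      using tscale_mono[of m "j + 1" "j + a"] m unfolding \<tau>_def a_def by (intro nn_integral_mono) (auto split: split_indicator)
     finally show "(\<Sum>\<^sup>+k\<in>{..j}. epowr (weight m q \<beta> k * octave_mean m U w k y) q') <= ennreal C * (\<integral>t \<in> {0<..<\<tau>}. G t y)"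
     by (simp add: mult_left_mono)
    qed
    also have "... <= avg j (ball x \<rho>) (\<lambda>y. ennreal C * (\<integral>t \<in> {0<..<\<tau>}. G t y))"
    by (rule avg_subset[OF sub])
    also have "... = ennreal (2 powr (- rl j * real CARD('n))) * (\<integral>y. ennreal C * (\<integral>t. G t y * indicator {0<..<\<tau>} t * indicator (ball x \<rho>) y))"
     unfolding avg_def by (intro arg_cong[where f="(*) _"] nn_integral_cong) (simp split: split_indicator)
    also have "(\<integral>y. ennreal C * (\<integral>t. G t y * indicator {0<..<\<tau>} t * indicator (ball x \<rho>) y)) = ennreal C * (\<integral>y. (\<integral>t. G t y * indicator {0<..<\<tau>} t * indicator (ball x \<rho>) y))"
    proof (rule nn_integral_cmult)
     have [measurable]: "(\<lambda>(x, t). G t x) \<in> borel_measurable (borel \<Otimes>\<^sub>M lborel)"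
      using measurable_pair_swap[OF \<open>joint_borel G\<close>]
     by (simp add: measurable_cong_sets[OF sets_pair_measure_cong[OF refl sets_lborel] refl] case_prod_beta)
     have "ball x \<rho> \<in> sets borel" by simp
     note [measurable] = this
     show "(\<lambda>y. (\<integral>t. G t y * indicator {0<..<\<tau>} t * indicator (ball x \<rho>) y)) \<in> borel_measurable lborel" by measurable
    qed
    also note swap
    also have "(\<integral>t. (\<integral>y. G t y * indicator {0<..<\<tau>} t * indicator (ball x \<rho>) y)) = (\<integral>t \<in> {0<..<\<tau>}. (\<integral>y \<in> ball x \<rho>. G t y))"
    by (intro nn_integral_cong) (auto split: split_indicator)
    also have "... = (\<integral>t \<in> {0<..<\<tau>}. (emeasure lborel (ball x \<rho>) * ((\<integral>y \<in> ball x \<rho>. G t y) / emeasure lborel (ball x \<rho>))))"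
     using kn by (intro nn_integral_cong) (simp add: ball ennreal_times_divide mult_divide_eq_ennreal mult.commute[of "ennreal _"])
    also have "... = emeasure lborel (ball x \<rho>) * (\<integral>t \<in> {0<..<\<tau>}. ((\<integral>y \<in> ball x \<rho>. G t y) / emeasure lborel (ball x \<rho>)))"
    proof -
     have "ball x \<rho> \<in> sets borel" by simp
     note [measurable] = this
     have [measurable]: "(\<lambda>(t, x). G t x) \<in> borel_measurable (borel \<Otimes>\<^sub>M lborel)" by measurable
     show ?thesis unfolding mult.assoc by (rule nn_integral_cmult) measurable
    qed
    also have "(\<integral>t \<in> {0<..<\<tau>}. ((\<integral>y \<in> ball x \<rho>. G t y) / emeasure lborel (ball x \<rho>))) <= epowr (tent_norm m p q r \<beta> f) q'"
    proof -
     have "epowr (\<integral>t \<in> {0<..<\<tau>}. ((\<integral>y \<in> ball x \<rho>. G t y) / emeasure lborel (ball x \<rho>))) (1 / q') <= tent_norm m p q r \<beta> f"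
      unfolding tent using \<tau> by (intro SUP_upper2[of "(\<tau>, x)"]) (auto simp: upper_half_space_def \<rho>_def)
     then show ?thesis using q' by (simp add: epowr_le_iff)
    qed
    finally have "avg j (cell3 j x) (\<lambda>y. (\<Sum>\<^sup>+k\<in>{..j}. epowr (weight m q \<beta> k * octave_mean m U w k y) q'))
     <= ennreal (2 powr (- rl j * real CARD('n))) * (ennreal C * (emeasure lborel (ball x \<rho>) * epowr (tent_norm m p q r \<beta> f) q'))"
    by (simp add: mult_left_mono)
    also have "... = ennreal (2 powr (- rl j * real CARD('n)) * (C * (\<kappa>n * 2 powr (rl a * real CARD('n)) * 2 powr (rl j * real CARD('n))))) * epowr (tent_norm m p q r \<beta> f) q'"
     unfolding ball using kn by (simp add: ennreal_mult C_def mult.assoc)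
    also have "2 powr (- rl j * real CARD('n)) * (C * (\<kappa>n * 2 powr (rl a * real CARD('n)) * 2 powr (rl j * real CARD('n)))) = D"
    proof -
     have "2 powr (- rl j * real CARD('n)) * 2 powr (rl j * real CARD('n)) = (1::real)"
     by (simp add: powr_add[symmetric])
     then show ?thesis by (simp add: D_def mult_ac)
    qed
    finally show ?thesis .
   qed
   have "dnorm p q (\<lambda>k x. weight m q \<beta> k * octave_mean m U w k x) <= epowr (ennreal D * epowr (tent_norm m p q r \<beta> f) q') (1 / q')"
    unfolding dnorm_def q'_def[symmetric] using pi qf q' main by (auto intro!: SUP_least epowr_mono)
   also have "... = ennreal (D powr (1 / q')) * tent_norm m p q r \<beta> f"
    using q' D0 by (simp add: epowr_mult epowr_epowr epowr_ennreal)
   finally show "dnorm p q (\<lambda>k x. weight m q \<beta> k * octave_mean m U w k x) <= ennreal (D powr (1 / q')) * tent_norm m p q r \<beta> f" .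
  qed simp
 qed
next
 case qi: False
 then have qi': "q = \<infinity>" by (auto simp: less_top[symmetric])
 define C where "C = 2 powr (m * (1 / U + \<bar>\<beta>\<bar>))"
 show ?thesis
 proof (intro exI[of _ C] conjI allI impI)
  show "0 <= C" by (simp add: C_def)
  fix f and w :: "real => real ^ 'n => ennreal"
  assume [measurable]: "joint_borel w" and w: "\<forall>t x. 0 < t --> whitney m r f t x = w t x"
  have [measurable]: "(\<lambda>t. w t x) \<in> bor" for x by measurable
  show "dnorm p q (\<lambda>k x. weight m q \<beta> k * octave_mean m U w k x) <= ennreal C * tent_norm m p q r \<beta> f"
  proof (cases "p < \<infinity>")
   case pf: True
   define p' where "p' = enn2real p"
   have p': "p = ennreal p'" "0 < p'"
    using p pf by (auto simp: p'_def enn2real_positive_iff)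
   define E where "E x = esssup (lebesgue_on {0<..}) (\<lambda>t. ennreal (t powr - \<beta>) * whitney m r f t x)" for x
   have le: "(SUP k. weight m q \<beta> k * octave_mean m U w k x) <= ennreal C * E x" for x
   proof (rule SUP_least)
    fix k
    have "AE t in lebesgue_on {0<..}. ennreal (t powr - \<beta>) * whitney m r f t x <= E x" unfolding E_def by (rule esssup_AE)
    then have "AE t in lborel. 0 < t --> ennreal (t powr - \<beta>) * w t x <= E x"
     using w by (subst (asm) AE_lebesgue_on) (auto elim!: eventually_mono)
    then show "weight m q \<beta> k * octave_mean m U w k x <= ennreal C * E x"
     unfolding C_def qi' using m U by (intro weighted_octave_mean_le_sup) auto
   qed
   text \<open>The function \<open>E\<close> need not be measurable, so constants are moved at the level of suprema.\<close>
   define S where "S x = (SUP k. weight m q \<beta> k * octave_mean m U w k x)" for x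
   have [measurable]: "S \<in> bor" unfolding S_def[abs_def] by measurable
   have C0: "0 < C" by (simp add: C_def)
   have SE: "ennreal (1 / C) * S x <= E x" for x
   proof -
    have "ennreal (1 / C) * S x <= ennreal (1 / C) * (ennreal C * E x)" using le[of x] unfolding S_def by (rule mult_left_mono) simp
    then show ?thesis using C0 by (simp add: mult.assoc[symmetric] ennreal_mult'' [symmetric])
   qed
   have "S x = ennreal C * (ennreal (1 / C) * S x)" for x
    using C0 by (simp add: mult.assoc[symmetric] ennreal_mult'' [symmetric])
   then have "dnorm p q (\<lambda>k x. weight m q \<beta> k * octave_mean m U w k x) = epowr (\<integral>x. epowr (ennreal C * (ennreal (1 / C) * S x)) p') (1 / p')"
    unfolding dnorm_def S_def[symmetric] using pf qi by (simp add: p'_def)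
   also have "... = epowr (epowr (ennreal C) p' * (\<integral>x. epowr (ennreal (1 / C) * S x) p')) (1 / p')"
   by (subst epowr_mult, subst nn_integral_cmult) auto
   also have "... = ennreal C * epowr (\<integral>x. epowr (ennreal (1 / C) * S x) p') (1 / p')"
    using p' by (simp add: epowr_mult[of "epowr _ _"] epowr_epowr)
   also have "... <= ennreal C * epowr (\<integral>x. epowr (E x) p') (1 / p')"
    using p' SE by (intro mult_left_mono epowr_mono nn_integral_mono) auto
   also have "epowr (\<integral>x. epowr (E x) p') (1 / p') = tent_norm m p q r \<beta> f"
    unfolding E_def p'_def qi' using pf p by (rule tent_norm_sup[symmetric])
   finally show ?thesis .
  next
   case pi: False
   define N where "N = esssup (lebesgue_on upper_half_space) (\<lambda>(t, x). ennreal (t powr - \<beta>) * whitney m r f t x)"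
   have "AE z in lebesgue_on upper_half_space. (\<lambda>(t, x). ennreal (t powr - \<beta>) * whitney m r f t x) z <= N"
    unfolding N_def by (rule esssup_AE)
   then have "AE z in lborel. z \<in> upper_half_space --> (\<lambda>(t, x). ennreal (t powr - \<beta>) * whitney m r f t x) z <= N"
   by (subst (asm) AE_lebesgue_on) auto
   then have "AE z in lborel. 0 < fst z --> ennreal (fst z powr - \<beta>) * w (fst z) (snd z) <= N"
   by eventually_elim (use w in \<open>auto simp: upper_half_space_def\<close>)
   then have "AE x in lborel. AE t in lborel. 0 < t --> ennreal (t powr - \<beta>) * w t x <= N"
   by (intro AE_lborel_swap) measurable
   then have "AE x in lborel. (SUP k. weight m q \<beta> k * octave_mean m U w k x) <= ennreal C * N"
   proof eventually_elim
    case (elim x)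
    then show ?case unfolding C_def qi' using m U by (intro SUP_least weighted_octave_mean_le_sup) auto
   qed
   then have "dnorm p q (\<lambda>k x. weight m q \<beta> k * octave_mean m U w k x) <= ennreal C * N"
    unfolding dnorm_def using pi qi by (auto intro!: esssup_I)
   then show ?thesis using pi qi by (simp add: tent_norm_def N_def)
  qed
 qed
qed

lemma set_nn_integral_eq_avg:
 "(\<integral>y \<in> S. g y) = ennreal (2 powr (rl R * real CARD('n))) * avg R (S :: (real ^ 'n) set) g"
 unfolding avg_def by (simp add: mult.assoc[symmetric] ennreal_mult'' [symmetric] powr_add[symmetric])

lemma octave_power_integral_le:
 assumes m: "0 < m" and q: "0 < q" and b: "\<And>t. t \<in> octave m k ==> w t <= b"
 shows "(\<integral>t \<in> octave m k. epowr (ennreal (t powr - \<beta>) * w t) q)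
  <= ennreal (2 powr (m * (\<bar>\<beta>\<bar> * q + 1))) * epowr (weight m (ennreal q) \<beta> k * b) q"
proof -
 have iq: "enn2real (inverse (ennreal q)) = 1 / q" using q by (simp add: inverse_ennreal divide_inverse)
 have "(\<integral>t \<in> octave m k. epowr (ennreal (t powr - \<beta>) * w t) q)
   <= (\<integral>t \<in> octave m k. epowr (ennreal (2 powr (m * \<bar>\<beta>\<bar>) * tscale m k powr - \<beta>) * b) q)"
 proof (intro nn_integral_mono)
  fix t
  have "ennreal (t powr - \<beta>) * w t <= ennreal (2 powr (m * \<bar>\<beta>\<bar>) * tscale m k powr - \<beta>) * b" if "t \<in> octave m k"
   using that octave_powr(1)[OF m that, of "- \<beta>"] b by (intro mult_mono ennreal_leI) auto
  then show "epowr (ennreal (t powr - \<beta>) * w t) q * indicator (octave m k) t <= epowr (ennreal (2 powr (m * \<bar>\<beta>\<bar>) * tscale m k powr - \<beta>) * b) q * indicator (octave m k) t"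
   using q by (auto intro!: epowr_mono split: split_indicator)
 qed
 also have "... = epowr (ennreal (2 powr (m * \<bar>\<beta>\<bar>) * tscale m k powr - \<beta>) * b) q * ennreal (tscale m k * (2 powr m - 1))"
 by (simp add: nn_integral_cmult_indicator emeasure_octave m)
 also have "... <= epowr (ennreal (2 powr (m * \<bar>\<beta>\<bar>) * tscale m k powr - \<beta>) * b) q * ennreal (tscale m k * 2 powr m)"
 by (intro mult_left_mono ennreal_leI) auto
 also have "... = ennreal ((2 powr (m * \<bar>\<beta>\<bar>) * tscale m k powr - \<beta>) powr q * (tscale m k * 2 powr m)) * epowr b q"
 by (simp add: epowr_mult epowr_ennreal ennreal_mult powr_mult mult_ac)
 also have "(2 powr (m * \<bar>\<beta>\<bar>) * tscale m k powr - \<beta>) powr q * (tscale m k * 2 powr m) = 2 powr (m * (\<bar>\<beta>\<bar> * q + 1)) * (2 powr (m * rl k * (1 / q - \<beta>))) powr q"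
 proof -
  have "m * rl k * (1 / q - \<beta>) * q = m * rl k * (- \<beta>) * q + m * rl k"
   using q by (simp add: field_simps)
  then show ?thesis by (simp add: tscale_def powr_mult powr_powr powr_add[symmetric] algebra_simps)
 qed
 finally show ?thesis by (simp add: weight_def iq epowr_mult epowr_ennreal ennreal_mult mult.assoc)
qed

lemma octave_power_le_sup:
 assumes m: "0 < m" and t: "t \<in> octave m k" and b: "w <= b"
 shows "ennreal (t powr - \<beta>) * w <= ennreal (2 powr (m * \<bar>\<beta>\<bar>)) * (weight m \<infinity> \<beta> k * b)"
proof -
 have "ennreal (t powr - \<beta>) * w <= ennreal (2 powr (m * \<bar>\<beta>\<bar>) * tscale m k powr - \<beta>) * b"
  using octave_powr(1)[OF m t, of "- \<beta>"] b by (intro mult_mono ennreal_leI) auto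
 then show ?thesis by (simp add: weight_def tscale_powr ennreal_mult mult.assoc)
qed

lemma measurable_swap_lborel:
 assumes "joint_borel w"
 shows "(\<lambda>(x, t). w t x) \<in> borel_measurable (borel \<Otimes>\<^sub>M lborel)"
 using measurable_pair_swap[OF assms]
 by (simp add: measurable_cong_sets[OF sets_pair_measure_cong[OF refl sets_lborel] refl] case_prod_beta)

lemma ennreal_divide_mono_right: "(b :: ennreal) <= a ==> x / a <= x / b"
 by (simp add: divide_ennreal_def mult_left_mono ennreal_inverse_anti_mono)

text \<open>On each octave the Whitney average enters through a majorant \<open>b k\<close> that is
  constant in time, so the time integrals are trivial. In the Carleson case a ball of radius
  \<open>\<tau>^(1/m) < 2^(j+1)\<close> fits into \<open>cell3 (j + 1)\<close> of its
  centre.\<close>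

theorem tent_norm_le_dnorm:
 assumes m: "0 < m" and p: "0 < p" and q: "0 < q"
 shows "\<exists>K::real. 0 <= K \<and> (\<forall>f (w :: real => real ^ 'n => ennreal) b. joint_borel w -->
   (\<forall>t x. 0 < t --> whitney m r f t x = w t x) -->
   (\<forall>k. b k \<in> bor) --> (\<forall>k t x. t \<in> octave m k --> w t x <= b k x) -->
   tent_norm m p q r \<beta> f <= ennreal K * dnorm p q (\<lambda>k x. weight m q \<beta> k * b k x))"
proof (cases "q < \<infinity>")
 case qf: True
 define q' where "q' = enn2real q"
 have q': "q = ennreal q'" "0 < q'"
  using q qf by (auto simp: q'_def enn2real_positive_iff)
 define C where "C = 2 powr (m * (\<bar>\<beta>\<bar> * q' + 1))"
 have C0: "0 < C" by (simp add: C_def)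
 show ?thesis
 proof (cases "p < \<infinity>")
  case pf: True
  define p' where "p' = enn2real p"
  have p': "p = ennreal p'" "0 < p'"
   using p pf by (auto simp: p'_def enn2real_positive_iff)
  show ?thesis
  proof (intro exI[of _ "C powr (1 / q')"] conjI allI impI)
   fix f and w :: "real => real ^ 'n => ennreal" and b
   assume [measurable]: "joint_borel w" and w: "\<forall>t x. 0 < t --> whitney m r f t x = w t x"
    and mb: "\<forall>k. b k \<in> bor" and b: "\<forall>k t x. t \<in> octave m k --> w t x <= b k x"
   note [measurable] = mb[rule_format]
   define Z where "Z x = (\<Sum>\<^sup>+k. epowr (weight m q \<beta> k * b k x) q')" for x
   have [measurable]: "Z \<in> bor"
    unfolding Z_def[abs_def] by (intro borel_measurable_nn_integral_count_space) auto
   have le: "(\<integral>t \<in> {0<..}. epowr (ennreal (t powr - \<beta>) * w t x) q') <= ennreal C * Z x" for x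
   proof -
    have "(\<integral>t \<in> {0<..}. epowr (ennreal (t powr - \<beta>) * w t x) q') = (\<Sum>\<^sup>+k. (\<integral>t \<in> octave m k. epowr (ennreal (t powr - \<beta>) * w t x) q'))"
    by (rule nn_integral_octaves(1)[OF m]) measurable
    also have "... <= (\<Sum>\<^sup>+k. ennreal C * epowr (weight m q \<beta> k * b k x) q')"
     unfolding C_def q'(1) using b m q' by (intro nn_integral_mono octave_power_integral_le) auto
    also have "... = ennreal C * Z x" unfolding Z_def by (rule nn_integral_cmult) simp
    finally show ?thesis .
   qed
   have "tent_norm m p q r \<beta> f = epowr (\<integral>x. epowr (\<integral>t \<in> {0<..}. epowr (ennreal (t powr - \<beta>) * w t x) q') (p' / q')) (1 / p')"
    unfolding p'_def q'_def using pf qf p q w by (intro tent_norm_finite) auto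
   also have "... <= epowr (\<integral>x. epowr (ennreal C * Z x) (p' / q')) (1 / p')"
    using p' q' le by (intro epowr_mono nn_integral_mono) auto
   also have "... = ennreal (C powr (1 / q')) * epowr (\<integral>x. epowr (Z x) (p' / q')) (1 / p')"
    using p' by (simp add: epowr_mult nn_integral_cmult epowr_epowr epowr_ennreal C_def powr_powr)
   also have "epowr (\<integral>x. epowr (Z x) (p' / q')) (1 / p') = dnorm p q (\<lambda>k x. weight m q \<beta> k * b k x)"
    unfolding dnorm_def Z_def p'_def[symmetric] q'_def[symmetric] using pf qf by simp
   finally show "tent_norm m p q r \<beta> f <= ennreal (C powr (1 / q')) * dnorm p q (\<lambda>k x. weight m q \<beta> k * b k x)" .
  qed simp
 next
  case pi: False
  then have pi': "p = \<infinity>" by (auto simp: less_top[symmetric])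
  define \<kappa>n where "\<kappa>n = unit_ball_vol (real CARD('n))"
  have kn: "0 < \<kappa>n" by (simp add: \<kappa>n_def unit_ball_vol_pos)
  define D where "D = C * 2 powr real CARD('n) / \<kappa>n"
  have D0: "0 <= D" using kn by (simp add: D_def C_def)
  show ?thesis
  proof (intro exI[of _ "D powr (1 / q')"] conjI allI impI)
   fix f and w :: "real => real ^ 'n => ennreal" and b
   assume [measurable]: "joint_borel w" and w: "\<forall>t x. 0 < t --> whitney m r f t x = w t x"
    and mb: "\<forall>k. b k \<in> bor" and b: "\<forall>k t x. t \<in> octave m k --> w t x <= b k x"
   note [measurable] = mb[rule_format]
   define G where "G t x = epowr (ennreal (t powr - \<beta>) * w t x) q'" for t x
   have mG [measurable]: "joint_borel G" unfolding G_def by measurable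
   define N where "N = dnorm p q (\<lambda>k x. weight m q \<beta> k * b k x)"
   have N: "avg j (cell3 j x) (\<lambda>y. (\<Sum>\<^sup>+k\<in>{..j}. epowr (weight m q \<beta> k * b k y) q')) <= epowr N q'" for j x
   proof -
    have "epowr (avg j (cell3 j x) (\<lambda>y. (\<Sum>\<^sup>+k\<in>{..j}. epowr (weight m q \<beta> k * b k y) q'))) (1 / q') <= N"
     unfolding N_def dnorm_def q'_def[symmetric] using pi qf by (auto intro: SUP_upper2[of "(j, x)"])
    then show ?thesis using q' by (simp add: epowr_le_iff)
   qed
   have "epowr (\<integral>t \<in> {0<..<\<tau>}. ((\<integral>x \<in> ball y (\<tau> powr (1 / m)). G t x) / emeasure lborel (ball y (\<tau> powr (1 / m))))) (1 / q') <= epowr (ennreal D * epowr N q') (1 / q')"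
    if \<tau>: "0 < \<tau>" for \<tau> y
   proof (rule epowr_mono)
    obtain j where j: "\<tau> \<in> octave m j" using octave_ex[OF m \<tau>] by auto
    define \<rho> where "\<rho> = \<tau> powr (1 / m)"
    have "tscale m j powr (1 / m) <= \<rho>" "\<rho> < tscale m (j + 1) powr (1 / m)"
     using j m \<tau> unfolding \<rho>_def octave_def by (auto intro!: powr_mono2 powr_less_mono2)
    then have \<rho>: "2 powr rl j <= \<rho>" "\<rho> < 2 powr rl (j + 1)"
     unfolding tscale_root[OF m] by auto
    have sub: "ball y \<rho> \<subseteq> cell3 (j + 1) y"
    proof
     fix z assume z: "z \<in> ball y \<rho>"
     have "\<bar>idx (j + 1) z $ i - idx (j + 1) y $ i\<bar> <= 1" for i
     proof -
      have "\<bar>z $ i - y $ i\<bar> <= dist y z" using component_le_norm_cart[of "z - y" i] by (simp add: dist_norm norm_minus_commute)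
      then have "\<bar>z $ i - y $ i\<bar> < 2 powr rl (j + 1)" using z \<rho> by simp
      then have "\<bar>z $ i / 2 powr rl (j + 1) - y $ i / 2 powr rl (j + 1)\<bar> < 1"
      by (simp add: diff_divide_distrib[symmetric] del: of_int_add)
      then show ?thesis unfolding idx_nth by linarith
     qed
     then show "z \<in> cell3 (j + 1) y" by (simp add: cell3_def)
    qed
    have vol: "ennreal (\<kappa>n * 2 powr (rl j * real CARD('n))) <= emeasure lborel (ball y \<rho>)"
    proof -
     have "(2 powr rl j) ^ CARD('n) <= \<rho> ^ CARD('n)" using \<rho> by (intro power_mono) auto
     then have "\<kappa>n * 2 powr (rl j * real CARD('n)) <= \<kappa>n * \<rho> ^ CARD('n)"
      using kn by (intro mult_left_mono) (auto simp: powr_realpow[symmetric] powr_powr)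
     then show ?thesis using \<rho> by (simp add: emeasure_ball \<rho>_def \<kappa>n_def ennreal_leI)
    qed
    have "(\<integral>t \<in> {0<..<\<tau>}. ((\<integral>x \<in> ball y \<rho>. G t x) / emeasure lborel (ball y \<rho>)))
     <= (\<integral>t \<in> {0<..<tscale m (j + 1)}. ((\<integral>x \<in> cell3 (j + 1) y. G t x) / ennreal (\<kappa>n * 2 powr (rl j * real CARD('n)))))"
    proof (rule nn_integral_mono)
     fix t
     have "(\<integral>x \<in> ball y \<rho>. G t x) / emeasure lborel (ball y \<rho>) <= (\<integral>x \<in> cell3 (j + 1) y. G t x) / emeasure lborel (ball y \<rho>)"
      using sub by (intro divide_right_mono_ennreal nn_integral_mono) (auto split: split_indicator)
     also have "... <= (\<integral>x \<in> cell3 (j + 1) y. G t x) / ennreal (\<kappa>n * 2 powr (rl j * real CARD('n)))"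
     by (rule ennreal_divide_mono_right[OF vol])
     finally show "((\<integral>x \<in> ball y \<rho>. G t x) / emeasure lborel (ball y \<rho>)) * indicator {0<..<\<tau>} t <= ((\<integral>x \<in> cell3 (j + 1) y. G t x) / ennreal (\<kappa>n * 2 powr (rl j * real CARD('n)))) * indicator {0<..<tscale m (j + 1)} t"
      using j by (auto simp: octave_def split: split_indicator)
    qed
    also have "... = (\<integral>t \<in> {0<..<tscale m (j + 1)}. (\<integral>x \<in> cell3 (j + 1) y. G t x)) / ennreal (\<kappa>n * 2 powr (rl j * real CARD('n)))"
    proof -
     have [measurable]: "(\<lambda>(t, x). G t x) \<in> borel_measurable (borel \<Otimes>\<^sub>M lborel)" by measurable
     have "(\<lambda>t. (\<integral>x \<in> cell3 (j + 1) y. G t x) * indicator {0<..<tscale m (j + 1)} t) \<in> borel_measurable lborel" by measurable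
     from nn_integral_divide[OF this, of "ennreal (\<kappa>n * 2 powr (rl j * real CARD('n)))"] show ?thesis
     by (simp add: divide_ennreal_def mult_ac)
    qed
    also have "(\<integral>t \<in> {0<..<tscale m (j + 1)}. (\<integral>x \<in> cell3 (j + 1) y. G t x))
      = (\<integral>t. (\<integral>x. G t x * indicator {0<..<tscale m (j + 1)} t * indicator (cell3 (j + 1) y) x))"
    by (intro nn_integral_cong) (auto split: split_indicator)
    also have "... = (\<integral>x. (\<integral>t. G t x * indicator {0<..<tscale m (j + 1)} t * indicator (cell3 (j + 1) y) x))"
    by (rule lborel_pair.Fubini'[symmetric]) measurable
    also have "... = (\<integral>x \<in> cell3 (j + 1) y. (\<integral>t \<in> {0<..<tscale m (j + 1)}. G t x))"
    by (intro nn_integral_cong) (auto split: split_indicator)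
    also have "... <= (\<integral>x. ennreal C * ((\<Sum>\<^sup>+k\<in>{..j + 1}. epowr (weight m q \<beta> k * b k x) q') * indicator (cell3 (j + 1) y) x))"
    proof (rule nn_integral_mono)
     fix x
     have "(\<integral>t \<in> {0<..<tscale m (j + 1)}. G t x) = (\<Sum>\<^sup>+k\<in>{..j}. (\<integral>t \<in> octave m k. G t x))"
     by (rule nn_integral_octaves(2)[OF m]) measurable
     also have "... <= (\<Sum>\<^sup>+k\<in>{..j}. ennreal C * epowr (weight m q \<beta> k * b k x) q')"
      unfolding C_def G_def q'(1) using b m q' by (intro nn_integral_mono octave_power_integral_le) auto
     also have "... = ennreal C * (\<Sum>\<^sup>+k\<in>{..j}. epowr (weight m q \<beta> k * b k x) q')"
     by (rule nn_integral_cmult) simp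
     also have "(\<Sum>\<^sup>+k\<in>{..j}. epowr (weight m q \<beta> k * b k x) q') <= (\<Sum>\<^sup>+k\<in>{..j + 1}. epowr (weight m q \<beta> k * b k x) q')"
     by (subst (1 2) nn_integral_count_space_indicator) (auto intro!: nn_integral_mono split: split_indicator)
     finally show "(\<integral>t \<in> {0<..<tscale m (j + 1)}. G t x) * indicator (cell3 (j + 1) y) x
       <= ennreal C * ((\<Sum>\<^sup>+k\<in>{..j + 1}. epowr (weight m q \<beta> k * b k x) q') * indicator (cell3 (j + 1) y) x)"
     by (auto simp: mult_left_mono split: split_indicator)
    qed
    also have "... = ennreal C * (\<integral>x \<in> cell3 (j + 1) y. (\<Sum>\<^sup>+k\<in>{..j + 1}. epowr (weight m q \<beta> k * b k x) q'))"
    proof (rule nn_integral_cmult)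
     have [measurable]: "(\<lambda>x. (\<Sum>\<^sup>+k\<in>{..j + 1}. epowr (weight m q \<beta> k * b k x) q')) \<in> bor"
     by (intro borel_measurable_nn_integral_count_space) auto
     show "(\<lambda>x. (\<Sum>\<^sup>+k\<in>{..j + 1}. epowr (weight m q \<beta> k * b k x) q') * indicator (cell3 (j + 1) y) x) \<in> borel_measurable lborel"
     by measurable
    qed
    also have "(\<integral>x \<in> cell3 (j + 1) y. (\<Sum>\<^sup>+k\<in>{..j + 1}. epowr (weight m q \<beta> k * b k x) q'))
      = ennreal (2 powr (rl (j + 1) * real CARD('n))) * avg (j + 1) (cell3 (j + 1) y) (\<lambda>x. (\<Sum>\<^sup>+k\<in>{..j + 1}. epowr (weight m q \<beta> k * b k x) q'))"
    by (rule set_nn_integral_eq_avg)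
    also have "... <= ennreal (2 powr (rl (j + 1) * real CARD('n))) * epowr N q'"
    by (intro mult_left_mono N) auto
    finally have "(\<integral>t \<in> {0<..<\<tau>}. ((\<integral>x \<in> ball y \<rho>. G t x) / emeasure lborel (ball y \<rho>)))
     <= (ennreal C * (ennreal (2 powr (rl (j + 1) * real CARD('n))) * epowr N q')) / ennreal (\<kappa>n * 2 powr (rl j * real CARD('n)))"
    by (simp add: mult_left_mono divide_right_mono_ennreal)
    also have "... = ennreal (C * 2 powr (rl (j + 1) * real CARD('n)) / (\<kappa>n * 2 powr (rl j * real CARD('n)))) * epowr N q'"
     using kn C0 by (simp add: divide_ennreal[symmetric] ennreal_mult ennreal_times_divide mult_ac divide_ennreal_def)
    also have "C * 2 powr (rl (j + 1) * real CARD('n)) / (\<kappa>n * 2 powr (rl j * real CARD('n))) = D"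
     using kn by (simp add: D_def distrib_right powr_add)
    finally show "(\<integral>t \<in> {0<..<\<tau>}. ((\<integral>x \<in> ball y (\<tau> powr (1 / m)). G t x) / emeasure lborel (ball y (\<tau> powr (1 / m))))) <= ennreal D * epowr N q'"
     unfolding \<rho>_def .
   qed (use q' in simp)
   then have "tent_norm m p q r \<beta> f <= epowr (ennreal D * epowr N q') (1 / q')"
    using tent_norm_Carleson[OF qf, of m r f w \<beta>] w
   by (auto simp: G_def q'_def pi' upper_half_space_def intro!: SUP_least)
   also have "... = ennreal (D powr (1 / q')) * N" using q' D0 by (simp add: epowr_mult epowr_epowr epowr_ennreal)
   finally show "tent_norm m p q r \<beta> f <= ennreal (D powr (1 / q')) * dnorm p q (\<lambda>k x. weight m q \<beta> k * b k x)"
    unfolding N_def .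
  qed simp
 qed
next
 case qi: False
 then have qi': "q = \<infinity>" by (auto simp: less_top[symmetric])
 define C where "C = 2 powr (m * \<bar>\<beta>\<bar>)"
 show ?thesis
 proof (intro exI[of _ C] conjI allI impI)
  show "0 <= C" by (simp add: C_def)
  fix f and w :: "real => real ^ 'n => ennreal" and b
  assume [measurable]: "joint_borel w" and w: "\<forall>t x. 0 < t --> whitney m r f t x = w t x"
   and mb: "\<forall>k. b k \<in> bor" and b: "\<forall>k t x. t \<in> octave m k --> w t x <= b k x"
  note [measurable] = mb[rule_format]
  have le: "ennreal (t powr - \<beta>) * whitney m r f t x <= ennreal C * (SUP k. weight m q \<beta> k * b k x)" if t: "0 < t" for t x
  proof -
   obtain k where k: "t \<in> octave m k" using octave_ex[OF m t] by auto
   have "ennreal (t powr - \<beta>) * whitney m r f t x <= ennreal C * (weight m q \<beta> k * b k x)"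
    unfolding C_def qi' using b k w t by (intro octave_power_le_sup[OF m k]) auto
   also have "... <= ennreal C * (SUP k. weight m q \<beta> k * b k x)"
   by (intro mult_left_mono SUP_upper) auto
   finally show ?thesis .
  qed
  show "tent_norm m p q r \<beta> f <= ennreal C * dnorm p q (\<lambda>k x. weight m q \<beta> k * b k x)"
  proof (cases "p < \<infinity>")
   case pf: True
   define p' where "p' = enn2real p"
   have p': "p = ennreal p'" "0 < p'"
    using p pf by (auto simp: p'_def enn2real_positive_iff)
   have ess: "esssup (lebesgue_on {0<..}) (\<lambda>t. ennreal (t powr - \<beta>) * whitney m r f t x) <= ennreal C * (SUP k. weight m q \<beta> k * b k x)" for x
   proof (rule esssup_I)
    have "(\<lambda>t. ennreal (t powr - \<beta>) * w t x) \<in> bor" by measurable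
    then show "(\<lambda>t. ennreal (t powr - \<beta>) * whitney m r f t x) \<in> borel_measurable (lebesgue_on {0<..})"
     using w by (rule_tac borel_measurable_lebesgue_on) auto
    show "AE t in lebesgue_on {0<..}. ennreal (t powr - \<beta>) * whitney m r f t x <= ennreal C * (SUP k. weight m q \<beta> k * b k x)"
     using le by (subst AE_lebesgue_on) auto
   qed
   have "tent_norm m p q r \<beta> f <= epowr (\<integral>x. epowr (ennreal C * (SUP k. weight m q \<beta> k * b k x)) p') (1 / p')"
    unfolding qi' tent_norm_sup[OF pf p] p'_def[symmetric]
    using p' ess unfolding qi' by (intro epowr_mono nn_integral_mono) auto
   also have "... = epowr (epowr (ennreal C) p' * (\<integral>x. epowr (SUP k. weight m q \<beta> k * b k x) p')) (1 / p')"
   by (subst epowr_mult, subst nn_integral_cmult) auto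
   also have "... = ennreal C * dnorm p q (\<lambda>k x. weight m q \<beta> k * b k x)"
    using pf qi p' by (simp add: dnorm_def p'_def[symmetric] epowr_mult[of "epowr _ _"] epowr_epowr)
   finally show ?thesis .
  next
   case pi: False
   define N where "N = dnorm p q (\<lambda>k x. weight m q \<beta> k * b k x)"
   have "AE x in lborel. (SUP k. weight m q \<beta> k * b k x) <= N"
    unfolding N_def dnorm_def using pi qi esssup_AE[of "\<lambda>x. SUP k. weight m q \<beta> k * b k x" lborel] by simp
   \<comment> \<open>The exceptional null set of points \<open>x\<close> does not depend on
     \<open>t\<close>, so by Fubini it produces a null set of the half-space.\<close>
   then have AE: "AE x in lborel. \<forall>t>0. ennreal (t powr - \<beta>) * w t x <= ennreal C * N"
   proof eventually_elim
    case (elim x)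
    have "ennreal (t powr - \<beta>) * w t x <= ennreal C * (SUP k. weight m q \<beta> k * b k x)" if "0 < t" for t
     using le[OF that, of x] w that by simp
    moreover have "ennreal C * (SUP k. weight m q \<beta> k * b k x) <= ennreal C * N"
     using elim by (rule mult_left_mono) simp
    ultimately show ?case by (blast intro: order_trans)
   qed
   have "AE z in lborel. 0 < fst z --> ennreal (fst z powr - \<beta>) * w (fst z) (snd z) <= ennreal C * N"
   proof -
    have AE2: "AE t in lborel. AE x in lborel. 0 < t --> ennreal (t powr - \<beta>) * w t x <= ennreal C * N"
    proof (rule AE_I2)
     show "AE x in lborel. 0 < t --> ennreal (t powr - \<beta>) * w t x <= ennreal C * N" for t
      using AE by (rule eventually_mono) auto
    qed
    have "AE z in lborel \<Otimes>\<^sub>M lborel. 0 < fst z --> ennreal (fst z powr - \<beta>) * w (fst z) (snd z) <= ennreal C * N"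
    proof (rule lborel_pair.AE_pair_measure[rotated])
     have "(\<lambda>z. ennreal (fst z powr - \<beta>) * w (fst z) (snd z)) \<in> borel_measurable (lborel \<Otimes>\<^sub>M lborel)"
      using measurable_compose[OF _ \<open>joint_borel w\<close>, of "\<lambda>z. (fst z, snd z)" "lborel \<Otimes>\<^sub>M lborel"] by simp
     note [measurable] = this
     show "{z \<in> space (lborel \<Otimes>\<^sub>M lborel). 0 < fst z --> ennreal (fst z powr - \<beta>) * w (fst z) (snd z) <= ennreal C * N} \<in> sets (lborel \<Otimes>\<^sub>M lborel)"
     by measurable
    qed (use AE2 in simp)
    then show ?thesis unfolding lborel_prod .
   qed
   then have "AE z in lebesgue_on upper_half_space. (\<lambda>(t, x). ennreal (t powr - \<beta>) * whitney m r f t x) z <= ennreal C * N"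
   by (subst AE_lebesgue_on[OF sets_upper_half_space]) (use w in \<open>auto simp: upper_half_space_def elim!: eventually_mono\<close>)
   moreover have "(\<lambda>(t, x). ennreal (t powr - \<beta>) * whitney m r f t x) \<in> borel_measurable (lebesgue_on upper_half_space)"
   proof (rule borel_measurable_lebesgue_on)
    have "(\<lambda>(t, x). ennreal (t powr - \<beta>) * w t x) \<in> borel_measurable (borel \<Otimes>\<^sub>M borel)" by measurable
    then show "(\<lambda>(t, x). ennreal (t powr - \<beta>) * w t x) \<in> bor" by (simp add: borel_prod)
   qed (use w in \<open>auto simp: upper_half_space_def\<close>)
   ultimately have "esssup (lebesgue_on upper_half_space) (\<lambda>(t, x). ennreal (t powr - \<beta>) * whitney m r f t x) <= ennreal C * N"
   by (intro esssup_I)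
   then show ?thesis using pi qi by (simp add: tent_norm_def N_def)
  qed
 qed
qed

section \<open>Whitney averages and tiles\<close>

definition wvol :: "'n::finite itself => real => real => real" where
 "wvol _ m t = unit_ball_vol (real CARD('n)) * (t powr (1 / m)) ^ CARD('n) * ((1 - 2 powr - m) * t)"

definition wnum :: "real => real => (real => real ^ 'n => ennreal) => real => real ^ 'n => ennreal" where
 "wnum m r \<phi> t x = (\<integral>s \<in> {2 powr - m * t <..< t}. (\<integral>y \<in> ball x (t powr (1 / m)). epowr (\<phi> s y) r))"

text \<open>The Whitney average with a jointly Borel \<open>\<phi>\<close> for the modulus of
  \<open>f\<close> and a single division by the volume \<open>wvol\<close> of the box; in this form
  it is visibly Borel in both variables.\<close>

definition wh :: "real => real => (real => real ^ 'n => ennreal) => real => real ^ 'n => ennreal" where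
 "wh m r \<phi> t x = epowr (wnum m r \<phi> t x / ennreal (wvol TYPE('n) m t)) (1 / r)"

lemma wvol_pos: "0 < m ==> 0 < t ==> 0 < wvol TYPE('n::finite) m t"
 using powr_less_mono[of "- m" 0 "2::real"] by (simp add: wvol_def unit_ball_vol_pos)

lemma borel_measurable_wh [measurable]:
 fixes \<phi> :: "real => real ^ 'n => ennreal"
 assumes "joint_borel \<phi>"
 shows "(\<lambda>(t, x). wh m r \<phi> t x) \<in> borel_measurable (borel \<Otimes>\<^sub>M borel)"
proof -
 have [measurable]: "(\<lambda>(t, x). \<phi> t x) \<in> borel_measurable (lborel \<Otimes>\<^sub>M lborel)" using assms by measurable
 have "wnum m r \<phi> t x = (\<integral>s. (\<integral>y. epowr (\<phi> s y) r * (if dist x y < t powr (1 / m) then 1 else 0)) * (if 2 powr - m * t < s \<and> s < t then 1 else 0))" for t x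
  unfolding wnum_def by (intro nn_integral_cong arg_cong2[where f="(*)"]) (auto split: split_indicator)
 moreover have "(\<lambda>(t, x). (\<integral>s. (\<integral>y. epowr (\<phi> s y) r * (if dist x y < t powr (1 / m) then 1 else 0)) * (if 2 powr - m * t < s \<and> s < t then 1 else 0))) \<in> borel_measurable (borel \<Otimes>\<^sub>M (borel :: (real ^ 'n) measure))"
 by measurable
 ultimately have [measurable]: "(\<lambda>(t, x). wnum m r \<phi> t x) \<in> borel_measurable (borel \<Otimes>\<^sub>M borel)" by simp
 show ?thesis unfolding wh_def wvol_def by measurable
qed

text \<open>Integrals ignore null sets, so agreement of \<open>\<phi>\<close> with the modulus
  almost everywhere gives equality of the Whitney averages at every point. Measurability questions
  about \<open>f\<close> end here.\<close>

lemma whitney_eq_wh: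
 fixes \<phi> :: "real => real ^ 'n => ennreal"
 assumes m: "0 < m" and t: "0 < t" and r: "0 < r"
  and m\<phi>: "joint_borel \<phi>"
  and AE: "AE z in lborel. 0 < fst z --> ennreal (norm (f z)) = \<phi> (fst z) (snd z)"
 shows "whitney m (ennreal r) f t x = wh m r \<phi> t x"
proof -
 have [measurable]: "(\<lambda>(t, x). \<phi> t x) \<in> borel_measurable (borel \<Otimes>\<^sub>M lborel)" using m\<phi> by measurable
 have "ball x (t powr (1 / m)) \<in> sets borel" by simp
 note [measurable] = this
 let ?B = "ball x (t powr (1 / m))" and ?T = "{2 powr - m * t <..< t}"
 have t0: "0 <= 2 powr - m * t" "2 powr - m * t <= t" using t m powr_mono[of "- m" 0 "2::real"] by simp_all
 have "AE z in lborel \<Otimes>\<^sub>M lborel. 0 < fst z --> ennreal (norm (f z)) = \<phi> (fst z) (snd z)"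
  using AE unfolding lborel_prod .
 then have AE2: "AE s in lborel. AE y in lborel. 0 < s --> ennreal (norm (f (s, y))) = \<phi> s y"
 by (auto dest: lborel_pair.AE_pair)
 have eB: "emeasure lborel ?B = ennreal (unit_ball_vol (real CARD('n)) * (t powr (1 / m)) ^ CARD('n))"
 by (simp add: emeasure_ball)
 have eT: "emeasure lborel ?T = ennreal ((1 - 2 powr - m) * t)"
  using t0 by (simp add: left_diff_distrib)
 have "mean_integral ?T (\<lambda>s. mean_integral ?B (\<lambda>y. epowr (ennreal (norm (f (s, y)))) r))
  = (\<integral>s \<in> ?T. ((\<integral>y \<in> ?B. epowr (ennreal (norm (f (s, y)))) r) / emeasure lborel ?B)) / emeasure lborel ?T"
  unfolding mean_integral_def nn_integral_lebesgue by (simp add: emeasure_lebesgue_borel)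
 also have "(\<integral>s \<in> ?T. ((\<integral>y \<in> ?B. epowr (ennreal (norm (f (s, y)))) r) / emeasure lborel ?B))
  = (\<integral>s. ((\<integral>y \<in> ?B. epowr (\<phi> s y) r) * indicator ?T s) / emeasure lborel ?B)"
 proof (rule nn_integral_cong_AE)
  show "AE s in lborel. ((\<integral>y \<in> ?B. epowr (ennreal (norm (f (s, y)))) r) / emeasure lborel ?B) * indicator ?T s = ((\<integral>y \<in> ?B. epowr (\<phi> s y) r) * indicator ?T s) / emeasure lborel ?B"
   using AE2
  proof eventually_elim
   case (elim s)
   show ?case
   proof (cases "s \<in> ?T")
    case True
    then have s: "0 < s" using t0 by auto
    have "(\<integral>y \<in> ?B. epowr (ennreal (norm (f (s, y)))) r) = (\<integral>y \<in> ?B. epowr (\<phi> s y) r)"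
     using elim s by (intro nn_integral_cong_AE) (auto elim!: eventually_mono)
    then show ?thesis using True by simp
   qed simp
  qed
 qed
 also have "... = wnum m r \<phi> t x / emeasure lborel ?B"
  unfolding wnum_def by (rule nn_integral_divide) measurable
 also have "wnum m r \<phi> t x / emeasure lborel ?B / emeasure lborel ?T = wnum m r \<phi> t x / ennreal (wvol TYPE('n) m t)"
 proof -
  have "0 < unit_ball_vol (real CARD('n)) * (t powr (1 / m)) ^ CARD('n)" using t by (simp add: unit_ball_vol_pos)
  moreover have "0 < (1 - 2 powr - m) * t" using t m powr_less_mono[of "- m" 0 "2::real"] by simp
  ultimately show ?thesis
   unfolding eB eT wvol_def divide_ennreal_def
  by (subst ennreal_mult) (simp_all add: ennreal_inverse_mult mult.assoc)
 qed
 finally show ?thesis unfolding whitney_def wh_def using r by simp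
qed

text \<open>Level \<open>k + 1\<close> is where cells are long enough for the octave: its supremum
  has \<open>m\<close>-th root \<open>2^(k+1)\<close>, and the operator estimates ask the length in
  space to be at least the \<open>m\<close>-th root of \<open>len_t\<close>. The set
  \<open>S\<close> is an octave for targets and three octaves for sources.\<close>

definition tile :: "real => real => real set => int => (real => real ^ 'n => ennreal) => real ^ 'n => ennreal" where
 "tile m r S k \<phi> x = epowr (avg (k + 1) (cell (k + 1) x) (\<lambda>y. ennreal (tscale m (- k)) * (\<integral>t \<in> S. epowr (\<phi> t y) r))) (1 / r)"

lemma cellwise_tile: "cellwise (k + 1) (tile m r S k \<phi>)"
 by (auto simp: cellwise_def tile_def cell_eq)

lemma borel_measurable_tile [measurable]: "tile m r S k \<phi> \<in> bor"
 by (rule cellwise_measurable[OF cellwise_tile])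

lemma borel_measurable_time_integral [measurable]:
 assumes "joint_borel \<phi>" "S \<in> sets borel"
 shows "(\<lambda>y. (\<integral>t \<in> S. epowr (\<phi> t y) r)) \<in> bor"
proof -
 note [measurable] = measurable_swap_lborel[OF assms(1)] assms(2)
 show ?thesis by measurable
qed

lemma time_space_swap:
 fixes \<phi> :: "real => real ^ 'n => ennreal"
 assumes [measurable]: "joint_borel \<phi>" "S \<in> sets borel" "X \<in> sets borel"
 shows "(\<integral>t \<in> S. (\<integral>y \<in> X. epowr (\<phi> t y) r)) = (\<integral>y \<in> X. (\<integral>t \<in> S. epowr (\<phi> t y) r))"
proof -
 have "(\<integral>t \<in> S. (\<integral>y \<in> X. epowr (\<phi> t y) r))
   = (\<integral>t. (\<integral>y. epowr (\<phi> t y) r * indicator S t * indicator X y))"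
 by (intro nn_integral_cong) (auto split: split_indicator)
 also have "... = (\<integral>y. (\<integral>t. epowr (\<phi> t y) r * indicator S t * indicator X y))"
 by (rule lborel_pair.Fubini'[symmetric]) measurable
 also have "... = (\<integral>y \<in> X. (\<integral>t \<in> S. epowr (\<phi> t y) r))"
 by (intro nn_integral_cong) (auto split: split_indicator)
 finally show ?thesis .
qed

text \<open>A tile is an \<open>L^r\<close> mean over its cell, so an \<open>r\<close>-mean of tiles
  over a union of such cells collapses without loss.\<close>

lemma pavg_tile:
 fixes \<phi> :: "real => real ^ 'n => ennreal"
 assumes [measurable]: "joint_borel \<phi>" "S \<in> sets borel" and r: "0 < r"
  and X: "\<And>y. y \<in> X ==> cell (k + 1) y \<subseteq> X"
 shows "epowr (pavg R r X (tile m r S k \<phi>)) r = avg R X (\<lambda>y. ennreal (tscale m (- k)) * (\<integral>t \<in> S. epowr (\<phi> t y) r))"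
proof -
 have "epowr (pavg R r X (tile m r S k \<phi>)) r = avg R X (\<lambda>y. epowr (tile m r S k \<phi> y) r)"
  using r by (simp add: pavg_def epowr_epowr)
 also have "... = avg R X (\<lambda>x. avg (k + 1) (cell (k + 1) x) (\<lambda>y. ennreal (tscale m (- k)) * (\<integral>t \<in> S. epowr (\<phi> t y) r)))"
  using r by (simp add: tile_def epowr_epowr)
 also have "... = avg (k + 1) X (\<lambda>x. avg (k + 1) (cell (k + 1) x) (\<lambda>y. ennreal (tscale m (- k)) * (\<integral>t \<in> S. epowr (\<phi> t y) r))) * ennreal (2 powr (rl (k + 1 - R) * real CARD('n)))"
 by (subst avg_level[of R _ _ "k + 1"]) (simp add: mult.commute)
 also have "avg (k + 1) X (\<lambda>x. avg (k + 1) (cell (k + 1) x) (\<lambda>y. ennreal (tscale m (- k)) * (\<integral>t \<in> S. epowr (\<phi> t y) r)))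
   = avg (k + 1) X (\<lambda>y. ennreal (tscale m (- k)) * (\<integral>t \<in> S. epowr (\<phi> t y) r))"
 by (rule avg_avg_cell) (use X in \<open>auto simp: subset_iff\<close>)
 also have "... * ennreal (2 powr (rl (k + 1 - R) * real CARD('n))) = avg R X (\<lambda>y. ennreal (tscale m (- k)) * (\<integral>t \<in> S. epowr (\<phi> t y) r))"
 by (subst avg_level[of R _ _ "k + 1"]) (simp add: mult.commute)
 finally show ?thesis .
qed

text \<open>For \<open>t\<close> in \<open>octave m l\<close> the Whitney window meets only the
  octaves \<open>l - 1\<close> and \<open>l\<close>, and the ball lies in
  \<open>cell3 (l + 1) x\<close>. The volume ratio with \<open>1 - 2^(-m) >= 1/2\<close> and the two
  summands together give \<open>2^(n+2)\<close>. The tiles of octave \<open>l - 1\<close> live one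
  level lower, which is the step paid for when \<open>r\<close> is lowered to
  \<open>U\<close>.\<close>

lemma wh_le_tiles:
 fixes \<phi> :: "real => real ^ 'n => ennreal"
 assumes m: "1 <= m" and r: "0 < r" and U: "0 < U" "U <= r"
  and [measurable]: "joint_borel \<phi>" and t: "t \<in> octave m l"
 shows "wh m r \<phi> t x <= ennreal ((2 ^ (CARD('n) + 2) / unit_ball_vol (real CARD('n))) powr (1 / r) * 2 powr (real CARD('n) * (1 / U - 1 / r)))
   * (\<Sum>i\<in>{0, 1}. pavg (l + 1) U (cell3 (l + 1) x) (tile m r (octave m (l - i)) (l - i) \<phi>))"
proof -
 define \<kappa>n where "\<kappa>n = unit_ball_vol (real CARD('n))"
 have kn: "0 < \<kappa>n" by (simp add: \<kappa>n_def unit_ball_vol_pos)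
 have m0: "0 < m" using m by simp
 have t0: "0 < t" by (rule octave_pos[OF t])
 define \<rho> where "\<rho> = t powr (1 / m)"
 have "tscale m l powr (1 / m) <= \<rho>" "\<rho> < tscale m (l + 1) powr (1 / m)"
  using t m0 t0 unfolding \<rho>_def octave_def by (auto intro!: powr_mono2 powr_less_mono2)
 then have \<rho>: "2 powr rl l <= \<rho>" "\<rho> < 2 powr rl (l + 1)"
  unfolding tscale_root[OF m0] by auto
 have sub: "ball x \<rho> \<subseteq> cell3 (l + 1) x"
 proof
  fix z assume z: "z \<in> ball x \<rho>"
  have "\<bar>idx (l + 1) z $ i - idx (l + 1) x $ i\<bar> <= 1" for i
  proof -
   have "\<bar>z $ i - x $ i\<bar> <= dist x z" using component_le_norm_cart[of "z - x" i] by (simp add: dist_norm norm_minus_commute)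
   then have "\<bar>z $ i - x $ i\<bar> < 2 powr rl (l + 1)" using z \<rho> by simp
   then have "\<bar>z $ i / 2 powr rl (l + 1) - x $ i / 2 powr rl (l + 1)\<bar> < 1"
   by (simp add: diff_divide_distrib[symmetric] del: of_int_add)
   then show ?thesis unfolding idx_nth by linarith
  qed
  then show "z \<in> cell3 (l + 1) x" by (simp add: cell3_def)
 qed
 define P where "P i = pavg (l + 1) r (cell3 (l + 1) x) (tile m r (octave m (l - i)) (l - i) \<phi>)" for i
 have "2 powr - m * t < 2 powr - m * tscale m (l + 1)" using t by (simp add: octave_def)
 have win: "{2 powr - m * t <..< t} \<subseteq> octave m (l - 1) \<union> octave m l"
 proof
  fix s assume s: "s \<in> {2 powr - m * t <..< t}"
  have "tscale m (l - 1) = 2 powr - m * tscale m l" using tscale_add[of m "-1" l] by (simp add: tscale_def)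
  also have "... <= 2 powr - m * t" using t by (simp add: octave_def)
  finally show "s \<in> octave m (l - 1) \<union> octave m l" using s t by (auto simp: octave_def)
 qed
 have "wnum m r \<phi> t x <= (\<integral>s. (\<Sum>i\<in>{0, 1}. (\<integral>y \<in> cell3 (l + 1) x. epowr (\<phi> s y) r) * indicator (octave m (l - i)) s))"
  unfolding wnum_def \<rho>_def[symmetric]
 proof (rule nn_integral_mono)
  fix s
  have le: "(\<integral>y \<in> ball x \<rho>. epowr (\<phi> s y) r) <= (\<integral>y \<in> cell3 (l + 1) x. epowr (\<phi> s y) r)"
   using sub by (intro nn_integral_mono) (auto split: split_indicator)
  show "(\<integral>y \<in> ball x \<rho>. epowr (\<phi> s y) r) * indicator {2 powr - m * t <..< t} s <= (\<Sum>i\<in>{0, 1}. (\<integral>y \<in> cell3 (l + 1) x. epowr (\<phi> s y) r) * indicator (octave m (l - i)) s)"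
  proof (cases "s \<in> {2 powr - m * t <..< t}")
   case True
   then have "s \<in> octave m (l - 1) \<or> s \<in> octave m l" using win by auto
   then obtain i :: int where i: "i \<in> {0, 1}" "s \<in> octave m (l - i)" by fastforce
   have "(\<integral>y \<in> cell3 (l + 1) x. epowr (\<phi> s y) r) * indicator (octave m (l - i)) s
    <= (\<Sum>i\<in>{0, 1}. (\<integral>y \<in> cell3 (l + 1) x. epowr (\<phi> s y) r) * indicator (octave m (l - i)) s)"
   by (rule member_le_sum[OF i(1)]) auto
   with True le i(2) show ?thesis by (auto intro: order_trans)
  qed simp
 qed
 also have "... = (\<Sum>i\<in>{0, 1}. (\<integral>s \<in> octave m (l - i). (\<integral>y \<in> cell3 (l + 1) x. epowr (\<phi> s y) r)))"
 proof -
  have [measurable]: "(\<lambda>(t, x). \<phi> t x) \<in> borel_measurable (borel \<Otimes>\<^sub>M lborel)" by measurable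
  show ?thesis by (rule nn_integral_sum) measurable
 qed
 also have "... <= (\<Sum>i\<in>{0, 1}. ennreal (2 powr (rl (l + 1) * real CARD('n)) * tscale m l) * epowr (P i) r)"
 proof (rule sum_mono)
  fix i :: int assume i: "i \<in> {0, 1}"
  let ?I = "\<lambda>y. (\<integral>t \<in> octave m (l - i). epowr (\<phi> t y) r)"
  have "epowr (P i) r = avg (l + 1) (cell3 (l + 1) x) (\<lambda>y. ennreal (tscale m (- (l - i))) * ?I y)"
   unfolding P_def using r i by (intro pavg_tile cell3_subset) auto
  also have "... = ennreal (tscale m (- (l - i))) * avg (l + 1) (cell3 (l + 1) x) ?I"
  by (rule avg_cmult) measurable
  finally have "ennreal (tscale m (l - i)) * epowr (P i) r = ennreal (tscale m (l - i) * tscale m (- (l - i))) * avg (l + 1) (cell3 (l + 1) x) ?I"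
  by (simp add: ennreal_mult mult.assoc)
  then have e: "ennreal (tscale m (l - i)) * epowr (P i) r = avg (l + 1) (cell3 (l + 1) x) ?I"
  by (simp only: tscale_minus) simp
  have "(\<integral>s \<in> octave m (l - i). (\<integral>y \<in> cell3 (l + 1) x. epowr (\<phi> s y) r)) = (\<integral>y \<in> cell3 (l + 1) x. ?I y)"
  by (rule time_space_swap) measurable
  also have "... = ennreal (2 powr (rl (l + 1) * real CARD('n))) * avg (l + 1) (cell3 (l + 1) x) ?I"
  by (rule set_nn_integral_eq_avg)
  also have "... = ennreal (2 powr (rl (l + 1) * real CARD('n))) * (ennreal (tscale m (l - i)) * epowr (P i) r)"
  by (simp only: e)
  also have "... <= ennreal (2 powr (rl (l + 1) * real CARD('n))) * (ennreal (tscale m l) * epowr (P i) r)"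
   using i m0 by (intro mult_left_mono mult_right_mono ennreal_leI tscale_mono) auto
  finally show "(\<integral>s \<in> octave m (l - i). (\<integral>y \<in> cell3 (l + 1) x. epowr (\<phi> s y) r)) <= ennreal (2 powr (rl (l + 1) * real CARD('n)) * tscale m l) * epowr (P i) r"
  by (simp add: ennreal_mult mult.assoc)
 qed
 also have "... = ennreal (2 powr (rl (l + 1) * real CARD('n)) * tscale m l) * (\<Sum>i\<in>{0, 1}. epowr (P i) r)"
 by (rule sum_distrib_left[symmetric])
 finally have num: "wnum m r \<phi> t x <= ennreal (2 powr (rl (l + 1) * real CARD('n)) * tscale m l) * (\<Sum>i\<in>{0, 1}. epowr (P i) r)" .
 define V where "V = \<kappa>n * 2 powr (rl l * real CARD('n)) * (tscale m l / 2)"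
 have V0: "0 < V" using kn by (simp add: V_def)
 have vol: "V <= wvol TYPE('n) m t"
  unfolding V_def wvol_def \<kappa>n_def[symmetric] \<rho>_def[symmetric]
 proof (intro mult_mono)
  have "(2 powr rl l) ^ CARD('n) <= \<rho> ^ CARD('n)" using \<rho> by (intro power_mono) auto
  then show "2 powr (rl l * real CARD('n)) <= \<rho> ^ CARD('n)" by (simp add: powr_realpow[symmetric] powr_powr)
  have "(2::real) powr - m <= 2 powr - 1" using m by (intro powr_mono) auto
  then have "1 / 2 <= 1 - (2::real) powr - m" by (simp add: powr_minus)
  then have "(1 / 2) * tscale m l <= (1 - 2 powr - m) * t" using t by (intro mult_mono) (auto simp: octave_def)
  then show "tscale m l / 2 <= (1 - 2 powr - m) * t" by simp
 qed (use kn in \<open>auto simp: \<rho>_def\<close>)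
 have "wnum m r \<phi> t x / ennreal (wvol TYPE('n) m t) <= (ennreal (2 powr (rl (l + 1) * real CARD('n)) * tscale m l) * (\<Sum>i\<in>{0, 1}. epowr (P i) r)) / ennreal V"
 by (rule order_trans[OF divide_right_mono_ennreal[OF num] ennreal_divide_mono_right[OF ennreal_leI[OF vol]]])
 also have "... = ennreal (2 powr (rl (l + 1) * real CARD('n)) * tscale m l / V) * (\<Sum>i\<in>{0, 1}. epowr (P i) r)"
  using V0 by (simp add: divide_ennreal[symmetric] divide_ennreal_def mult_ac)
 also have "2 powr (rl (l + 1) * real CARD('n)) * tscale m l / V = 2 ^ (CARD('n) + 1) / \<kappa>n"
  using kn tscale_pos[of m l, THEN less_imp_neq] by (simp add: V_def distrib_right powr_add powr_realpow field_simps)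
 finally have "wh m r \<phi> t x <= epowr (ennreal (2 ^ (CARD('n) + 1) / \<kappa>n) * (\<Sum>i\<in>{0, 1}. epowr (P i) r)) (1 / r)"
  unfolding wh_def using r by (intro epowr_mono) auto
 also have "... <= ennreal ((2 ^ (CARD('n) + 1) / \<kappa>n) powr (1 / r)) * (ennreal (real (card {0 :: int, 1}) powr (1 / r)) * (\<Sum>i\<in>{0, 1}. epowr (epowr (P i) r) (1 / r)))"
  unfolding epowr_mult using r kn by (intro mult_mono epowr_sum_le) (auto simp: epowr_ennreal)
 also have "... = ennreal ((2 ^ (CARD('n) + 2) / \<kappa>n) powr (1 / r)) * (\<Sum>i\<in>{0, 1}. P i)"
  using r kn by (simp add: epowr_epowr mult.assoc[symmetric] ennreal_mult'' [symmetric] powr_mult[symmetric] mult_ac)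
 also have "(\<Sum>i\<in>{0, 1}. P i) <= (\<Sum>i\<in>{0, 1}. ennreal (2 powr (real CARD('n) * (1 / U - 1 / r))) * pavg (l + 1) U (cell3 (l + 1) x) (tile m r (octave m (l - i)) (l - i) \<phi>))"
 proof (rule sum_mono)
  fix i :: int assume i: "i \<in> {0, 1}"
  have "P i <= ennreal (2 powr (rl (l + 1 - (l - i + 1)) * real CARD('n) * (1 / U - 1 / r))) * pavg (l + 1) U (cell3 (l + 1) x) (tile m r (octave m (l - i)) (l - i) \<phi>)"
   unfolding P_def using U i by (intro pavg_exponent_le cellwise_tile cell3_subset) auto
  also have "... <= ennreal (2 powr (real CARD('n) * (1 / U - 1 / r))) * pavg (l + 1) U (cell3 (l + 1) x) (tile m r (octave m (l - i)) (l - i) \<phi>)"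
  proof (rule mult_right_mono[OF ennreal_leI[OF powr_mono]])
   have "0 <= 1 / U - 1 / r" using U r by (simp add: frac_le)
   then have "rl i * (real CARD('n) * (1 / U - 1 / r)) <= 1 * (real CARD('n) * (1 / U - 1 / r))"
    using i by (intro mult_right_mono) auto
   then show "rl (l + 1 - (l - i + 1)) * real CARD('n) * (1 / U - 1 / r) <= real CARD('n) * (1 / U - 1 / r)" by simp
  qed auto
  finally show "P i <= ennreal (2 powr (real CARD('n) * (1 / U - 1 / r))) * pavg (l + 1) U (cell3 (l + 1) x) (tile m r (octave m (l - i)) (l - i) \<phi>)" .
 qed
 also have "... = ennreal (2 powr (real CARD('n) * (1 / U - 1 / r))) * (\<Sum>i\<in>{0, 1}. pavg (l + 1) U (cell3 (l + 1) x) (tile m r (octave m (l - i)) (l - i) \<phi>))"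
 by (rule sum_distrib_left[symmetric])
 finally show ?thesis by (simp add: \<kappa>n_def ennreal_mult mult.assoc mult_left_mono)
qed

section \<open>Tiles bounded by Whitney averages\<close>

definition wide :: "real => int => real set" where
 "wide m k = {tscale m (k - 1) ..< tscale m (k + 2)}"

lemma sets_wide [measurable]: "wide m k \<in> sets borel"
 by (simp add: wide_def)

lemma octave_subset_wide: "0 < m ==> octave m k \<subseteq> wide m k"
 using tscale_mono[of m "k - 1" k] tscale_mono[of m "k + 1" "k + 2"] by (auto simp: wide_def octave_def)

lemma tscale_half: "tscale m k = tscale (m / 2) (2 * k)"
 by (simp add: tscale_def)

text \<open>Half octaves enter because the open window \<open>2^(-m) t < s < t\<close> never
  contains a whole octave, whereas it contains the half octave \<open>h\<close> for every
  \<open>t\<close> in the half octave \<open>h + 1\<close>. The three octaves of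
  \<open>wide m k\<close> consist of six half octaves.\<close>

lemma wide_half_octaves:
 assumes m: "0 < m" and t: "t \<in> wide m k"
 shows "\<exists>j\<in>{- 2, - 1, 0, 1, 2, 3}. t \<in> octave (m / 2) (2 * k + j)"
proof -
 have t0: "0 < t" using t by (auto simp: wide_def intro: less_le_trans[OF tscale_pos])
 obtain h where h: "t \<in> octave (m / 2) h" using octave_ex[of "m / 2" t] m t0 by auto
 have "t < tscale (m / 2) (2 * (k + 2))" "tscale (m / 2) (2 * (k - 1)) <= t"
  using t unfolding wide_def tscale_half[of m] by auto
 then have "h <= 2 * k + 3" "\<not> h <= 2 * k - 3"
  using octave_le_iff[of "m / 2" t h "2 * k + 3"] octave_le_iff[of "m / 2" t h "2 * k - 3"] m h
 by (auto simp: algebra_simps)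
 then have "h - 2 * k \<in> {- 2, - 1, 0, 1, 2, 3}" by auto
 moreover have "t \<in> octave (m / 2) (2 * k + (h - 2 * k))" using h by simp
 ultimately show ?thesis by blast
qed

lemma half_octave_subset:
 assumes m: "0 < m" shows "octave (m / 2) h \<subseteq> octave m (h div 2)"
proof -
 have "tscale (m / 2) (2 * (h div 2)) <= tscale (m / 2) h" "tscale (m / 2) (h + 1) <= tscale (m / 2) (2 * (h div 2 + 1))"
  using m by (auto intro!: tscale_mono)
 then show ?thesis unfolding octave_def tscale_half[of m] by auto
qed

text \<open>The level \<open>R\<close> is so low that the diameter of a cell is at most
  \<open>n 2^R <= 2^(k-1) <= t^(1/m)\<close>; hence the ball about any point of the cell contains
  the cell, while the window contains the half octave. The constant compares the volume of the
  Whitney box with that of the cell times \<open>tscale m k\<close>.\<close>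

lemma cell_avg_le_wh:
 fixes \<phi> :: "real => real ^ 'n => ennreal"
 assumes m: "1 <= m" and r: "0 < r"
  and [measurable]: "joint_borel \<phi>"
  and h: "2 * k - 2 <= h" "h <= 2 * k + 3" and t: "t \<in> octave (m / 2) (h + 1)"
  and R: "R = k - int CARD('n) - 1" and y: "y \<in> cell R z"
 shows "avg R (cell R z) (\<lambda>y. ennreal (tscale m (- k)) * (\<integral>s \<in> octave (m / 2) h. epowr (\<phi> s y) r))
  <= ennreal (unit_ball_vol (real CARD('n)) * 2 powr (real CARD('n) * (real CARD('n) + 4) + 3 * m)) * epowr (wh m r \<phi> t y) r"
proof -
 define \<kappa>n where "\<kappa>n = unit_ball_vol (real CARD('n))"
 have kn: "0 < \<kappa>n" by (simp add: \<kappa>n_def unit_ball_vol_pos)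
 have m0: "0 < m" using m by simp
 have t0: "0 < t" by (rule octave_pos[OF t])
 define \<rho> where "\<rho> = t powr (1 / m)"
 have tl: "tscale m (k - 1) <= t"
 proof -
  have "tscale m (k - 1) <= tscale (m / 2) (h + 1)" unfolding tscale_half[of m] using h m0 by (intro tscale_mono) auto
  then show ?thesis using t by (simp add: octave_def)
 qed
 have tu: "t <= tscale m (k + 3)"
 proof -
  have "tscale (m / 2) (h + 1 + 1) <= tscale m (k + 3)" unfolding tscale_half[of m] using h m0 by (intro tscale_mono) auto
  then show ?thesis using t by (simp add: octave_def)
 qed
 have "tscale m (k - 1) powr (1 / m) <= \<rho>" "\<rho> <= tscale m (k + 3) powr (1 / m)"
  using tl tu m0 t0 unfolding \<rho>_def by (auto intro!: powr_mono2)
 then have \<rho>: "2 powr rl (k - 1) <= \<rho>" "\<rho> <= 2 powr rl (k + 3)"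
  unfolding tscale_root[OF m0] by auto
 have sub: "cell R z \<subseteq> ball y \<rho>"
 proof
  fix u assume u: "u \<in> cell R z"
  have "\<bar>y $ i - u $ i\<bar> < (rl 0 + 1) * 2 powr rl R" for i
   using u y by (intro idx_diff_bound) (simp add: cell_def)
  from dist_bound[OF this] have "dist y u < real CARD('n) * 2 powr rl R" by simp
  also have "... <= 2 powr real CARD('n) * 2 powr rl R"
  proof (intro mult_right_mono)
   show "real CARD('n) <= 2 powr real CARD('n)"
    using less_exp[of "CARD('n)"] by (simp add: powr_realpow)
  qed simp
  also have "... = 2 powr rl (k - 1)" by (simp add: R powr_add[symmetric])
  finally show "u \<in> ball y \<rho>" using \<rho> by simp
 qed
 have win: "octave (m / 2) h \<subseteq> {2 powr - m * t <..< t}"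
 proof
  fix s assume s: "s \<in> octave (m / 2) h"
  have "2 powr - m * t < 2 powr - m * tscale (m / 2) (h + 1 + 1)" using t by (simp add: octave_def)
  also have "... = tscale (m / 2) h" by (simp add: tscale_def powr_add[symmetric] algebra_simps)
  finally show "s \<in> {2 powr - m * t <..< t}" using s t by (auto simp: octave_def)
 qed
 have "(\<integral>u \<in> cell R z. (\<integral>s \<in> octave (m / 2) h. epowr (\<phi> s u) r)) = (\<integral>s \<in> octave (m / 2) h. (\<integral>u \<in> cell R z. epowr (\<phi> s u) r))"
 by (rule time_space_swap[symmetric]) measurable
 also have "... <= wnum m r \<phi> t y"
  unfolding wnum_def \<rho>_def[symmetric]
 proof (rule nn_integral_mono)
  fix s
  have le: "(\<integral>u \<in> cell R z. epowr (\<phi> s u) r) <= (\<integral>u \<in> ball y \<rho>. epowr (\<phi> s u) r)"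
   using sub by (intro nn_integral_mono) (auto split: split_indicator)
  then show "(\<integral>u \<in> cell R z. epowr (\<phi> s u) r) * indicator (octave (m / 2) h) s
    <= (\<integral>u \<in> ball y \<rho>. epowr (\<phi> s u) r) * indicator {2 powr - m * t <..< t} s"
   using win by (intro mult_mono) (auto split: split_indicator)
 qed
 also have "... = ennreal (wvol TYPE('n) m t) * epowr (wh m r \<phi> t y) r"
  using r wvol_pos[OF m0 t0, where 'n='n]
 by (simp add: wh_def epowr_epowr ennreal_times_divide mult_divide_eq_ennreal mult.commute[of "ennreal (wvol _ _ _)"])
 also have "wvol TYPE('n) m t <= \<kappa>n * 2 powr (rl (k + 3) * real CARD('n)) * tscale m (k + 3)"
  unfolding wvol_def \<rho>_def[symmetric] \<kappa>n_def[symmetric]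
 proof (intro mult_mono)
  have "\<rho> ^ CARD('n) <= (2 powr rl (k + 3)) ^ CARD('n)" using \<rho>(2) by (intro power_mono) (auto simp: \<rho>_def)
  then show "\<rho> ^ CARD('n) <= 2 powr (rl (k + 3) * real CARD('n))" by (simp add: powr_realpow[symmetric] powr_powr)
  have "(1 - 2 powr - m) * t <= 1 * t" using t0 by (intro mult_right_mono) auto
  then show "(1 - 2 powr - m) * t <= tscale m (k + 3)" using tu by simp
  show "0 <= (1 - 2 powr - m) * t" using t0 m powr_mono[of "- m" 0 "2::real"] by simp
 qed (use kn in \<open>auto simp: \<rho>_def\<close>)
 finally have le: "(\<integral>u \<in> cell R z. (\<integral>s \<in> octave (m / 2) h. epowr (\<phi> s u) r))
   <= ennreal (\<kappa>n * 2 powr (rl (k + 3) * real CARD('n)) * tscale m (k + 3)) * epowr (wh m r \<phi> t y) r"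
 by (simp add: mult_right_mono ennreal_leI)
 have "avg R (cell R z) (\<lambda>y. ennreal (tscale m (- k)) * (\<integral>s \<in> octave (m / 2) h. epowr (\<phi> s y) r))
   = ennreal (tscale m (- k)) * avg R (cell R z) (\<lambda>y. (\<integral>s \<in> octave (m / 2) h. epowr (\<phi> s y) r))"
 by (rule avg_cmult) measurable
 also have "... <= ennreal (tscale m (- k)) * (ennreal (2 powr (- rl R * real CARD('n))) * (ennreal (\<kappa>n * 2 powr (rl (k + 3) * real CARD('n)) * tscale m (k + 3)) * epowr (wh m r \<phi> t y) r))"
  unfolding avg_def by (intro mult_left_mono le) auto
 also have "... = ennreal (tscale m (- k) * (2 powr (- rl R * real CARD('n)) * (\<kappa>n * 2 powr (rl (k + 3) * real CARD('n)) * tscale m (k + 3)))) * epowr (wh m r \<phi> t y) r"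
  using kn by (simp add: ennreal_mult mult.assoc)
 also have "tscale m (- k) * (2 powr (- rl R * real CARD('n)) * (\<kappa>n * 2 powr (rl (k + 3) * real CARD('n)) * tscale m (k + 3)))
   = \<kappa>n * 2 powr (real CARD('n) * (real CARD('n) + 4) + 3 * m)"
 by (simp add: tscale_def R mult.left_commute[of _ \<kappa>n] powr_add[symmetric] algebra_simps)
 finally show ?thesis by (simp add: \<kappa>n_def)
qed

text \<open>The preceding bound holds for all \<open>t\<close> in the half octave
  \<open>h + 1\<close> and all \<open>y\<close> in the small cell, so its right side may be averaged
  over both in \<open>U\<close>-mean; this is why \<open>U\<close> may be arbitrarily small. That
  half octave is part of \<open>octave m ((h + 1) div 2)\<close>.\<close>

lemma cell_avg_le_octave_mean:
 fixes \<phi> :: "real => real ^ 'n => ennreal"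
 assumes m: "1 <= m" and r: "0 < r" and U: "0 < U"
 shows "\<exists>C::real. 0 < C \<and> (\<forall>(\<phi> :: real => real ^ 'n => ennreal) k h x z. joint_borel \<phi> -->
   2 * k - 2 <= h --> h <= 2 * k + 3 --> z \<in> cell (k + 1) x -->
   avg (k - int CARD('n) - 1) (cell (k - int CARD('n) - 1) z) (\<lambda>y. ennreal (tscale m (- k)) * (\<integral>s \<in> octave (m / 2) h. epowr (\<phi> s y) r))
   <= ennreal C * epowr (pavg (k + 3) U (cell3 (k + 3) x) (octave_mean m U (wh m r \<phi>) ((h + 1) div 2))) r)"
proof -
 have m0: "0 < m" using m by simp
 define C1 where "C1 = unit_ball_vol (real CARD('n)) * 2 powr (real CARD('n) * (real CARD('n) + 4) + 3 * m)"
 have C1: "0 < C1" by (simp add: C1_def unit_ball_vol_pos)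
 \<comment> \<open>The 4 is the inverse of the lower bound \<open>1 / 4\<close> for
   \<open>2^(m/2) - 1\<close>, the relative length of a half octave; the power of 2 is the change
   from level \<open>R\<close> to level \<open>k + 3\<close>, which are \<open>n + 4\<close>
   apart.\<close>
 define C2 where "C2 = 4 * 2 powr ((real CARD('n) + 4) * real CARD('n))"
 have C2: "0 < C2" by (simp add: C2_def)
 have "(2 powr (1/2)) <= (2::real) powr (m / 2)" using m by (intro powr_mono) (auto simp del: powr_half_sqrt)
 moreover have "5 / 4 <= (2::real) powr (1/2)"
  unfolding powr_half_sqrt[OF zero_le_numeral] by (rule real_le_rsqrt) (simp add: power2_eq_square)
 ultimately have half: "1 / 4 <= (2::real) powr (m / 2) - 1" by linarith
 show ?thesis
 proof (intro exI[of _ "C1 * C2 powr (r / U)"] conjI allI impI)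
  show "0 < C1 * C2 powr (r / U)" using C1 C2 by simp
  fix \<phi> :: "real => real ^ 'n => ennreal" and k h :: int and x z :: "real ^ 'n"
  assume m\<phi>: "joint_borel \<phi>" and h: "2 * k - 2 <= h" "h <= 2 * k + 3" and z: "z \<in> cell (k + 1) x"
  define R where "R = k - int CARD('n) - 1"
  define w where "w = wh m r \<phi>"
  have mw [measurable]: "joint_borel w" unfolding w_def by (rule borel_measurable_wh[OF m\<phi>])
  define k' where "k' = (h + 1) div 2"
  define A where "A = octave_mean m U w k'"
  have mA [measurable]: "A \<in> bor" unfolding A_def by (rule borel_measurable_octave_mean[OF mw])
  define L where "L = avg R (cell R z) (\<lambda>y. ennreal (tscale m (- k)) * (\<integral>s \<in> octave (m / 2) h. epowr (\<phi> s y) r))"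
  define X where "X = epowr (ennreal (1 / C1) * L) (U / r)"
  have Xw: "X <= epowr (w t y) U" if "y \<in> cell R z" "t \<in> octave (m / 2) (h + 1)" for t y
  proof -
   have "L <= ennreal C1 * epowr (w t y) r"
    unfolding L_def C1_def w_def using that by (intro cell_avg_le_wh[OF m r m\<phi> h]) (auto simp: R_def)
   then have "ennreal (1 / C1) * L <= ennreal (1 / C1) * (ennreal C1 * epowr (w t y) r)" by (rule mult_left_mono) simp
   also have "... = epowr (w t y) r" using C1 by (simp add: mult.assoc[symmetric] ennreal_mult'' [symmetric])
   finally have "X <= epowr (epowr (w t y) r) (U / r)" unfolding X_def using U r by (intro epowr_mono) auto
   then show ?thesis using r by (simp add: epowr_epowr)
  qed
  have XA: "ennreal (1 / 4) * X <= epowr (A y) U" if y: "y \<in> cell R z" for y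
  proof -
   have "tscale m k' <= tscale (m / 2) (h + 1)" unfolding tscale_half[of m] using m0 by (intro tscale_mono) (auto simp: k'_def)
   then have "tscale m (- k') * tscale m k' * (1 / 4) <= tscale m (- k') * tscale (m / 2) (h + 1) * (2 powr (m / 2) - 1)"
    using half by (intro mult_mono) auto
   then have "1 / 4 <= tscale m (- k') * (tscale (m / 2) (h + 1) * (2 powr (m / 2) - 1))" by (simp add: tscale_minus mult.assoc)
   then have "ennreal (1 / 4) * X <= ennreal (tscale m (- k') * (tscale (m / 2) (h + 1) * (2 powr (m / 2) - 1))) * X"
   by (intro mult_right_mono ennreal_leI) auto
   also have "... = ennreal (tscale m (- k')) * (\<integral>t \<in> octave (m / 2) (h + 1). X)"
    using m0 half by (simp add: nn_integral_cmult_indicator emeasure_octave ennreal_mult mult_ac)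
   also have "... <= ennreal (tscale m (- k')) * (\<integral>t \<in> octave m k'. epowr (w t y) U)"
    using Xw[OF y] half_octave_subset[OF m0, of "h + 1"]
   by (intro mult_left_mono nn_integral_mono) (auto simp: k'_def split: split_indicator)
   also have "... = epowr (A y) U" unfolding A_def octave_mean_def using U by (simp add: epowr_epowr)
   finally show ?thesis .
  qed
  have "ennreal (1 / 4) * X = avg R (cell R z) (\<lambda>_. ennreal (1 / 4) * X)" by (simp add: avg_one_cell)
  also have "... <= avg R (cell R z) (\<lambda>y. epowr (A y) U)" by (intro avg_mono XA)
  also have "... <= avg R (cell3 (k + 3) x) (\<lambda>y. epowr (A y) U)"
  proof (rule avg_subset)
   have "cell R z \<subseteq> cell (k + 1) x" by (rule cell_subset) (auto simp: R_def z)
   also have "... \<subseteq> cell3 (k + 3) x" using cell_mono[of "k + 1" "k + 3" x] cell_subset_cell3[of "k + 3" x] by auto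
   finally show "cell R z \<subseteq> cell3 (k + 3) x" .
  qed
  also have "... = ennreal (2 powr (rl (k + 3 - R) * real CARD('n))) * avg (k + 3) (cell3 (k + 3) x) (\<lambda>y. epowr (A y) U)"
  by (rule avg_level)
  finally have "ennreal 4 * (ennreal (1 / 4) * X) <= ennreal 4 * (ennreal (2 powr (rl (k + 3 - R) * real CARD('n))) * avg (k + 3) (cell3 (k + 3) x) (\<lambda>y. epowr (A y) U))"
  by (rule mult_left_mono) simp
  moreover have "ennreal 4 * (ennreal (1 / 4) * X) = X" by (simp add: mult.assoc[symmetric] ennreal_mult'' [symmetric] del: ennreal_numeral)
  moreover have "ennreal 4 * (ennreal (2 powr (rl (k + 3 - R) * real CARD('n))) * avg (k + 3) (cell3 (k + 3) x) (\<lambda>y. epowr (A y) U))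
    = ennreal C2 * epowr (pavg (k + 3) U (cell3 (k + 3) x) A) U"
  proof -
   have "rl (k + 3 - R) = real CARD('n) + 4" by (simp add: R_def)
   then show ?thesis unfolding C2_def using U by (simp only:) (simp add: pavg_def epowr_epowr ennreal_mult mult.assoc)
  qed
  ultimately have "X <= ennreal C2 * epowr (pavg (k + 3) U (cell3 (k + 3) x) A) U" by simp
  then have "epowr X (r / U) <= epowr (ennreal C2 * epowr (pavg (k + 3) U (cell3 (k + 3) x) A) U) (r / U)"
   using r U by (intro epowr_mono) auto
  then have "ennreal (1 / C1) * L <= ennreal (C2 powr (r / U)) * epowr (pavg (k + 3) U (cell3 (k + 3) x) A) r"
   using r U C2 by (simp add: X_def epowr_mult epowr_epowr epowr_ennreal)
  then have "ennreal C1 * (ennreal (1 / C1) * L) <= ennreal C1 * (ennreal (C2 powr (r / U)) * epowr (pavg (k + 3) U (cell3 (k + 3) x) A) r)"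
  by (rule mult_left_mono) simp
  also have "ennreal C1 * (ennreal (1 / C1) * L) = L" using C1 by (simp add: mult.assoc[symmetric] ennreal_mult'' [symmetric])
  finally have "L <= ennreal (C1 * C2 powr (r / U)) * epowr (pavg (k + 3) U (cell3 (k + 3) x) A) r"
   using C1 by (simp add: ennreal_mult mult.assoc)
  then show "avg (k - int CARD('n) - 1) (cell (k - int CARD('n) - 1) z) (\<lambda>y. ennreal (tscale m (- k)) * (\<integral>s \<in> octave (m / 2) h. epowr (\<phi> s y) r))
   <= ennreal (C1 * C2 powr (r / U)) * epowr (pavg (k + 3) U (cell3 (k + 3) x) (octave_mean m U (wh m r \<phi>) ((h + 1) div 2))) r"
  by (simp add: L_def R_def A_def w_def k'_def)
 qed
qed

text \<open>\<open>wide m k\<close> is cut into half octaves and \<open>cell (k + 1) x\<close> into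
  small cells, to which the preceding lemma applies. For \<open>j\<close> from \<open>-2\<close> to
  \<open>3\<close> the octaves \<open>k + (j + 1) div 2\<close> run from \<open>k - 1\<close> to
  \<open>k + 2\<close>, so level \<open>k + 3\<close> lies above all of them.\<close>

lemma tile_le_octave_means:
 assumes m: "1 <= m" and r: "0 < r" and U: "0 < U"
 shows "\<exists>C::real. 0 < C \<and> (\<forall>(\<phi> :: real => real ^ 'n => ennreal) k x. joint_borel \<phi> -->
   tile m r (wide m k) k \<phi> x <= ennreal C * (\<Sum>j\<in>{- 2, - 1, 0, 1, 2, 3}. pavg (k + 3) U (cell3 (k + 3) x) (octave_mean m U (wh m r \<phi>) (k + (j + 1) div 2))))"
proof -
 have m0: "0 < m" using m by simp
 obtain C where C: "0 < C" and CC: "\<And>(\<phi> :: real => real ^ 'n => ennreal) k h x z. joint_borel \<phi> ==>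
   2 * k - 2 <= h ==> h <= 2 * k + 3 ==> z \<in> cell (k + 1) x ==>
   avg (k - int CARD('n) - 1) (cell (k - int CARD('n) - 1) z) (\<lambda>y. ennreal (tscale m (- k)) * (\<integral>s \<in> octave (m / 2) h. epowr (\<phi> s y) r))
   <= ennreal C * epowr (pavg (k + 3) U (cell3 (k + 3) x) (octave_mean m U (wh m r \<phi>) ((h + 1) div 2))) r"
  using cell_avg_le_octave_mean[OF m r U, where 'n='n] by (elim exE conjE) (rule that, assumption, blast)
 let ?J = "{- 2, - 1, 0, 1, 2, 3} :: int set"
 show ?thesis
 proof (intro exI[of _ "C powr (1 / r) * 6 powr (1 / r)"] conjI allI impI)
  show "0 < C powr (1 / r) * 6 powr (1 / r)" using C by simp
  fix \<phi> :: "real => real ^ 'n => ennreal" and k and x :: "real ^ 'n"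
  assume m\<phi> [measurable]: "joint_borel \<phi>"
  define \<psi> where "\<psi> j y = ennreal (tscale m (- k)) * (\<integral>s \<in> octave (m / 2) (2 * k + j). epowr (\<phi> s y) r)" for j y
  have [measurable]: "\<psi> j \<in> bor" for j unfolding \<psi>_def by measurable
  define P where "P j = pavg (k + 3) U (cell3 (k + 3) x) (octave_mean m U (wh m r \<phi>) (k + (j + 1) div 2))" for j
  define R where "R = k - int CARD('n) - 1"
  have "avg (k + 1) (cell (k + 1) x) (\<lambda>y. ennreal (tscale m (- k)) * (\<integral>t \<in> wide m k. epowr (\<phi> t y) r)) <= avg (k + 1) (cell (k + 1) x) (\<lambda>y. \<Sum>j\<in>?J. \<psi> j y)"
  proof (rule avg_mono)
   fix y
   have [measurable]: "(\<lambda>t. \<phi> t y) \<in> borel_measurable lborel" by measurable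
   have "(\<integral>t \<in> wide m k. epowr (\<phi> t y) r) <= (\<integral>t. (\<Sum>j\<in>?J. epowr (\<phi> t y) r * indicator (octave (m / 2) (2 * k + j)) t))"
   proof (rule nn_integral_mono)
    fix t
    show "epowr (\<phi> t y) r * indicator (wide m k) t <= (\<Sum>j\<in>?J. epowr (\<phi> t y) r * indicator (octave (m / 2) (2 * k + j)) t)"
    proof (cases "t \<in> wide m k")
     case True
     from wide_half_octaves[OF m0 this] obtain j where j: "j \<in> ?J" "t \<in> octave (m / 2) (2 * k + j)" by (elim bexE)
     have "epowr (\<phi> t y) r * indicator (octave (m / 2) (2 * k + j)) t <= (\<Sum>j\<in>?J. epowr (\<phi> t y) r * indicator (octave (m / 2) (2 * k + j)) t)"
     by (rule member_le_sum[OF j(1)]) auto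
     then show ?thesis using True j(2) by (simp del: sum.insert)
    qed simp
   qed
   also have "... = (\<Sum>j\<in>?J. (\<integral>s \<in> octave (m / 2) (2 * k + j). epowr (\<phi> s y) r))"
   by (rule nn_integral_sum) measurable
   finally have "ennreal (tscale m (- k)) * (\<integral>t \<in> wide m k. epowr (\<phi> t y) r) <= ennreal (tscale m (- k)) * (\<Sum>j\<in>?J. (\<integral>s \<in> octave (m / 2) (2 * k + j). epowr (\<phi> s y) r))"
   by (rule mult_left_mono) simp
   also have "... = (\<Sum>j\<in>?J. \<psi> j y)" unfolding \<psi>_def by (rule sum_distrib_left)
   finally show "ennreal (tscale m (- k)) * (\<integral>t \<in> wide m k. epowr (\<phi> t y) r) <= (\<Sum>j\<in>?J. \<psi> j y)" .
  qed
  also have "... = (\<Sum>j\<in>?J. avg (k + 1) (cell (k + 1) x) (\<psi> j))"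
  by (rule avg_sum) measurable
  also have "... <= (\<Sum>j\<in>?J. ennreal C * epowr (P j) r)"
  proof (rule sum_mono)
   fix j assume j: "j \<in> ?J"
   have "avg (k + 1) (cell (k + 1) x) (\<psi> j) = avg (k + 1) (cell (k + 1) x) (\<lambda>z. avg R (cell R z) (\<psi> j))"
   proof -
    have "avg R (cell (k + 1) x) (\<lambda>z. avg R (cell R z) (\<psi> j)) = avg R (cell (k + 1) x) (\<psi> j)"
    by (rule avg_avg_cell) (simp, rule cell_subset, simp add: R_def)
    then show ?thesis
     unfolding avg_level[of "k + 1" "cell (k + 1) x" _ R] by simp
   qed
   also have "... <= avg (k + 1) (cell (k + 1) x) (\<lambda>_. ennreal C * epowr (P j) r)"
   proof (rule avg_mono)
    fix z assume z: "z \<in> cell (k + 1) x"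
    have "(2 * k + j + 1) div 2 = k + (j + 1) div 2" by simp
    moreover have "- 2 <= j" "j <= 3" using j by auto
    ultimately show "avg R (cell R z) (\<psi> j) <= ennreal C * epowr (P j) r"
     using CC[OF m\<phi> _ _ z, of "2 * k + j"] unfolding \<psi>_def[abs_def] R_def P_def by (simp add: add.assoc)
   qed
   also have "... = ennreal C * epowr (P j) r" by (rule avg_one_cell)
   finally show "avg (k + 1) (cell (k + 1) x) (\<psi> j) <= ennreal C * epowr (P j) r" .
  qed
  also have "... = ennreal C * (\<Sum>j\<in>?J. epowr (P j) r)" by (rule sum_distrib_left[symmetric])
  finally have "tile m r (wide m k) k \<phi> x <= epowr (ennreal C * (\<Sum>j\<in>?J. epowr (P j) r)) (1 / r)"
   unfolding tile_def using r by (intro epowr_mono) auto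
  also have "... <= ennreal (C powr (1 / r)) * (ennreal (real (card ?J) powr (1 / r)) * (\<Sum>j\<in>?J. epowr (epowr (P j) r) (1 / r)))"
   unfolding epowr_mult using r C by (intro mult_mono epowr_sum_le) (simp_all add: epowr_ennreal del: sum.insert)
  also have "... = ennreal (C powr (1 / r) * 6 powr (1 / r)) * (\<Sum>j\<in>?J. P j)"
   using r C by (simp add: epowr_epowr ennreal_mult mult.assoc del: sum.insert)
  finally show "tile m r (wide m k) k \<phi> x <= ennreal (C powr (1 / r) * 6 powr (1 / r)) * (\<Sum>j\<in>?J. pavg (k + 3) U (cell3 (k + 3) x) (octave_mean m U (wh m r \<phi>) (k + (j + 1) div 2)))"
   unfolding P_def .
 qed
qed

section \<open>Equivalence of tent norms and norms of tiles\<close>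

lemma weight_shift: "weight m q \<beta> l = ennreal (2 powr (m * rl i * (enn2real (inverse q) - \<beta>))) * weight m q \<beta> (l - i)"
 unfolding weight_def by (simp add: ennreal_mult'' [symmetric] powr_add[symmetric] algebra_simps)

text \<open>The instance of \<open>dnorm_pieces\<close> with finitely many pieces and a constant
  level shift. The ratio of the weights of shifted octaves does not depend on the octave
  (\<open>weight_shift\<close>) and goes into the coefficient \<open>e j\<close>.\<close>

lemma dnorm_finite_shifts:
 fixes J :: "int set"
 assumes p: "0 < p" and q: "0 < q" and U: "0 < U" "ennreal U < p" "ennreal U < q" and J: "finite J" "\<And>j. j \<in> J ==> - \<delta> j <= int s"
  and C: "0 < C"
 shows "\<exists>K::real. 0 <= K \<and> (\<forall>a b. (\<forall>k. a k \<in> bor) --> (\<forall>k. b k \<in> bor) -->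
   (\<forall>l (x :: real ^ 'n). b l x <= ennreal C * (\<Sum>j\<in>J. pavg (l + int s) U (cell3 (l + int s) x) (a (l - \<delta> j)))) -->
   dnorm p q (\<lambda>k x. weight m q \<beta> k * b k x) <= ennreal K * dnorm p q (\<lambda>k x. weight m q \<beta> k * a k x))"
proof -
 define c where "c = enn2real (inverse q) - \<beta>"
 define e where "e j = C * 2 powr (m * rl (\<delta> j) * c)" for j
 have e: "0 < e j" for j using C by (simp add: e_def)
 \<comment> \<open>Any positive number above the finite ones among \<open>p\<close> and
   \<open>q\<close> serves, because the bounds here are pointwise.\<close>
 define V where "V = enn2real p + enn2real q + 1"
 have V0: "0 < V" unfolding V_def by (metis add_nonneg_pos enn2real_nonneg add_nonneg_nonneg zero_less_one)
 have V: "p < ennreal V \<and> q < ennreal V" if "p < \<infinity>" "q < \<infinity>"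
 proof -
  obtain p' q' where pq: "p = ennreal p'" "0 <= p'" "q = ennreal q'" "0 <= q'"
   using \<open>p < \<infinity>\<close> \<open>q < \<infinity>\<close> by (cases p; cases q) auto
  show ?thesis unfolding V_def pq using pq(2,4) by (simp add: ennreal_less_iff del: ennreal_plus)
 qed
 have fin: "(\<Sum>\<^sup>+j\<in>J. (1 + of_nat s) * ennreal (e j powr \<eta>)) < top" for \<eta>
  using J by (simp add: nn_integral_count_space_finite ennreal_mult_less_top sum_distrib_left[symmetric] of_nat_less_top)
 have "\<exists>K::real. 0 <= K \<and> (\<forall>a b (bb :: int => int => real ^ 'n => ennreal).
   (\<forall>k. a k \<in> bor) --> (\<forall>k. b k \<in> bor) --> (\<forall>l. \<forall>j\<in>J. bb l j \<in> bor) -->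
   (\<forall>l x. b l x <= (\<Sum>\<^sup>+j\<in>J. bb l j x)) -->
   (\<forall>l. \<forall>j\<in>J. piece_bound p q V U (l + int s) (e j) (bb l j) (a (l - \<delta> j))) -->
   dnorm p q b <= ennreal K * dnorm p q a)" (is "\<exists>K. _ \<and> ?main K")
   using J e fin V by (intro dnorm_pieces[where s="\<lambda>_. s", OF p q U]) (auto simp: countable_finite)
 then obtain K where K: "0 <= K" and main: "?main K" by (elim exE conjE)
 show ?thesis
 proof (intro exI[of _ K] conjI K allI impI)
  fix a b :: "int => real ^ 'n => ennreal"
  assume ma: "\<forall>k. a k \<in> bor" and mb: "\<forall>k. b k \<in> bor"
   and le: "\<forall>l x. b l x <= ennreal C * (\<Sum>j\<in>J. pavg (l + int s) U (cell3 (l + int s) x) (a (l - \<delta> j)))"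
  note [measurable] = ma[rule_format] mb[rule_format]
  define bb where "bb l j x = ennreal (e j) * pavg (l + int s) U (cell3 (l + int s) x) (\<lambda>y. weight m q \<beta> (l - \<delta> j) * a (l - \<delta> j) y)" for l j x
  show "dnorm p q (\<lambda>k x. weight m q \<beta> k * b k x) <= ennreal K * dnorm p q (\<lambda>k x. weight m q \<beta> k * a k x)"
  proof (rule main[THEN spec, THEN spec, THEN spec[of _ bb], THEN mp, THEN mp, THEN mp, THEN mp, THEN mp]; (intro allI ballI)?)
   fix l x
   have "weight m q \<beta> l * b l x <= weight m q \<beta> l * (ennreal C * (\<Sum>j\<in>J. pavg (l + int s) U (cell3 (l + int s) x) (a (l - \<delta> j))))"
    using le by (intro mult_left_mono) auto
   also have "... = (\<Sum>j\<in>J. bb l j x)"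
    unfolding sum_distrib_left
   proof (rule sum.cong[OF refl])
    fix j
    show "weight m q \<beta> l * (ennreal C * pavg (l + int s) U (cell3 (l + int s) x) (a (l - \<delta> j))) = bb l j x"
     unfolding bb_def e_def c_def using C U
    by (subst weight_shift[of m q \<beta> l "\<delta> j"]) (subst pavg_cmult, simp_all add: ennreal_mult mult_ac)
   qed
   also have "... = (\<Sum>\<^sup>+j\<in>J. bb l j x)" using J by (simp add: nn_integral_count_space_finite)
   finally show "weight m q \<beta> l * b l x <= (\<Sum>\<^sup>+j\<in>J. bb l j x)" .
  next
   fix l j
   show "piece_bound p q V U (l + int s) (e j) (bb l j) (\<lambda>x. weight m q \<beta> (l - \<delta> j) * a (l - \<delta> j) x)"
   by (rule piece_bound_pointwise[OF V0]) (simp add: bb_def)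
   show "bb l j \<in> bor" unfolding bb_def by measurable
  qed measurable
 qed
qed

theorem tent_norm_le_tiles:
 assumes m: "1 <= m" and r: "0 < r" and p: "0 < p" and q: "0 < q" and U: "0 < U" "U <= r" "ennreal U < p" "ennreal U < q"
 shows "\<exists>K::real. 0 <= K \<and> (\<forall>(f :: real \<times> (real ^ 'n) => complex) (\<phi> :: real => real ^ 'n => ennreal). joint_borel \<phi> -->
   (AE z in lborel. 0 < fst z --> ennreal (norm (f z)) = \<phi> (fst z) (snd z)) -->
   tent_norm m p q (ennreal r) \<beta> f <= ennreal K * dnorm p q (\<lambda>k x. weight m q \<beta> k * tile m r (octave m k) k \<phi> x))"
proof -
 have m0: "0 < m" using m by simp
 define C where "C = (2 ^ (CARD('n) + 2) / unit_ball_vol (real CARD('n))) powr (1 / r) * 2 powr (real CARD('n) * (1 / U - 1 / r))"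
 have C: "0 < C" unfolding C_def by (intro mult_pos_pos powr_gt_zero[THEN iffD2] divide_pos_pos[THEN less_imp_neq, symmetric] unit_ball_vol_pos) auto
 obtain K1 where K1: "0 <= K1" and T1: "\<And>(f :: real \<times> (real ^ 'n) => complex) w b. joint_borel w ==>
   (\<forall>t x. 0 < t --> whitney m (ennreal r) f t x = w t x) ==>
   (\<forall>k. b k \<in> bor) ==> (\<forall>k t x. t \<in> octave m k --> w t x <= b k x) ==>
   tent_norm m p q (ennreal r) \<beta> f <= ennreal K1 * dnorm p q (\<lambda>k x. weight m q \<beta> k * b k x)"
  using tent_norm_le_dnorm[OF m0 p q, where 'n='n and r="ennreal r" and \<beta>=\<beta>] by (elim exE conjE) (rule that, assumption, blast)
 have "\<exists>K::real. 0 <= K \<and> (\<forall>a b. (\<forall>k. a k \<in> bor) --> (\<forall>k. b k \<in> bor) -->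
   (\<forall>l (x :: real ^ 'n). b l x <= ennreal C * (\<Sum>j\<in>{0, 1}. pavg (l + int 1) U (cell3 (l + int 1) x) (a (l - j)))) -->
   dnorm p q (\<lambda>k x. weight m q \<beta> k * b k x) <= ennreal K * dnorm p q (\<lambda>k x. weight m q \<beta> k * a k x))" (is "\<exists>K. _ \<and> ?T2 K")
   using C by (intro dnorm_finite_shifts[where s=1, OF p q U(1,3,4)]) auto
 then obtain K2 where K2: "0 <= K2" and T2: "?T2 K2" by (elim exE conjE)
 show ?thesis
 proof (intro exI[of _ "K1 * K2"] conjI allI impI)
  show "0 <= K1 * K2" using K1 K2 by simp
  fix f :: "real \<times> (real ^ 'n) => complex" and \<phi> :: "real => real ^ 'n => ennreal"
  assume m\<phi>: "joint_borel \<phi>" and AE: "AE z in lborel. 0 < fst z --> ennreal (norm (f z)) = \<phi> (fst z) (snd z)"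
  define b where "b l x = ennreal C * (\<Sum>j\<in>{0, 1 :: int}. pavg (l + 1) U (cell3 (l + 1) x) (tile m r (octave m (l - j)) (l - j) \<phi>))" for l x
  have mb: "b l \<in> bor" for l unfolding b_def by measurable
  have "tent_norm m p q (ennreal r) \<beta> f <= ennreal K1 * dnorm p q (\<lambda>k x. weight m q \<beta> k * b k x)"
  proof (rule T1[OF borel_measurable_wh[OF m\<phi>]]; intro allI impI)
   show "whitney m (ennreal r) f t x = wh m r \<phi> t x" if "0 < t" for t x
    using m0 that r m\<phi> AE by (rule whitney_eq_wh)
   show "wh m r \<phi> t x <= b k x" if "t \<in> octave m k" for k t x
    unfolding b_def C_def using m r U that m\<phi> by (intro wh_le_tiles) auto
  qed (rule mb)
  also have "... <= ennreal K1 * (ennreal K2 * dnorm p q (\<lambda>k x. weight m q \<beta> k * tile m r (octave m k) k \<phi> x))"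
  by (intro mult_left_mono T2[rule_format]) (auto simp: mb b_def)
  finally show "tent_norm m p q (ennreal r) \<beta> f <= ennreal (K1 * K2) * dnorm p q (\<lambda>k x. weight m q \<beta> k * tile m r (octave m k) k \<phi> x)"
   using K1 K2 by (simp add: ennreal_mult mult.assoc)
 qed
qed

text \<open>The converse comparison is made for the larger tiles over three octaves, since these are
  what the source side of the operator estimates produces.\<close>

theorem tiles_le_tent_norm:
 assumes m: "1 <= m" and r: "0 < r" and p: "0 < p" and q: "0 < q" and U: "0 < U" "ennreal U < p" "ennreal U < q"
 shows "\<exists>K::real. 0 <= K \<and> (\<forall>(f :: real \<times> (real ^ 'n) => complex) (\<phi> :: real => real ^ 'n => ennreal). joint_borel \<phi> -->
   (AE z in lborel. 0 < fst z --> ennreal (norm (f z)) = \<phi> (fst z) (snd z)) -->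
   dnorm p q (\<lambda>k x. weight m q \<beta> k * tile m r (wide m k) k \<phi> x) <= ennreal K * tent_norm m p q (ennreal r) \<beta> f)"
proof -
 have m0: "0 < m" using m by simp
 let ?J = "{- 2, - 1, 0, 1, 2, 3} :: int set"
 obtain C where C: "0 < C" and T: "\<And>(\<phi> :: real => real ^ 'n => ennreal) k x. joint_borel \<phi> ==>
   tile m r (wide m k) k \<phi> x <= ennreal C * (\<Sum>j\<in>?J. pavg (k + 3) U (cell3 (k + 3) x) (octave_mean m U (wh m r \<phi>) (k + (j + 1) div 2)))"
  using tile_le_octave_means[OF m r U(1), where 'n='n] by (elim exE conjE) (rule that, assumption, blast)
 obtain K1 where K1: "0 <= K1" and T1: "\<And>(f :: real \<times> (real ^ 'n) => complex) w. joint_borel w ==>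
   (\<forall>t x. 0 < t --> whitney m (ennreal r) f t x = w t x) ==>
   dnorm p q (\<lambda>k x. weight m q \<beta> k * octave_mean m U w k x) <= ennreal K1 * tent_norm m p q (ennreal r) \<beta> f"
  using dnorm_le_tent_norm[OF m0 p q U(1,3), where 'n='n and r="ennreal r" and \<beta>=\<beta>] by (elim exE conjE) (rule that, assumption, blast)
 have "\<exists>K::real. 0 <= K \<and> (\<forall>a b. (\<forall>k. a k \<in> bor) --> (\<forall>k. b k \<in> bor) -->
   (\<forall>l (x :: real ^ 'n). b l x <= ennreal C * (\<Sum>j\<in>?J. pavg (l + int 3) U (cell3 (l + int 3) x) (a (l - (- ((j + 1) div 2)))))) -->
   dnorm p q (\<lambda>k x. weight m q \<beta> k * b k x) <= ennreal K * dnorm p q (\<lambda>k x. weight m q \<beta> k * a k x))" (is "\<exists>K. _ \<and> ?T2 K")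
   using C by (intro dnorm_finite_shifts[where s=3 and \<delta>="\<lambda>j. - ((j + 1) div 2)", OF p q U]) auto
 then obtain K2 where K2: "0 <= K2" and T2: "?T2 K2" by (elim exE conjE)
 show ?thesis
 proof (intro exI[of _ "K2 * K1"] conjI allI impI)
  show "0 <= K2 * K1" using K1 K2 by simp
  fix f :: "real \<times> (real ^ 'n) => complex" and \<phi> :: "real => real ^ 'n => ennreal"
  assume m\<phi>: "joint_borel \<phi>" and AE: "AE z in lborel. 0 < fst z --> ennreal (norm (f z)) = \<phi> (fst z) (snd z)"
  have "dnorm p q (\<lambda>k x. weight m q \<beta> k * tile m r (wide m k) k \<phi> x) <= ennreal K2 * dnorm p q (\<lambda>k x. weight m q \<beta> k * octave_mean m U (wh m r \<phi>) k x)"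
  proof (rule T2[THEN spec, THEN spec, THEN mp, THEN mp, THEN mp]; intro allI)
   show "octave_mean m U (wh m r \<phi>) k \<in> bor" for k
   by (rule borel_measurable_octave_mean[OF borel_measurable_wh[OF m\<phi>]])
   show "tile m r (wide m l) l \<phi> x <= ennreal C * (\<Sum>j\<in>?J. pavg (l + int 3) U (cell3 (l + int 3) x) (octave_mean m U (wh m r \<phi>) (l - (- ((j + 1) div 2)))))" for l x
    using T[OF m\<phi>, of l x] by (simp del: sum.insert)
  qed measurable
  also have "... <= ennreal K2 * (ennreal K1 * tent_norm m p q (ennreal r) \<beta> f)"
  proof (intro mult_left_mono T1 borel_measurable_wh m\<phi> allI impI)
   show "whitney m (ennreal r) f t x = wh m r \<phi> t x" if "0 < t" for t x
    using m0 that r m\<phi> AE by (rule whitney_eq_wh)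
  qed simp
  finally show "dnorm p q (\<lambda>k x. weight m q \<beta> k * tile m r (wide m k) k \<phi> x) <= ennreal (K2 * K1) * tent_norm m p q (ennreal r) \<beta> f"
   using K1 K2 by (simp add: ennreal_mult mult.assoc)
 qed
qed

section \<open>Mixed norms and tiles\<close>

lemma nn_integral_lebesgue_on: "S \<in> sets borel ==> (\<integral>\<^sup>+ x. h x \<partial>lebesgue_on S) = (\<integral>x \<in> S. h x)"
 for h :: "'a::euclidean_space => ennreal"
 by (simp add: nn_integral_restrict_space nn_integral_lebesgue)

lemma ennreal_powr_mult: "ennreal (2 powr a) * (ennreal (2 powr b) * X) = ennreal (2 powr (a + b)) * X"
 by (simp add: mult.assoc[symmetric] ennreal_mult'' [symmetric] powr_add)

text \<open>On a set of measure \<open>A\<close> the exponent \<open>v\<close> may be lowered to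
  \<open>r\<close>, the endpoint \<open>v = \<infinity>\<close> included. The majorant
  \<open>N\<close> is a bare function because it will also be an inner norm of
  \<open>T f\<close>.\<close>

lemma Lp_norm_Holder:
 fixes G N :: "'a::euclidean_space => ennreal"
 assumes r: "0 < r" "ennreal r <= v" and [measurable]: "G \<in> bor" "S \<in> sets borel" "\<Omega> \<in> sets borel"
  and S: "S \<subseteq> \<Omega>" "emeasure lborel S = ennreal A" "0 < A" and le: "AE x in lborel. x \<in> S --> G x <= N x"
 shows "epowr (\<integral>x \<in> S. epowr (G x) r) (1 / r) <= ennreal (A powr (1 / r - enn2real (inverse v))) * Lp_norm v (lebesgue_on \<Omega>) N"
proof (cases v)
 case (real v')
 then have v': "r <= v'" "0 < v'" using r by (auto simp: ennreal_le_iff2)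
 have inv: "enn2real (inverse v) = 1 / v'" using real v' by (simp add: inverse_ennreal inverse_eq_divide)
 have "(\<integral>x \<in> S. epowr (G x) r) = (\<integral>x. indicator S x * epowr (epowr (G x) v') (r / v'))"
  using v' by (simp add: epowr_epowr mult.commute)
 also have "... <= epowr (\<integral>x. indicator S x * epowr (G x) v') (r / v') * epowr (\<integral>x. indicator S x) (1 - r / v')"
  using r v' by (intro nn_integral_Jensen_weight) auto
 also have "(\<integral>x. indicator S x) = ennreal A" using S by simp
 also have "(\<integral>x. indicator S x * epowr (G x) v') <= (\<integral>x \<in> \<Omega>. epowr (N x) v')"
  using le S v' by (intro nn_integral_mono_AE) (auto split: split_indicator intro: epowr_mono elim!: eventually_mono)
 finally have "(\<integral>x \<in> S. epowr (G x) r) <= epowr (\<integral>x \<in> \<Omega>. epowr (N x) v') (r / v') * epowr (ennreal A) (1 - r / v')"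
  using r v' by (simp add: mult_right_mono epowr_mono)
 then have "epowr (\<integral>x \<in> S. epowr (G x) r) (1 / r) <= epowr (epowr (\<integral>x \<in> \<Omega>. epowr (N x) v') (r / v') * epowr (ennreal A) (1 - r / v')) (1 / r)"
  using r by (intro epowr_mono) auto
 also have "... = ennreal (A powr (1 / r - 1 / v')) * epowr (\<integral>x \<in> \<Omega>. epowr (N x) v') (1 / v')"
  using r v' S by (simp add: epowr_mult epowr_epowr epowr_ennreal powr_powr diff_divide_distrib mult.commute)
 finally show ?thesis using v' unfolding inv unfolding Lp_norm_def real by (simp add: nn_integral_lebesgue_on)
next
 case top
 define E where "E = esssup (lebesgue_on \<Omega>) N"
 have NE: "AE x in lborel. x \<in> \<Omega> --> N x <= E"
  using esssup_AE[of N "lebesgue_on \<Omega>"] unfolding E_def by (subst (asm) AE_lebesgue_on) auto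
 have "(\<integral>x \<in> S. epowr (G x) r) <= (\<integral>x. epowr E r * indicator S x)"
 proof (intro nn_integral_mono_AE, use le NE in eventually_elim)
  case (elim x)
  then have "x \<in> S ==> G x <= E" using S by (auto intro: order_trans)
  then show ?case using r by (auto split: split_indicator intro: epowr_mono)
 qed
 also have "... = epowr E r * ennreal A" using S by (simp add: nn_integral_cmult_indicator)
 finally have "epowr (\<integral>x \<in> S. epowr (G x) r) (1 / r) <= epowr (epowr E r * ennreal A) (1 / r)"
  using r by (intro epowr_mono) auto
 also have "... = ennreal (A powr (1 / r)) * E" using r S by (simp add: epowr_mult epowr_epowr epowr_ennreal mult.commute)
 finally show ?thesis unfolding Lp_norm_def top by (simp add: E_def)
qed

lemma measurable_lborel_pair: "borel_measurable (lborel \<Otimes>\<^sub>M lborel) = borel_measurable (borel \<Otimes>\<^sub>M borel)"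
 by (rule measurable_cong_sets[OF sets_pair_measure_cong[OF sets_lborel sets_lborel] refl])

text \<open>\<open>f\<close> and \<open>T f\<close> are Lebesgue measurable only, which says nothing
  about individual slices; iterated integrals are therefore taken of a jointly Borel version of the
  modulus.\<close>

definition borel_modulus :: "(real \<times> (real ^ 'n) => complex) => (real => real ^ 'n => ennreal) => bool" where
 "borel_modulus f \<phi> \<longleftrightarrow> joint_borel \<phi> \<and>
   (AE z in lborel. 0 < fst z --> ennreal (norm (f z)) = \<phi> (fst z) (snd z))"

lemma borel_modulus_ex: assumes "f \<in> L0" shows "\<exists>\<phi>. borel_modulus f \<phi>"
proof -
 have [measurable]: "f \<in> borel_measurable (lebesgue_on upper_half_space)" using assms by (simp add: L0_def)
 have "(\<lambda>z. ennreal (norm (f z))) \<in> borel_measurable (lebesgue_on upper_half_space)" by measurable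
 then have "(\<lambda>z. ennreal (norm (f z)) * indicator upper_half_space z) \<in> borel_measurable lebesgue"
 by (subst (asm) borel_measurable_restrict_space_iff_ennreal) auto
 from completion_ex_borel_measurable[OF this] obtain g where g: "g \<in> borel_measurable lborel"
   "AE z in lborel. ennreal (norm (f z)) * indicator upper_half_space z = g z" by auto
 have "(\<lambda>(t, x). g (t, x)) \<in> borel_measurable (borel \<Otimes>\<^sub>M borel)" using g(1) by (simp add: borel_prod)
 moreover have "AE z in lborel. 0 < fst z --> ennreal (norm (f z)) = g (fst z, snd z)"
  using g(2) by eventually_elim (auto simp: upper_half_space_def split: split_indicator)
 ultimately show ?thesis unfolding borel_modulus_def by (intro exI[of _ "\<lambda>t x. g (t, x)"]) simp
qed

lemma borel_modulus_slices:
 assumes "borel_modulus f \<phi>"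
 shows "AE t in lborel. AE x in lborel. 0 < t --> ennreal (norm (f (t, x))) = \<phi> t x"
proof -
 have "AE z in lborel \<Otimes>\<^sub>M lborel. 0 < fst z --> ennreal (norm (f z)) = \<phi> (fst z) (snd z)"
  using assms unfolding lborel_prod borel_modulus_def by simp
 then show ?thesis by (auto dest: lborel_pair.AE_pair)
qed

text \<open>Jensen (\<open>r <= v1\<close>) removes the averaging inside the tiles, Minkowski takes
  the time norm outside the space norm, and Hoelder passes from \<open>v1\<close> to
  \<open>vx\<close> on the cell and from \<open>r\<close> to \<open>vt\<close> on the octave. The
  finite \<open>v1\<close> stands in for \<open>vx\<close>, which may be infinite; the summand
  \<open>m\<close> in the exponent absorbs \<open>2^m - 1 <= 2^m\<close>.\<close>

lemma tile_target_bound: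
 fixes g :: "real \<times> (real ^ 'n) => complex"
 assumes m: "1 <= m" and r: "1 <= r" "ennreal r <= vt" and v1: "r <= v1" "ennreal v1 <= vx" and g: "borel_modulus g U"
  and F: "octave m l \<subseteq> Ft" "cell R x \<subseteq> Fx" and R: "l + 1 <= R"
 shows "pavg R v1 (cell R x) (tile m r (octave m l) l U)
  <= ennreal (2 powr (m - m * rl l * enn2real (inverse vt) - rl R * real CARD('n) * enn2real (inverse vx))) * mixed_norm vt vx (restr (Ft \<times> Fx) g)"
proof -
 define P where "P = cell R x"
 define O' where "O' = octave m l"
 have [measurable]: "P \<in> sets borel" "O' \<in> sets borel" by (simp_all add: P_def O'_def)
 have mU [measurable]: "joint_borel U" using g by (simp add: borel_modulus_def)
 have [measurable]: "(\<lambda>(t, x). U t x) \<in> borel_measurable (borel \<Otimes>\<^sub>M lborel)" by measurable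
 have m0: "0 < m" and r0: "0 < r" and v0: "0 < v1" using m r v1 by auto
 let ?n = "real CARD('n)" and ?it = "enn2real (inverse vt)" and ?ix = "enn2real (inverse vx)"
 define H where "H y = ennreal (tscale m (- l)) * (\<integral>t \<in> O'. epowr (U t y) r)" for y
 have [measurable]: "H \<in> bor" unfolding H_def by measurable
 have "avg R P (\<lambda>y. epowr (tile m r O' l U y) v1) <= avg R P (\<lambda>y. avg (l + 1) (cell (l + 1) y) (\<lambda>z. epowr (H z) (v1 / r)))"
 proof (rule avg_mono)
  fix y
  have "avg (l + 1) (cell (l + 1) y) (\<lambda>z. epowr (epowr (H z) (v1 / r)) (r / v1)) <= epowr (avg (l + 1) (cell (l + 1) y) (\<lambda>z. epowr (H z) (v1 / r))) (r / v1)"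
   using r0 v1 by (intro avg_Jensen_cell) auto
  then have "epowr (avg (l + 1) (cell (l + 1) y) H) (v1 / r) <= epowr (epowr (avg (l + 1) (cell (l + 1) y) (\<lambda>z. epowr (H z) (v1 / r))) (r / v1)) (v1 / r)"
   using r0 v0 by (intro epowr_mono) (auto simp: epowr_epowr)
  then show "epowr (tile m r O' l U y) v1 <= avg (l + 1) (cell (l + 1) y) (\<lambda>z. epowr (H z) (v1 / r))"
   using r0 v0 by (simp add: tile_def H_def[abs_def] epowr_epowr)
 qed
 also have "... = avg R P (\<lambda>z. epowr (H z) (v1 / r))"
 by (rule avg_avg_cell) (simp, unfold P_def, rule cell_subset[OF R])
 also have "... = ennreal (2 powr (- rl R * ?n)) * (\<integral>y \<in> P. epowr (H y) (v1 / r))" by (simp add: avg_def)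
 finally have 1: "pavg R v1 P (tile m r O' l U) <= epowr (ennreal (2 powr (- rl R * ?n)) * (\<integral>y \<in> P. epowr (H y) (v1 / r))) (1 / v1)"
  unfolding pavg_def using v0 by (intro epowr_mono) auto
 define G where "G t y = ennreal (tscale m (- l)) * epowr (U t y) r * indicator O' t * indicator P y" for t y
 define Q where "Q t = epowr (\<integral>y \<in> P. epowr (U t y) v1) (1 / v1)" for t
 have [measurable]: "Q \<in> bor" unfolding Q_def by measurable
 have mL: "(\<lambda>(t, y). ennreal (tscale m (- l)) * epowr (U t y) r * indicator O' t * indicator P y) \<in> borel_measurable (lborel \<Otimes>\<^sub>M lborel)"
  unfolding measurable_lborel_pair by measurable
 have Gy: "(\<integral>t. G t y) = H y * indicator P y" for y
  unfolding G_def H_def by (simp add: nn_integral_cmult mult.assoc split: split_indicator)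
 have Gt: "epowr (\<integral>y. epowr (G t y) (v1 / r)) (1 / (v1 / r)) = ennreal (tscale m (- l)) * (epowr (Q t) r * indicator O' t)" for t
 proof (cases "t \<in> O'")
  case True
  have "(\<integral>y. epowr (G t y) (v1 / r)) = (\<integral>y. epowr (ennreal (tscale m (- l))) (v1 / r) * (epowr (U t y) v1 * indicator P y))"
   using True r0 by (intro nn_integral_cong) (auto simp: G_def epowr_mult epowr_epowr split: split_indicator)
  also have "... = epowr (ennreal (tscale m (- l))) (v1 / r) * (\<integral>y \<in> P. epowr (U t y) v1)" by (simp add: nn_integral_cmult)
  finally show ?thesis using True r0 v0 by (simp add: epowr_mult epowr_epowr Q_def)
 qed (simp add: G_def)
 have "epowr (\<integral>y. epowr (\<integral>t. G t y) (v1 / r)) (1 / (v1 / r)) <= (\<integral>t. epowr (\<integral>y. epowr (G t y) (v1 / r)) (1 / (v1 / r)))"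
  using v1 r0 unfolding G_def by (intro nn_integral_Minkowski sigma_finite_lborel mL) simp
 also have "... = ennreal (tscale m (- l)) * (\<integral>t \<in> O'. epowr (Q t) r)"
  unfolding Gt by (simp add: nn_integral_cmult)
 also have "(\<integral>y. epowr (\<integral>t. G t y) (v1 / r)) = (\<integral>y \<in> P. epowr (H y) (v1 / r))"
  unfolding Gy by (intro nn_integral_cong) (auto split: split_indicator)
 finally have 2: "epowr (\<integral>y \<in> P. epowr (H y) (v1 / r)) (1 / (v1 / r)) <= ennreal (tscale m (- l)) * (\<integral>t \<in> O'. epowr (Q t) r)" .
 have "epowr (\<integral>y \<in> P. epowr (H y) (v1 / r)) (1 / v1) = epowr (epowr (\<integral>y \<in> P. epowr (H y) (v1 / r)) (1 / (v1 / r))) (1 / r)"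
  using r0 v0 by (simp add: epowr_epowr)
 also have "... <= epowr (ennreal (tscale m (- l)) * (\<integral>t \<in> O'. epowr (Q t) r)) (1 / r)"
  using r0 by (intro epowr_mono 2) simp
 finally have 3: "epowr (\<integral>y \<in> P. epowr (H y) (v1 / r)) (1 / v1) <= ennreal (tscale m (- l) powr (1 / r)) * epowr (\<integral>t \<in> O'. epowr (Q t) r) (1 / r)"
 by (simp add: epowr_mult epowr_ennreal)
 define \<alpha> where "\<alpha> = rl R * ?n * (1 / v1 - ?ix)"
 define N where "N t = Lp_norm vx lebesgue (\<lambda>x. ennreal (norm (restr (Ft \<times> Fx) g (t, x))))" for t
 have "AE t in lborel. t \<in> O' --> ennreal (2 powr - \<alpha>) * Q t <= N t"
  using borel_modulus_slices[OF g]
 proof eventually_elim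
  case (elim t)
  show ?case
  proof
   assume t: "t \<in> O'"
   then have "0 < t" "t \<in> Ft" using F by (auto simp: O'_def dest: octave_pos)
   have "Q t <= ennreal ((2 powr (rl R * ?n)) powr (1 / v1 - ?ix)) * Lp_norm vx (lebesgue_on UNIV) (\<lambda>x. ennreal (norm (restr (Ft \<times> Fx) g (t, x))))"
    unfolding Q_def
   proof (rule Lp_norm_Holder[OF v0 v1(2)])
    show "emeasure lborel P = ennreal (2 powr (rl R * ?n))" by (simp add: P_def emeasure_cell)
    show "AE y in lborel. y \<in> P --> U t y <= ennreal (norm (restr (Ft \<times> Fx) g (t, y)))"
     using elim by eventually_elim (use \<open>0 < t\<close> \<open>t \<in> Ft\<close> F in \<open>auto simp: P_def restr_def\<close>)
   qed auto
   then have "ennreal (2 powr - \<alpha>) * Q t <= ennreal (2 powr - \<alpha>) * (ennreal (2 powr \<alpha>) * N t)"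
   by (intro mult_left_mono) (simp_all add: N_def lebesgue_on_UNIV_eq powr_powr \<alpha>_def)
   also have "... = N t" by (simp add: mult.assoc[symmetric] ennreal_mult'' [symmetric] powr_add[symmetric])
   finally show "ennreal (2 powr - \<alpha>) * Q t <= N t" .
  qed
 qed
 then have "epowr (\<integral>t \<in> O'. epowr (ennreal (2 powr - \<alpha>) * Q t) r) (1 / r) <= ennreal ((tscale m l * (2 powr m - 1)) powr (1 / r - ?it)) * Lp_norm vt (lebesgue_on {0<..}) N"
  using m0 r by (intro Lp_norm_Holder) (auto simp: O'_def emeasure_octave dest: octave_pos)
 also have "Lp_norm vt (lebesgue_on {0<..}) N = mixed_norm vt vx (restr (Ft \<times> Fx) g)" by (simp add: mixed_norm_def N_def[abs_def])
 also have "(\<integral>t \<in> O'. epowr (ennreal (2 powr - \<alpha>) * Q t) r) = epowr (ennreal (2 powr - \<alpha>)) r * (\<integral>t \<in> O'. epowr (Q t) r)"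
 by (simp add: epowr_mult nn_integral_cmult mult.assoc)
 finally have 4: "ennreal (2 powr - \<alpha>) * epowr (\<integral>t \<in> O'. epowr (Q t) r) (1 / r) <= ennreal ((tscale m l * (2 powr m - 1)) powr (1 / r - ?it)) * mixed_norm vt vx (restr (Ft \<times> Fx) g)"
  using r0 by (simp add: epowr_mult epowr_epowr)
 have it: "?it <= 1 / r" "0 <= ?it"
 proof -
  have "inverse vt <= inverse (ennreal r)" using r by (simp add: ennreal_inverse_anti_mono)
  then have "?it <= enn2real (inverse (ennreal r))" using r0 by (intro enn2real_mono) (auto simp: inverse_ennreal)
  then show "?it <= 1 / r" using r0 by (simp add: inverse_ennreal inverse_eq_divide)
 qed simp
 have "(tscale m l * (2 powr m - 1)) powr (1 / r - ?it) = tscale m l powr (1 / r - ?it) * (2 powr m - 1) powr (1 / r - ?it)"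
  using m0 by (subst powr_mult) auto
 also have "... <= tscale m l powr (1 / r - ?it) * 2 powr m"
 proof (intro mult_left_mono)
  have "(2 powr m - 1) powr (1 / r - ?it) <= (2 powr m) powr (1 / r - ?it)" using it m0 ge_one_powr_ge_zero[of 2 m] by (intro powr_mono2) auto
  also have "... <= (2 powr m) powr 1" using it r m0 ge_one_powr_ge_zero[of 2 m] by (intro powr_mono) (auto intro: order_trans[of _ "1 / r"])
  finally show "(2 powr m - 1) powr (1 / r - ?it) <= 2 powr m" by (simp add: powr_powr)
 qed simp
 finally have 5: "(tscale m l * (2 powr m - 1)) powr (1 / r - ?it) <= 2 powr (m * rl l * (1 / r - ?it) + m)"
 by (simp add: tscale_powr powr_add)
 let ?N = "mixed_norm vt vx (restr (Ft \<times> Fx) g)" and ?X = "epowr (\<integral>t \<in> O'. epowr (Q t) r) (1 / r)"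
 have X: "?X <= ennreal (2 powr (\<alpha> + m * rl l * (1 / r - ?it) + m)) * ?N"
 proof -
  have "?X = ennreal (2 powr \<alpha>) * (ennreal (2 powr - \<alpha>) * ?X)" by (simp add: mult.assoc[symmetric] ennreal_mult'' [symmetric] powr_add[symmetric])
  also have "... <= ennreal (2 powr \<alpha>) * (ennreal (2 powr (m * rl l * (1 / r - ?it) + m)) * ?N)"
  by (intro mult_left_mono order_trans[OF 4 mult_right_mono[OF ennreal_leI[OF 5]]]) auto
  finally show ?thesis by (simp add: mult.assoc[symmetric] ennreal_mult'' [symmetric] powr_add[symmetric] add_ac)
 qed
 have "pavg R v1 P (tile m r O' l U) <= ennreal (2 powr (- rl R * ?n * (1 / v1))) * epowr (\<integral>y \<in> P. epowr (H y) (v1 / r)) (1 / v1)"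
  using 1 by (simp add: epowr_mult epowr_ennreal powr_powr)
 also have "... <= ennreal (2 powr (- rl R * ?n * (1 / v1))) * (ennreal (2 powr (- m * rl l * (1 / r))) * (ennreal (2 powr (\<alpha> + m * rl l * (1 / r - ?it) + m)) * ?N))"
  using order_trans[OF 3 mult_left_mono[OF X]] by (intro mult_left_mono) (simp_all add: tscale_powr)
 also have "... = ennreal (2 powr (- rl R * ?n * (1 / v1) + (- m * rl l * (1 / r) + (\<alpha> + m * rl l * (1 / r - ?it) + m)))) * ?N"
 by (simp only: ennreal_powr_mult)
 also have "- rl R * ?n * (1 / v1) + (- m * rl l * (1 / r) + (\<alpha> + m * rl l * (1 / r - ?it) + m)) = m - m * rl l * ?it - rl R * ?n * ?ix"
  unfolding \<alpha>_def by (simp add: algebra_simps)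
 finally show ?thesis unfolding P_def O'_def .
qed

text \<open>The mirror image of the target estimate: Hoelder passes from \<open>a\<close> to
  \<open>r\<close> in time, Minkowski exchanges the order of the norms (\<open>b <= r\<close>),
  Jensen on the cells produces tiles, and \<open>b\<close> is lowered to \<open>u\<close> for
  functions constant on cells, at one factor per level between \<open>k + 1\<close> and
  \<open>R\<close>. The \<open>3 * m\<close> accounts for the length of the three octaves.\<close>

lemma mixed_norm_source_bound:
 fixes f :: "real \<times> (real ^ 'n) => complex"
 assumes m: "1 <= m" and a: "1 <= a" "a <= r" and b: "1 <= b" "b <= r" and u: "0 < u" "u <= b" and f: "borel_modulus f \<phi>"
  and [measurable]: "I \<in> sets borel" and I: "I \<subseteq> wide m k"
  and [measurable]: "X \<in> sets borel" and X: "\<And>y. y \<in> X ==> cell (k + 1) y \<subseteq> X" "X \<subseteq> cell3 R x"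
 shows "mixed_norm (ennreal a) (ennreal b) (restr (I \<times> X) f)
  <= ennreal (2 powr (3 * m + m * rl k * (1 / a) + rl R * real CARD('n) * (1 / b) + (rl R - rl k - 1) * (real CARD('n) * (1 / u - 1 / b))))
   * pavg R u (cell3 R x) (tile m r (wide m k) k \<phi>)"
proof -
 have m\<phi> [measurable]: "joint_borel \<phi>" using f by (simp add: borel_modulus_def)
 have [measurable]: "(\<lambda>(t, x). \<phi> t x) \<in> borel_measurable (borel \<Otimes>\<^sub>M lborel)" by measurable
 have [measurable]: "(\<lambda>(x, t). \<phi> t x) \<in> borel_measurable (borel \<Otimes>\<^sub>M borel)" using measurable_swap_lborel[OF m\<phi>] by measurable
 let ?n = "real CARD('n)" and ?W = "wide m k"
 have m0: "0 < m" "0 < a" "0 < b" "0 < r" using m a b by auto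
 have W0: "0 < t" if "t \<in> ?W" for t using that by (auto simp: wide_def intro: less_le_trans[OF tscale_pos])
 define Q where "Q t = epowr (\<integral>y \<in> X. epowr (\<phi> t y) b) (1 / b)" for t
 have [measurable]: "Q \<in> bor" unfolding Q_def by measurable
 have "(\<integral>\<^sup>+ t. epowr (Lp_norm (ennreal b) lebesgue (\<lambda>x. ennreal (norm (restr (I \<times> X) f (t, x))))) a \<partial>lebesgue_on {0<..}) <= (\<integral>t \<in> ?W. epowr (Q t) a)"
  unfolding nn_integral_lebesgue_on_pos
 proof (rule nn_integral_mono_AE, use borel_modulus_slices[OF f] in eventually_elim)
  case (elim t)
  show ?case
  proof (cases "t \<in> I")
   case True
   then have "0 < t" "t \<in> ?W" using I W0 by auto
   have "(\<integral>y. epowr (ennreal (norm (restr (I \<times> X) f (t, y)))) b) <= (\<integral>y \<in> X. epowr (\<phi> t y) b)"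
   proof (rule nn_integral_mono_AE, use elim in eventually_elim)
    case (elim y)
    then show ?case using \<open>0 < t\<close> by (simp add: restr_def split: split_indicator)
   qed
   then show ?thesis using \<open>0 < t\<close> \<open>t \<in> ?W\<close> m0 by (simp add: Lp_norm_def nn_integral_lebesgue Q_def epowr_mono)
  qed (use m0 in \<open>simp add: Lp_norm_def restr_def\<close>)
 qed
 then have 1: "mixed_norm (ennreal a) (ennreal b) (restr (I \<times> X) f) <= epowr (\<integral>t \<in> ?W. epowr (Q t) a) (1 / a)"
  unfolding mixed_norm_def using m0 by (subst Lp_norm_def) (auto intro: epowr_mono)
 define A where "A = tscale m (k + 2) - tscale m (k - 1)"
 have A: "0 < A" "A <= 2 powr (2 * m) * tscale m k" using m0 tscale_strict_mono[of m "k - 1" "k + 2"]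
 by (auto simp: A_def tscale_def powr_add[symmetric] algebra_simps)
 have "epowr (\<integral>t \<in> ?W. epowr (Q t) a) (1 / a) <= ennreal (A powr (1 / a - enn2real (inverse (ennreal r)))) * Lp_norm (ennreal r) (lebesgue_on ?W) Q"
  using m0 a A by (intro Lp_norm_Holder) (auto simp: wide_def A_def ennreal_leI)
 also have "Lp_norm (ennreal r) (lebesgue_on ?W) Q = epowr (\<integral>t \<in> ?W. epowr (Q t) r) (1 / r)"
  using m0 by (simp add: Lp_norm_def nn_integral_lebesgue_on)
 also have "enn2real (inverse (ennreal r)) = 1 / r" using m0 by (simp add: inverse_ennreal inverse_eq_divide)
 finally have 2: "epowr (\<integral>t \<in> ?W. epowr (Q t) a) (1 / a) <= ennreal (A powr (1 / a - 1 / r)) * epowr (\<integral>t \<in> ?W. epowr (Q t) r) (1 / r)" .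
 define H where "H y = ennreal (tscale m (- k)) * (\<integral>t \<in> ?W. epowr (\<phi> t y) r)" for y
 have [measurable]: "H \<in> bor" unfolding H_def by measurable
 define G where "G y t = epowr (\<phi> t y) b * indicator X y * indicator ?W t" for y t
 have mL: "(\<lambda>(y, t). epowr (\<phi> t y) b * indicator X y * indicator ?W t) \<in> borel_measurable (lborel \<Otimes>\<^sub>M lborel)"
  unfolding measurable_lborel_pair by measurable
 have Gt: "epowr (\<integral>y. G y t) (r / b) = epowr (Q t) r * indicator ?W t" for t
  unfolding G_def Q_def using m0 by (cases "t \<in> ?W") (auto simp: epowr_epowr)
 have Gy: "epowr (\<integral>t. epowr (G y t) (r / b)) (1 / (r / b)) = ennreal (tscale m k powr (b / r)) * (epowr (H y) (b / r) * indicator X y)" for y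
 proof (cases "y \<in> X")
  case True
  have "(\<integral>t. epowr (G y t) (r / b)) = (\<integral>t \<in> ?W. epowr (\<phi> t y) r)"
   using True m0 by (intro nn_integral_cong) (auto simp: G_def epowr_epowr split: split_indicator)
  also have "... = ennreal (tscale m k) * H y" unfolding H_def
  by (simp add: mult.assoc[symmetric] ennreal_mult'' [symmetric] tscale_minus)
  finally show ?thesis using True by (simp add: epowr_mult epowr_ennreal)
 qed (simp add: G_def)
 have "epowr (\<integral>t. epowr (\<integral>y. G y t) (r / b)) (1 / (r / b)) <= (\<integral>y. epowr (\<integral>t. epowr (G y t) (r / b)) (1 / (r / b)))"
  using b m0 unfolding G_def by (intro nn_integral_Minkowski sigma_finite_lborel mL) simp
 also have "... = ennreal (tscale m k powr (b / r)) * (\<integral>y \<in> X. epowr (H y) (b / r))"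
  unfolding Gy by (simp add: nn_integral_cmult)
 finally have 3: "epowr (\<integral>t \<in> ?W. epowr (Q t) r) (b / r) <= ennreal (tscale m k powr (b / r)) * (\<integral>y \<in> X. epowr (H y) (b / r))"
  unfolding Gt by simp
 have "(\<integral>y \<in> X. epowr (H y) (b / r)) = ennreal (2 powr (rl R * ?n)) * avg R X (\<lambda>y. epowr (H y) (b / r))"
 by (rule set_nn_integral_eq_avg)
 also have "avg R X (\<lambda>y. epowr (H y) (b / r)) = avg R X (\<lambda>y. avg (k + 1) (cell (k + 1) y) (\<lambda>y. epowr (H y) (b / r)))"
 by (rule avg_avg_cell[symmetric]) (simp, rule X)
 also have "... <= avg R X (\<lambda>y. epowr (tile m r ?W k \<phi> y) b)"
  using b m0 unfolding tile_def by (intro avg_mono) (auto simp: epowr_epowr H_def[abs_def, symmetric] intro!: avg_Jensen_cell)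
 finally have 4: "(\<integral>y \<in> X. epowr (H y) (b / r)) <= ennreal (2 powr (rl R * ?n)) * avg R X (\<lambda>y. epowr (tile m r ?W k \<phi> y) b)"
 by (simp add: mult_left_mono)
 let ?p = "pavg R u (cell3 R x) (tile m r ?W k \<phi>)" and ?e = "(rl R - rl k - 1) * (?n * (1 / u - 1 / b))"
 have 5: "epowr (avg R X (\<lambda>y. epowr (tile m r ?W k \<phi> y) b)) (1 / b) <= ennreal (2 powr ?e) * ?p"
 proof -
  have "pavg R b X (tile m r ?W k \<phi>) <= ennreal (2 powr (rl (R - (k + 1)) * ?n * (1 / u - 1 / b))) * pavg R u X (tile m r ?W k \<phi>)"
   using u X by (intro pavg_exponent_le cellwise_tile) auto
  also have "rl (R - (k + 1)) * ?n * (1 / u - 1 / b) = ?e" by (simp only: of_int_diff of_int_add of_int_1 mult.assoc diff_diff_add)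
  also have "pavg R u X (tile m r ?W k \<phi>) <= ?p" unfolding pavg_def using u X by (intro epowr_mono avg_subset) auto
  finally show ?thesis by (simp add: pavg_def mult_left_mono)
 qed
 have "epowr (\<integral>t \<in> ?W. epowr (Q t) r) (1 / r) = epowr (epowr (\<integral>t \<in> ?W. epowr (Q t) r) (b / r)) (1 / b)"
  using m0 by (simp add: epowr_epowr)
 also have "... <= epowr (ennreal (tscale m k powr (b / r)) * (ennreal (2 powr (rl R * ?n)) * avg R X (\<lambda>y. epowr (tile m r ?W k \<phi> y) b))) (1 / b)"
  using m0 by (intro epowr_mono order_trans[OF 3 mult_left_mono[OF 4]]) auto
 also have "... = ennreal (2 powr (m * rl k * (1 / r))) * (ennreal (2 powr (rl R * ?n * (1 / b))) * epowr (avg R X (\<lambda>y. epowr (tile m r ?W k \<phi> y) b)) (1 / b))"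
  using m0 by (simp add: epowr_mult epowr_ennreal tscale_powr powr_powr)
 also have "... <= ennreal (2 powr (m * rl k * (1 / r))) * (ennreal (2 powr (rl R * ?n * (1 / b))) * (ennreal (2 powr ?e) * ?p))"
 by (intro mult_left_mono 5) auto
 finally have 6: "epowr (\<integral>t \<in> ?W. epowr (Q t) r) (1 / r) <= ennreal (2 powr (m * rl k * (1 / r))) * (ennreal (2 powr (rl R * ?n * (1 / b))) * (ennreal (2 powr ?e) * ?p))" .
 have "1 / r <= 1 / a" "1 / a <= 1" "0 <= 1 / r" using a m0 by (auto intro: divide_left_mono)
 then have d: "0 <= 1 / a - 1 / r" "1 / a - 1 / r <= 1" by linarith+
 then have "A powr (1 / a - 1 / r) <= (2 powr (2 * m) * tscale m k) powr (1 / a - 1 / r)" using A by (intro powr_mono2) auto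
 also have "... = 2 powr (2 * m * (1 / a - 1 / r)) * 2 powr (m * rl k * (1 / a - 1 / r))"
 by (subst powr_mult) (auto simp: powr_powr tscale_powr)
 also have "... <= 2 powr (2 * m * 1) * 2 powr (m * rl k * (1 / a - 1 / r))"
  using d m0 by (intro mult_right_mono powr_mono mult_left_mono) auto
 also have "... <= 2 powr (3 * m + m * rl k * (1 / a - 1 / r))" using m0 by (simp add: powr_add)
 finally have 7: "A powr (1 / a - 1 / r) <= 2 powr (3 * m + m * rl k * (1 / a - 1 / r))" .
 have "mixed_norm (ennreal a) (ennreal b) (restr (I \<times> X) f) <= ennreal (2 powr (3 * m + m * rl k * (1 / a - 1 / r))) *
   (ennreal (2 powr (m * rl k * (1 / r))) * (ennreal (2 powr (rl R * ?n * (1 / b))) * (ennreal (2 powr ?e) * ?p)))"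
  using 1 2 by (rule order_trans[OF order_trans]) (intro mult_mono ennreal_leI 6 7; simp)
 also have "... = ennreal (2 powr (3 * m + m * rl k * (1 / a - 1 / r) + (m * rl k * (1 / r) + (rl R * ?n * (1 / b) + ?e)))) * ?p"
 by (simp only: ennreal_powr_mult)
 also have "3 * m + m * rl k * (1 / a - 1 / r) + (m * rl k * (1 / r) + (rl R * ?n * (1 / b) + ?e)) = 3 * m + m * rl k * (1 / a) + rl R * ?n * (1 / b) + ?e"
 by (simp add: algebra_simps)
 finally show ?thesis .
qed

section \<open>Geometry of cells and octaves\<close>

text \<open>Translation by whole cells: every cell with prescribed index offset from that of
  \<open>x\<close> becomes the cell of an explicit point.\<close>

definition shift :: "int => int ^ 'n => real ^ 'n => real ^ 'n" where
 "shift R \<tau> x = x + (\<chi> i. rl (\<tau> $ i) * 2 powr rl R)"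

lemma idx_shift: "idx R (shift R \<tau> x) = idx R x + \<tau>"
 by (simp add: vec_eq_iff idx_nth shift_def add_divide_distrib)

lemma cell_shift: "cell R (shift R \<tau> x) = {y. idx R y = idx R x + \<tau>}"
 by (simp add: cell_def idx_shift)

lemma idx_diff_lower:
 assumes "k <= \<bar>idx R x $ i - idx R y $ i\<bar>" shows "(rl k - 1) * 2 powr rl R <= \<bar>x $ i - y $ i\<bar>"
proof -
 have "rl k - 1 <= \<bar>x $ i / 2 powr rl R - y $ i / 2 powr rl R\<bar>"
  using assms unfolding idx_nth by linarith
 then show ?thesis by (simp add: diff_divide_distrib[symmetric] pos_le_divide_eq)
qed

text \<open>The factor \<open>sqrt n\<close>, sharper than the factor \<open>n\<close> of
  \<open>dist_bound\<close>, matches the bound \<open>1 / (16 sqrt n)\<close> for the constant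
  \<open>c\<close> of the operator estimates.\<close>

lemma norm_le_sqrt_card:
 fixes x :: "real ^ 'n"
 assumes "\<And>i. \<bar>x $ i\<bar> <= B" shows "norm x <= sqrt (real CARD('n)) * B"
proof -
 have B: "0 <= B" using assms[of undefined] by linarith
 have "(\<Sum>i\<in>UNIV. (x $ i)\<^sup>2) <= (\<Sum>i\<in>(UNIV :: 'n set). B\<^sup>2)"
  using assms by (intro sum_mono) (simp add: abs_le_square_iff[symmetric] B)
 then have "norm x <= sqrt (real CARD('n) * B\<^sup>2)" by (simp add: norm_vec_def L2_set_def)
 then show ?thesis using B by (simp add: real_sqrt_mult)
qed

lemma diameter_half_open: "a < b ==> diameter {a ..< b :: real} = b - a"
 using diameter_closure[of "{a ..< b}"] by (simp add: bounded_Ico)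

lemma axis_cube_half_open:
 fixes a :: "real ^ 'n"
 assumes "0 < s" shows "axis_cube {y. \<forall>i. a $ i <= y $ i \<and> y $ i < a $ i + s}"
 unfolding axis_cube_def using assms
 by (intro exI[of _ s] conjI exI[of _ "\<lambda>i. {a $ i ..< a $ i + s}"] allI) (auto simp: diameter_half_open bounded_Ico is_interval_co)

lemma axis_cube_cell: "axis_cube (cell R x)" "axis_cube (cell3 R x)"
 unfolding cell_eq_cube cell3_eq_cube by (rule axis_cube_half_open, simp)+

lemma rectangle_half_open: "0 < a ==> a < b ==> axis_cube X ==> rectangle {a ..< b} X"
 unfolding rectangle_def by (auto simp: diameter_half_open is_interval_co bounded_Ico)

lemma rectangle_octave: "0 < m ==> axis_cube X ==> rectangle (octave m k) X" "0 < m ==> axis_cube X ==> rectangle (wide m k) X"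
 unfolding octave_def wide_def by (auto intro!: rectangle_half_open tscale_strict_mono)

text \<open>For the upper bound, indices of two points differ by at most 2; for the lower bound, the
  points obtained from \<open>x\<close> by shifting one cell along the diagonal in either direction
  both lie in \<open>cell3 R x\<close>.\<close>

lemma cell3_len_x:
 fixes x :: "real ^ 'n"
 assumes X: "X \<subseteq> cell3 R x"
 shows "2 * 2 powr rl R <= len_x (cell3 R x) X" "len_x (cell3 R x) X <= sqrt (real CARD('n)) * (3 * 2 powr rl R)"
proof -
 have d: "norm (u - v) <= sqrt (real CARD('n)) * (3 * 2 powr rl R)" if "u \<in> cell3 R x" "v \<in> cell3 R x" for u v
 proof (rule norm_le_sqrt_card)
  fix i
  have "\<bar>idx R u $ i - idx R v $ i\<bar> <= 2" using that by (auto simp: cell3_def dest!: spec[of _ i])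
  from idx_diff_bound[OF this] show "\<bar>(u - v) $ i\<bar> <= 3 * 2 powr rl R" by simp
 qed
 have e: "len_x (cell3 R x) X = diameter (cell3 R x)" using X by (simp add: len_x_def sup_absorb1)
 show "len_x (cell3 R x) X <= sqrt (real CARD('n)) * (3 * 2 powr rl R)"
  unfolding e using cell3_self[of x R] by (intro diameter_le d) auto
 have b: "bounded (cell3 R x)"
  unfolding bounded_def using cell3_self[of x R] by (intro exI[of _ x] exI[of _ "sqrt (real CARD('n)) * (3 * 2 powr rl R)"]) (auto simp: dist_norm intro!: d)
 obtain i :: 'n where True by auto
 have "2 * 2 powr rl R = \<bar>(shift R 1 x - shift R (- 1) x) $ i\<bar>" by (simp add: shift_def)
 also have "... <= dist (shift R 1 x) (shift R (- 1) x)" unfolding dist_norm by (rule component_le_norm_cart)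
 also have "... <= diameter (cell3 R x)"
 by (rule diameter_bounded_bound[OF b]) (auto simp: cell3_def idx_shift)
 finally show "2 * 2 powr rl R <= len_x (cell3 R x) X" unfolding e .
qed

text \<open>An offset of at least 2 in one coordinate leaves a full cell between the two; offsets of
  at most 3 keep the union within 4 cells in each coordinate. Separation over diameter is thus at
  least \<open>1 / (4 sqrt n)\<close>, well above \<open>c\<close>.\<close>

lemma shifted_cell_geometry:
 fixes x :: "real ^ 'n" and \<tau> :: "int ^ 'n" and R :: int
 assumes \<tau>: "\<And>i. \<bar>\<tau> $ i\<bar> <= 3" "2 <= \<bar>\<tau> $ j\<bar>"
 defines "Z \<equiv> cell R (shift R \<tau> x)" and "X \<equiv> cell R x"
 shows "2 * 2 powr rl R <= len_x Z X" "len_x Z X <= sqrt (real CARD('n)) * (4 * 2 powr rl R)"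
  "2 powr rl R <= setdist Z X" "setdist Z X <= 2 powr (rl R + (real CARD('n) + 2))"
proof -
 define W where "W = 2 powr rl R"
 have W: "0 < W" by (simp add: W_def)
 let ?z = "shift R \<tau> x"
 have in': "x \<in> X" "?z \<in> Z" by (simp_all add: X_def Z_def)
 have d: "norm (u - v) <= sqrt (real CARD('n)) * (4 * W)" if "u \<in> Z \<union> X" "v \<in> Z \<union> X" for u v
 proof (rule norm_le_sqrt_card)
  fix i
  have "\<bar>idx R u $ i - idx R v $ i\<bar> <= 3" using that \<tau>(1)[of i] unfolding Z_def X_def cell_shift by (auto simp: cell_def)
  from idx_diff_bound[OF this] show "\<bar>(u - v) $ i\<bar> <= 4 * W" by (simp add: W_def)
 qed
 show "len_x Z X <= sqrt (real CARD('n)) * (4 * 2 powr rl R)"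
  unfolding len_x_def W_def[symmetric] using in' by (intro diameter_le d) auto
 have b: "bounded (Z \<union> X)"
  unfolding bounded_def using in' by (intro exI[of _ x] exI[of _ "sqrt (real CARD('n)) * (4 * W)"]) (auto simp: dist_norm intro!: d)
 have "2 * W <= rl \<bar>\<tau> $ j\<bar> * W" using \<tau>(2) W by (intro mult_right_mono) auto
 also have "... = \<bar>(?z - x) $ j\<bar>" using W by (simp add: shift_def abs_mult W_def)
 also have "... <= dist ?z x" unfolding dist_norm by (rule component_le_norm_cart)
 also have "... <= diameter (Z \<union> X)" using in' by (intro diameter_bounded_bound[OF b]) auto
 finally show "2 * 2 powr rl R <= len_x Z X" by (simp add: len_x_def W_def)
 show "2 powr rl R <= setdist Z X"
 proof (rule le_setdistI)
  fix u v assume "u \<in> Z" "v \<in> X"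
  then have "2 <= \<bar>idx R u $ j - idx R v $ j\<bar>" using \<tau>(2) unfolding Z_def X_def cell_shift by (auto simp: cell_def)
  from idx_diff_lower[OF this] have "2 powr rl R <= \<bar>(u - v) $ j\<bar>" by simp
  also have "... <= dist u v" unfolding dist_norm by (rule component_le_norm_cart)
  finally show "2 powr rl R <= dist u v" .
 qed (use in' in auto)
 have "setdist Z X <= dist ?z x" using in' by (intro setdist_le_dist) auto
 also have "... <= sqrt (real CARD('n)) * (4 * W)" using in' by (simp add: dist_norm d)
 also have "... <= 2 powr real CARD('n) * (4 * W)"
 proof (intro mult_right_mono)
  have "sqrt (real CARD('n)) <= real CARD('n)" by (rule real_le_lsqrt) (auto simp: power2_eq_square)
  also have "... <= 2 powr real CARD('n)" using less_exp[of "CARD('n)"] by (simp add: powr_realpow)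
  finally show "sqrt (real CARD('n)) <= 2 powr real CARD('n)" .
 qed (use W in simp)
 also have "... = 2 powr (rl R + (real CARD('n) + 2))" by (simp add: W_def powr_add)
 finally show "setdist Z X <= 2 powr (rl R + (real CARD('n) + 2))" .
qed

lemma octave_bounds:
 assumes "0 < m" shows "octave m k \<noteq> {}" "Sup (octave m k) = tscale m (k + 1)" "bdd_above (octave m k)" "bounded (octave m k)"
  "wide m k \<noteq> {}" "Sup (wide m k) = tscale m (k + 2)" "Inf (wide m k) = tscale m (k - 1)"
 using tscale_strict_mono[OF assms, of k "k + 1"] tscale_strict_mono[OF assms, of "k - 1" "k + 2"]
 by (auto simp: octave_def wide_def cSup_atLeastLessThan cInf_atLeastLessThan bounded_Ico)

lemma len_t_octave:
 assumes m: "0 < m"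
 shows "len_t (octave m k) (octave m l) = tscale m (max k l + 1)"
  "len_t (wide m l) (octave m l) = tscale m (l + 2)" "len_t (wide m l) (wide m l) = tscale m (l + 2)"
proof -
 have "len_t (octave m k) (octave m l) = max (tscale m (k + 1)) (tscale m (l + 1))"
  unfolding len_t_def using octave_bounds[OF m] by (simp add: cSup_union_distrib sup_max)
 also have "... = tscale m (max k l + 1)"
  using tscale_mono[of m "k + 1" "l + 1"] tscale_mono[of m "l + 1" "k + 1"] m by (cases "k <= l") (auto simp: max_def)
 finally show "len_t (octave m k) (octave m l) = tscale m (max k l + 1)" .
 show "len_t (wide m l) (octave m l) = tscale m (l + 2)" "len_t (wide m l) (wide m l) = tscale m (l + 2)"
  using octave_subset_wide[OF m, of l] octave_bounds[OF m] by (simp_all add: len_t_def sup_absorb1)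
qed

text \<open>With a full octave in between, the earlier octave ends at or before
  \<open>2^(m (h-1)) <= 2^(m h - 1)\<close>, half of the start \<open>2^(m h)\<close> of the later
  one, by \<open>m >= 1\<close>. Separation and diameter are therefore both comparable to
  \<open>2^(m h)\<close>, where \<open>h\<close> is the later index.\<close>

lemma octave_separation:
 assumes m: "1 <= m" and kl: "2 <= \<bar>k - l\<bar>"
 shows "2 powr (m * rl (max k l) - 1) <= setdist (octave m k) (octave m l)"
  "setdist (octave m k) (octave m l) <= 2 powr (m * rl (max k l))"
  "2 powr (m * rl (max k l) - 1) <= diameter (octave m k \<union> octave m l)"
  "diameter (octave m k \<union> octave m l) <= 2 powr (m * rl (max k l) + m)"
proof -
 have m0: "0 < m" using m by simp
 define h where "h = max k l"
 define s where "s = (if k <= l then l else k)"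
 have lo: "2 powr (m * rl h - 1) <= dist u v" if u: "u \<in> octave m k" and v: "v \<in> octave m l" for u v
 proof -
  have key: "2 powr (m * rl j - 1) <= b - a" if "a \<in> octave m i" "b \<in> octave m j" "i + 2 <= j" for a b i j
  proof -
   have "a < tscale m (i + 1)" using that by (simp add: octave_def)
   also have "... <= tscale m (j - 1)" using m0 that by (intro tscale_mono) auto
   also have "... <= 2 powr (m * rl j - 1)" unfolding tscale_def using m by (intro powr_mono) (auto simp: algebra_simps)
   finally have "a <= 2 powr (m * rl j - 1)" by simp
   moreover have "2 * 2 powr (m * rl j - 1) <= b" using that by (simp add: octave_def tscale_def powr_diff)
   ultimately show ?thesis by linarith
  qed
  show ?thesis
  proof (cases "k <= l")
   case True then show ?thesis using key[OF u v] kl by (simp add: h_def max_def dist_real_def)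
  next
   case False then show ?thesis using key[OF v u] kl by (simp add: h_def max_def dist_real_def)
  qed
 qed
 have in': "tscale m i \<in> octave m i" for i using m0 tscale_strict_mono[of m i "i + 1"] by (simp add: octave_def)
 show "2 powr (m * rl (max k l) - 1) <= setdist (octave m k) (octave m l)"
  using in' lo by (intro le_setdistI) (auto simp: h_def)
 have "setdist (octave m k) (octave m l) <= dist (tscale m k) (tscale m l)" by (intro setdist_le_dist in')
 also have "... <= tscale m h"
 proof -
  have "tscale m k <= tscale m h" "tscale m l <= tscale m h" using m0 by (auto intro!: tscale_mono simp: h_def)
  then show ?thesis unfolding dist_real_def using tscale_pos[of m k] tscale_pos[of m l] by linarith
 qed
 finally show "setdist (octave m k) (octave m l) <= 2 powr (m * rl (max k l))" by (simp add: h_def tscale_def)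
 have "2 powr (m * rl h - 1) <= dist (tscale m k) (tscale m l)" by (intro lo in')
 also have "... <= diameter (octave m k \<union> octave m l)"
  using in' octave_bounds(4)[OF m0] by (intro diameter_bounded_bound) auto
 finally show "2 powr (m * rl (max k l) - 1) <= diameter (octave m k \<union> octave m l)" by (simp add: h_def)
 have up: "0 < t \<and> t <= tscale m (h + 1)" if "t \<in> octave m k \<union> octave m l" for t
  using that m0 tscale_mono[of m "k + 1" "h + 1"] tscale_mono[of m "l + 1" "h + 1"] by (auto simp: octave_def h_def intro: less_le_trans[OF tscale_pos])
 have "diameter (octave m k \<union> octave m l) <= tscale m (h + 1)"
 proof (rule diameter_le)
  show "norm (s - t) <= tscale m (h + 1)" if "s \<in> octave m k \<union> octave m l" "t \<in> octave m k \<union> octave m l" for s t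
   using up[OF that(1)] up[OF that(2)] by (auto simp: abs_le_iff)
 qed simp
 then show "diameter (octave m k \<union> octave m l) <= 2 powr (m * rl (max k l) + m)" by (simp add: h_def tscale_def algebra_simps)
qed

lemma wide_diameter:
 assumes m: "1 <= m"
 shows "2 powr (m * rl l - 1) <= diameter (wide m l \<union> octave m l)" "diameter (wide m l \<union> octave m l) <= 2 powr (m * rl l + 2 * m)"
proof -
 have m0: "0 < m" using m by simp
 have e: "diameter (wide m l \<union> octave m l) = tscale m (l + 2) - tscale m (l - 1)"
  using octave_subset_wide[OF m0, of l] tscale_strict_mono[OF m0, of "l - 1" "l + 2"] by (simp add: sup_absorb1 wide_def diameter_half_open)
 have "tscale m (l - 1) <= 2 powr (m * rl l - 1)" unfolding tscale_def using m by (intro powr_mono) (auto simp: algebra_simps)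
 moreover have "2 * 2 powr (m * rl l - 1) <= tscale m (l + 2)"
  using tscale_mono[of m l "l + 2"] m0 by (simp add: tscale_def powr_diff)
 ultimately show "2 powr (m * rl l - 1) <= diameter (wide m l \<union> octave m l)" unfolding e by linarith
 have "tscale m (l + 2) - tscale m (l - 1) <= tscale m (l + 2)" by simp
 then show "diameter (wide m l \<union> octave m l) <= 2 powr (m * rl l + 2 * m)" unfolding e by (simp add: tscale_def algebra_simps)
qed

text \<open>A number known up to a factor \<open>2^a\<close> has powers known up to
  \<open>2^(a |e|)\<close>, for exponents of either sign.\<close>

lemma powr_comparable:
 fixes s :: real
 assumes "2 powr (X - a) <= s" "s <= 2 powr (X + a)"
 shows "s powr e <= 2 powr (X * e + a * \<bar>e\<bar>)"
proof (cases "0 <= e")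
 case True
 have "0 < s" using assms(1) by (rule less_le_trans[rotated]) simp
 then have "s powr e <= (2 powr (X + a)) powr e" using True assms(2) by (intro powr_mono2) auto
 then show ?thesis using True by (simp add: powr_powr algebra_simps)
next
 case False
 have "s powr e <= (2 powr (X - a)) powr e" using False assms(1) by (intro powr_mono2') auto
 then show ?thesis using False by (simp add: powr_powr algebra_simps)
qed

lemma quotient_comparable:
 fixes D s :: real
 assumes "2 powr (X - a) <= D" "D <= 2 powr (X + a)" "2 powr (Y - b) <= s" "s <= 2 powr (Y + b)" "0 <= m"
 shows "2 powr (X - m * Y - (a + m * b)) <= D / s powr m" "D / s powr m <= 2 powr (X - m * Y + (a + m * b))"
proof -
 have s: "0 < s" by (rule less_le_trans[OF _ assms(3)]) simp
 have "(2 powr (Y - b)) powr m <= s powr m" "s powr m <= (2 powr (Y + b)) powr m" using s assms by (auto intro!: powr_mono2)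
 then have sm: "2 powr (m * Y - m * b) <= s powr m" "s powr m <= 2 powr (m * Y + m * b)" by (simp_all add: powr_powr algebra_simps)
 have D0: "0 <= D" by (rule order_trans[OF _ assms(1)]) simp
 have "2 powr (X - m * Y - (a + m * b)) = 2 powr (X - a) / 2 powr (m * Y + m * b)" by (simp add: powr_diff[symmetric] algebra_simps)
 also have "... <= D / s powr m" using assms sm s D0 by (intro frac_le) auto
 finally show "2 powr (X - m * Y - (a + m * b)) <= D / s powr m" .
 have "D / s powr m <= 2 powr (X + a) / 2 powr (m * Y - m * b)" using assms sm s D0 by (intro frac_le) auto
 also have "... = 2 powr (X - m * Y + (a + m * b))" by (simp add: powr_diff[symmetric] algebra_simps)
 finally show "D / s powr m <= 2 powr (X - m * Y + (a + m * b))" .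
qed

text \<open>The four defining estimates on dyadic data: equal boxes, separation in time only, in
  time and space, in space only. All lengths are replaced by powers of 2 and all comparability
  constants are collected in one \<open>B\<close>, so that from here on only exponents are
  added.\<close>

lemma singular_operator_estimates:
 fixes T :: "(real \<times> (real ^ 'n) => complex) => (real \<times> (real ^ 'n) => complex)"
 assumes c: "0 < c" "c <= 1 / (16 * sqrt (real CARD('n)))" and m: "1 <= m"
  and T: "singular_operator c \<kappa> m r ut ux vt vx M T"
 shows "\<exists>B. \<forall>f\<in>Linf_c.
   (\<forall>l x. mixed_norm r r (restr (wide m l \<times> cell3 (l + 1) x) (T (restr (wide m l \<times> cell3 (l + 1) x) f)))
     <= ennreal (2 powr (B + m * \<kappa> * rl l)) * mixed_norm r r (restr (wide m l \<times> cell3 (l + 1) x) f)) \<and>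
   (\<forall>k l h x. 2 <= \<bar>k - l\<bar> --> h = max k l -->
    mixed_norm vt vx (restr (octave m l \<times> cell (h + 1) x) (T (restr (octave m k \<times> cell3 (h + 1) x) f)))
     <= ennreal (2 powr (B + (m * (\<kappa> - brk ut vt) - real CARD('n) * brk ux vx) * rl h)) * mixed_norm ut ux (restr (octave m k \<times> cell3 (h + 1) x) f)) \<and>
   (\<forall>k l i R x \<tau>. 2 <= \<bar>k - l\<bar> --> 1 <= i --> R = max k l + i --> (\<forall>i. \<bar>\<tau> $ i\<bar> <= 3) --> (\<exists>j. 2 <= \<bar>\<tau> $ j\<bar>) -->
    mixed_norm vt vx (restr (octave m l \<times> cell R x) (T (restr (octave m k \<times> cell R (shift R \<tau> x)) f)))
     <= ennreal (2 powr (B + (m * (\<kappa> - brk ut vt) - real CARD('n) * brk ux vx) * rl R - m * rl i * M))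
      * mixed_norm ut ux (restr (octave m k \<times> cell R (shift R \<tau> x)) f)) \<and>
   (\<forall>l i R x \<tau>. 1 <= i --> R = l + i --> (\<forall>i. \<bar>\<tau> $ i\<bar> <= 3) --> (\<exists>j. 2 <= \<bar>\<tau> $ j\<bar>) -->
    mixed_norm r vx (restr (octave m l \<times> cell R x) (T (restr (wide m l \<times> cell R (shift R \<tau> x)) f)))
     <= ennreal (2 powr (B + (m * \<kappa> - real CARD('n) * brk ux vx) * rl R - m * rl i * (M + brk ut vt)))
      * mixed_norm r ux (restr (wide m l \<times> cell R (shift R \<tau> x)) f))"
proof -
 from T[unfolded singular_operator_def] show ?thesis
 proof (elim conjE exE, goal_cases)
 case (1 C)
 note C = 1(2) and est = 1(3)
 let ?n = "real CARD('n)"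
 have m0: "0 < m" using m by simp
 \<comment> \<open>Diameters are at most \<open>sqrt n\<close> times a few side lengths; the bound
   on \<open>c\<close> turns this into a sixteenth of those.\<close>
 have cn: "c * L <= a / 16" if "L <= sqrt ?n * a" "0 <= a" for a L
 proof -
  have "c * sqrt ?n <= 1 / 16" using c by (simp add: field_simps)
  from mult_right_mono[OF this that(2)] mult_left_mono[OF that(1) less_imp_le[OF c(1)]] show ?thesis by (simp add: mult_ac)
 qed
 have c16: "c <= 1 / 16"
 proof -
  have "1 / (16 * sqrt ?n) <= 1 / 16" by (intro divide_left_mono) (auto simp: real_le_rsqrt)
  from order_trans[OF c(2) this] show ?thesis .
 qed
 \<comment> \<open>Multiplication by \<open>c^m\<close> moves back at least four octaves, hence
   below the gap between separated octaves and below the start of \<open>wide m l\<close>.\<close>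
 have cm: "c powr m * tscale m j <= 2 powr (m * (rl j - 4))" for j
 proof -
  have "c powr m <= (2 powr (- 4)) powr m" using c c16 m0 by (intro powr_mono2) (auto simp: powr_minus)
  then have "c powr m * tscale m j <= 2 powr (- 4 * m) * tscale m j" by (intro mult_right_mono) (auto simp: powr_powr)
  also have "... = 2 powr (m * (rl j - 4))" by (simp add: tscale_def powr_add[symmetric] algebra_simps)
  finally show ?thesis .
 qed
 define E2 where "E2 = - brk ut vt - ?n / m * brk ux vx + \<kappa>"
 define E3 where "E3 = - m * brk ut vt - ?n * brk ux vx + m * \<kappa>"
 define E4 where "E4 = - ?n * brk ux vx + m * \<kappa>"
 \<comment> \<open>Adding 1 keeps the logarithm meaningful when \<open>C = 0\<close>.\<close>
 define B0 where "B0 = log 2 (C + 1)"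
 define B3 where "B3 = (?n + 2) * \<bar>E3\<bar> + (m + m * (?n + 2)) * \<bar>M\<bar>"
 define B4 where "B4 = (?n + 2) * \<bar>E4\<bar> + (2 * m + m * (?n + 2)) * \<bar>M + brk ut vt\<bar>"
 define B where "B = B0 + m * \<bar>\<kappa>\<bar> + \<bar>E2\<bar> + B3 + B4"
 have nn: "0 <= m * \<bar>\<kappa>\<bar>" "0 <= B3" "0 <= B4" using m0 by (auto simp: B3_def B4_def)
 have CB: "ennreal (C * y) * X <= ennreal (2 powr (B0 + z)) * X" if "y <= 2 powr z" for y z X
 proof (intro mult_right_mono ennreal_leI)
  have "C * y <= (C + 1) * 2 powr z" using C that by (intro order_trans[OF mult_left_mono[OF that C]]) (simp add: distrib_right)
  also have "C + 1 = 2 powr B0" using C by (simp add: B0_def)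
  finally show "C * y <= 2 powr (B0 + z)" by (simp add: powr_add)
 qed simp
 have up: "ennreal (2 powr (B0 + z)) * X <= ennreal (2 powr w) * X" if "B0 + z <= w" for z w X
  using that by (intro mult_right_mono ennreal_leI powr_mono) auto
 have lo: "2 powr a <= s" if "2 powr b <= s" "a <= b" for a b s :: real
  using that by (intro order_trans[OF powr_mono that(1)]) auto
 note rect = rectangle_octave[OF m0 axis_cube_cell(1)] rectangle_octave[OF m0 axis_cube_cell(2)]
 note est1 = est[rule_format, THEN conjunct1, rule_format]
 note est2 = est[rule_format, THEN conjunct2, THEN conjunct1, rule_format]
 note est3 = est[rule_format, THEN conjunct2, THEN conjunct2, THEN conjunct1, rule_format]
 note est4 = est[rule_format, THEN conjunct2, THEN conjunct2, THEN conjunct2, rule_format]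
 show ?case
 proof (intro exI[of _ B] ballI conjI allI impI)
  fix f :: "real \<times> (real ^ 'n) => complex" assume f: "f \<in> Linf_c"
  fix l and x :: "real ^ 'n"
   let ?X = "cell3 (l + 1) x"
   have lx: "2 powr rl (l + 2) <= len_x ?X ?X" "c * len_x ?X ?X <= 2 powr rl (l + 2)"
   proof -
    have "c * len_x ?X ?X <= (3 * 2 powr rl (l + 1)) / 16" by (rule cn[OF cell3_len_x(2)]) auto
    moreover have "0 < 2 powr rl l" "2 powr rl (l + 1) = 2 * 2 powr rl l" "2 powr rl (l + 2) = 4 * 2 powr rl l"
    by (simp_all add: powr_add)
    ultimately show "2 powr rl (l + 2) <= len_x ?X ?X" "c * len_x ?X ?X <= 2 powr rl (l + 2)"
     using cell3_len_x(1)[of ?X "l + 1" x] by (simp, linarith)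
   qed
   have "mixed_norm r r (restr (wide m l \<times> ?X) (T (restr (wide m l \<times> ?X) f))) <= ennreal (C * tscale m (l - 1) powr \<kappa>) * mixed_norm r r (restr (wide m l \<times> ?X) f)"
    unfolding octave_bounds(7)[OF m0, of l, symmetric]
   proof (rule est1[OF f])
    show "c powr m * len_t (wide m l) (wide m l) <= Inf (wide m l)"
     unfolding len_t_octave[OF m0] octave_bounds[OF m0] by (rule order_trans[OF cm]) (use m0 in \<open>auto simp: tscale_def\<close>)
   qed (use rect lx in \<open>simp_all add: len_t_octave m0 tscale_root\<close>)
   also have "... <= ennreal (2 powr (B0 + (m * \<kappa> * rl l + m * \<bar>\<kappa>\<bar>))) * mixed_norm r r (restr (wide m l \<times> ?X) f)"
   proof (rule CB)
    have "- m * \<kappa> <= m * \<bar>\<kappa>\<bar>" using m0 by (simp add: mult_left_mono[of "- \<kappa>" "\<bar>\<kappa>\<bar>" m, simplified])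
    then show "tscale m (l - 1) powr \<kappa> <= 2 powr (m * \<kappa> * rl l + m * \<bar>\<kappa>\<bar>)"
     unfolding tscale_powr by (intro powr_mono) (auto simp: algebra_simps)
   qed
   also have "... <= ennreal (2 powr (B + m * \<kappa> * rl l)) * mixed_norm r r (restr (wide m l \<times> ?X) f)"
   by (rule up) (use nn in \<open>simp add: B_def\<close>)
   finally show "mixed_norm r r (restr (wide m l \<times> ?X) (T (restr (wide m l \<times> ?X) f))) <= ennreal (2 powr (B + m * \<kappa> * rl l)) * mixed_norm r r (restr (wide m l \<times> ?X) f)" .
  next
  fix f :: "real \<times> (real ^ 'n) => complex" assume f: "f \<in> Linf_c"
   fix k l h :: int and x :: "real ^ 'n" assume kl: "2 <= \<bar>k - l\<bar>" and h: "h = max k l"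
   let ?X = "cell3 (h + 1) x" and ?P = "cell (h + 1) x"
   let ?N = "mixed_norm ut ux (restr (octave m k \<times> ?X) f)"
   have lx: "2 powr rl (h + 1) <= len_x ?X ?P" "c * len_x ?X ?P <= 2 powr rl (h + 1)"
   proof -
    have "c * len_x ?X ?P <= (3 * 2 powr rl (h + 1)) / 16" by (rule cn[OF cell3_len_x(2)[OF cell_subset_cell3]]) auto
    moreover have "0 < 2 powr rl (h + 1)" by simp
    ultimately show "2 powr rl (h + 1) <= len_x ?X ?P" "c * len_x ?X ?P <= 2 powr rl (h + 1)"
     using cell3_len_x(1)[OF cell_subset_cell3, of "h + 1" x] by linarith+
   qed
   have "mixed_norm vt vx (restr (octave m l \<times> ?P) (T (restr (octave m k \<times> ?X) f))) <= ennreal (C * setdist (octave m k) (octave m l) powr E2) * ?N"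
    unfolding E2_def
   proof (rule est2[OF f])
    show "c powr m * len_t (octave m k) (octave m l) <= setdist (octave m k) (octave m l)"
     unfolding len_t_octave[OF m0] by (rule order_trans[OF cm order_trans[OF powr_mono octave_separation(1)[OF m kl]]]) (use m in \<open>simp_all add: algebra_simps\<close>)
   qed (use rect lx in \<open>simp_all add: len_t_octave m0 tscale_root h\<close>)
   also have "... <= ennreal (2 powr (B0 + (m * rl h * E2 + 1 * \<bar>E2\<bar>))) * ?N"
    using octave_separation(1,2)[OF m kl] by (intro CB powr_comparable) (auto simp: h intro: order_trans[OF _ powr_mono])
   also have "... <= ennreal (2 powr (B + (m * (\<kappa> - brk ut vt) - ?n * brk ux vx) * rl h)) * ?N"
   proof (rule up)
    have "m * rl h * E2 = (m * (\<kappa> - brk ut vt) - ?n * brk ux vx) * rl h" using m0 by (simp add: E2_def field_simps)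
    then show "B0 + (m * rl h * E2 + 1 * \<bar>E2\<bar>) <= B + (m * (\<kappa> - brk ut vt) - ?n * brk ux vx) * rl h"
     using nn abs_ge_zero[of E2] unfolding B_def by linarith
   qed
   finally show "mixed_norm vt vx (restr (octave m l \<times> ?P) (T (restr (octave m k \<times> ?X) f))) <= ennreal (2 powr (B + (m * (\<kappa> - brk ut vt) - ?n * brk ux vx) * rl h)) * ?N" .
  next
  fix f :: "real \<times> (real ^ 'n) => complex" assume f: "f \<in> Linf_c"
   fix k l i R :: int and x :: "real ^ 'n" and \<tau> :: "int ^ 'n" assume kl: "2 <= \<bar>k - l\<bar>" and i: "1 <= i" and R: "R = max k l + i"
    and \<tau>: "\<forall>i. \<bar>\<tau> $ i\<bar> <= 3" "\<exists>j. 2 <= \<bar>\<tau> $ j\<bar>"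
   let ?X = "cell R (shift R \<tau> x)" and ?P = "cell R x"
   let ?N = "mixed_norm ut ux (restr (octave m k \<times> ?X) f)"
   obtain j where j: "2 <= \<bar>\<tau> $ j\<bar>" using \<tau>(2) ..
   note geo = shifted_cell_geometry[OF \<tau>(1)[rule_format] j, where R=R and x=x]
   have lx: "2 powr rl (max k l + 1) <= len_x ?X ?P" "c * len_x ?X ?P <= setdist ?X ?P"
   proof -
    have "2 powr rl (max k l + 1) <= 2 powr rl R" using i by (intro powr_mono) (auto simp: R)
    also have "... <= len_x ?X ?P" using geo(1) powr_gt_zero[of 2 "rl R"] by linarith
    finally show "2 powr rl (max k l + 1) <= len_x ?X ?P" .
    show "c * len_x ?X ?P <= setdist ?X ?P"
    proof -
     have "c * len_x ?X ?P <= (4 * 2 powr rl R) / 16" by (rule cn[OF geo(2)]) auto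
     moreover have "0 < 2 powr rl R" by simp
     ultimately show ?thesis using geo(3) by linarith
    qed
   qed
   have "mixed_norm vt vx (restr (octave m l \<times> ?P) (T (restr (octave m k \<times> ?X) f)))
     <= ennreal (C * setdist ?X ?P powr E3 * (diameter (octave m k \<union> octave m l) / setdist ?X ?P powr m) powr M) * ?N"
    unfolding E3_def
   proof (rule est3[OF f])
    show "c powr m * len_t (octave m k) (octave m l) <= setdist (octave m k) (octave m l)"
     unfolding len_t_octave[OF m0] by (rule order_trans[OF cm order_trans[OF powr_mono octave_separation(1)[OF m kl]]]) (use m in \<open>simp_all add: algebra_simps\<close>)
   qed (use rect lx in \<open>simp_all add: len_t_octave m0 tscale_root\<close>)
   also have "... <= ennreal (2 powr (B0 + (rl R * E3 - m * rl i * M + B3))) * ?N"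
    unfolding mult.assoc[of C]
   proof (rule CB)
    have s: "2 powr (rl R - (?n + 2)) <= setdist ?X ?P" "setdist ?X ?P <= 2 powr (rl R + (?n + 2))"
     using lo[OF geo(3)] geo(4) by simp_all
    have D: "2 powr (m * rl (max k l) - m) <= diameter (octave m k \<union> octave m l)" "diameter (octave m k \<union> octave m l) <= 2 powr (m * rl (max k l) + m)"
     using lo[OF octave_separation(3)[OF m kl]] octave_separation(4)[OF m kl] m by simp_all
    have "setdist ?X ?P powr E3 * (diameter (octave m k \<union> octave m l) / setdist ?X ?P powr m) powr M
     <= 2 powr (rl R * E3 + (?n + 2) * \<bar>E3\<bar>) * 2 powr ((m * rl (max k l) - m * rl R) * M + (m + m * (?n + 2)) * \<bar>M\<bar>)"
     using m0 by (intro mult_mono powr_comparable quotient_comparable s D) auto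
    also have "... = 2 powr (rl R * E3 - m * rl i * M + B3)"
    by (simp add: powr_add[symmetric] B3_def R algebra_simps)
    finally show "setdist ?X ?P powr E3 * (diameter (octave m k \<union> octave m l) / setdist ?X ?P powr m) powr M <= 2 powr (rl R * E3 - m * rl i * M + B3)" .
   qed
   also have "... <= ennreal (2 powr (B + (m * (\<kappa> - brk ut vt) - ?n * brk ux vx) * rl R - m * rl i * M)) * ?N"
   proof (rule up)
    have "rl R * E3 = (m * (\<kappa> - brk ut vt) - ?n * brk ux vx) * rl R" by (simp add: E3_def algebra_simps)
    then show "B0 + (rl R * E3 - m * rl i * M + B3) <= B + (m * (\<kappa> - brk ut vt) - ?n * brk ux vx) * rl R - m * rl i * M"
     using nn abs_ge_zero[of E2] unfolding B_def by linarith
   qed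
   finally show "mixed_norm vt vx (restr (octave m l \<times> ?P) (T (restr (octave m k \<times> ?X) f)))
     <= ennreal (2 powr (B + (m * (\<kappa> - brk ut vt) - ?n * brk ux vx) * rl R - m * rl i * M)) * ?N" .
  next
  fix f :: "real \<times> (real ^ 'n) => complex" assume f: "f \<in> Linf_c"
   fix l i R :: int and x :: "real ^ 'n" and \<tau> :: "int ^ 'n" assume i: "1 <= i" and R: "R = l + i"
    and \<tau>: "\<forall>i. \<bar>\<tau> $ i\<bar> <= 3" "\<exists>j. 2 <= \<bar>\<tau> $ j\<bar>"
   let ?X = "cell R (shift R \<tau> x)" and ?P = "cell R x"
   let ?N = "mixed_norm r ux (restr (wide m l \<times> ?X) f)" and ?D = "diameter (wide m l \<union> octave m l)" and ?M = "M + brk ut vt"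
   obtain j where j: "2 <= \<bar>\<tau> $ j\<bar>" using \<tau>(2) ..
   note geo = shifted_cell_geometry[OF \<tau>(1)[rule_format] j, where R=R and x=x]
   have lx: "2 powr rl (l + 2) <= len_x ?X ?P" "c * len_x ?X ?P <= setdist ?X ?P"
   proof -
    have "2 powr rl (l + 2) <= 2 powr (1 + rl R)" using i by (intro powr_mono) (auto simp: R)
    also have "... <= len_x ?X ?P" using geo(1) by (simp add: powr_add)
    finally show "2 powr rl (l + 2) <= len_x ?X ?P" .
    show "c * len_x ?X ?P <= setdist ?X ?P"
    proof -
     have "c * len_x ?X ?P <= (4 * 2 powr rl R) / 16" by (rule cn[OF geo(2)]) auto
     moreover have "0 < 2 powr rl R" by simp
     ultimately show ?thesis using geo(3) by linarith
    qed
   qed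
   have "mixed_norm r vx (restr (octave m l \<times> ?P) (T (restr (wide m l \<times> ?X) f)))
     <= ennreal (C * setdist ?X ?P powr E4 * (?D / setdist ?X ?P powr m) powr ?M) * ?N"
    unfolding E4_def by (rule est4[OF f]) (use rect lx in \<open>simp_all add: len_t_octave m0 tscale_root\<close>)
   also have "... <= ennreal (2 powr (B0 + (rl R * E4 - m * rl i * ?M + B4))) * ?N"
    unfolding mult.assoc[of C]
   proof (rule CB)
    have s: "2 powr (rl R - (?n + 2)) <= setdist ?X ?P" "setdist ?X ?P <= 2 powr (rl R + (?n + 2))"
     using lo[OF geo(3)] geo(4) by simp_all
    have D: "2 powr (m * rl l - 2 * m) <= ?D" "?D <= 2 powr (m * rl l + 2 * m)"
     using lo[OF wide_diameter(1)[OF m]] wide_diameter(2)[OF m] m by simp_all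
    have "setdist ?X ?P powr E4 * (?D / setdist ?X ?P powr m) powr ?M
     <= 2 powr (rl R * E4 + (?n + 2) * \<bar>E4\<bar>) * 2 powr ((m * rl l - m * rl R) * ?M + (2 * m + m * (?n + 2)) * \<bar>?M\<bar>)"
     using m0 by (intro mult_mono powr_comparable quotient_comparable s D) auto
    also have "... = 2 powr (rl R * E4 - m * rl i * ?M + B4)"
    by (simp add: powr_add[symmetric] B4_def R algebra_simps)
    finally show "setdist ?X ?P powr E4 * (?D / setdist ?X ?P powr m) powr ?M <= 2 powr (rl R * E4 - m * rl i * ?M + B4)" .
   qed
   also have "... <= ennreal (2 powr (B + (m * \<kappa> - ?n * brk ux vx) * rl R - m * rl i * ?M)) * ?N"
   proof (rule up)
    have "rl R * E4 = (m * \<kappa> - ?n * brk ux vx) * rl R" by (simp add: E4_def algebra_simps)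
    then show "B0 + (rl R * E4 - m * rl i * ?M + B4) <= B + (m * \<kappa> - ?n * brk ux vx) * rl R - m * rl i * ?M"
     using nn abs_ge_zero[of E2] unfolding B_def by linarith
   qed
   finally show "mixed_norm r vx (restr (octave m l \<times> ?P) (T (restr (wide m l \<times> ?X) f)))
     <= ennreal (2 powr (B + (m * \<kappa> - ?n * brk ux vx) * rl R - m * rl i * ?M)) * ?N" .
 qed
qed
qed

section \<open>Estimates for the pieces of the operator\<close>

lemma powr_chain:
 assumes "t <= ennreal (2 powr x0) * n0" "n0 <= ennreal (2 powr x1) * n1" "n1 <= ennreal (2 powr x2) * n2" "n2 <= ennreal (2 powr x3) * p"
  and "x0 + x1 + x2 + x3 <= y"
 shows "t <= ennreal (2 powr y) * p"
proof -
 have "t <= ennreal (2 powr x0) * (ennreal (2 powr x1) * (ennreal (2 powr x2) * (ennreal (2 powr x3) * p)))"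
 by (rule order_trans[OF assms(1) mult_left_mono[OF order_trans[OF assms(2) mult_left_mono[OF order_trans[OF assms(3) mult_left_mono[OF assms(4)]]]]]]) simp_all
 also have "... = ennreal (2 powr (x0 + (x1 + (x2 + x3)))) * p" by (simp only: ennreal_powr_mult)
 also have "... <= ennreal (2 powr y) * p" using assms(5) by (intro mult_right_mono ennreal_leI powr_mono) auto
 finally show ?thesis .
qed

text \<open>
 When \<open>p\<close> or \<open>q\<close> is infinite there is no exponent \<open>V\<close> above both; the supremum over the cell then replaces
 the \<open>V\<close>-average, and \<open>1 / V\<close> becomes \<open>0\<close>. The flag \<open>fin\<close> distinguishes the two situations.
\<close>

lemma cellwise_functional:
 fixes g :: "real ^ 'n => ennreal"
 assumes g: "cellwise (l + 1) g" and R: "l + 1 <= R" and v: "0 < v1" "fin ==> v1 <= V"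
 shows "(if fin then pavg R V (cell R x) g else g x)
   <= ennreal (2 powr ((rl R - rl l - 1) * (real CARD('n) * (1 / v1 - (if fin then 1 / V else 0))))) * pavg R v1 (cell R x) g"
proof (cases fin)
 case True
 have "pavg R V (cell R x) g <= ennreal (2 powr (rl (R - (l + 1)) * real CARD('n) * (1 / v1 - 1 / V))) * pavg R v1 (cell R x) g"
  using v True by (intro pavg_exponent_le g) (auto intro: subsetD[OF cell_subset[OF R]])
 then show ?thesis using True by (simp add: mult.assoc diff_diff_add)
next
 case False
 have "g x <= ennreal (2 powr (rl (R - (l + 1)) * real CARD('n) / v1)) * pavg R v1 (cell R x) g"
  using v by (intro cellwise_le_pavg g) (auto intro: subsetD[OF cell_subset[OF R]])
 then show ?thesis using False by (simp add: diff_diff_add)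
qed

text \<open>As one integral over a product set the tile is a normalised \<open>L^r\<close> norm on
  the half-space, for which null sets and the triangle inequality make sense directly.\<close>

lemma tile_eq:
 fixes x :: "real ^ 'n"
 assumes [measurable]: "joint_borel \<phi>" "S \<in> sets borel"
 shows "tile m r S k \<phi> x = epowr (ennreal (2 powr (- rl (k + 1) * real CARD('n))) * (ennreal (tscale m (- k)) *
   (\<integral>z. epowr (\<phi> (fst z) (snd z)) r * indicator (S \<times> cell (k + 1) x) z))) (1 / r)"
proof -
 have mL: "(\<lambda>(t, x). \<phi> t x) \<in> borel_measurable (lborel \<Otimes>\<^sub>M lborel)" unfolding measurable_lborel_pair by measurable
 have mz: "(\<lambda>z. epowr (\<phi> (fst z) (snd z)) r * indicator (S \<times> cell (k + 1) x) z) \<in> borel_measurable (lborel \<Otimes>\<^sub>M lborel)"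
  using mL by (simp add: case_prod_beta) measurable
 have "(\<integral>z. epowr (\<phi> (fst z) (snd z)) r * indicator (S \<times> cell (k + 1) x) z)
   = (\<integral>t. (\<integral>y. epowr (\<phi> t y) r * indicator (S \<times> cell (k + 1) x) (t, y)))"
  unfolding lborel_prod[symmetric] using lborel.nn_integral_fst[OF mz] by simp
 also have "... = (\<integral>t \<in> S. (\<integral>y \<in> cell (k + 1) x. epowr (\<phi> t y) r))"
 by (intro nn_integral_cong) (auto simp: indicator_times split: split_indicator)
 also have "... = (\<integral>y \<in> cell (k + 1) x. (\<integral>t \<in> S. epowr (\<phi> t y) r))"
 by (rule time_space_swap) simp_all
 finally have e: "avg (k + 1) (cell (k + 1) x) (\<lambda>y. (\<integral>t \<in> S. epowr (\<phi> t y) r)) = ennreal (2 powr (- rl (k + 1) * real CARD('n))) *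
   (\<integral>z. epowr (\<phi> (fst z) (snd z)) r * indicator (S \<times> cell (k + 1) x) z)" by (simp add: avg_def)
 show ?thesis unfolding tile_def by (subst avg_cmult) (measurable, simp only: e mult.left_commute)
qed

lemma tile_zero:
 fixes \<phi> :: "real => real ^ 'n => ennreal"
 assumes m: "joint_borel \<phi>" "S \<in> sets borel"
  and z: "AE z in lborel. fst z \<in> S --> \<phi> (fst z) (snd z) = 0"
 shows "tile m r S k \<phi> x = 0"
proof -
 have "(\<integral>z. epowr (\<phi> (fst z) (snd z)) r * indicator (S \<times> cell (k + 1) x) z) = (\<integral>\<^sup>+ z. 0 \<partial>(lborel :: (real \<times> (real ^ 'n)) measure))"
 proof (rule nn_integral_cong_AE, use z in eventually_elim)
  case (elim w)
  then show ?case by (auto split: split_indicator)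
 qed
 then show ?thesis by (simp add: tile_eq[OF m])
qed

text \<open>Minkowski's inequality with counting measure on \<open>F\<close>, where
  \<open>r >= 1\<close> enters. The pointwise bound holds almost everywhere, as subadditivity
  provides it.\<close>

lemma tile_sum_le:
 fixes \<phi> :: "real => real ^ 'n => ennreal"
 assumes m: "joint_borel \<phi>" "S \<in> sets borel" and F: "finite F" and r: "1 <= r"
  and U: "\<And>j. j \<in> F ==> (\<lambda>(t, x). U j t x) \<in> borel_measurable (borel \<Otimes>\<^sub>M borel)"
  and le: "AE z in lborel. fst z \<in> S --> \<phi> (fst z) (snd z) <= (\<Sum>j\<in>F. U j (fst z) (snd z))"
 shows "tile m r S k \<phi> x <= (\<Sum>j\<in>F. tile m r S k (U j) x)"
proof -
 let ?E = "S \<times> cell (k + 1) x" and ?C = "epowr (ennreal (2 powr (- rl (k + 1) * real CARD('n)))) (1 / r) * epowr (ennreal (tscale m (- k))) (1 / r)"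
 have [measurable]: "S \<in> sets borel" by (rule m)
 have t: "tile m r S k \<psi> x = ?C * epowr (\<integral>z. epowr (\<psi> (fst z) (snd z)) r * indicator ?E z) (1 / r)"
  if "joint_borel \<psi>" for \<psi>
 by (simp add: tile_eq[OF that m(2)] epowr_mult mult.assoc)
 define G where "G j z = U j (fst z) (snd z) * indicator ?E z" for j z
 have mG: "G j \<in> borel_measurable lborel" if "j \<in> F" for j
 proof -
  have "(\<lambda>z. U j (fst z) (snd z)) \<in> bor" using U[OF that] by (simp add: borel_prod case_prod_beta')
  moreover have "?E \<in> sets borel" unfolding borel_prod[symmetric] by measurable
  ultimately show ?thesis unfolding G_def by (intro borel_measurable_times_ennreal borel_measurable_indicator) auto
 qed
 have "(\<integral>z. epowr (\<phi> (fst z) (snd z)) r * indicator ?E z) <= (\<integral>z. epowr (\<Sum>\<^sup>+j\<in>F. G j z) r)"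
 proof (rule nn_integral_mono_AE, use le in eventually_elim)
  case (elim z)
  then show ?case using r F by (auto simp: G_def nn_integral_count_space_finite split: split_indicator intro!: epowr_mono)
 qed
 then have "epowr (\<integral>z. epowr (\<phi> (fst z) (snd z)) r * indicator ?E z) (1 / r) <= epowr (\<integral>z. epowr (\<Sum>\<^sup>+j\<in>F. G j z) r) (1 / r)"
  using r by (intro epowr_mono) auto
 also have "... <= (\<Sum>\<^sup>+j\<in>F. epowr (\<integral>z. epowr (G j z) r) (1 / r))"
  using F r mG by (intro nn_integral_Minkowski sigma_finite_lborel sigma_finite_measure_count_space_finite)
   (auto intro!: measurable_pair_measure_countable1 countable_finite)
 also have "... = (\<Sum>j\<in>F. epowr (\<integral>z. epowr (G j z) r) (1 / r))" using F by (rule nn_integral_count_space_finite)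
 also have "... = (\<Sum>j\<in>F. epowr (\<integral>z. epowr (U j (fst z) (snd z)) r * indicator ?E z) (1 / r))"
  unfolding G_def by (intro sum.cong refl arg_cong[where f="\<lambda>y. epowr y (1 / r)"] nn_integral_cong) (auto split: split_indicator)
 finally have "tile m r S k \<phi> x <= ?C * (\<Sum>j\<in>F. epowr (\<integral>z. epowr (U j (fst z) (snd z)) r * indicator ?E z) (1 / r))"
  unfolding t[OF m(1)] by (rule mult_left_mono) simp
 also have "... = (\<Sum>j\<in>F. tile m r S k (U j) x)" unfolding sum_distrib_left by (intro sum.cong refl) (simp add: t[OF U])
 finally show ?thesis .
qed

definition src :: "real => int => int => real set" where
 "src m l d = (if d = 0 then wide m l else octave m (l - d))"

definition lev :: "int => int => nat => int" where
 "lev l d i = max l (l - d) + (if i = 0 then 1 else int i)"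

definition reg :: "nat => int => int ^ 'n => real ^ 'n => (real ^ 'n) set" where
 "reg i R \<tau> x = (if i = 0 then cell3 R x else cell R (shift R \<tau> x))"

text \<open>
 The pieces belong to a target octave \<open>l\<close> and a point \<open>x\<close>. In a triple \<open>(d, i, \<tau>)\<close> the source octave is \<open>l - d\<close>,
 where \<open>d = 0\<close> stands for the three octaves of \<open>wide m l\<close>, so that \<open>d = 1\<close> and \<open>d = -1\<close> do not occur. For \<open>i = 0\<close> the
 spatial part is \<open>cell3 R x\<close> with \<open>R = max l (l - d) + 1\<close>; for \<open>i > 0\<close> it is the cell of level \<open>R = max l (l - d) + i\<close>
 with index offset \<open>\<tau>\<close>, and these cells fill the ring between \<open>cell3 R x\<close> and \<open>cell3 (R + 1) x\<close>.
\<close>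

definition pieces :: "(int \<times> nat \<times> (int ^ 'n)) set" where
 "pieces = {(d, i, \<tau>). \<bar>d\<bar> \<noteq> 1 \<and> (\<forall>a. \<bar>\<tau> $ a\<bar> <= 3) \<and> (if i = 0 then \<tau> = 0 else \<exists>a. 2 <= \<bar>\<tau> $ a\<bar>)}"

text \<open>In index offsets at level \<open>R\<close>, \<open>cell3 (R + 1) x\<close> reaches from
  \<open>-2\<close> to \<open>3\<close> or from \<open>-3\<close> to \<open>2\<close>, depending on
  the parity of the index of \<open>x\<close>. A given offset thus belongs to the ring for some
  \<open>x\<close> only, while the index set \<open>pieces\<close> has to be the same for
  all.\<close>

definition admissible :: "nat => int => int ^ 'n => real ^ 'n => bool" where
 "admissible i R \<tau> x \<longleftrightarrow> i = 0 \<or> shift R \<tau> x \<in> cell3 (R + 1) x"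

text \<open>Each case chains four bounds: from \<open>V\<close> to \<open>v1\<close> on the target
  cell, from target tile to mixed norm, the operator estimate, and from mixed norm to source tiles.
  In the exponent, \<open>cs\<close> and \<open>ct\<close> are the costs per level of changing the
  space exponent on the source and on the target side, counted from the scale of the box to that of
  the average; per ring the operator estimate gains
  \<open>m * (M + 1 / a - it - \<kappa>)\<close>.\<close>

lemma piece_estimate:
 fixes T :: "(real \<times> (real ^ 'n) => complex) => (real \<times> (real ^ 'n) => complex)"
 assumes c: "0 < c" "c <= 1 / (16 * sqrt (real CARD('n)))" and m: "1 <= m"
  and T: "singular_operator c \<kappa> m (ennreal r) (ennreal a) (ennreal b) vt vx M T"
  and a: "1 <= a" "a <= r" and b: "1 <= b" "b <= r" and vt: "ennreal r <= vt" and v1: "r <= v1" "ennreal v1 <= vx"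
  and u: "0 < u" "u <= b" and V: "fin --> v1 <= V"
 defines "it \<equiv> enn2real (inverse vt)" and "cs \<equiv> real CARD('n) * (1 / u - 1 / b)"
  and "ct \<equiv> real CARD('n) * (1 / v1 - (if fin then 1 / V else 0))"
 shows "\<exists>B. \<forall>f\<in>Linf_c. \<forall>\<phi> l d i \<tau> x R h U. borel_modulus f \<phi> --> (d, i, \<tau>) \<in> pieces --> R = lev l d i --> h = max l (l - d) --> admissible i R \<tau> x -->
   borel_modulus (T (restr (src m l d \<times> reg i R \<tau> x) f)) U -->
   (if fin then pavg R V (cell R x) (tile m r (octave m l) l U) else tile m r (octave m l) l U x)
    <= ennreal (2 powr (B + m * \<kappa> * rl h - m * (rl h - rl (l - d)) / a + m * (rl h - rl l) * it
      + (rl h - rl (l - d)) * cs + (rl h - rl l) * ct - real i * (m * (M + 1 / a - it - \<kappa>) - cs - ct)))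
     * pavg (h + int i + 1) u (cell3 (h + int i + 1) x) (tile m r (wide m (l - d)) (l - d) \<phi>)"
proof -
 from singular_operator_estimates[OF c m T] show ?thesis
 proof (elim exE, goal_cases)
 case (1 B)
 note est = 1
 let ?n = "real CARD('n)"
 note est1 = est[rule_format, THEN conjunct1, rule_format]
 note est2 = est[rule_format, THEN conjunct2, THEN conjunct1, rule_format]
 note est3 = est[rule_format, THEN conjunct2, THEN conjunct2, THEN conjunct1, rule_format]
 note est4 = est[rule_format, THEN conjunct2, THEN conjunct2, THEN conjunct2, rule_format]
 have m0: "0 < m" "0 < a" "0 < b" "0 < r" "0 < v1" using m a b v1 by auto
 define ix where "ix = enn2real (inverse vx)"
 have inv: "enn2real (inverse (ennreal s)) = 1 / s" if "0 < s" for s using that by (simp add: inverse_ennreal inverse_eq_divide)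
 have br: "brk (ennreal a) vt = 1 / a - it" "brk (ennreal b) vx = 1 / b - ix" using m0 by (simp_all add: brk_def inv it_def ix_def)
 have n0: "0 <= ix" "0 <= it" "0 < ?n" "0 <= ?n * ix" "0 <= ?n / b" using m0 by (simp_all add: ix_def it_def)
 have ct0: "0 <= ct"
 proof (cases fin)
  case True then have "1 / V <= 1 / v1" using V m0 by (intro divide_left_mono) auto
  then show ?thesis using True by (simp add: ct_def)
 qed (use m0 in \<open>simp add: ct_def\<close>)
 have vr: "ennreal r <= vx" using v1 by (meson ennreal_leI order_trans)
 show ?case
 \<comment> \<open>\<open>4 * m\<close> is the \<open>m\<close> of the target bound plus the
   \<open>3 * m\<close> of the source bound; \<open>?n / b\<close> is the price of averaging at
   level \<open>R + 1\<close> instead of \<open>R\<close>.\<close>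
 proof (intro exI[of _ "B + 4 * m + ?n / b"] ballI allI impI)
  fix f :: "real \<times> (real ^ 'n) => complex" and \<phi> l d i \<tau> and x :: "real ^ 'n" and R h U
  assume f: "f \<in> Linf_c" and \<phi>: "borel_modulus f \<phi>" and j: "(d, i, \<tau>) \<in> pieces" and R: "R = lev l d i" and h: "h = max l (l - d)" and adm: "admissible i R \<tau> x"
   and U: "borel_modulus (T (restr (src m l d \<times> reg i R \<tau> x) f)) U"
  define k where "k = l - d"
  define t where "t = tile m r (octave m l) l U"
  define q where "q = tile m r (wide m k) k \<phi>"
  define goal where "goal = B + 4 * m + ?n / b + m * \<kappa> * rl h - m * (rl h - rl k) / a + m * (rl h - rl l) * it
      + (rl h - rl k) * cs + (rl h - rl l) * ct - real i * (m * (M + 1 / a - it - \<kappa>) - cs - ct)"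
  have cw: "cellwise (l + 1) t" unfolding t_def by (rule cellwise_tile)
  have Rl: "l + 1 <= R" "k + 1 <= R" using R by (auto simp: lev_def k_def)
  let ?hi = "if fin then pavg R V (cell R x) t else t x"
  have fun1: "?hi <= ennreal (2 powr ((rl R - rl l - 1) * ct)) * pavg R v1 (cell R x) t"
   unfolding ct_def by (intro cellwise_functional cw Rl m0) (use V in auto)
  have "(if fin then pavg R V (cell R x) t else t x) <= ennreal (2 powr goal) * pavg (h + int i + 1) u (cell3 (h + int i + 1) x) q"
  proof (cases "i = 0")
   case i: True
   have Rh: "R = h + 1" using i R h by (simp add: lev_def)
   show ?thesis
   proof (cases "d = 0")
    case d: True
    have kl: "k = l" "h = l" "R = l + 1" using d h Rh by (auto simp: k_def)
    have E: "src m l d \<times> reg i R \<tau> x = wide m l \<times> cell3 (l + 1) x" using i d kl by (simp add: src_def reg_def)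
    let ?N = "mixed_norm (ennreal r) (ennreal r)"
    \<comment> \<open>The tile is constant on this cell, so each of its means equals
      \<open>t x\<close> and nothing is lost on the target side.\<close>
    have 0: "(if fin then pavg R V (cell R x) t else t x) <= ennreal (2 powr 0) * pavg (l + 1) r (cell (l + 1) x) t"
    proof -
     have "pavg (l + 1) s (cell (l + 1) x) t = t x" if "0 < s" for s
      using that avg_cellwise[of "l + 1" "\<lambda>y. epowr (t y) s" x] cw by (auto simp: pavg_def cellwise_def epowr_epowr)
     moreover have "fin ==> 0 < V" using V m0 by auto
     ultimately show ?thesis using m0 by (auto simp: kl)
    qed
    have 1: "pavg (l + 1) r (cell (l + 1) x) t <= ennreal (2 powr (m - m * rl l * (1 / r) - rl (l + 1) * ?n * (1 / r))) * ?N (restr (wide m l \<times> cell3 (l + 1) x) (T (restr (wide m l \<times> cell3 (l + 1) x) f)))"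
     unfolding t_def inv[OF m0(4), symmetric] using U[unfolded E] m a m0 octave_subset_wide[of m l] cell_subset_cell3[of "l + 1" x]
    by (intro tile_target_bound) auto
    have 3: "?N (restr (wide m l \<times> cell3 (l + 1) x) f) <= ennreal (2 powr (3 * m + m * rl l * (1 / r) + rl (l + 1) * ?n * (1 / r) + (rl (l + 1) - rl l - 1) * (?n * (1 / u - 1 / r)))) * pavg (l + 1) u (cell3 (l + 1) x) q"
     unfolding q_def kl using \<phi> m a b u m0 by (intro mixed_norm_source_bound) (auto intro: subsetD[OF cell3_subset])
    have "?hi <= ennreal (2 powr goal) * pavg (l + 1) u (cell3 (l + 1) x) q"
    proof (rule powr_chain[OF 0 1 est1[OF f] 3])
     show "0 + (m - m * rl l * (1 / r) - rl (l + 1) * ?n * (1 / r)) + (B + m * \<kappa> * rl l) +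
      (3 * m + m * rl l * (1 / r) + rl (l + 1) * ?n * (1 / r) + (rl (l + 1) - rl l - 1) * (?n * (1 / u - 1 / r))) <= goal"
      unfolding goal_def kl i using n0 by simp
    qed
    then show ?thesis by (simp add: kl i)
   next
    case d: False
    then have kl: "2 <= \<bar>k - l\<bar>" "h = max k l" using j h by (auto simp: pieces_def k_def)
    have E: "src m l d \<times> reg i R \<tau> x = octave m k \<times> cell3 (h + 1) x" using i d Rh by (simp add: src_def reg_def k_def)
    have 1: "pavg R v1 (cell R x) t <= ennreal (2 powr (m - m * rl l * it - rl R * ?n * ix)) * mixed_norm vt vx (restr (octave m l \<times> cell (h + 1) x) (T (restr (octave m k \<times> cell3 (h + 1) x) f)))"
     unfolding t_def it_def ix_def using U[unfolded E] m a m0 v1 vt Rl Rh by (intro tile_target_bound) auto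
    have 3: "mixed_norm (ennreal a) (ennreal b) (restr (octave m k \<times> cell3 (h + 1) x) f) <= ennreal (2 powr (3 * m + m * rl k * (1 / a) + rl R * ?n * (1 / b) + (rl R - rl k - 1) * cs)) * pavg R u (cell3 R x) q"
     unfolding q_def cs_def Rh[symmetric] using \<phi> m a b u m0 octave_subset_wide[of m k] by (intro mixed_norm_source_bound cell3_subset[OF Rl(2)]) auto
    have "?hi <= ennreal (2 powr goal) * pavg R u (cell3 R x) q"
    proof (rule powr_chain[OF fun1 1 est2[OF f kl] 3])
     show "(rl R - rl l - 1) * ct + (m - m * rl l * it - rl R * ?n * ix) + (B + (m * (\<kappa> - brk (ennreal a) vt) - ?n * brk (ennreal b) vx) * rl h) +
      (3 * m + m * rl k * (1 / a) + rl R * ?n * (1 / b) + (rl R - rl k - 1) * cs) <= goal"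
      unfolding goal_def br Rh i using n0 by (simp add: algebra_simps add_divide_distrib diff_divide_distrib)
    qed
    then show ?thesis by (simp add: Rh i)
   qed
  next
   case i: False
   have Rh: "R = h + int i" "1 <= int i" using i R h by (auto simp: lev_def)
   have \<tau>: "\<forall>a. \<bar>\<tau> $ a\<bar> <= 3" "\<exists>a. 2 <= \<bar>\<tau> $ a\<bar>" using j i by (auto simp: pieces_def)
   have X: "cell R (shift R \<tau> x) \<subseteq> cell3 (R + 1) x" using adm i cell3_subset[of R "R + 1"] by (auto simp: admissible_def)
   have X': "cell (k + 1) y \<subseteq> cell R (shift R \<tau> x)" if "y \<in> cell R (shift R \<tau> x)" for y using Rl that by (intro cell_subset) auto
   show ?thesis
   proof (cases "d = 0")
    case d: True
    have kl: "k = l" "h = l" using d h by (auto simp: k_def)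
    have E: "src m l d \<times> reg i R \<tau> x = wide m l \<times> cell R (shift R \<tau> x)" using i d by (simp add: src_def reg_def)
    have 1: "pavg R v1 (cell R x) t <= ennreal (2 powr (m - m * rl l * (1 / r) - rl R * ?n * ix)) * mixed_norm (ennreal r) vx (restr (octave m l \<times> cell R x) (T (restr (wide m l \<times> cell R (shift R \<tau> x)) f)))"
     unfolding t_def inv[OF m0(4), symmetric] ix_def using U[unfolded E] m a m0 v1 vt Rl by (intro tile_target_bound) auto
    have 3: "mixed_norm (ennreal r) (ennreal b) (restr (wide m l \<times> cell R (shift R \<tau> x)) f) <= ennreal (2 powr (3 * m + m * rl l * (1 / r) + rl (R + 1) * ?n * (1 / b) + (rl (R + 1) - rl l - 1) * cs)) * pavg (R + 1) u (cell3 (R + 1) x) q"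
     unfolding q_def cs_def kl using \<phi> m a b u m0 X X'[unfolded kl] by (intro mixed_norm_source_bound) auto
    have Rl': "R = l + int i" using Rh kl by simp
    have "?hi <= ennreal (2 powr goal) * pavg (R + 1) u (cell3 (R + 1) x) q"
    proof (rule powr_chain[OF fun1 1 est4[OF f Rh(2) Rl' \<tau>(1)[rule_format] \<tau>(2)] 3])
     show "(rl R - rl l - 1) * ct + (m - m * rl l * (1 / r) - rl R * ?n * ix) + (B + (m * \<kappa> - ?n * brk (ennreal b) vx) * rl R - m * rl (int i) * (M + brk (ennreal a) vt)) +
      (3 * m + m * rl l * (1 / r) + rl (R + 1) * ?n * (1 / b) + (rl (R + 1) - rl l - 1) * cs) <= goal"
      unfolding goal_def br Rh kl using n0 ct0 by (simp add: algebra_simps add_divide_distrib diff_divide_distrib)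
    qed
    then show ?thesis by (simp add: Rh add_ac)
   next
    case d: False
    then have kl: "2 <= \<bar>k - l\<bar>" "h = max k l" using j h by (auto simp: pieces_def k_def)
    have E: "src m l d \<times> reg i R \<tau> x = octave m k \<times> cell R (shift R \<tau> x)" using i d by (simp add: src_def reg_def k_def)
    have 1: "pavg R v1 (cell R x) t <= ennreal (2 powr (m - m * rl l * it - rl R * ?n * ix)) * mixed_norm vt vx (restr (octave m l \<times> cell R x) (T (restr (octave m k \<times> cell R (shift R \<tau> x)) f)))"
     unfolding t_def it_def ix_def using U[unfolded E] m a m0 v1 vt Rl by (intro tile_target_bound) auto
    have 3: "mixed_norm (ennreal a) (ennreal b) (restr (octave m k \<times> cell R (shift R \<tau> x)) f) <= ennreal (2 powr (3 * m + m * rl k * (1 / a) + rl (R + 1) * ?n * (1 / b) + (rl (R + 1) - rl k - 1) * cs)) * pavg (R + 1) u (cell3 (R + 1) x) q"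
     unfolding q_def cs_def using \<phi> m a b u m0 X X' octave_subset_wide[of m k] by (intro mixed_norm_source_bound) auto
    have Rl': "R = max k l + int i" using Rh kl by simp
    have "?hi <= ennreal (2 powr goal) * pavg (R + 1) u (cell3 (R + 1) x) q"
    proof (rule powr_chain[OF fun1 1 est3[OF f kl(1) Rh(2) Rl' \<tau>(1)[rule_format] \<tau>(2)] 3])
     show "(rl R - rl l - 1) * ct + (m - m * rl l * it - rl R * ?n * ix) + (B + (m * (\<kappa> - brk (ennreal a) vt) - ?n * brk (ennreal b) vx) * rl R - m * rl (int i) * M) +
      (3 * m + m * rl k * (1 / a) + rl (R + 1) * ?n * (1 / b) + (rl (R + 1) - rl k - 1) * cs) <= goal"
      unfolding goal_def br Rh using n0 ct0 by (simp add: algebra_simps add_divide_distrib diff_divide_distrib)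
    qed
    then show ?thesis by (simp add: Rh add_ac)
   qed
  qed
  then show "(if fin then pavg R V (cell R x) (tile m r (octave m l) l U) else tile m r (octave m l) l U x)
    <= ennreal (2 powr (B + 4 * m + ?n / b + m * \<kappa> * rl h - m * (rl h - rl (l - d)) / a + m * (rl h - rl l) * it
      + (rl h - rl (l - d)) * cs + (rl h - rl l) * ct - real i * (m * (M + 1 / a - it - \<kappa>) - cs - ct)))
     * pavg (h + int i + 1) u (cell3 (h + int i + 1) x) (tile m r (wide m (l - d)) (l - d) \<phi>)"
   unfolding goal_def t_def q_def k_def .
 qed
qed
qed

section \<open>Partition of the half-space into regions around a target\<close>

definition region :: "real => int => real ^ 'n => int \<times> nat \<times> (int ^ 'n) => (real \<times> (real ^ 'n)) set" where
 "region m l x = (\<lambda>(d, i, \<tau>). src m l d \<times> reg i (lev l d i) \<tau> x)"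

definition adm :: "int => real ^ 'n => int \<times> nat \<times> (int ^ 'n) => bool" where
 "adm l x = (\<lambda>(d, i, \<tau>). admissible i (lev l d i) \<tau> x)"

lemma src_iff:
 assumes m: "0 < m" and t: "t \<in> octave m k" shows "t \<in> src m l d \<longleftrightarrow> (if d = 0 then \<bar>l - k\<bar> <= 1 else k = l - d)"
proof (cases "d = 0")
 case True
 have "t \<in> wide m l \<longleftrightarrow> \<not> t < tscale m ((l - 2) + 1) \<and> t < tscale m ((l + 1) + 1)" by (auto simp: wide_def add_ac)
 also have "... \<longleftrightarrow> \<bar>l - k\<bar> <= 1" unfolding octave_le_iff[OF m t] by auto
 finally show ?thesis using True by (simp add: src_def)
next
 case False
 have "t \<in> octave m (l - d) \<longleftrightarrow> k = l - d" using t octave_unique[OF m t, of "l - d"] by blast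
 then show ?thesis using False by (simp add: src_def)
qed

lemma reg_mem:
 assumes j: "(d, i, \<tau>) \<in> pieces" and a: "admissible i (lev l d i) \<tau> x" and y: "y \<in> reg i (lev l d i) \<tau> x"
 shows "y \<in> cell3 (max l (l - d) + int i + 1) x" "0 < i ==> y \<notin> cell3 (max l (l - d) + int i) x"
  "\<tau> = (if i = 0 then 0 else idx (lev l d i) y - idx (lev l d i) x)"
proof -
 define R where "R = lev l d i"
 have "y \<in> cell3 (max l (l - d) + int i + 1) x \<and> (0 < i --> y \<notin> cell3 (max l (l - d) + int i) x) \<and> \<tau> = (if i = 0 then 0 else idx R y - idx R x)"
 proof (cases "i = 0")
  case True then show ?thesis using y j by (simp add: reg_def pieces_def lev_def R_def)
 next
  case False
  have R: "R = max l (l - d) + int i" using False by (simp add: R_def lev_def)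
  have y': "y \<in> cell R (shift R \<tau> x)" using y False by (simp add: reg_def R_def)
  then have i: "idx R y = idx R x + \<tau>" by (simp add: cell_shift)
  obtain b where "2 <= \<bar>\<tau> $ b\<bar>" using j False by (auto simp: pieces_def)
  then have "y \<notin> cell3 R x" by (auto simp: cell3_def i intro!: exI[of _ b])
  moreover have "y \<in> cell3 (R + 1) x" using a False y' cell3_subset[of R "R + 1" "shift R \<tau> x" x] by (auto simp: admissible_def R_def)
  ultimately show ?thesis using False i by (simp add: R)
 qed
 then show "y \<in> cell3 (max l (l - d) + int i + 1) x" "0 < i ==> y \<notin> cell3 (max l (l - d) + int i) x"
  "\<tau> = (if i = 0 then 0 else idx (lev l d i) y - idx (lev l d i) x)" by (auto simp: R_def)
qed

text \<open>The time determines \<open>d\<close>, since \<open>d = 1\<close> and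
  \<open>d = -1\<close> do not occur; \<open>i\<close> is the first step at which the point enters
  the increasing neighbourhoods of \<open>x\<close>, and \<open>\<tau>\<close> is then an index
  difference.\<close>

lemma region_unique:
 assumes m: "0 < m" and z: "0 < fst z" and "j \<in> pieces" "adm l x j" "z \<in> region m l x j" and "j' \<in> pieces" "adm l x j'" "z \<in> region m l x j'"
 shows "j = j'"
proof -
 obtain d i \<tau> d' i' \<tau>' where j: "j = (d, i, \<tau>)" "j' = (d', i', \<tau>')" by (cases j, cases j')
 obtain k where k: "fst z \<in> octave m k" using octave_ex[OF m z] by auto
 have "fst z \<in> src m l d" "fst z \<in> src m l d'" "\<bar>d\<bar> \<noteq> 1" "\<bar>d'\<bar> \<noteq> 1" using assms unfolding j by (auto simp: region_def pieces_def)
 then have "(if d = 0 then \<bar>l - k\<bar> <= 1 else k = l - d)" "(if d' = 0 then \<bar>l - k\<bar> <= 1 else k = l - d')" "\<bar>d\<bar> \<noteq> 1" "\<bar>d'\<bar> \<noteq> 1"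
  unfolding src_iff[OF m k] by simp_all
 then have d: "d = d'" by (auto split: if_splits)
 define h where "h = max l (l - d)"
 have r: "snd z \<in> cell3 (h + int i + 1) x" "0 < i ==> snd z \<notin> cell3 (h + int i) x" "\<tau> = (if i = 0 then 0 else idx (lev l d i) (snd z) - idx (lev l d i) x)"
   "snd z \<in> cell3 (h + int i' + 1) x" "0 < i' ==> snd z \<notin> cell3 (h + int i') x" "\<tau>' = (if i' = 0 then 0 else idx (lev l d i') (snd z) - idx (lev l d i') x)"
  using reg_mem[of d i \<tau> l x "snd z"] reg_mem[of d' i' \<tau>' l x "snd z"] assms unfolding j d h_def by (auto simp: region_def adm_def)
 have "\<not> i < i'" using r(1,5) cell3_mono[of "h + int i + 1" "h + int i'" x] by auto
 moreover have "\<not> i' < i" using r(2,4) cell3_mono[of "h + int i' + 1" "h + int i" x] by auto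
 ultimately have "i = i'" by simp
 then show ?thesis using j d r by simp
qed

text \<open>The ring number is the least \<open>i\<close> with \<open>y\<close> in
  \<open>cell3 (h + int i + 1) x\<close>. Adjacency at the parent level leaves offsets of at most 3,
  failure of adjacency at level \<open>R\<close> gives one of at least 2. The bounds on
  \<open>d\<close> and \<open>i\<close> make the decomposition of a compactly supported function
  finite.\<close>

lemma region_ex:
 fixes x :: "real ^ 'n"
 assumes m: "0 < m" and t: "t \<in> octave m k" and y: "y \<in> cell3 (l + int I) x"
 shows "\<exists>d i \<tau>. (d, i, \<tau>) \<in> pieces \<and> adm l x (d, i, \<tau>) \<and> (t, y) \<in> region m l x (d, i, \<tau>) \<and> \<bar>d\<bar> <= \<bar>l - k\<bar> \<and> i <= I"
proof -
 define d where "d = (if \<bar>l - k\<bar> <= 1 then 0 else l - k)"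
 have td: "t \<in> src m l d" unfolding src_iff[OF m t] by (auto simp: d_def)
 define h where "h = max l (l - d)"
 define i where "i = (LEAST i. y \<in> cell3 (h + int i + 1) x)"
 have lh: "l <= h" by (simp add: h_def)
 then have yI: "y \<in> cell3 (h + int I + 1) x" using y cell3_mono[of "l + int I" "h + int I + 1" x] by auto
 have yi: "y \<in> cell3 (h + int i + 1) x" unfolding i_def by (rule LeastI[of "\<lambda>i. y \<in> cell3 (h + int i + 1) x", OF yI])
 have iI: "i <= I" unfolding i_def by (rule Least_le[of "\<lambda>i. y \<in> cell3 (h + int i + 1) x", OF yI])
 define R where "R = lev l d i"
 define \<tau> where "\<tau> = (if i = 0 then 0 else idx R y - idx R x)"
 have "(d, i, \<tau>) \<in> pieces \<and> admissible i R \<tau> x \<and> y \<in> reg i R \<tau> x"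
 proof (cases "i = 0")
  case True then show ?thesis using yi by (auto simp: pieces_def admissible_def reg_def \<tau>_def R_def lev_def h_def d_def)
 next
  case False
  have R: "R = h + int i" using False by (simp add: R_def lev_def h_def)
  have "\<not> y \<in> cell3 (h + int (i - 1) + 1) x" using False unfolding i_def by (intro not_less_Least) auto
  then have "y \<notin> cell3 R x" using False R by (simp add: of_nat_diff)
  then obtain a where "\<not> \<bar>idx R y $ a - idx R x $ a\<bar> <= 1" by (auto simp: cell3_def)
  then have ex: "\<exists>a. 2 <= \<bar>\<tau> $ a\<bar>" using False by (intro exI[of _ a]) (simp add: \<tau>_def)
  have y1: "y \<in> cell3 (R + 1) x" using yi R by simp
  have "\<bar>a - b\<bar> <= 3" if "\<bar>a div 2 - b div 2\<bar> <= 1" for a b :: int using that by linarith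
  then have "\<forall>a. \<bar>\<tau> $ a\<bar> <= 3" using y1 False by (auto simp: cell3_def idx_Suc \<tau>_def)
  moreover have yc: "y \<in> cell R (shift R \<tau> x)" using False by (simp add: cell_shift \<tau>_def)
  moreover have "shift R \<tau> x \<in> cell3 (R + 1) x"
   using cell3_subset[of R "R + 1" y x] y1 yc cell_sym by auto
  ultimately show ?thesis using ex False by (auto simp: pieces_def admissible_def reg_def d_def)
 qed
 then show ?thesis using td iI
 by (intro exI[of _ d] exI[of _ i] exI[of _ \<tau>]) (auto simp: adm_def region_def R_def d_def)
qed

lemma finite_bounded_int_vec: "finite {\<tau> :: int ^ 'n. \<forall>a. \<bar>\<tau> $ a\<bar> <= N}"
proof (rule finite_subset)
 show "{\<tau> :: int ^ 'n. \<forall>a. \<bar>\<tau> $ a\<bar> <= N} \<subseteq> vec_lambda ` (PiE UNIV (\<lambda>_. {- N..N}))"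
 proof
  fix \<tau> :: "int ^ 'n" assume "\<tau> \<in> {\<tau>. \<forall>a. \<bar>\<tau> $ a\<bar> <= N}"
  then have "vec_nth \<tau> \<in> PiE UNIV (\<lambda>_. {- N..N})" by (auto simp: abs_le_iff minus_le_iff)
  then show "\<tau> \<in> vec_lambda ` (PiE UNIV (\<lambda>_. {- N..N}))" by (intro image_eqI[of _ _ "vec_nth \<tau>"]) auto
 qed
qed (intro finite_imageI finite_PiE; simp)

lemma compact_upper_half_space_bounds:
 fixes x :: "real ^ 'n"
 assumes m: "0 < m" and K: "compact K" "K \<subseteq> upper_half_space"
 shows "\<exists>D I. \<forall>t y. (t, y) \<in> K --> (\<exists>k. t \<in> octave m k \<and> \<bar>l - k\<bar> <= D) \<and> y \<in> cell3 (l + int I) x"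
proof (cases "K = {}")
 case False
 have cf: "compact (fst ` K)" using K by (intro compact_continuous_image continuous_intros)
 from compact_attains_inf[OF cf] obtain z0 where z0: "z0 \<in> K" "\<And>z. z \<in> K ==> fst z0 <= fst z" using False by auto
 from compact_attains_sup[OF cf] obtain z1 where z1: "z1 \<in> K" "\<And>z. z \<in> K ==> fst z <= fst z1" using False by auto
 have p: "0 < fst z" if "z \<in> K" for z using K that by (auto simp: upper_half_space_def)
 obtain k0 where k0: "fst z0 \<in> octave m k0" using octave_ex[OF m p[OF z0(1)]] by auto
 obtain k1 where k1: "fst z1 \<in> octave m k1" using octave_ex[OF m p[OF z1(1)]] by auto
 have "bounded (snd ` K)" using K by (intro compact_imp_bounded compact_continuous_image continuous_intros)
 then obtain B where B: "\<And>z. z \<in> K ==> norm (snd z - x) <= B" unfolding bounded_def using norm_minus_commute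
 by (metis bounded_any_center[of _ x] \<open>bounded (snd ` K)\<close> dist_norm imageI)
 obtain J :: nat where J: "B < real J" using reals_Archimedean2 by blast
 define I where "I = nat (int J - l)"
 show ?thesis
 proof (rule exI[of _ "\<bar>l - k0\<bar> + \<bar>l - k1\<bar>"], rule exI[of _ I], intro allI impI conjI)
  fix t y assume ty: "(t, y) \<in> K"
  obtain k where k: "t \<in> octave m k" using octave_ex[OF m] p[OF ty] by auto
  have "fst z0 <= t" "t <= fst z1" using z0(2)[OF ty] z1(2)[OF ty] by auto
  then have "k0 <= k" "k <= k1"
   using octave_le_iff[OF m k0, of k] octave_le_iff[OF m k, of k1] k k1 by (auto simp: octave_def)
  then show "\<exists>k. t \<in> octave m k \<and> \<bar>l - k\<bar> <= \<bar>l - k0\<bar> + \<bar>l - k1\<bar>" using k by (intro exI[of _ k]) auto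
  have "\<bar>\<lfloor>a\<rfloor> - \<lfloor>b\<rfloor>\<bar> <= 1" if "\<bar>a - b\<bar> <= 1" for a b :: real using that by linarith
  moreover have "\<bar>y $ a / 2 powr rl (l + int I) - x $ a / 2 powr rl (l + int I)\<bar> <= 1" for a
  proof -
   have "\<bar>y $ a - x $ a\<bar> <= B" using component_le_norm_cart[of "y - x" a] B[OF ty] by simp
   also have "... <= 2 powr real J" using J less_exp[of J] by (simp add: powr_realpow) (metis less_le_trans less_imp_le of_nat_less_two_power)
   also have "... <= 2 powr rl (l + int I)" by (intro powr_mono) (auto simp: I_def)
   finally show ?thesis by (simp add: diff_divide_distrib[symmetric] pos_divide_le_eq)
  qed
  ultimately show "y \<in> cell3 (l + int I) x" by (simp add: cell3_def idx_nth)
 qed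
qed auto

text \<open>The identity is exact at every point, because \<open>T\<close> may distinguish functions
  that agree almost everywhere. The triple \<open>(0, 0, 0)\<close> keeps \<open>F\<close> nonempty:
  subadditivity gives no information about an empty sum.\<close>

lemma region_decomposition:
 fixes f :: "real \<times> (real ^ 'n) => complex"
 assumes m: "0 < m" and f: "f \<in> Linf_c"
 shows "\<exists>F. finite F \<and> F \<noteq> {} \<and> (\<forall>j\<in>F. j \<in> pieces \<and> adm l x j) \<and> (\<forall>z. f z = (\<Sum>j\<in>F. restr (region m l x j) f z))"
proof -
 obtain K where K: "compact K" "K \<subseteq> upper_half_space" "\<And>z. z \<notin> K ==> f z = 0" using f by (auto simp: Linf_c_def)
 obtain D I where DI: "\<And>t y. (t, y) \<in> K ==> (\<exists>k. t \<in> octave m k \<and> \<bar>l - k\<bar> <= D) \<and> y \<in> cell3 (l + int I) x"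
  using compact_upper_half_space_bounds[OF m K(1,2), of l x] by blast
 define F where "F = ({- \<bar>D\<bar>..\<bar>D\<bar>} \<times> {..I} \<times> {\<tau> :: int ^ 'n. \<forall>a. \<bar>\<tau> $ a\<bar> <= 3}) \<inter> {j \<in> pieces. adm l x j}"
 show ?thesis
 proof (intro exI[of _ F] conjI ballI allI)
  show F: "finite F" unfolding F_def by (intro finite_Int disjI1 finite_cartesian_product finite_bounded_int_vec) auto
  have "(0, 0, 0) \<in> F" by (auto simp: F_def pieces_def adm_def admissible_def)
  then show "F \<noteq> {}" by auto
  show "j \<in> pieces" "adm l x j" if "j \<in> F" for j using that by (auto simp: F_def)
  fix z
  show "f z = (\<Sum>j\<in>F. restr (region m l x j) f z)"
  proof (cases "z \<in> K")
   case True
   obtain t y where z: "z = (t, y)" by (cases z)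
   obtain k where k: "t \<in> octave m k" "\<bar>l - k\<bar> <= D" and y: "y \<in> cell3 (l + int I) x" using DI True z by blast
   obtain d i \<tau> where j: "(d, i, \<tau>) \<in> pieces" "adm l x (d, i, \<tau>)" "(t, y) \<in> region m l x (d, i, \<tau>)" "\<bar>d\<bar> <= \<bar>l - k\<bar>" "i <= I"
    using region_ex[OF m k(1) y] by blast
   have jF: "(d, i, \<tau>) \<in> F" using j k by (auto simp: F_def pieces_def)
   have "(\<Sum>j\<in>F. restr (region m l x j) f z) = (\<Sum>j\<in>{(d, i, \<tau>)}. restr (region m l x j) f z)"
   proof (rule sum.mono_neutral_right[OF F])
    have "0 < fst z" using K(2) True by (auto simp: upper_half_space_def)
    then have "z \<notin> region m l x j'" if "j' \<in> F - {(d, i, \<tau>)}" for j'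
     using region_unique[OF m _ j(1,2) j(3)[folded z], of j'] that unfolding F_def by blast
    then show "\<forall>j\<in>F - {(d, i, \<tau>)}. restr (region m l x j) f z = 0" by (simp add: restr_def)
   qed (use jF in simp)
   then show ?thesis using j(3) z by (simp add: restr_def)
  qed (simp add: K(3) restr_def)
 qed
qed

section \<open>Finite sums, dependence on the target point, causality\<close>

lemma Linf_c_add: "f \<in> Linf_c ==> g \<in> Linf_c ==> (\<lambda>w. f w + g w) \<in> Linf_c"
proof -
 assume f: "f \<in> Linf_c" and g: "g \<in> Linf_c"
 obtain K where K: "compact K" "K \<subseteq> upper_half_space" "\<And>z. z \<notin> K ==> f z = 0" using f by (auto simp: Linf_c_def)
 obtain K' where K': "compact K'" "K' \<subseteq> upper_half_space" "\<And>z. z \<notin> K' ==> g z = 0" using g by (auto simp: Linf_c_def)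
 obtain B B' where "\<And>z. norm (f z) <= B" "\<And>z. norm (g z) <= B'" using f g by (auto simp: Linf_c_def bounded_iff)
 then have "bounded (range (\<lambda>w. f w + g w))" by (intro boundedI[of _ "B + B'"]) (auto intro!: norm_triangle_mono)
 moreover have "(\<lambda>w. f w + g w) \<in> borel_measurable lebesgue" using f g by (auto simp: Linf_c_def)
 moreover have "\<exists>K. compact K \<and> K \<subseteq> upper_half_space \<and> (\<forall>z. z \<notin> K --> f z + g z = 0)"
  using K K' by (intro exI[of _ "K \<union> K'"]) auto
 ultimately show ?thesis by (simp add: Linf_c_def)
qed

lemma Linf_c_restr:
 assumes f: "f \<in> Linf_c" and E: "E \<in> sets borel" shows "restr E f \<in> Linf_c"
proof -
 have "E \<in> sets lebesgue" using E by simp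
 then have "restr E f \<in> borel_measurable lebesgue" using f unfolding restr_def Linf_c_def
 by (intro borel_measurable_times borel_measurable_indicator) auto
 moreover obtain B where B: "\<And>z. norm (f z) <= B" using f by (auto simp: Linf_c_def bounded_iff)
 moreover have "bounded (range (restr E f))"
 by (intro boundedI[of _ B]) (use B order_trans[OF norm_ge_zero B] in \<open>auto simp: restr_def split: split_indicator\<close>)
 moreover obtain K where "compact K" "K \<subseteq> upper_half_space" "\<And>z. z \<notin> K ==> f z = 0" using f by (auto simp: Linf_c_def)
 ultimately show ?thesis by (auto simp: Linf_c_def restr_def)
qed

lemma subadditive_op_sum:
 assumes T: "subadditive_op T" and F: "finite F" "F \<noteq> {}" and g: "\<And>j. j \<in> F ==> g j \<in> Linf_c"
 shows "(\<lambda>w. \<Sum>j\<in>F. g j w) \<in> Linf_c \<and> (AE z in lebesgue_on upper_half_space. norm (T (\<lambda>w. \<Sum>j\<in>F. g j w) z) <= (\<Sum>j\<in>F. norm (T (g j) z)))"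
 using F g
proof (induction F rule: finite_ne_induct)
 case (insert j F)
 have "AE z in lebesgue_on upper_half_space. norm (T (\<lambda>w. g j w + (\<Sum>j\<in>F. g j w)) z) <= norm (T (g j) z) + norm (T (\<lambda>w. \<Sum>j\<in>F. g j w) z)"
  using T insert by (intro T[unfolded subadditive_op_def, THEN conjunct2, rule_format]) auto
 moreover have "AE z in lebesgue_on upper_half_space. norm (T (\<lambda>w. \<Sum>j\<in>F. g j w) z) <= (\<Sum>j\<in>F. norm (T (g j) z))" using insert by auto
 ultimately have "AE z in lebesgue_on upper_half_space. norm (T (\<lambda>w. g j w + (\<Sum>j\<in>F. g j w)) z) <= norm (T (g j) z) + (\<Sum>j\<in>F. norm (T (g j) z))"
 by eventually_elim simp
 moreover have "(\<lambda>w. g j w + (\<Sum>j\<in>F. g j w)) \<in> Linf_c" using insert by (intro Linf_c_add) auto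
 ultimately show ?case using insert by simp
qed auto

lemma sets_region [measurable]: "region m l (x :: real ^ 'n) j \<in> sets borel"
proof -
 obtain d i \<tau> where j: "j = (d, i, \<tau>)" by (cases j)
 have [measurable]: "src m l d \<in> sets borel" "reg i (lev l d i) \<tau> x \<in> sets borel" by (simp_all add: src_def reg_def)
 have "src m l d \<times> reg i (lev l d i) \<tau> x \<in> sets borel" unfolding borel_prod[symmetric] by measurable
 then show ?thesis by (simp add: region_def j)
qed

text \<open>Region and admissibility see \<open>x\<close> only through its cell at level
  \<open>lev l d i\<close>. So the same function \<open>T (f 1_E)\<close> serves all points of that
  cell, which gives averaging over the cell a meaning.\<close>

lemma region_cell:
 assumes y: "y \<in> cell (lev l d i) x"
 shows "region m l y (d, i, \<tau>) = region m l x (d, i, \<tau>)" "adm l y (d, i, \<tau>) \<longleftrightarrow> adm l x (d, i, \<tau>)"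
proof -
 define R where "R = lev l d i"
 have e: "idx R y = idx R x" using y by (simp add: cell_def R_def)
 then have s: "cell R (shift R \<tau> y) = cell R (shift R \<tau> x)" by (simp add: cell_shift)
 have "reg i R \<tau> y = reg i R \<tau> x" using s cell3_eq[OF y] by (cases "i = 0") (simp_all only: reg_def R_def if_True if_False)
 then show "region m l y (d, i, \<tau>) = region m l x (d, i, \<tau>)" by (simp add: region_def R_def del: times_eq_iff)
 have "idx (R + 1) (shift R \<tau> y) = idx (R + 1) (shift R \<tau> x)" by (rule idx_mono_eq[of R]) (simp_all add: idx_shift e)
 moreover have "idx (R + 1) y = idx (R + 1) x" by (rule idx_mono_eq[OF _ e]) simp
 ultimately show "adm l y (d, i, \<tau>) \<longleftrightarrow> adm l x (d, i, \<tau>)" by (simp add: adm_def admissible_def R_def[symmetric] cell3_def)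
qed

text \<open>The \<open>V\<close>-th power of a mean over the large cell is an average of those over
  small cells. This raises a bound from the level of the region to that of the source
  average.\<close>

lemma pavg_level_up:
 fixes g :: "real ^ 'n => ennreal"
 assumes [measurable]: "g \<in> bor" and R: "R <= R'" and V: "0 < V" and le: "\<And>y. y \<in> cell R' x ==> pavg R V (cell R y) g <= S"
 shows "pavg R' V (cell R' x) g <= S"
proof -
 have "avg R' (cell R' x) (\<lambda>y. epowr (g y) V) = avg R' (cell R' x) (\<lambda>y. avg R (cell R y) (\<lambda>y. epowr (g y) V))"
 by (rule avg_avg_cell[symmetric]) (simp, rule cell_subset[OF R])
 also have "... <= avg R' (cell R' x) (\<lambda>_. epowr S V)"
 proof (rule avg_mono)
  fix y assume "y \<in> cell R' x"
  from epowr_mono[OF le[OF this], of V] show "avg R (cell R y) (\<lambda>y. epowr (g y) V) <= epowr S V" using V by (simp add: pavg_def epowr_epowr)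
 qed
 finally have "avg R' (cell R' x) (\<lambda>y. epowr (g y) V) <= epowr S V" by (simp add: avg_one_cell)
 from epowr_mono[OF this, of "1 / V"] show ?thesis using V by (simp add: pavg_def epowr_epowr)
qed

text \<open>For \<open>d <= -2\<close> the source octave begins after the target octave has ended,
  for \<open>d >= 2\<close> it ends before the target begins. Causality thus removes one of the two
  unbounded ranges of \<open>d\<close>, and with it the need for one of the bounds on
  \<beta>.\<close>

lemma causal_tile_zero:
 fixes f :: "real \<times> (real ^ 'n) => complex"
 assumes m: "0 < m" and f: "f \<in> Linf_c" and U: "borel_modulus (T (restr (region m l x (d, i, \<tau>)) f)) U"
  and d: "causal T \<and> d <= - 2 \<or> anticausal T \<and> 2 <= d"
 shows "tile m r (octave m l) l U y = 0"
proof (rule tile_zero)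
 define E where "E = octave m (l - d)"
 define X where "X = reg i (lev l d i) \<tau> x"
 have r: "region m l x (d, i, \<tau>) = E \<times> X" using d by (auto simp: region_def src_def E_def X_def)
 have ms: "E \<in> sets lebesgue" "X \<in> sets lebesgue" "E \<subseteq> {0<..}" by (auto simp: E_def X_def reg_def dest: octave_pos)
 have z: "AE z in lborel. z \<in> upper_half_space --> fst z \<in> octave m l --> T (restr (E \<times> X) f) z = 0"
  using d
 proof
  assume c: "causal T \<and> d <= - 2"
  then have "AE z in lebesgue_on upper_half_space. ereal (fst z) < (INF s\<in>E. ereal s) --> T (restr (E \<times> X) f) z = 0"
   using f ms by (simp add: causal_def)
  then have A: "AE z in lborel. z \<in> upper_half_space --> ereal (fst z) < (INF s\<in>E. ereal s) --> T (restr (E \<times> X) f) z = 0"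
  by (simp add: AE_lebesgue_on)
  have lt: "ereal t < (INF s\<in>E. ereal s)" if "t \<in> octave m l" for t
  proof -
   have "t < tscale m (l - d)" using that tscale_mono[of m "l + 1" "l - d"] c m by (auto simp: octave_def)
   then have "ereal t < ereal (tscale m (l - d))" by simp
   also have "... <= (INF s\<in>E. ereal s)" by (intro INF_greatest) (auto simp: E_def octave_def)
   finally show ?thesis .
  qed
  show ?thesis by (rule AE_mp[OF A]) (auto simp: lt)
 next
  assume c: "anticausal T \<and> 2 <= d"
  then have "AE z in lebesgue_on upper_half_space. ereal (fst z) > (SUP s\<in>E. ereal s) --> T (restr (E \<times> X) f) z = 0"
   using f ms by (simp add: anticausal_def)
  then have A: "AE z in lborel. z \<in> upper_half_space --> ereal (fst z) > (SUP s\<in>E. ereal s) --> T (restr (E \<times> X) f) z = 0"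
  by (simp add: AE_lebesgue_on)
  have lt: "(SUP s\<in>E. ereal s) < ereal t" if "t \<in> octave m l" for t
  proof -
   have "(SUP s\<in>E. ereal s) <= ereal (tscale m (l - d + 1))" by (intro SUP_least) (auto simp: E_def octave_def)
   also have "... < ereal t" using that tscale_strict_mono[of m "l - d + 1" l] c m by (auto simp: octave_def)
   finally show ?thesis .
  qed
  show ?thesis by (rule AE_mp[OF A]) (auto simp: lt)
 qed
 have "AE z in lborel. 0 < fst z --> ennreal (norm (T (restr (E \<times> X) f) z)) = U (fst z) (snd z)" using U by (simp add: borel_modulus_def r)
 with z show "AE z in lborel. fst z \<in> octave m l --> U (fst z) (snd z) = 0"
 proof eventually_elim
  case (elim z)
  show ?case
  proof
   assume "fst z \<in> octave m l"
   then have "0 < fst z" by (rule octave_pos)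
   moreover have "z \<in> upper_half_space" using \<open>0 < fst z\<close> by (cases z) (simp add: upper_half_space_def)
   ultimately show "U (fst z) (snd z) = 0" using elim \<open>fst z \<in> octave m l\<close> by simp
  qed
 qed
qed (use U in \<open>auto simp: borel_modulus_def\<close>)

lemma nn_integral_powr_int:
 assumes "0 < \<theta>"
 shows "(\<Sum>\<^sup>+n. ennreal (2 powr (- \<theta> * real n))) < top" "(\<Sum>\<^sup>+d. ennreal (2 powr (- \<theta> * \<bar>rl d\<bar>))) < top"
proof -
 have e: "2 powr (- \<theta> * real n) = (2 powr - \<theta>) ^ n" for n by (simp add: powr_realpow[symmetric] powr_powr)
 have "2 powr - \<theta> < 2 powr 0" using assms by (intro powr_less_mono) auto
 then have "summable (\<lambda>n. (2 powr - \<theta>) ^ n)" by (intro summable_geometric) simp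
 then show 1: "(\<Sum>\<^sup>+n. ennreal (2 powr (- \<theta> * real n))) < top"
  unfolding e nn_integral_count_space_nat by (subst suminf_ennreal2) auto
 let ?g = "\<lambda>d. ennreal (2 powr (- \<theta> * \<bar>rl d\<bar>))"
 have "(\<Sum>\<^sup>+d. ?g d) <= (\<Sum>\<^sup>+d. ?g d * indicator {0..} d + ?g d * indicator {..0} d)"
 by (intro nn_integral_mono) (auto split: split_indicator)
 also have "... = (\<Sum>\<^sup>+d\<in>{0..}. ?g d) + (\<Sum>\<^sup>+d\<in>{..0}. ?g d)"
 by (simp add: nn_integral_add nn_integral_count_space_indicator)
 also have "(\<Sum>\<^sup>+d\<in>{0..}. ?g d) = (\<Sum>\<^sup>+n. ?g (int n))"
 by (rule nn_integral_bij_count_space[symmetric]) (rule bij_betwI[where g=nat], auto)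
 also have "(\<Sum>\<^sup>+d\<in>{..0}. ?g d) = (\<Sum>\<^sup>+n. ?g (- int n))"
 by (rule nn_integral_bij_count_space[symmetric]) (rule bij_betwI[where g="\<lambda>d. nat (- d)"], auto)
 also have "(\<Sum>\<^sup>+n. ?g (int n)) + (\<Sum>\<^sup>+n. ?g (- int n)) < top" using 1 by simp
 finally show "(\<Sum>\<^sup>+d. ?g d) < top" .
qed

text \<open>Half of the exponential decay absorbs the linear factor; the other half is summed as a
  product of two geometric series, and \<open>\<tau>\<close> takes finitely many values.\<close>

lemma pieces_summable:
 assumes \<theta>: "0 < \<theta>"
 shows "(\<Sum>\<^sup>+j\<in>(pieces :: (int \<times> nat \<times> (int ^ 'n)) set). (1 + of_nat (nat (max 0 (- fst j)) + fst (snd j) + 1)) * ennreal (2 powr (C - \<theta> * (\<bar>rl (fst j)\<bar> + real (fst (snd j)))))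
) < top"
proof -
 let ?T = "{\<tau> :: int ^ 'n. \<forall>a. \<bar>\<tau> $ a\<bar> <= 3}"
 \<comment> \<open>Chosen to make \<open>exp (y * N) = 2 powr (\<theta> / 2 * N)\<close>, so that
   \<open>1 + y * N\<close> is compared with half of the decay.\<close>
 define y where "y = \<theta> / 2 * ln 2"
 have y: "0 < y" using \<theta> by (simp add: y_def)
 define A where "A = (3 + 1 / y) * 2 powr C"
 have A: "0 <= A" using y by (simp add: A_def)
 define g where "g j = ennreal A * (ennreal (2 powr (- (\<theta> / 2) * \<bar>rl (fst j)\<bar>)) * ennreal (2 powr (- (\<theta> / 2) * real (fst (snd j)))))" for j :: "int \<times> nat \<times> (int ^ 'n)"
 have le: "(1 + of_nat (nat (max 0 (- d)) + i + 1)) * ennreal (2 powr (C - \<theta> * (\<bar>rl d\<bar> + real i))) <= g (d, i, \<tau>)" for d i \<tau>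
 proof -
  define N where "N = \<bar>rl d\<bar> + real i"
  have "1 + y * N <= exp (y * N)" by (rule exp_ge_add_one_self)
  also have "... = 2 powr (\<theta> / 2 * N)" by (simp add: powr_def y_def mult_ac)
  finally have "(3 + 1 / y) * (1 + y * N) <= (3 + 1 / y) * 2 powr (\<theta> / 2 * N)" using y by (intro mult_left_mono) auto
  moreover have "(3 + 1 / y) * (1 + y * N) = 3 + N + 1 / y + 3 * y * N" using y by (simp add: algebra_simps)
  moreover have "0 <= 1 / y" "0 <= 3 * y * N" using y by (auto simp: N_def)
  ultimately have "3 + N <= (3 + 1 / y) * 2 powr (\<theta> / 2 * N)" by linarith
  then have "(3 + N) * 2 powr (C - \<theta> * N) <= (3 + 1 / y) * 2 powr (\<theta> / 2 * N) * 2 powr (C - \<theta> * N)" by (rule mult_right_mono) simp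
  also have "... = A * (2 powr (- (\<theta> / 2) * \<bar>rl d\<bar>) * 2 powr (- (\<theta> / 2) * real i))"
   unfolding A_def mult.assoc powr_add[symmetric] by (simp add: N_def algebra_simps)
  finally have 1: "(3 + N) * 2 powr (C - \<theta> * N) <= A * (2 powr (- (\<theta> / 2) * \<bar>rl d\<bar>) * 2 powr (- (\<theta> / 2) * real i))" .
  have s: "1 + real (nat (max 0 (- d)) + i + 1) <= 3 + N" by (auto simp: N_def max_def)
  have "(1 + of_nat (nat (max 0 (- d)) + i + 1)) * ennreal (2 powr (C - \<theta> * N)) = ennreal ((1 + real (nat (max 0 (- d)) + i + 1)) * 2 powr (C - \<theta> * N))"
  by (simp only: ennreal_mult ennreal_of_nat_eq_real_of_nat ennreal_plus ennreal_1 of_nat_0_le_iff add_nonneg_nonneg zero_le_one powr_ge_zero)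
  also have "... <= ennreal (A * (2 powr (- (\<theta> / 2) * \<bar>rl d\<bar>) * 2 powr (- (\<theta> / 2) * real i)))"
  by (intro ennreal_leI order_trans[OF mult_right_mono[OF s] 1]) simp
  also have "... = g (d, i, \<tau>)" using A by (simp add: g_def ennreal_mult)
  finally show ?thesis by (simp add: N_def)
 qed
 have ind: "(\<Sum>\<^sup>+j\<in>X. h j) = (\<Sum>\<^sup>+j. h j * indicator X j)" for h and X :: "(int \<times> nat \<times> (int ^ 'n)) set"
 by (rule nn_integral_count_space_indicator[unfolded NO_MATCH_def, OF TrueI])
 have cT: "countable ?T" by (rule countable_finite[OF finite_bounded_int_vec])
 have "(\<Sum>\<^sup>+j\<in>(pieces :: (int \<times> nat \<times> (int ^ 'n)) set). (1 + of_nat (nat (max 0 (- fst j)) + fst (snd j) + 1)) * ennreal (2 powr (C - \<theta> * (\<bar>rl (fst j)\<bar> + real (fst (snd j))))))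
   <= (\<Sum>\<^sup>+j\<in>(UNIV \<times> UNIV \<times> ?T). g j)"
  unfolding ind[where X=pieces] ind[where X="UNIV \<times> UNIV \<times> ?T"]
 proof (rule nn_integral_mono)
  fix j :: "int \<times> nat \<times> (int ^ 'n)"
  obtain d i \<tau> where j: "j = (d, i, \<tau>)" by (cases j)
  show "(1 + of_nat (nat (max 0 (- fst j)) + fst (snd j) + 1)) * ennreal (2 powr (C - \<theta> * (\<bar>rl (fst j)\<bar> + real (fst (snd j))))) * indicator pieces j
   <= g j * indicator (UNIV \<times> UNIV \<times> ?T) j"
   using le[of d i \<tau>] unfolding j by (intro mult_mono) (auto simp: pieces_def split: split_indicator)
 qed
 also have "... = (\<Sum>\<^sup>+d. (\<Sum>\<^sup>+z\<in>(UNIV \<times> ?T). g (d, z)))"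
  using nn_integral_count_space_times[of UNIV "UNIV \<times> ?T" "\<lambda>d z. g (d, z)"] cT by simp
 also have "... = (\<Sum>\<^sup>+d. (\<Sum>\<^sup>+i. (\<Sum>\<^sup>+\<tau>\<in>?T. g (d, i, \<tau>))))"
  using nn_integral_count_space_times[of UNIV ?T "\<lambda>i \<tau>. g (d, i, \<tau>)" for d] cT by simp
 also have "... = ennreal A * ((\<Sum>\<^sup>+d. ennreal (2 powr (- (\<theta> / 2) * \<bar>rl d\<bar>))) * ((\<Sum>\<^sup>+i. ennreal (2 powr (- (\<theta> / 2) * real i))) * of_nat (card ?T)))"
  unfolding g_def by (simp add: nn_integral_count_space_finite[OF finite_bounded_int_vec] nn_integral_cmult nn_integral_multc emeasure_count_space_finite[OF subset_refl finite_bounded_int_vec] mult_ac)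
 also have "... < top" using nn_integral_powr_int[of "\<theta> / 2"] \<theta> by (intro ennreal_mult_less_top[THEN iffD2] disjI2 conjI) (auto simp: ennreal_mult_less_top of_nat_less_top)
 finally show ?thesis .
qed

section \<open>Summation of the pieces\<close>

text \<open>The finite family into which \<open>f\<close> splits depends on \<open>f\<close> and
  \<open>x\<close>. Enlarging it to all of \<open>pieces\<close>, with \<open>0\<close> for
  inadmissible ones, gives an index set common to all targets.\<close>

lemma tile_decomposition:
 fixes f :: "real \<times> (real ^ 'n) => complex"
 assumes m: "0 < m" and r: "1 <= r" and T: "subadditive_op T" and f: "f \<in> Linf_c" and \<Phi>: "borel_modulus (T f) \<Phi>"
  and U: "\<And>j. borel_modulus (T (restr (region m l x j) f)) (U j)"
 shows "tile m r (octave m l) l \<Phi> x <= (\<Sum>\<^sup>+j\<in>pieces. (if adm l x j then tile m r (octave m l) l (U j) x else 0))"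
proof -
 obtain F where F: "finite F" "F \<noteq> {}" "\<forall>j\<in>F. j \<in> pieces \<and> adm l x j" and fF: "\<And>z. f z = (\<Sum>j\<in>F. restr (region m l x j) f z)"
  using region_decomposition[OF m f, of l x] by blast
 have "AE z in lebesgue_on upper_half_space. norm (T (\<lambda>w. \<Sum>j\<in>F. restr (region m l x j) f w) z) <= (\<Sum>j\<in>F. norm (T (restr (region m l x j) f) z))"
  using subadditive_op_sum[OF T F(1,2), of "\<lambda>j. restr (region m l x j) f"] Linf_c_restr[OF f] by simp
 then have "AE z in lborel. z \<in> upper_half_space --> norm (T f z) <= (\<Sum>j\<in>F. norm (T (restr (region m l x j) f) z))"
  unfolding fF[symmetric] by (simp add: AE_lebesgue_on)
 moreover have "AE z in lborel. \<forall>j\<in>F. 0 < fst z --> ennreal (norm (T (restr (region m l x j) f) z)) = U j (fst z) (snd z)"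
  using U F(1) by (intro AE_finite_allI) (auto simp: borel_modulus_def)
 moreover have "AE z in lborel. 0 < fst z --> ennreal (norm (T f z)) = \<Phi> (fst z) (snd z)" using \<Phi> by (simp add: borel_modulus_def)
 ultimately have le: "AE z in lborel. fst z \<in> octave m l --> \<Phi> (fst z) (snd z) <= (\<Sum>j\<in>F. U j (fst z) (snd z))"
 proof eventually_elim
  case (elim z)
  show ?case
  proof
   assume "fst z \<in> octave m l"
   then have z: "0 < fst z" by (rule octave_pos)
   then have "z \<in> upper_half_space" by (cases z) (simp add: upper_half_space_def)
   then have "\<Phi> (fst z) (snd z) <= ennreal (\<Sum>j\<in>F. norm (T (restr (region m l x j) f) z))" using elim z by (metis ennreal_leI)
   also have "... = (\<Sum>j\<in>F. U j (fst z) (snd z))" using elim z by (subst sum_ennreal[symmetric]) (auto intro!: sum.cong)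
   finally show "\<Phi> (fst z) (snd z) <= (\<Sum>j\<in>F. U j (fst z) (snd z))" .
  qed
 qed
 have "tile m r (octave m l) l \<Phi> x <= (\<Sum>j\<in>F. tile m r (octave m l) l (U j) x)"
  using \<Phi> U by (intro tile_sum_le F(1) r le) (auto simp: borel_modulus_def)
 also have "... = (\<Sum>\<^sup>+j\<in>F. (if adm l x j then tile m r (octave m l) l (U j) x else 0))"
  using F by (simp add: nn_integral_count_space_finite)
 also have "... <= (\<Sum>\<^sup>+j\<in>pieces. (if adm l x j then tile m r (octave m l) l (U j) x else 0))"
 proof -
  have ind: "(\<Sum>\<^sup>+j\<in>X. h j) = (\<Sum>\<^sup>+j. h j * indicator X j)" for h and X :: "(int \<times> nat \<times> (int ^ 'n)) set"
  by (rule nn_integral_count_space_indicator[unfolded NO_MATCH_def, OF TrueI])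
  show ?thesis unfolding ind[where X=F] ind[where X=pieces] using F by (intro nn_integral_mono) (auto split: split_indicator)
 qed
 finally show ?thesis .
qed

lemma countable_pieces: "countable (pieces :: (int \<times> nat \<times> (int ^ 'n)) set)"
proof (rule countable_subset)
 show "pieces \<subseteq> UNIV \<times> UNIV \<times> {\<tau> :: int ^ 'n. \<forall>a. \<bar>\<tau> $ a\<bar> <= 3}" by (auto simp: pieces_def)
qed (auto intro!: countable_SIGMA countable_finite[OF finite_bounded_int_vec])

text \<open>The exponents of \<open>piece_estimate\<close> are combined with the weights of source
  and target octave. Relative to the source weight, the exponent is at most
  \<open>B - \<epsilon> (|d| + i)\<close> for every piece that does not vanish, and such
  coefficients are summable as \<open>dnorm_pieces\<close> demands.\<close>

theorem operator_dnorm_bound: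
 fixes T :: "(real \<times> (real ^ 'n) => complex) => (real \<times> (real ^ 'n) => complex)"
 assumes c: "0 < c" "c <= 1 / (16 * sqrt (real CARD('n)))" and m: "1 <= m"
  and T: "singular_operator c \<kappa> m (ennreal r) (ennreal a) (ennreal b) vt vx M T"
  and a: "1 <= a" "a <= r" and b: "1 <= b" "b <= r" and vt: "ennreal r <= vt" and v1: "r <= v1" "ennreal v1 <= vx"
  and p: "0 < p" and q: "0 < q" and u: "0 < u" "u <= b" "ennreal u < p" "ennreal u < q"
  and V: "p < \<infinity> \<and> q < \<infinity> --> v1 <= V \<and> p < ennreal V \<and> q < ennreal V"
 defines "iq \<equiv> enn2real (inverse q)" and "it \<equiv> enn2real (inverse vt)" and "cs \<equiv> real CARD('n) * (1 / u - 1 / b)"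
  and "ct \<equiv> real CARD('n) * (1 / v1 - (if p < \<infinity> \<and> q < \<infinity> then 1 / V else 0))"
 assumes D1: "anticausal T \<or> cs < m * (\<beta> + 1 / a - iq)" and D2: "causal T \<or> ct < m * (iq - it - \<kappa> - \<beta>)"
  and G: "cs + ct < m * (M + 1 / a - it - \<kappa>)"
 shows "\<exists>K::real. 0 <= K \<and> (\<forall>f\<in>Linf_c. \<forall>\<phi> \<Phi>. borel_modulus f \<phi> --> borel_modulus (T f) \<Phi> -->
   dnorm p q (\<lambda>k x. weight m q (\<beta> + \<kappa>) k * tile m r (octave m k) k \<Phi> x) <= ennreal K * dnorm p q (\<lambda>k x. weight m q \<beta> k * tile m r (wide m k) k \<phi> x))"
proof -
 define fin where "fin \<longleftrightarrow> p < \<infinity> \<and> q < \<infinity>"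
 have m0: "0 < m" "0 < r" "0 < v1" using m a v1 by auto
 have V': "fin --> v1 <= V" and V0: "fin ==> 0 < V" using V m0 by (auto simp: fin_def)
 \<comment> \<open>The value \<open>1\<close> is a placeholder for the case in which the lower
   condition fails: then \<open>T\<close> is anticausal and the pieces with \<open>d >= 2\<close>
   vanish. \<open>\<epsilon>2\<close> plays the same role for causal operators and
   \<open>d <= -2\<close>.\<close>
 define \<epsilon>1 where "\<epsilon>1 = (if cs < m * (\<beta> + 1 / a - iq) then m * (\<beta> + 1 / a - iq) - cs else 1)"
 define \<epsilon>2 where "\<epsilon>2 = (if ct < m * (iq - it - \<kappa> - \<beta>) then m * (iq - it - \<kappa> - \<beta>) - ct else 1)"
 define \<epsilon> where "\<epsilon> = min (min \<epsilon>1 \<epsilon>2) (m * (M + 1 / a - it - \<kappa>) - cs - ct)"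
 have \<epsilon>: "0 < \<epsilon>" "\<epsilon> <= \<epsilon>1" "\<epsilon> <= \<epsilon>2" "\<epsilon> <= m * (M + 1 / a - it - \<kappa>) - cs - ct" using G by (auto simp: \<epsilon>_def \<epsilon>1_def \<epsilon>2_def)
 have ctf: "ct = real CARD('n) * (1 / v1 - (if fin then 1 / V else 0))" by (simp add: ct_def fin_def)
 from piece_estimate[OF c m T a b vt v1 u(1,2) V'] show ?thesis
 proof (elim exE, goal_cases)
 case (1 B)
 note est = 1[folded it_def cs_def, folded ctf]
 define e where "e j = 2 powr (B - \<epsilon> * (\<bar>rl (fst j)\<bar> + real (fst (snd j))))" for j :: "int \<times> nat \<times> (int ^ 'n)"
 \<comment> \<open>Makes \<open>l + int (s j)\<close> the level \<open>h + i + 1\<close> of the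
   source average; \<open>max 0 (- d)\<close> accounts for sources in later, hence coarser,
   octaves.\<close>
 define s where "s j = nat (max 0 (- fst j)) + fst (snd j) + 1" for j :: "int \<times> nat \<times> (int ^ 'n)"
 have "\<exists>K::real. 0 <= K \<and> (\<forall>A b' (bb :: int => int \<times> nat \<times> (int ^ 'n) => real ^ 'n => ennreal).
   (\<forall>k. A k \<in> bor) --> (\<forall>k. b' k \<in> bor) --> (\<forall>l. \<forall>j\<in>pieces. bb l j \<in> bor) -->
   (\<forall>l x. b' l x <= (\<Sum>\<^sup>+j\<in>pieces. bb l j x)) -->
   (\<forall>l. \<forall>j\<in>pieces. piece_bound p q V u (l + int (s j)) (e j) (bb l j) (A (l - fst j))) -->
   dnorm p q b' <= ennreal K * dnorm p q A)" (is "\<exists>K. _ \<and> ?P K")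
 proof (rule dnorm_pieces[OF p q u(1,3,4)])
  show "(\<Sum>\<^sup>+j\<in>pieces. (1 + of_nat (s j)) * ennreal (e j powr \<eta>)) < top" if "0 < \<eta>" for \<eta>
  proof -
   have "e j powr \<eta> = 2 powr (B * \<eta> - \<epsilon> * \<eta> * (\<bar>rl (fst j)\<bar> + real (fst (snd j))))" for j by (simp add: e_def powr_powr algebra_simps)
   then show ?thesis unfolding s_def using pieces_summable[of "\<epsilon> * \<eta>" "B * \<eta>"] \<epsilon> that by simp
  qed
 qed (use V countable_pieces in \<open>auto simp: e_def s_def\<close>)
 then obtain K where K: "0 <= K" and main: "?P K" by (elim exE conjE)
 show ?case
 proof (intro exI[of _ K] conjI K ballI allI impI)
  fix f :: "real \<times> (real ^ 'n) => complex" and \<phi> \<Phi>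
  assume f: "f \<in> Linf_c" and \<phi>: "borel_modulus f \<phi>" and \<Phi>: "borel_modulus (T f) \<Phi>"
  have sub: "subadditive_op T" using T by (simp add: singular_operator_def)
  \<comment> \<open>The choice depends on \<open>x\<close> only through the region, so by
    \<open>region_cell\<close> the same modulus is chosen at all points of a cell. This is what
    makes \<open>t\<close> below constant on cells.\<close>
  define UU where "UU l x j = (SOME U. borel_modulus (T (restr (region m l x j) f)) U)" for l x j
  have UU: "borel_modulus (T (restr (region m l x j) f)) (UU l x j)" for l x j
   unfolding UU_def using sub Linf_c_restr[OF f sets_region] by (intro someI_ex[OF borel_modulus_ex]) (auto simp: subadditive_op_def)
  define t where "t l x j = (if adm l x j then tile m r (octave m l) l (UU l x j) x else 0)" for l x j
  define w where "w = weight m q (\<beta> + \<kappa>)"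
  have cell_t: "t l y (d, i, \<tau>) = (if adm l x (d, i, \<tau>) then tile m r (octave m l) l (UU l x (d, i, \<tau>)) y else 0)" if "y \<in> cell (lev l d i) x" for l x y d i \<tau>
   using region_cell(1)[OF that, where m=m and \<tau>=\<tau>] region_cell(2)[OF that, where \<tau>=\<tau>] by (simp add: t_def UU_def)
  have mt: "(\<lambda>x. t l x j) \<in> bor" for l j
  proof (rule cellwise_measurable[of "l + 1"])
   obtain d i \<tau> where j: "j = (d, i, \<tau>)" by (cases j)
   have "cell (l + 1) x \<subseteq> cell (lev l d i) x" for x :: "real ^ 'n" by (rule cell_mono) (auto simp: lev_def)
   then have c: "t l y j = (if adm l x j then tile m r (octave m l) l (UU l x j) y else 0)" if "y \<in> cell (l + 1) x" for x y
    unfolding j using that by (intro cell_t) auto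
   show "cellwise (l + 1) (\<lambda>x. t l x j)"
    unfolding cellwise_def
   proof (intro allI impI)
    fix x y :: "real ^ 'n" assume y: "y \<in> cell (l + 1) x"
    show "t l y j = t l x j"
     using c[OF y] c[OF cell_self[of x]] cellwise_tile[of l m r "octave m l" "UU l x j", unfolded cellwise_def, rule_format, OF y] by simp
   qed
  qed
  note [measurable] = mt
  show "dnorm p q (\<lambda>k x. weight m q (\<beta> + \<kappa>) k * tile m r (octave m k) k \<Phi> x) <= ennreal K * dnorm p q (\<lambda>k x. weight m q \<beta> k * tile m r (wide m k) k \<phi> x)"
  proof (rule main[rule_format, where bb="\<lambda>l j x. w l * t l x j"])
   fix l x
   have "tile m r (octave m l) l \<Phi> x <= (\<Sum>\<^sup>+j\<in>pieces. t l x j)"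
    unfolding t_def using a m0 by (intro tile_decomposition[where T=T and f=f] sub f \<Phi> UU) auto
   then show "weight m q (\<beta> + \<kappa>) l * tile m r (octave m l) l \<Phi> x <= (\<Sum>\<^sup>+j\<in>pieces. w l * t l x j)"
    unfolding w_def[symmetric] by (subst nn_integral_cmult) (auto intro: mult_left_mono)
  next
   fix l and j :: "int \<times> nat \<times> (int ^ 'n)" assume j': "j \<in> pieces"
   obtain d i \<tau> where j: "j = (d, i, \<tau>)" by (cases j)
   define k where "k = l - d"
   define h where "h = max l k"
   define R where "R = lev l d i"
   define R' where "R' = h + int i + 1"
   have R': "l + int (s j) = R'" "R <= R'" by (auto simp: s_def j R'_def h_def k_def R_def lev_def)
   define g where "g = tile m r (wide m k) k \<phi>"
   have [measurable]: "g \<in> bor" by (simp add: g_def)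
   let ?A = "\<lambda>y. ennreal (e j) * pavg R' u (cell3 R' y) (\<lambda>z. weight m q \<beta> k * g z)"
   have bound: "(if fin then pavg R V (cell R y) (\<lambda>z. w l * t l z j) else w l * t l y j) <= ?A y" for y
   proof -
    define \<psi> where "\<psi> = tile m r (octave m l) l (UU l y j)"
    have [measurable]: "\<psi> \<in> bor" by (simp add: \<psi>_def)
    have "pavg R V (cell R y) (\<lambda>z. w l * t l z j) = pavg R V (cell R y) (\<lambda>z. w l * (if adm l y j then \<psi> z else 0))"
     unfolding pavg_def \<psi>_def using cell_t[of _ l d i y \<tau>] by (intro arg_cong[where f="\<lambda>y. epowr y (1 / V)"] avg_cong) (simp add: j R_def)
    also have "... = w l * pavg R V (cell R y) (\<lambda>z. if adm l y j then \<psi> z else 0)" if fin using V0[OF that] by (intro pavg_cmult) auto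
    finally have e1: "(if fin then pavg R V (cell R y) (\<lambda>z. w l * t l z j) else w l * t l y j)
      = w l * (if fin then pavg R V (cell R y) (\<lambda>z. if adm l y j then \<psi> z else 0) else if adm l y j then \<psi> y else 0)"
    by (simp add: t_def \<psi>_def)
    have z0: "pavg R V (cell R y) (\<lambda>_. 0) = 0" by (simp add: pavg_def avg_def)
    have e2: "?A y = ennreal (e j) * (weight m q \<beta> k * pavg R' u (cell3 R' y) g)" using u by (subst pavg_cmult) auto
    show ?thesis
    proof (cases "adm l y j \<and> \<not> (causal T \<and> d <= - 2 \<or> anticausal T \<and> 2 <= d)")
     case False
     have "\<psi> z = 0" if "adm l y j" for z unfolding \<psi>_def using False that UU[of l y j] m0 f by (intro causal_tile_zero[where T=T and f=f]) (auto simp: j)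
     then have "(\<lambda>z. if adm l y j then \<psi> z else 0) = (\<lambda>_. 0)" by auto
     then show ?thesis unfolding e1 by (auto simp: z0 dest: fun_cong[where x=y])
    next
     case True
     have kh: "h = max l (l - d)" by (simp add: h_def k_def)
     let ?E = "B + m * \<kappa> * rl h - m * (rl h - rl k) / a + m * (rl h - rl l) * it
      + (rl h - rl k) * cs + (rl h - rl l) * ct - real i * (m * (M + 1 / a - it - \<kappa>) - cs - ct)"
     have "(if fin then pavg R V (cell R y) \<psi> else \<psi> y) <= ennreal (2 powr ?E) * pavg R' u (cell3 R' y) g"
      unfolding \<psi>_def g_def R'_def k_def
      using True j' by (intro est[rule_format, OF f \<phi> _ R_def kh]) (use UU[of l y j] in \<open>auto simp: j R_def adm_def region_def\<close>)
     then have "(if fin then pavg R V (cell R y) (\<lambda>z. w l * t l z j) else w l * t l y j) <= w l * (ennreal (2 powr ?E) * pavg R' u (cell3 R' y) g)"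
      unfolding e1 using True by (intro mult_left_mono) auto
     also have "... = ennreal (2 powr (m * rl l * (iq - (\<beta> + \<kappa>)) + ?E)) * pavg R' u (cell3 R' y) g"
     by (simp add: w_def weight_def iq_def ennreal_powr_mult)
     also have "... <= ennreal (2 powr (B - \<epsilon> * (\<bar>rl d\<bar> + real i) + m * rl k * (iq - \<beta>))) * pavg R' u (cell3 R' y) g"
     proof (intro mult_right_mono ennreal_leI powr_mono)
      have i: "real i * \<epsilon> <= real i * (m * (M + 1 / a - it - \<kappa>) - cs - ct)" using \<epsilon> by (intro mult_left_mono) auto
      have "\<bar>d\<bar> \<noteq> 1" using j' j by (auto simp: pieces_def)
      \<comment> \<open>For \<open>d = 0\<close> no gain in time is required. For
        \<open>d >= 2\<close> one has \<open>h = l\<close> and the slope in \<open>d\<close> is the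
        slack of the lower bound; for \<open>d <= -2\<close> one has \<open>h = k\<close> and it is
        the slack of the upper bound.\<close>
      then consider "d = 0" | "2 <= d" | "d <= - 2" by linarith
      then show "m * rl l * (iq - (\<beta> + \<kappa>)) + ?E <= B - \<epsilon> * (\<bar>rl d\<bar> + real i) + m * rl k * (iq - \<beta>)"
      proof cases
       case 1
       then show ?thesis using i by (simp add: h_def k_def algebra_simps)
      next
       case 2
       then have "\<epsilon> <= m * (\<beta> + 1 / a - iq) - cs" using True D1 \<epsilon> by (auto simp: \<epsilon>1_def)
       then have "rl d * \<epsilon> <= rl d * (m * (\<beta> + 1 / a - iq) - cs)" using 2 by (intro mult_left_mono) auto
       then show ?thesis using i 2 by (simp add: h_def k_def algebra_simps add_divide_distrib diff_divide_distrib)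
      next
       case 3
       then have "\<epsilon> <= m * (iq - it - \<kappa> - \<beta>) - ct" using True D2 \<epsilon> by (auto simp: \<epsilon>2_def)
       then have "- rl d * \<epsilon> <= - rl d * (m * (iq - it - \<kappa> - \<beta>) - ct)" using 3 by (intro mult_left_mono) auto
       then show ?thesis using i 3 by (simp add: h_def k_def algebra_simps add_divide_distrib diff_divide_distrib)
      qed
     qed auto
     also have "... = ?A y" unfolding e2 by (simp add: e_def j weight_def iq_def ennreal_powr_mult)
     finally show ?thesis .
    qed
   qed
   show "piece_bound p q V u (l + int (s j)) (e j) (\<lambda>x. w l * t l x j) (\<lambda>x. weight m q \<beta> (l - fst j) * tile m r (wide m (l - fst j)) (l - fst j) \<phi> x)"
    unfolding piece_bound_def R'(1) fin_def[symmetric]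
   proof
    fix x
    \<comment> \<open>The estimate is known at the level \<open>R\<close> of the region and is
      raised to the level \<open>R'\<close> of the source average, as \<open>piece_bound\<close>
      uses one level for both sides.\<close>
    have "pavg R' V (cell R' x) (\<lambda>z. w l * t l z j) <= ?A x" if fin
    proof (rule pavg_level_up[OF _ R'(2) V0[OF that]])
     fix y assume "y \<in> cell R' x"
     then show "pavg R V (cell R y) (\<lambda>z. w l * t l z j) <= ?A x" using bound[of y] that by (simp add: cell3_eq)
    qed measurable
    then show "(if fin then pavg R' V (cell R' x) (\<lambda>z. w l * t l z j) else w l * t l x j)
      <= ennreal (e j) * pavg R' u (cell3 R' x) (\<lambda>x. weight m q \<beta> (l - fst j) * tile m r (wide m (l - fst j)) (l - fst j) \<phi> x)"
     using bound[of x] by (auto simp: g_def k_def j)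
   qed
  qed measurable
 qed
qed
qed

section \<open>Choice of the averaging exponents\<close>

lemma source_exponent_ex:
 assumes "0 < p" "0 < q" "1 <= b" "0 < \<sigma>"
 shows "\<exists>u>0. u <= b \<and> ennreal u < p \<and> ennreal u < q \<and> 1 / u - 1 / b = brk (min p (min q (ennreal b))) (ennreal b) + \<sigma>"
proof -
 have "min p (min q (ennreal b)) < top" by (simp add: min_less_iff_disj)
 then obtain w where w: "min p (min q (ennreal b)) = ennreal w" "0 <= w" by (cases "min p (min q (ennreal b))") auto
 have "0 < ennreal w" using assms unfolding w(1)[symmetric] by simp
 then have w0: "0 < w" by simp
 \<comment> \<open>The reciprocal of \<open>u\<close> exceeds that of the minimum \<open>w\<close>
   by exactly \<open>\<sigma>\<close>, which puts \<open>u\<close> strictly below \<open>p\<close>,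
   \<open>q\<close> and \<open>b\<close>.\<close>
 define u where "u = 1 / (1 / w + \<sigma>)"
 have "1 / w < 1 / w + \<sigma>" using assms by simp
 then have u: "0 < u" "u < w" using w0 assms by (auto simp: u_def divide_less_eq field_simps add_pos_pos)
 then have "ennreal u < min p (min q (ennreal b))" unfolding w by (simp add: ennreal_less_iff)
 then have "ennreal u < p" "ennreal u < q" "u <= b" using u by (simp_all add: ennreal_less_iff)
 moreover have "enn2real (inverse (ennreal w)) = 1 / w" "enn2real (inverse (ennreal b)) = 1 / b" using w0 assms by (simp_all add: inverse_ennreal inverse_eq_divide)
 moreover have "1 / u = 1 / w + \<sigma>" by (simp add: u_def)
 ultimately show ?thesis using u unfolding brk_def w(1) by (intro exI[of _ u]) simp
qed

text \<open>For finite \<open>vx\<close> take \<open>v1 = vx\<close> and, if \<open>p\<close> and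
  \<open>q\<close> are finite, let \<open>V\<close> exceed the maximum by at most
  \<open>\<sigma>\<close> in terms of reciprocals. For infinite \<open>vx\<close> one large finite
  number serves as \<open>v1\<close> and \<open>V\<close>; its reciprocal is at most
  \<open>\<sigma>\<close>, so the loss is no larger.\<close>

lemma target_exponents_ex:
 assumes r: "1 <= r" "ennreal r <= vx" and \<sigma>: "0 < \<sigma>"
 shows "\<exists>v1 V. r <= v1 \<and> ennreal v1 <= vx \<and> (p < \<infinity> \<and> q < \<infinity> --> v1 <= V \<and> p < ennreal V \<and> q < ennreal V) \<and>
   1 / v1 - (if p < \<infinity> \<and> q < \<infinity> then 1 / V else 0) <= brk vx (max p (max q vx)) + \<sigma>"
proof (cases vx)
 case (real v)
 then have v: "r <= v" "0 < v" using r by (auto simp: ennreal_le_iff2)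
 have iv: "enn2real (inverse vx) = 1 / v" using v real by (simp add: inverse_ennreal inverse_eq_divide)
 show ?thesis
 proof (cases "p < \<infinity> \<and> q < \<infinity>")
  case True
  then obtain w where w: "max p (max q vx) = ennreal w" "0 <= w" using real by (cases "max p (max q vx)") (auto simp: max_def split: if_splits)
  have "ennreal v <= ennreal w" unfolding w(1)[symmetric] real by (simp add: le_max_iff_disj)
  then have w0: "0 < w" "v <= w" using v w by (auto simp: ennreal_le_iff)
  \<comment> \<open>The bound \<open>1 / (2 * w)\<close> keeps \<open>1 / w - \<rho>\<close>
    positive, so that \<open>V\<close> is a positive number.\<close>
  define \<rho> where "\<rho> = min \<sigma> (1 / (2 * w))"
  have \<rho>: "0 < \<rho>" "\<rho> < 1 / w" "\<rho> <= \<sigma>" using \<sigma> w0 by (auto simp: \<rho>_def min_less_iff_disj field_simps)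
  define V where "V = 1 / (1 / w - \<rho>)"
  have "0 < 1 / w - \<rho>" "(1 / w - \<rho>) * w < 1" using \<rho> w0 by (auto simp: field_simps)
  then have V: "w < V" by (simp add: V_def pos_less_divide_eq mult.commute)
  then have "max p (max q vx) < ennreal V" unfolding w using w by (simp add: ennreal_less_iff)
  moreover have "brk vx (max p (max q vx)) = 1 / v - 1 / w" unfolding brk_def iv w(1) using w0 by (simp add: inverse_ennreal inverse_eq_divide)
  moreover have "1 / V = 1 / w - \<rho>" by (simp add: V_def)
  moreover have "ennreal v <= vx" by (simp add: real)
  ultimately have "r <= v \<and> ennreal v <= vx \<and> (p < \<infinity> \<and> q < \<infinity> --> v <= V \<and> p < ennreal V \<and> q < ennreal V) \<and>
    1 / v - (if p < \<infinity> \<and> q < \<infinity> then 1 / V else 0) <= brk vx (max p (max q vx)) + \<sigma>" using True V v w0 \<rho> by simp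
  then show ?thesis by blast
 next
  case False
  then have "max p (max q vx) = top" by (auto simp: max_def not_less top_unique)
  then have "brk vx (max p (max q vx)) = 1 / v" by (simp add: brk_def iv)
  moreover have "ennreal v <= vx" by (simp add: real)
  ultimately show ?thesis using False v \<sigma> by (intro exI[of _ v]) auto
 qed
next
 case top
 then have W: "max p (max q vx) = \<infinity>" "vx = \<infinity>" by (auto simp: max_def top_unique)
 define v where "v = max (max r (1 / \<sigma>)) (max (enn2real p) (enn2real q) + 1)"
 have v: "r <= v" "1 / \<sigma> <= v" "0 < v" using r by (auto simp: v_def)
 have less: "s < ennreal v" if "enn2real s + 1 <= v" "s < \<infinity>" for s
 proof -
  have "s = ennreal (enn2real s)" using that(2) by simp
  also have "... < ennreal v" using that(1) by (subst ennreal_less_iff) auto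
  finally show ?thesis .
 qed
 have "p < \<infinity> \<and> q < \<infinity> ==> p < ennreal v \<and> q < ennreal v" using less[of p] less[of q] by (auto simp: v_def)
 moreover have "1 / v <= \<sigma>" using v \<sigma> by (simp add: field_simps)
 ultimately show ?thesis using v \<sigma> by (intro exI[of _ v]) (auto simp: brk_def W)
qed

theorem theorem4p11:
  fixes T :: "(real \<times> (real ^ 'n) \<Rightarrow> complex) \<Rightarrow> (real \<times> (real ^ 'n) \<Rightarrow> complex)"
    and c m \<kappa> M \<beta> :: real
    and r ut ux vt vx p q :: ennreal
  assumes c: "0 < c" "c < 1" "c \<le> 1 / (16 * sqrt (real CARD('n)))"
    and m: "1 \<le> m"
    and r: "1 < r" "r < \<infinity>"
    and u: "1 \<le> ut" "ut < \<infinity>" "1 \<le> ux" "ux < \<infinity>"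
    and v: "1 < vt" "1 < vx"
    and urv: "max ut ux \<le> r" "r \<le> min vt vx"
    and T: "singular_operator c \<kappa> m r ut ux vt vx M T"
    and pq: "0 < p" "0 < q"
    and decay: "M > - brk ut vt + real CARD('n) / m * brk (min p (min q ux)) ux
                  + real CARD('n) / m * brk vx (max p (max q vx)) + \<kappa>"
    and lower: "anticausal T \<or>
                \<beta> > - brk ut q + real CARD('n) / m * brk (min p (min q ux)) ux"
    and upper: "causal T \<or>
                \<beta> < brk q vt - real CARD('n) / m * brk vx (max p (max q vx)) - \<kappa>"
  shows "\<exists>C::real. C \<ge> 0 \<and>
           (\<forall>f \<in> Linf_c. tent_norm m p q r (\<beta> + \<kappa>) (T f) \<le> ennreal C * tent_norm m p q r \<beta> f)"
proof -
 obtain r' a b where re: "r = ennreal r'" "ut = ennreal a" "ux = ennreal b" and n0: "0 <= r'" "0 <= a" "0 <= b"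
  using r u by (cases r; cases ut; cases ux) auto
 have ab: "1 <= a" "a <= r'" "1 <= b" "b <= r'" "1 <= r'" using r u urv n0 by (auto simp: re ennreal_le_iff simp flip: ennreal_1)
 let ?n = "real CARD('n)" and ?it = "enn2real (inverse vt)" and ?iq = "enn2real (inverse q)"
 define s1 where "s1 = ?n * brk (min p (min q ux)) ux"
 define s2 where "s2 = ?n * brk vx (max p (max q vx))"
 have inv: "enn2real (inverse ut) = 1 / a" using ab by (simp add: re inverse_ennreal inverse_eq_divide)
 have n: "0 < ?n" and m0: "0 < m" using m by auto
 have G: "s1 + s2 < m * (M + 1 / a - ?it - \<kappa>)"
  using mult_strict_left_mono[OF decay m0] m0 by (simp add: brk_def[of ut vt] inv s1_def s2_def distrib_left right_diff_distrib)
 have L: "anticausal T \<or> s1 < m * (\<beta> + 1 / a - ?iq)"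
  using lower mult_strict_left_mono[of "- brk ut q + ?n / m * brk (min p (min q ux)) ux" \<beta> m] m0
 by (auto simp: brk_def[of ut q] inv s1_def distrib_left right_diff_distrib)
 have H: "causal T \<or> s2 < m * (?iq - ?it - \<kappa> - \<beta>)"
  using upper mult_strict_left_mono[of \<beta> "brk q vt - ?n / m * brk vx (max p (max q vx)) - \<kappa>" m] m0
 by (auto simp: brk_def[of q vt] s2_def distrib_left right_diff_distrib)
 \<comment> \<open>\<open>\<epsilon>\<close> will be the common slack of the strict inequalities
   assumed, with \<open>1\<close> as a placeholder where causality replaces one of them.\<close>
 define \<epsilon>1 where "\<epsilon>1 = (if s1 < m * (\<beta> + 1 / a - ?iq) then m * (\<beta> + 1 / a - ?iq) - s1 else 1)"
 define \<epsilon>2 where "\<epsilon>2 = (if s2 < m * (?iq - ?it - \<kappa> - \<beta>) then m * (?iq - ?it - \<kappa> - \<beta>) - s2 else 1)"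
 define \<epsilon> where "\<epsilon> = min (min \<epsilon>1 \<epsilon>2) (m * (M + 1 / a - ?it - \<kappa>) - s1 - s2)"
 have \<epsilon>: "0 < \<epsilon>" "\<epsilon> <= \<epsilon>1" "\<epsilon> <= \<epsilon>2" "\<epsilon> <= m * (M + 1 / a - ?it - \<kappa>) - s1 - s2" using G by (auto simp: \<epsilon>_def \<epsilon>1_def \<epsilon>2_def)
 \<comment> \<open>A loss of \<open>\<sigma>\<close> in reciprocal exponents costs, multiplied by
   the dimension, a third of the slack on either side; so both losses together still fit into the
   decay condition.\<close>
 define \<sigma> where "\<sigma> = \<epsilon> / (3 * ?n)"
 have \<sigma>: "0 < \<sigma>" "?n * \<sigma> = \<epsilon> / 3" using \<epsilon> n by (simp_all add: \<sigma>_def)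
 obtain w where w: "0 < w" "w <= b" "ennreal w < p" "ennreal w < q" "1 / w - 1 / b = brk (min p (min q ux)) ux + \<sigma>"
  using source_exponent_ex[OF pq ab(3) \<sigma>(1)] unfolding re by blast
 have vr: "ennreal r' <= vt" "ennreal r' <= vx" using urv re by auto
 obtain v1 V where v1: "r' <= v1" "ennreal v1 <= vx" and V: "p < \<infinity> \<and> q < \<infinity> --> v1 <= V \<and> p < ennreal V \<and> q < ennreal V"
  and ct: "1 / v1 - (if p < \<infinity> \<and> q < \<infinity> then 1 / V else 0) <= brk vx (max p (max q vx)) + \<sigma>"
  using target_exponents_ex[OF ab(5) vr(2) \<sigma>(1), of p q] by blast
 define \<gamma>1 where "\<gamma>1 = ?n * (1 / w - 1 / b)"
 define \<gamma>2 where "\<gamma>2 = ?n * (1 / v1 - (if p < \<infinity> \<and> q < \<infinity> then 1 / V else 0))"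
 have \<gamma>1: "\<gamma>1 = s1 + \<epsilon> / 3" unfolding \<gamma>1_def w(5) s1_def distrib_left \<sigma>(2) ..
 have \<gamma>2: "\<gamma>2 <= s2 + \<epsilon> / 3" using mult_left_mono[OF ct, of ?n] unfolding \<gamma>2_def s2_def distrib_left \<sigma>(2) by simp
 have D: "anticausal T \<or> \<gamma>1 < m * (\<beta> + 1 / a - ?iq)" "causal T \<or> \<gamma>2 < m * (?iq - ?it - \<kappa> - \<beta>)" "\<gamma>1 + \<gamma>2 < m * (M + 1 / a - ?it - \<kappa>)"
  using L H \<epsilon> \<gamma>1 \<gamma>2 by (auto simp: \<epsilon>1_def \<epsilon>2_def)
 have wr: "w <= r'" using w ab by simp
 note bounds = operator_dnorm_bound[OF c(1,3) m T[unfolded re] ab(1-4) vr(1) v1 pq w(1-4) V D(1)[unfolded \<gamma>1_def] D(2)[unfolded \<gamma>2_def] D(3)[unfolded \<gamma>1_def \<gamma>2_def]]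
  tent_norm_le_tiles[OF m less_le_trans[OF zero_less_one ab(5)] pq w(1) wr w(3,4), where \<beta>="\<beta> + \<kappa>" and 'n='n]
  tiles_le_tent_norm[OF m less_le_trans[OF zero_less_one ab(5)] pq w(1,3,4), where \<beta>=\<beta> and 'n='n]
 show ?thesis
 proof (insert bounds, elim exE conjE, goal_cases)
  case (1 K1 K2 K3)
  show ?case
  proof (intro exI[of _ "K2 * (K1 * K3)"] conjI ballI)
   show "0 <= K2 * (K1 * K3)" using 1 by simp
   fix f :: "real \<times> (real ^ 'n) => complex" assume f: "f \<in> Linf_c"
   have "f \<in> L0" using f by (simp add: Linf_c_def L0_def measurable_restrict_space1)
   then obtain \<phi> where \<phi>: "borel_modulus f \<phi>" using borel_modulus_ex by blast
   have "T f \<in> L0" using T f by (simp add: singular_operator_def subadditive_op_def)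
   then obtain \<Phi> where \<Phi>: "borel_modulus (T f) \<Phi>" using borel_modulus_ex by blast
   \<comment> \<open>The target is compared with tiles for the weight
     \<open>\<beta> + \<kappa>\<close>, the source for the weight \<open>\<beta>\<close>; the bound
     for the operator on tiles stands between them.\<close>
   have "tent_norm m p q (ennreal r') (\<beta> + \<kappa>) (T f) <= ennreal K2 * dnorm p q (\<lambda>k x. weight m q (\<beta> + \<kappa>) k * tile m r' (octave m k) k \<Phi> x)"
    using \<Phi> unfolding borel_modulus_def by (intro 1(4)[rule_format]) auto
   also have "... <= ennreal K2 * (ennreal K1 * dnorm p q (\<lambda>k x. weight m q \<beta> k * tile m r' (wide m k) k \<phi> x))"
   by (intro mult_left_mono 1(2)[rule_format, OF f] \<phi> \<Phi>) simp
   also have "... <= ennreal K2 * (ennreal K1 * (ennreal K3 * tent_norm m p q (ennreal r') \<beta> f))"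
    using \<phi> unfolding borel_modulus_def by (intro mult_left_mono 1(6)[rule_format]) auto
   finally show "tent_norm m p q r (\<beta> + \<kappa>) (T f) <= ennreal (K2 * (K1 * K3)) * tent_norm m p q r \<beta> f"
    unfolding re using 1(1,3,5) by (simp add: ennreal_mult mult.assoc)
  qed
 qed
qed

end
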